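(* Let $\Omega^1,\Omega^2,d,\wedge$ be calculus data over $A$ as described in the context, with $\Omega^1$ and $\Omega^2$ pivotal bimodules and $\wedge$ a pivotal bimodule morphism. Then the left $A$-bialgebroid $\mathcal{D}\mathfrak{X}$ has a (Schauenburg) Hopf algebroid structure.
   Context: Conventions. $\mathbb{K}$ is a field, $A$ a unital associative $\mathbb{K}$-algebra, $\otimes$ means $\otimes_A$. $A^{op}=\{\overline{a}: a\in A\}$ with $\overline{a}\,\overline{b}=\overline{ba}$; $A^e=A\otimes_{\mathbb{K}}A^{op}$ with elements written $a\overline{b}$. Summation over repeated dual-basis indices is implicit. $T_{A^e}(V)$, $TV$ are tensor algebras, $\star$ the free product of algebras. Left $A$-bialgebroids. An $A^e$-ring is a $\mathbb{K}$-algebra $B$ with an algebra map $A^e\to B$; write $a,\overline{a}$ for images in $B$. $|B$ denotes $B$ as an $A$-bimodule via $r\cdot b\cdot s=r\overline{s}b$. A left $A$-bialgebroid structure on $B$ consists of $A$-bimodule maps $\Delta:|B\to|B\otimes|B$, $\Delta(b)=b_{(1)}\otimes b_{(2)}$, and $\epsilon:|B\to A$ such that: $\Delta$ is coassociative; $\epsilon(b_{(1)})b_{(2)}=b=\overline{\epsilon(b_{(2)})}b_{(1)}$; $\Delta(br\overline{s})=b_{(1)}r\otimes b_{(2)}\overline{s}$; $\epsilon(br)=\epsilon(b\overline{r})$; $\Delta(bb')=b_{(1)}b'_{(1)}\otimes b_{(2)}b'_{(2)}$; $\Delta(1)=1\otimes1$; $\epsilon(1)=1$; $\epsilon(bb')=\epsilon(b\,\epsilon(b'))=\epsilon(b\,\overline{\epsilon(b')})$.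 Schauenburg Hopf algebroid: a left $A$-bialgebroid $B$ such that the maps $\beta:B\otimes_{A^{op}}B\to B\diamond B$, $b\otimes b'\mapsto b_{(1)}\diamond b_{(2)}b'$, and $\vartheta:B\odot B\to B\diamond B$, $b\odot b'\mapsto b_{(1)}b'\diamond b_{(2)}$, are invertible, where $B\otimes_{A^{op}}B$, $B\odot B$, $B\diamond B$ are the quotients of $B\otimes_{\mathbb{K}}B$ by the spans of $b\overline{s}\otimes b'-b\otimes\overline{s}b'$, of $br\otimes b'-b\otimes rb'$, and of $\overline{s}b\otimes b'-b\otimes sb'$ respectively. Equivalently, the forgetful functor from left $B$-modules to $A$-bimodules is left and right closed (preserves both kinds of inner homs). Calculus data. $\Omega^1,\Omega^2$ are $A$-bimodules, $d:A\to\Omega^1$, $d:\Omega^1\to\Omega^2$ are $\mathbb{K}$-linear and $\wedge:\Omega^1\otimes\Omega^1\to\Omega^2$ is a bimodule map, with $d(ab)=(da)b+a\,db$, $d(a\omega)=da\wedge\omega+a\,d\omega$, $d(\omega a)=(d\omega)a-\omega\wedge da$, $d(da)=0$. Pivotal bimodules. A bimodule $\Omega$ is pivotal if it is finitely generated projective on both sides and its left dual $\mathrm{Hom}_A(\Omega,A)$ and right dual ${}_A\mathrm{Hom}(\Omega,A)$ are isomorphic bimodules. Fixing an isomorphism, a single bimodule is both left and right dual. For $\Omega^1$: dual $\mathfrak{X}^1$, maps $\mathrm{ev}:\mathfrak{X}^1\otimes\Omega^1\to A$, $\mathrm{coev}(1)=\omega_i\otimes x_i\in\Omega^1\otimes\mathfrak{X}^1$,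 $\underline{\mathrm{ev}}:\Omega^1\otimes\mathfrak{X}^1\to A$, $\underline{\mathrm{coev}}(1)=y_j\otimes\rho_j\in\mathfrak{X}^1\otimes\Omega^1$, satisfying $\omega=\omega_i\mathrm{ev}(x_i\otimes\omega)=\underline{\mathrm{ev}}(\omega\otimes y_j)\rho_j$, $x=\mathrm{ev}(x\otimes\omega_i)x_i=y_j\underline{\mathrm{ev}}(\rho_j\otimes x)$. For $\Omega^2$: dual $\mathfrak{X}^2$, maps $\mathfrak{ev}:\mathfrak{X}^2\otimes\Omega^2\to A$, $\mathfrak{coev}(1)=\omega^2_i\otimes x^2_i$, $\underline{\mathfrak{ev}}:\Omega^2\otimes\mathfrak{X}^2\to A$, $\underline{\mathfrak{coev}}(1)=y^2_i\otimes\rho^2_i$, with the analogous identities. $\wedge$ is a pivotal morphism if for all $x^2\in\mathfrak{X}^2$ $$\mathfrak{ev}(x^2\otimes\omega_i\wedge\omega_j)\,x_j\otimes x_i=y_i\otimes y_j\,\underline{\mathfrak{ev}}(\rho_j\wedge\rho_i\otimes x^2)\quad\text{in }\mathfrak{X}^1\otimes\mathfrak{X}^1.$$ The bialgebroid $H(\Omega)$ for a pivotal bimodule $\Omega$ with dual $\mathfrak{X}$ and dual bases $\mathrm{coev}(1)=\omega_i\otimes x_i$, $\underline{\mathrm{coev}}(1)=y_j\otimes\rho_j$: let $\mathfrak{Z}=(\mathfrak{X}\otimes_{\mathbb{K}}\Omega)\oplus(\Omega\otimes_{\mathbb{K}}\mathfrak{X})$, with elements $(x,\omega)$, resp. $(\omega,x)$,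 an $A^e$-bimodule via $a\overline{a'}(x,\omega)b\overline{b'}=(axb,b'\omega a')$, $a\overline{a'}(\omega,x)b\overline{b'}=(a\omega b,b'xa')$. $H(\Omega)$ is the quotient of $T_{A^e}(\mathfrak{Z})$ (product $\bullet$) by the relations, for all $x\in\mathfrak{X}$, $\omega\in\Omega$: $(\omega_i,x)\bullet(x_i,\omega)=\overline{\underline{\mathrm{ev}}(\omega\otimes x)}$, $(x,\rho_j)\bullet(\omega,y_j)=\mathrm{ev}(x\otimes\omega)$, $(y_j,\omega)\bullet(\rho_j,x)=\overline{\mathrm{ev}(x\otimes\omega)}$, $(\omega,x_i)\bullet(x,\omega_i)=\underline{\mathrm{ev}}(\omega\otimes x)$. Coproduct and counit: $\Delta(a\overline{b})=a\otimes\overline{b}$, $\Delta((x,\omega))=(x,\omega_i)\otimes(x_i,\omega)$, $\Delta((\omega,x))=(\omega,y_j)\otimes(\rho_j,x)$, $\epsilon(a\overline{b})=ab$, $\epsilon((x,\omega))=\mathrm{ev}(x\otimes\omega)$, $\epsilon((\omega,x))=\underline{\mathrm{ev}}(\omega\otimes x)$, extended by $\Delta(m\bullet n)=m_{(1)}\bullet n_{(1)}\otimes m_{(2)}\bullet n_{(2)}$, $\epsilon(m\bullet n)=\epsilon(m\bullet\epsilon(n))$. The bialgebroid $H\mathfrak{X}^1$ is the quotient of $H(\Omega^1)\star T\mathfrak{X}^1$ by $a\bullet x=ax$, $x\bullet a=xa+\mathrm{ev}(x\otimes da)$, $x\bullet\overline{a}=\overline{a}\bullet x+(x,da)$ ($x\in\mathfrak{X}^1$,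 $a\in A$), with additionally $\Delta(x)=x\otimes1+(x,\omega_i)\otimes x_i$, $\epsilon(x)=0$. $F$ is the free product of $H\mathfrak{X}^1$ and $H(\Omega^2)$ as $A^e$-rings (amalgamated over $A^e$), with the left $A$-bialgebroid structure extending multiplicatively those of $H\mathfrak{X}^1$ and $H(\Omega^2)$. $\mathcal{D}\mathfrak{X}$, with the bialgebroid structure induced from $F$, is the quotient of $F$ by the ideal generated by, for all $x^2\in\mathfrak{X}^2$, $\omega,\rho\in\Omega^1$, $$\mathfrak{ev}(x^2\otimes d\omega_i)\bullet x_i-\mathfrak{ev}(x^2\otimes\omega_j\wedge\omega_k)\bullet x_k\bullet x_j=0,$$ $$\mathfrak{ev}(x^2\otimes\omega_i\wedge\omega_j)\bullet[x_j\bullet(x_i,\omega)+(x_j,\omega)\bullet x_i]=\mathfrak{ev}(x^2\otimes d\omega_i)\bullet(x_i,\omega)-(x^2,d\omega),$$ $$\mathfrak{ev}(x^2\otimes\omega_i\wedge\omega_j)\bullet(x_j,\rho)\bullet(x_i,\omega)=(x^2,\omega\wedge\rho),$$ $$\overline{\underline{\mathfrak{ev}}(\rho_i\wedge\rho_j\otimes x^2)}\bullet(\omega,y_i)\bullet(\rho,y_j)=(\omega\wedge\rho,x^2).$$ *)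

theory Defs
  imports "HOL.Vector_Spaces" "HOL-Library.Poly_Mapping" "HOL-Algebra.QuotRing" "HOL-Algebra.Module"
begin

section \<open>Algebras, bimodules and pivotal bimodules\<close>

text \<open>
  The given objects (the field, the algebra \<open>A\<close>, the bimodules) are types; the algebras built from
  them are quotients that depend on these data, hence \<open>HOL-Algebra\<close> records with a carrier.
  The sort \<open>{ring, monoid_mult}\<close> is that of unital rings; unlike \<open>ring_1\<close> it admits the zero ring.
\<close>

locale k_algebra = vector_space scA
  for scA :: "'k::field \<Rightarrow> 'a::{ring,monoid_mult} \<Rightarrow> 'a" +
  assumes scale_mult_left: "scA k a * b = scA k (a * b)"
    and scale_mult_right: "a * scA k b = scA k (a * b)"

record ('a, 'm) bimod =
  lact :: "'a \<Rightarrow> 'm \<Rightarrow> 'm"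
  ract :: "'m \<Rightarrow> 'a \<Rightarrow> 'm"

text \<open>A bimodule is a left module over \<open>A\<^sup>e\<close>, so the two actions of the field coincide.\<close>

locale bimodule = k_algebra scA
  for scA :: "'k::field \<Rightarrow> 'a::{ring,monoid_mult} \<Rightarrow> 'a" +
  fixes M :: "('a, 'm::ab_group_add) bimod"
  assumes lact_add_left: "lact M (a + b) m = lact M a m + lact M b m"
    and lact_add_right: "lact M a (m + n) = lact M a m + lact M a n"
    and lact_mult: "lact M (a * b) m = lact M a (lact M b m)"
    and lact_one: "lact M 1 m = m"
    and ract_add_left: "ract M (m + n) a = ract M m a + ract M n a"
    and ract_add_right: "ract M m (a + b) = ract M m a + ract M m b"
    and ract_mult: "ract M m (a * b) = ract M (ract M m a) b"
    and ract_one: "ract M m 1 = m"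
    and lact_ract: "ract M (lact M a m) b = lact M a (ract M m b)"
    and central: "lact M (scA k 1) m = ract M m (scA k 1)"

definition kact :: "('k \<Rightarrow> 'a::{ring,monoid_mult} \<Rightarrow> 'a) \<Rightarrow> ('a, 'm) bimod \<Rightarrow> 'k \<Rightarrow> 'm \<Rightarrow> 'm" where
  "kact scA M k m = lact M (scA k 1) m"

text \<open>\<open>Hom\<^sub>A(M, A)\<close>, the right \<open>A\<close>-module maps, is the left dual; the left \<open>A\<close>-module maps form
  the right dual.\<close>

definition left_dual :: "('a::{ring,monoid_mult}, 'm::ab_group_add) bimod \<Rightarrow> ('m \<Rightarrow> 'a) set" where
  "left_dual M = {f. (\<forall>m n. f (m + n) = f m + f n) \<and> (\<forall>m a. f (ract M m a) = f m * a)}"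

definition right_dual :: "('a::{ring,monoid_mult}, 'm::ab_group_add) bimod \<Rightarrow> ('m \<Rightarrow> 'a) set" where
  "right_dual M = {f. (\<forall>m n. f (m + n) = f m + f n) \<and> (\<forall>a m. f (lact M a m) = a * f m)}"

text \<open>Finitely generated projective means direct summand of some \<open>A\<^sup>n\<close>: the section is
  \<open>m \<mapsto> (f 0 m, \<dots>, f (n - 1) m)\<close> and the projection sends the \<open>i\<close>-th basis vector to \<open>p i\<close>.\<close>

definition fgp_left :: "('a::{ring,monoid_mult}, 'm::ab_group_add) bimod \<Rightarrow> bool" where
  "fgp_left M \<longleftrightarrow> (\<exists>(n::nat) f p. (\<forall>i<n. f i \<in> right_dual M) \<and>
     (\<forall>m. (\<Sum>i<n. lact M (f i m) (p i)) = m))"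

definition fgp_right :: "('a::{ring,monoid_mult}, 'm::ab_group_add) bimod \<Rightarrow> bool" where
  "fgp_right M \<longleftrightarrow> (\<exists>(n::nat) f p. (\<forall>i<n. f i \<in> left_dual M) \<and>
     (\<forall>m. (\<Sum>i<n. ract M (p i) (f i m)) = m))"

text \<open>
  A bimodule \<open>\<Omega>\<close> with a bimodule \<open>\<XX>\<close> that is both its left and its right dual.
  Maps out of a tensor product over \<open>A\<close> are given as balanced biadditive maps, and
  \<open>coev(1) = \<omega>\<^sub>i \<otimes> x\<^sub>i\<close>, \<open>coevr(1) = y\<^sub>j \<otimes> \<rho>\<^sub>j\<close> as the lists of the pairs \<open>(\<omega>\<^sub>i, x\<^sub>i)\<close>, \<open>(y\<^sub>j, \<rho>\<^sub>j)\<close>.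
\<close>

record ('a, 'm, 'x) pivotal_data =
  Om :: "('a, 'm) bimod"
  Xd :: "('a, 'x) bimod"
  ev :: "'x \<Rightarrow> 'm \<Rightarrow> 'a"
  coev :: "('m \<times> 'x) list"
  evr :: "'m \<Rightarrow> 'x \<Rightarrow> 'a"
  coevr :: "('x \<times> 'm) list"

text \<open>The two bijectivity assumptions identify \<open>\<XX>\<close> as a bimodule with the left dual and with the
  right dual, which fixes an isomorphism between the latter. They and \<open>fgp\<close> are the definition of
  a pivotal bimodule; they also follow from the identities for the dual bases.\<close>

locale pivotal_bimodule = \<Omega>: bimodule scA "Om P" + \<XX>: bimodule scA "Xd P"
  for scA :: "'k::field \<Rightarrow> 'a::{ring,monoid_mult} \<Rightarrow> 'a"
    and P :: "('a, 'm::ab_group_add, 'x::ab_group_add) pivotal_data" +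
  assumes fgp: "fgp_left (Om P)" "fgp_right (Om P)"
    and ev_bij: "bij_betw (ev P) UNIV (left_dual (Om P))"
    and ev_add: "ev P (x + y) w = ev P x w + ev P y w"
    and ev_lact: "ev P (lact (Xd P) a x) w = a * ev P x w"
    and ev_balanced: "ev P (ract (Xd P) x a) w = ev P x (lact (Om P) a w)"
    and evr_bij: "bij_betw (\<lambda>x w. evr P w x) UNIV (right_dual (Om P))"
    and evr_add: "evr P w (x + y) = evr P w x + evr P w y"
    and evr_ract: "evr P w (ract (Xd P) x a) = evr P w x * a"
    and evr_balanced: "evr P w (lact (Xd P) a x) = evr P (ract (Om P) w a) x"
    and coev_ev: "(\<Sum>(wi, xi)\<leftarrow>coev P. ract (Om P) wi (ev P xi w)) = w"
    and ev_coev: "(\<Sum>(wi, xi)\<leftarrow>coev P. lact (Xd P) (ev P x wi) xi) = x"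
    and evr_coevr: "(\<Sum>(yj, rj)\<leftarrow>coevr P. lact (Om P) (evr P w yj) rj) = w"
    and coevr_evr: "(\<Sum>(yj, rj)\<leftarrow>coevr P. ract (Xd P) yj (evr P rj x)) = x"


section \<open>Tensor products\<close>

text \<open>\<open>'s \<Rightarrow>\<^sub>0 'k\<close> is the vector space with basis \<open>'s\<close>, and for a monoid \<open>'s\<close> it is the monoid algebra.\<close>

definition cscale :: "'k::field \<Rightarrow> ('s \<Rightarrow>\<^sub>0 'k) \<Rightarrow> ('s \<Rightarrow>\<^sub>0 'k)" where
  "cscale k = Poly_Mapping.map ((*) k)"

lemma lookup_cscale [simp]: "Poly_Mapping.lookup (cscale k p) s = k * Poly_Mapping.lookup p s"
  by (simp add: cscale_def Poly_Mapping.map.rep_eq when_def)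

interpretation free_vs: vector_space "cscale :: 'k::field \<Rightarrow> ('s \<Rightarrow>\<^sub>0 'k) \<Rightarrow> _"
  by unfold_locales (auto intro!: poly_mapping_eqI simp: Poly_Mapping.lookup_add algebra_simps)

abbreviation pure :: "'s \<Rightarrow> ('s \<Rightarrow>\<^sub>0 'k::field)" where
  "pure s \<equiv> Poly_Mapping.single s 1"

definition pushforward :: "('s \<Rightarrow> 'r) \<Rightarrow> ('s \<Rightarrow>\<^sub>0 'k::field) \<Rightarrow> ('r \<Rightarrow>\<^sub>0 'k)" where
  "pushforward g p = (\<Sum>s\<in>Poly_Mapping.keys p. Poly_Mapping.single (g s) (Poly_Mapping.lookup p s))"

definition coset :: "('s \<Rightarrow>\<^sub>0 'k::field) set \<Rightarrow> ('s \<Rightarrow>\<^sub>0 'k) \<Rightarrow> ('s \<Rightarrow>\<^sub>0 'k) set" where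
  "coset N p = {q. q - p \<in> N}"

definition coset_add :: "('s \<Rightarrow>\<^sub>0 'k::field) set \<Rightarrow> ('s \<Rightarrow>\<^sub>0 'k) set \<Rightarrow> ('s \<Rightarrow>\<^sub>0 'k) set" where
  "coset_add X Y = {p + q | p q. p \<in> X \<and> q \<in> Y}"

text \<open>The vector space with basis \<open>S\<close> modulo a subspace \<open>N\<close> of it.\<close>

definition quotient_space :: "'s set \<Rightarrow> ('s \<Rightarrow>\<^sub>0 'k::field) set \<Rightarrow> ('s \<Rightarrow>\<^sub>0 'k) set set" where
  "quotient_space S N = coset N ` {p. Poly_Mapping.keys p \<subseteq> S}"

text \<open>The tensor product over the field of vector spaces with carriers \<open>U\<close> and \<open>V\<close> is the vector space
  with basis \<open>U \<times> V\<close> modulo the span of the following elements; the other tensor products below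
  are quotients by the span of these and further elements.\<close>

definition bilinear_rels ::
  "'u set \<Rightarrow> ('u \<Rightarrow> 'u \<Rightarrow> 'u) \<Rightarrow> ('k::field \<Rightarrow> 'u \<Rightarrow> 'u) \<Rightarrow>
   'v set \<Rightarrow> ('v \<Rightarrow> 'v \<Rightarrow> 'v) \<Rightarrow> ('k \<Rightarrow> 'v \<Rightarrow> 'v) \<Rightarrow> ('u \<times> 'v \<Rightarrow>\<^sub>0 'k) set" where
  "bilinear_rels U addU scU V addV scV =
     {pure (addU u u', v) - pure (u, v) - pure (u', v) | u u' v. u \<in> U \<and> u' \<in> U \<and> v \<in> V} \<union>
     {pure (u, addV v v') - pure (u, v) - pure (u, v') | u v v'. u \<in> U \<and> v \<in> V \<and> v' \<in> V} \<union>
     {pure (scU k u, v) - cscale k (pure (u, v)) | k u v. u \<in> U \<and> v \<in> V} \<union>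
     {pure (u, scV k v) - cscale k (pure (u, v)) | k u v. u \<in> U \<and> v \<in> V}"

definition bimod_tensor_null ::
  "('k::field \<Rightarrow> 'a::{ring,monoid_mult} \<Rightarrow> 'a) \<Rightarrow> ('a, 'm::ab_group_add) bimod \<Rightarrow>
   ('a, 'n::ab_group_add) bimod \<Rightarrow> ('m \<times> 'n \<Rightarrow>\<^sub>0 'k) set" where
  "bimod_tensor_null scA M N = free_vs.span
     (bilinear_rels UNIV (+) (kact scA M) UNIV (+) (kact scA N) \<union>
      {pure (ract M m a, n) - pure (m, lact N a n) | m a n. True})"


section \<open>Calculus data and pivotal morphisms\<close>

locale calculus_data = \<Omega>1: bimodule scA M1 + \<Omega>2: bimodule scA M2
  for scA :: "'k::field \<Rightarrow> 'a::{ring,monoid_mult} \<Rightarrow> 'a"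
    and M1 :: "('a, 'm::ab_group_add) bimod"
    and M2 :: "('a, 'n::ab_group_add) bimod" +
  fixes d0 :: "'a \<Rightarrow> 'm" and d1 :: "'m \<Rightarrow> 'n" and wedge :: "'m \<Rightarrow> 'm \<Rightarrow> 'n" (infixl \<open>\<curlywedge>\<close> 70)
  assumes d0_add: "d0 (a + b) = d0 a + d0 b"
    and d0_scale: "d0 (scA k a) = kact scA M1 k (d0 a)"
    and d1_add: "d1 (w + v) = d1 w + d1 v"
    and d1_scale: "d1 (kact scA M1 k w) = kact scA M2 k (d1 w)"
    and wedge_add_left: "(w + w') \<curlywedge> v = w \<curlywedge> v + w' \<curlywedge> v"
    and wedge_add_right: "w \<curlywedge> (v + v') = w \<curlywedge> v + w \<curlywedge> v'"
    and wedge_balanced: "ract M1 w a \<curlywedge> v = w \<curlywedge> lact M1 a v"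
    and wedge_lact: "lact M1 a w \<curlywedge> v = lact M2 a (w \<curlywedge> v)"
    and wedge_ract: "w \<curlywedge> ract M1 v a = ract M2 (w \<curlywedge> v) a"
    and d0_mult: "d0 (a * b) = ract M1 (d0 a) b + lact M1 a (d0 b)"
    and d1_lact: "d1 (lact M1 a w) = d0 a \<curlywedge> w + lact M2 a (d1 w)"
    and d1_ract: "d1 (ract M1 w a) = ract M2 (d1 w) a - w \<curlywedge> d0 a"
    and d1_d0: "d1 (d0 a) = 0"

definition pivotal_morphism ::
  "('k::field \<Rightarrow> 'a::{ring,monoid_mult} \<Rightarrow> 'a) \<Rightarrow>
   ('a, 'm::ab_group_add, 'x::ab_group_add) pivotal_data \<Rightarrow>
   ('a, 'n::ab_group_add, 'y::ab_group_add) pivotal_data \<Rightarrow> ('m \<Rightarrow> 'm \<Rightarrow> 'n) \<Rightarrow> bool" where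
  "pivotal_morphism scA P1 P2 wedge \<longleftrightarrow>
     (\<forall>z. (\<Sum>(wi, xi)\<leftarrow>coev P1. \<Sum>(wj, xj)\<leftarrow>coev P1.
              pure (lact (Xd P1) (ev P2 z (wedge wi wj)) xj, xi))
        - (\<Sum>(yi, ri)\<leftarrow>coevr P1. \<Sum>(yj, rj)\<leftarrow>coevr P1.
              pure (yi, ract (Xd P1) yj (evr P2 (wedge rj ri) z)))
        \<in> bimod_tensor_null scA (Xd P1) (Xd P1))"


section \<open>Left bialgebroids and Hopf algebroids\<close>

text \<open>The locales \<open>module\<close> and \<open>algebra\<close> of \<open>HOL-Algebra\<close> are not used since the latter is restricted
  to commutative algebras and both require the field to be given as a record.\<close>

locale record_k_algebra = ring B
  for B :: "('k::field, 'b) module" (structure) +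
  assumes smult_closed: "b \<in> carrier B \<Longrightarrow> k \<odot> b \<in> carrier B"
    and smult_add_left: "b \<in> carrier B \<Longrightarrow> (k + l) \<odot> b = k \<odot> b \<oplus> l \<odot> b"
    and smult_add_right: "b \<in> carrier B \<Longrightarrow> c \<in> carrier B \<Longrightarrow> k \<odot> (b \<oplus> c) = k \<odot> b \<oplus> k \<odot> c"
    and smult_assoc: "b \<in> carrier B \<Longrightarrow> (k * l) \<odot> b = k \<odot> (l \<odot> b)"
    and smult_one: "b \<in> carrier B \<Longrightarrow> 1 \<odot> b = b"
    and smult_mult_left: "b \<in> carrier B \<Longrightarrow> c \<in> carrier B \<Longrightarrow> (k \<odot> b) \<otimes> c = k \<odot> (b \<otimes> c)"
    and smult_mult_right: "b \<in> carrier B \<Longrightarrow> c \<in> carrier B \<Longrightarrow> b \<otimes> (k \<odot> c) = k \<odot> (b \<otimes> c)"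

text \<open>An algebra map \<open>A\<^sup>e \<rightarrow> B\<close> amounts to algebra maps \<open>s\<close> on \<open>A\<close> and \<open>t\<close> on \<open>A\<^sup>o\<^sup>p\<close> with
  commuting images; \<open>s a\<close> and \<open>t a\<close> are the elements usually written \<open>a\<close> and \<open>a\<close> with a bar.
  Throughout, \<open>\<otimes>\<close> is the product of \<open>B\<close> and \<open>pure (b, c)\<close> the tensor of \<open>b\<close> and \<open>c\<close>.\<close>

locale Ae_ring = k_algebra scA + record_k_algebra B
  for scA :: "'k::field \<Rightarrow> 'a::{ring,monoid_mult} \<Rightarrow> 'a"
    and B :: "('k, 'b) module" (structure) +
  fixes s t :: "'a \<Rightarrow> 'b"
  assumes s_closed: "s a \<in> carrier B" and t_closed: "t a \<in> carrier B"
    and s_add: "s (a + b) = s a \<oplus> s b" and t_add: "t (a + b) = t a \<oplus> t b"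
    and s_scale: "s (scA k a) = k \<odot> s a" and t_scale: "t (scA k a) = k \<odot> t a"
    and s_mult: "s (a * b) = s a \<otimes> s b" and t_mult: "t (b * a) = t a \<otimes> t b"
    and s_one: "s 1 = \<one>" and t_one: "t 1 = \<one>"
    and s_t_commute: "s a \<otimes> t b = t b \<otimes> s a"
begin

definition tensor_null :: "('b \<times> 'b \<Rightarrow>\<^sub>0 'k) set \<Rightarrow> ('b \<times> 'b \<Rightarrow>\<^sub>0 'k) set" where
  "tensor_null R = free_vs.span
     (bilinear_rels (carrier B) (add B) (smult B) (carrier B) (add B) (smult B) \<union> R)"

text \<open>The subspaces by which \<open>B \<diamondop> B\<close>, \<open>B \<otimes> B\<close> over \<open>A\<^sup>o\<^sup>p\<close>, and \<open>B \<odot> B\<close> are the quotients.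
  As \<open>|B\<close> has the actions \<open>r \<cdot> b = s r \<otimes> b\<close> and \<open>b \<cdot> r = t r \<otimes> b\<close>, \<open>B \<diamondop> B\<close> is also the tensor
  product over \<open>A\<close> of \<open>|B\<close> with itself, the codomain of the coproduct.\<close>

definition dia_null :: "('b \<times> 'b \<Rightarrow>\<^sub>0 'k) set" where
  "dia_null = tensor_null {pure (t r \<otimes> b, c) - pure (b, s r \<otimes> c) | r b c.
     b \<in> carrier B \<and> c \<in> carrier B}"

definition op_null :: "('b \<times> 'b \<Rightarrow>\<^sub>0 'k) set" where
  "op_null = tensor_null {pure (b \<otimes> t r, c) - pure (b, t r \<otimes> c) | r b c.
     b \<in> carrier B \<and> c \<in> carrier B}"

definition odot_null :: "('b \<times> 'b \<Rightarrow>\<^sub>0 'k) set" where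
  "odot_null = tensor_null {pure (b \<otimes> s r, c) - pure (b, s r \<otimes> c) | r b c.
     b \<in> carrier B \<and> c \<in> carrier B}"

text \<open>The threefold tensor product of \<open>|B\<close> is the vector space with basis the triples over the carrier
  modulo the relations of \<open>B \<diamondop> B\<close> in the first two and in the last two places.\<close>

definition dia3_null :: "('b \<times> 'b \<times> 'b \<Rightarrow>\<^sub>0 'k) set" where
  "dia3_null = free_vs.span
     ({pushforward (\<lambda>(b, c). (b, c, e)) n | n e. n \<in> dia_null \<and> e \<in> carrier B} \<union>
      {pushforward (\<lambda>(c, e). (b, c, e)) n | n b. n \<in> dia_null \<and> b \<in> carrier B})"

abbreviation tensors :: "('b \<times> 'b \<Rightarrow>\<^sub>0 'k) set \<Rightarrow> ('b \<times> 'b \<Rightarrow>\<^sub>0 'k) set set" where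
  "tensors N \<equiv> quotient_space (carrier B \<times> carrier B) N"

text \<open>For a choice \<open>D b\<close> of representatives of \<open>\<Delta> b\<close>, the next map gives \<open>(\<Delta> \<otimes> id) p\<close> and \<open>(id \<otimes> \<Delta>) p\<close>:
  it applies \<open>D\<close> to the component of the tensor selected by \<open>pr\<close>, and \<open>g\<close> restores the other one.\<close>

definition linear_tensor ::
  "('b \<Rightarrow> ('s \<Rightarrow>\<^sub>0 'k)) \<Rightarrow> ('b \<times> 'b \<Rightarrow> 's \<Rightarrow> 'r) \<Rightarrow> ('b \<times> 'b \<Rightarrow> 'b) \<Rightarrow>
   ('b \<times> 'b \<Rightarrow>\<^sub>0 'k) \<Rightarrow> ('r \<Rightarrow>\<^sub>0 'k)" where
  "linear_tensor D g pr p =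
     (\<Sum>u\<in>Poly_Mapping.keys p. cscale (Poly_Mapping.lookup p u) (pushforward (g u) (D (pr u))))"

definition tensor_mult ::
  "('b \<times> 'b \<Rightarrow>\<^sub>0 'k) \<Rightarrow> ('b \<times> 'b \<Rightarrow>\<^sub>0 'k) \<Rightarrow> ('b \<times> 'b \<Rightarrow>\<^sub>0 'k)" where
  "tensor_mult p q = (\<Sum>u\<in>Poly_Mapping.keys p. \<Sum>v\<in>Poly_Mapping.keys q.
     Poly_Mapping.single (fst u \<otimes> fst v, snd u \<otimes> snd v) (Poly_Mapping.lookup p u * Poly_Mapping.lookup q v))"

end

text \<open>
  \<open>\<Delta> b\<close> is an element of \<open>B \<diamondop> B\<close>, i.e. a coset, so \<open>p \<in> \<Delta> b\<close> says that \<open>p\<close> represents \<open>b\<^sub>(\<^sub>1\<^sub>) \<otimes> b\<^sub>(\<^sub>2\<^sub>)\<close>.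
  In \<open>comult_mult\<close> the product must represent \<open>\<Delta> (b \<otimes> c)\<close> for all choices of representatives,
  since products are not defined on all of \<open>B \<diamondop> B\<close>; this includes the Takeuchi condition
  that makes the formula \<open>b\<^sub>(\<^sub>1\<^sub>)c\<^sub>(\<^sub>1\<^sub>) \<otimes> b\<^sub>(\<^sub>2\<^sub>)c\<^sub>(\<^sub>2\<^sub>)\<close> meaningful.
\<close>

locale left_bialgebroid = Ae_ring scA B s t
  for scA :: "'k::field \<Rightarrow> 'a::{ring,monoid_mult} \<Rightarrow> 'a"
    and B :: "('k, 'b) module" (structure)
    and s t :: "'a \<Rightarrow> 'b" +
  fixes \<Delta> :: "'b \<Rightarrow> ('b \<times> 'b \<Rightarrow>\<^sub>0 'k) set" and \<epsilon> :: "'b \<Rightarrow> 'a"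
  assumes comult_closed: "b \<in> carrier B \<Longrightarrow> \<Delta> b \<in> tensors dia_null"
    and comult_add: "b \<in> carrier B \<Longrightarrow> c \<in> carrier B \<Longrightarrow> \<Delta> (b \<oplus> c) = coset_add (\<Delta> b) (\<Delta> c)"
    and comult_bimod: "b \<in> carrier B \<Longrightarrow> p \<in> \<Delta> b \<Longrightarrow>
      pushforward (\<lambda>(u, v). (s r \<otimes> u, t a \<otimes> v)) p \<in> \<Delta> (s r \<otimes> t a \<otimes> b)"
    and counit_add: "b \<in> carrier B \<Longrightarrow> c \<in> carrier B \<Longrightarrow> \<epsilon> (b \<oplus> c) = \<epsilon> b + \<epsilon> c"
    and counit_bimod: "b \<in> carrier B \<Longrightarrow> \<epsilon> (s r \<otimes> t a \<otimes> b) = r * \<epsilon> b * a"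
    and coassoc: "(\<And>c. c \<in> carrier B \<Longrightarrow> D c \<in> \<Delta> c) \<Longrightarrow> b \<in> carrier B \<Longrightarrow> p \<in> \<Delta> b \<Longrightarrow>
      linear_tensor D (\<lambda>(u, v) (u1, u2). (u1, u2, v)) fst p
      - linear_tensor D (\<lambda>(u, v) (v1, v2). (u, v1, v2)) snd p \<in> dia3_null"
    and counit_left: "b \<in> carrier B \<Longrightarrow> p \<in> \<Delta> b \<Longrightarrow>
      (\<Oplus>u\<in>Poly_Mapping.keys p. Poly_Mapping.lookup p u \<odot> (s (\<epsilon> (fst u)) \<otimes> snd u)) = b"
    and counit_right: "b \<in> carrier B \<Longrightarrow> p \<in> \<Delta> b \<Longrightarrow>
      (\<Oplus>u\<in>Poly_Mapping.keys p. Poly_Mapping.lookup p u \<odot> (t (\<epsilon> (snd u)) \<otimes> fst u)) = b"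
    and comult_right: "b \<in> carrier B \<Longrightarrow> p \<in> \<Delta> b \<Longrightarrow>
      pushforward (\<lambda>(u, v). (u \<otimes> s r, v \<otimes> t a)) p \<in> \<Delta> (b \<otimes> s r \<otimes> t a)"
    and counit_s_t: "b \<in> carrier B \<Longrightarrow> \<epsilon> (b \<otimes> s r) = \<epsilon> (b \<otimes> t r)"
    and comult_mult: "b \<in> carrier B \<Longrightarrow> c \<in> carrier B \<Longrightarrow> p \<in> \<Delta> b \<Longrightarrow> q \<in> \<Delta> c \<Longrightarrow>
      tensor_mult p q \<in> \<Delta> (b \<otimes> c)"
    and comult_one: "pure (\<one>, \<one>) \<in> \<Delta> \<one>"
    and counit_one: "\<epsilon> \<one> = 1"
    and counit_mult_s: "b \<in> carrier B \<Longrightarrow> c \<in> carrier B \<Longrightarrow> \<epsilon> (b \<otimes> c) = \<epsilon> (b \<otimes> s (\<epsilon> c))"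
    and counit_mult_t: "b \<in> carrier B \<Longrightarrow> c \<in> carrier B \<Longrightarrow> \<epsilon> (b \<otimes> c) = \<epsilon> (b \<otimes> t (\<epsilon> c))"

text \<open>The maps \<open>\<beta>\<close> and \<open>\<theta>\<close> are determined by additivity and their values on the classes of the
  \<open>pure (b, c)\<close>, as a scalar can be absorbed in \<open>b\<close>.\<close>

locale schauenburg_hopf_algebroid = left_bialgebroid scA B s t \<Delta> \<epsilon>
  for scA :: "'k::field \<Rightarrow> 'a::{ring,monoid_mult} \<Rightarrow> 'a"
    and B :: "('k, 'b) module" (structure)
    and s t :: "'a \<Rightarrow> 'b"
    and \<Delta> :: "'b \<Rightarrow> ('b \<times> 'b \<Rightarrow>\<^sub>0 'k) set" and \<epsilon> :: "'b \<Rightarrow> 'a" +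
  assumes beta_invertible: "\<exists>\<beta>. bij_betw \<beta> (tensors op_null) (tensors dia_null) \<and>
      (\<forall>X\<in>tensors op_null. \<forall>Y\<in>tensors op_null. \<beta> (coset_add X Y) = coset_add (\<beta> X) (\<beta> Y)) \<and>
      (\<forall>b\<in>carrier B. \<forall>c\<in>carrier B. \<forall>p\<in>\<Delta> b.
         pushforward (\<lambda>(u, v). (u, v \<otimes> c)) p \<in> \<beta> (coset op_null (pure (b, c))))"
    and theta_invertible: "\<exists>\<theta>. bij_betw \<theta> (tensors odot_null) (tensors dia_null) \<and>
      (\<forall>X\<in>tensors odot_null. \<forall>Y\<in>tensors odot_null. \<theta> (coset_add X Y) = coset_add (\<theta> X) (\<theta> Y)) \<and>
      (\<forall>b\<in>carrier B. \<forall>c\<in>carrier B. \<forall>p\<in>\<Delta> b.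
         pushforward (\<lambda>(u, v). (u \<otimes> c, v)) p \<in> \<theta> (coset odot_null (pure (b, c))))"


section \<open>Algebras given by generators and relations\<close>

text \<open>Words are wrapped because lists carry no instance of \<open>monoid_add\<close>. \<open>'g word \<Rightarrow>\<^sub>0 'k\<close> is the
  free algebra on \<open>'g\<close>.\<close>

datatype 'g word = Word (letters: "'g list")

instantiation word :: (type) monoid_add
begin

definition zero_word :: "'a word" where "zero_word = Word []"

definition plus_word :: "'a word \<Rightarrow> 'a word \<Rightarrow> 'a word" where
  "plus_word v w = Word (letters v @ letters w)"

instance
  by standard (simp_all add: zero_word_def plus_word_def)

end

definition gen :: "'g \<Rightarrow> ('g word \<Rightarrow>\<^sub>0 'k::field)" where
  "gen g = pure (Word [g])"

definition free_algebra :: "('k::field, 'g word \<Rightarrow>\<^sub>0 'k) module" where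
  "free_algebra = \<lparr>carrier = UNIV, mult = (*), one = 1, zero = 0, add = (+), smult = cscale\<rparr>"

definition quotient_algebra :: "('k, 'b) module \<Rightarrow> 'b set \<Rightarrow> ('k, 'b set) module" where
  "quotient_algebra R I = ring.extend (R Quot I)
     (module.fields (\<lambda>k X. \<Union>x\<in>X. I +>\<^bsub>R\<^esub> (k \<odot>\<^bsub>R\<^esub> x)))"

definition rel_ideal ::
  "(('g word \<Rightarrow>\<^sub>0 'k::field) \<Rightarrow> ('g word \<Rightarrow>\<^sub>0 'k) \<Rightarrow> bool) \<Rightarrow> ('g word \<Rightarrow>\<^sub>0 'k) set" where
  "rel_ideal rel = Idl\<^bsub>free_algebra\<^esub> {f - g | f g. rel f g}"

definition presented_algebra ::
  "(('g word \<Rightarrow>\<^sub>0 'k::field) \<Rightarrow> ('g word \<Rightarrow>\<^sub>0 'k) \<Rightarrow> bool) \<Rightarrow> ('k, ('g word \<Rightarrow>\<^sub>0 'k) set) module" where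
  "presented_algebra rel = quotient_algebra free_algebra (rel_ideal rel)"


section \<open>The algebra \<open>D\<XX>\<close>\<close>

text \<open>
  Tensor algebras, free products and amalgamated free products of algebras given by generators and
  relations are again such, with the generators and the relations put together, and so are
  quotients. So \<open>D\<XX>\<close> is the free algebra over the field on the generators of all the algebras it is
  built from, modulo the relations of all of them:
  \<open>Ae_rel\<close> presents \<open>A\<^sup>e\<close>; adding \<open>TZ_rel\<close> presents the tensor algebra over \<open>A\<^sup>e\<close> of \<open>\<ZZ>\<close>, and adding
  \<open>H_rel\<close> presents \<open>H(\<Omega>)\<close>; with \<open>\<Omega> = \<Omega>\<^sup>1\<close>, adding \<open>T_rel\<close> presents the free product with the tensor
  algebra of \<open>\<XX>\<^sup>1\<close> over the field, and adding \<open>HX_rel\<close> presents \<open>H\<XX>\<^sup>1\<close>; adding \<open>TZ_rel\<close> and \<open>H_rel\<close>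
  for \<open>\<Omega>\<^sup>2\<close> presents \<open>F\<close>, and adding \<open>D_rel\<close> presents \<open>D\<XX>\<close>.
\<close>

datatype ('a, 'm, 'x, 'n, 'y) gens =
    El 'a  \<comment> \<open>\<open>a\<close>\<close>
  | Bar 'a  \<comment> \<open>\<open>a\<close> with a bar\<close>
  | XO1 'x 'm  \<comment> \<open>\<open>(x, \<omega>)\<close> for \<open>\<Omega>\<^sup>1\<close>\<close>
  | OX1 'm 'x  \<comment> \<open>\<open>(\<omega>, x)\<close> for \<open>\<Omega>\<^sup>1\<close>\<close>
  | Vf 'x  \<comment> \<open>\<open>x \<in> \<XX>\<^sup>1\<close> in the tensor algebra\<close>
  | XO2 'y 'n  \<comment> \<open>\<open>(x, \<omega>)\<close> for \<open>\<Omega>\<^sup>2\<close>\<close>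
  | OX2 'n 'y  \<comment> \<open>\<open>(\<omega>, x)\<close> for \<open>\<Omega>\<^sup>2\<close>\<close>

type_synonym ('k, 'a, 'm, 'x, 'n, 'y) falg = "('a, 'm, 'x, 'n, 'y) gens word \<Rightarrow>\<^sub>0 'k"

abbreviation gA :: "'a \<Rightarrow> ('k::field, 'a, 'm, 'x, 'n, 'y) falg" where "gA a \<equiv> gen (El a)"
abbreviation gAbar :: "'a \<Rightarrow> ('k::field, 'a, 'm, 'x, 'n, 'y) falg" where "gAbar a \<equiv> gen (Bar a)"
abbreviation gXO1 :: "'x \<Rightarrow> 'm \<Rightarrow> ('k::field, 'a, 'm, 'x, 'n, 'y) falg" where "gXO1 x w \<equiv> gen (XO1 x w)"
abbreviation gOX1 :: "'m \<Rightarrow> 'x \<Rightarrow> ('k::field, 'a, 'm, 'x, 'n, 'y) falg" where "gOX1 w x \<equiv> gen (OX1 w x)"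
abbreviation gX1 :: "'x \<Rightarrow> ('k::field, 'a, 'm, 'x, 'n, 'y) falg" where "gX1 x \<equiv> gen (Vf x)"
abbreviation gXO2 :: "'y \<Rightarrow> 'n \<Rightarrow> ('k::field, 'a, 'm, 'x, 'n, 'y) falg" where "gXO2 x w \<equiv> gen (XO2 x w)"
abbreviation gOX2 :: "'n \<Rightarrow> 'y \<Rightarrow> ('k::field, 'a, 'm, 'x, 'n, 'y) falg" where "gOX2 w x \<equiv> gen (OX2 w x)"

inductive Ae_rel ::
  "('k::field \<Rightarrow> 'a::{ring,monoid_mult} \<Rightarrow> 'a) \<Rightarrow>
   ('k, 'a, 'm, 'x, 'n, 'y) falg \<Rightarrow> ('k, 'a, 'm, 'x, 'n, 'y) falg \<Rightarrow> bool"
  for scA where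
  "Ae_rel scA (gA (a + b)) (gA a + gA b)"
| "Ae_rel scA (gA (scA k a)) (cscale k (gA a))"
| "Ae_rel scA (gA (a * b)) (gA a * gA b)"
| "Ae_rel scA (gA 1) 1"
| "Ae_rel scA (gAbar (a + b)) (gAbar a + gAbar b)"
| "Ae_rel scA (gAbar (scA k a)) (cscale k (gAbar a))"
| "Ae_rel scA (gAbar (b * a)) (gAbar a * gAbar b)"
| "Ae_rel scA (gAbar 1) 1"
| "Ae_rel scA (gA a * gAbar b) (gAbar b * gA a)"

text \<open>\<open>xo x w\<close> and \<open>ox w x\<close> are the generators \<open>(x, \<omega>)\<close> and \<open>(\<omega>, x)\<close> belonging to \<open>P\<close>.\<close>

inductive TZ_rel ::
  "('k::field \<Rightarrow> 'a::{ring,monoid_mult} \<Rightarrow> 'a) \<Rightarrow>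
   ('a, 'o::ab_group_add, 'v::ab_group_add) pivotal_data \<Rightarrow>
   ('v \<Rightarrow> 'o \<Rightarrow> ('k, 'a, 'm, 'x, 'n, 'y) falg) \<Rightarrow> ('o \<Rightarrow> 'v \<Rightarrow> ('k, 'a, 'm, 'x, 'n, 'y) falg) \<Rightarrow>
   ('k, 'a, 'm, 'x, 'n, 'y) falg \<Rightarrow> ('k, 'a, 'm, 'x, 'n, 'y) falg \<Rightarrow> bool"
  for scA P xo ox where
  "TZ_rel scA P xo ox (xo (x + x') w) (xo x w + xo x' w)"
| "TZ_rel scA P xo ox (xo x (w + w')) (xo x w + xo x w')"
| "TZ_rel scA P xo ox (xo (kact scA (Xd P) k x) w) (cscale k (xo x w))"
| "TZ_rel scA P xo ox (xo x (kact scA (Om P) k w)) (cscale k (xo x w))"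
| "TZ_rel scA P xo ox (ox (w + w') x) (ox w x + ox w' x)"
| "TZ_rel scA P xo ox (ox w (x + x')) (ox w x + ox w x')"
| "TZ_rel scA P xo ox (ox (kact scA (Om P) k w) x) (cscale k (ox w x))"
| "TZ_rel scA P xo ox (ox w (kact scA (Xd P) k x)) (cscale k (ox w x))"
| "TZ_rel scA P xo ox (gA a * xo x w) (xo (lact (Xd P) a x) w)"
| "TZ_rel scA P xo ox (gAbar a * xo x w) (xo x (ract (Om P) w a))"
| "TZ_rel scA P xo ox (xo x w * gA b) (xo (ract (Xd P) x b) w)"
| "TZ_rel scA P xo ox (xo x w * gAbar b) (xo x (lact (Om P) b w))"
| "TZ_rel scA P xo ox (gA a * ox w x) (ox (lact (Om P) a w) x)"
| "TZ_rel scA P xo ox (gAbar a * ox w x) (ox w (ract (Xd P) x a))"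
| "TZ_rel scA P xo ox (ox w x * gA b) (ox (ract (Om P) w b) x)"
| "TZ_rel scA P xo ox (ox w x * gAbar b) (ox w (lact (Xd P) b x))"

inductive H_rel ::
  "('a::{ring,monoid_mult}, 'o::ab_group_add, 'v::ab_group_add) pivotal_data \<Rightarrow>
   ('v \<Rightarrow> 'o \<Rightarrow> ('k::field, 'a, 'm, 'x, 'n, 'y) falg) \<Rightarrow> ('o \<Rightarrow> 'v \<Rightarrow> ('k, 'a, 'm, 'x, 'n, 'y) falg) \<Rightarrow>
   ('k, 'a, 'm, 'x, 'n, 'y) falg \<Rightarrow> ('k, 'a, 'm, 'x, 'n, 'y) falg \<Rightarrow> bool"
  for P xo ox where
  "H_rel P xo ox (\<Sum>(wi, xi)\<leftarrow>coev P. ox wi x * xo xi w) (gAbar (evr P w x))"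
| "H_rel P xo ox (\<Sum>(yj, rj)\<leftarrow>coevr P. xo x rj * ox w yj) (gA (ev P x w))"
| "H_rel P xo ox (\<Sum>(yj, rj)\<leftarrow>coevr P. xo yj w * ox rj x) (gAbar (ev P x w))"
| "H_rel P xo ox (\<Sum>(wi, xi)\<leftarrow>coev P. ox w xi * xo x wi) (gA (evr P w x))"

inductive T_rel ::
  "('k::field \<Rightarrow> 'a::{ring,monoid_mult} \<Rightarrow> 'a) \<Rightarrow>
   ('a, 'm::ab_group_add, 'x::ab_group_add) pivotal_data \<Rightarrow>
   ('k, 'a, 'm, 'x, 'n, 'y) falg \<Rightarrow> ('k, 'a, 'm, 'x, 'n, 'y) falg \<Rightarrow> bool"
  for scA P1 where
  "T_rel scA P1 (gX1 (x + x')) (gX1 x + gX1 x')"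
| "T_rel scA P1 (gX1 (kact scA (Xd P1) k x)) (cscale k (gX1 x))"

inductive HX_rel ::
  "('a::{ring,monoid_mult}, 'm::ab_group_add, 'x::ab_group_add) pivotal_data \<Rightarrow> ('a \<Rightarrow> 'm) \<Rightarrow>
   ('k::field, 'a, 'm, 'x, 'n, 'y) falg \<Rightarrow> ('k, 'a, 'm, 'x, 'n, 'y) falg \<Rightarrow> bool"
  for P1 d0 where
  "HX_rel P1 d0 (gA a * gX1 x) (gX1 (lact (Xd P1) a x))"
| "HX_rel P1 d0 (gX1 x * gA a) (gX1 (ract (Xd P1) x a) + gA (ev P1 x (d0 a)))"
| "HX_rel P1 d0 (gX1 x * gAbar a) (gAbar a * gX1 x + gXO1 x (d0 a))"

definition F_rel ::
  "('k::field \<Rightarrow> 'a::{ring,monoid_mult} \<Rightarrow> 'a) \<Rightarrow>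
   ('a, 'm::ab_group_add, 'x::ab_group_add) pivotal_data \<Rightarrow>
   ('a, 'n::ab_group_add, 'y::ab_group_add) pivotal_data \<Rightarrow> ('a \<Rightarrow> 'm) \<Rightarrow>
   ('k, 'a, 'm, 'x, 'n, 'y) falg \<Rightarrow> ('k, 'a, 'm, 'x, 'n, 'y) falg \<Rightarrow> bool" where
  "F_rel scA P1 P2 d0 f g \<longleftrightarrow> Ae_rel scA f g \<or>
     TZ_rel scA P1 gXO1 gOX1 f g \<or> H_rel P1 gXO1 gOX1 f g \<or>
     T_rel scA P1 f g \<or> HX_rel P1 d0 f g \<or>
     TZ_rel scA P2 gXO2 gOX2 f g \<or> H_rel P2 gXO2 gOX2 f g"

inductive D_rel ::
  "('a::{ring,monoid_mult}, 'm::ab_group_add, 'x::ab_group_add) pivotal_data \<Rightarrow>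
   ('a, 'n::ab_group_add, 'y::ab_group_add) pivotal_data \<Rightarrow> ('m \<Rightarrow> 'n) \<Rightarrow> ('m \<Rightarrow> 'm \<Rightarrow> 'n) \<Rightarrow>
   ('k::field, 'a, 'm, 'x, 'n, 'y) falg \<Rightarrow> ('k, 'a, 'm, 'x, 'n, 'y) falg \<Rightarrow> bool"
  for P1 P2 d1 wedge where
  "D_rel P1 P2 d1 wedge
     ((\<Sum>(wi, xi)\<leftarrow>coev P1. gA (ev P2 z (d1 wi)) * gX1 xi)
      - (\<Sum>(wj, xj)\<leftarrow>coev P1. \<Sum>(wk, xk)\<leftarrow>coev P1. gA (ev P2 z (wedge wj wk)) * gX1 xk * gX1 xj))
     0"
| "D_rel P1 P2 d1 wedge
     (\<Sum>(wi, xi)\<leftarrow>coev P1. \<Sum>(wj, xj)\<leftarrow>coev P1.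
        gA (ev P2 z (wedge wi wj)) * (gX1 xj * gXO1 xi w + gXO1 xj w * gX1 xi))
     ((\<Sum>(wi, xi)\<leftarrow>coev P1. gA (ev P2 z (d1 wi)) * gXO1 xi w) - gXO2 z (d1 w))"
| "D_rel P1 P2 d1 wedge
     (\<Sum>(wi, xi)\<leftarrow>coev P1. \<Sum>(wj, xj)\<leftarrow>coev P1.
        gA (ev P2 z (wedge wi wj)) * gXO1 xj r * gXO1 xi w)
     (gXO2 z (wedge w r))"
| "D_rel P1 P2 d1 wedge
     (\<Sum>(yi, ri)\<leftarrow>coevr P1. \<Sum>(yj, rj)\<leftarrow>coevr P1.
        gAbar (evr P2 (wedge ri rj) z) * gOX1 w yi * gOX1 r yj)
     (gOX2 (wedge w r) z)"

definition DX_rel ::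
  "('k::field \<Rightarrow> 'a::{ring,monoid_mult} \<Rightarrow> 'a) \<Rightarrow>
   ('a, 'm::ab_group_add, 'x::ab_group_add) pivotal_data \<Rightarrow>
   ('a, 'n::ab_group_add, 'y::ab_group_add) pivotal_data \<Rightarrow>
   ('a \<Rightarrow> 'm) \<Rightarrow> ('m \<Rightarrow> 'n) \<Rightarrow> ('m \<Rightarrow> 'm \<Rightarrow> 'n) \<Rightarrow>
   ('k, 'a, 'm, 'x, 'n, 'y) falg \<Rightarrow> ('k, 'a, 'm, 'x, 'n, 'y) falg \<Rightarrow> bool" where
  "DX_rel scA P1 P2 d0 d1 wedge f g \<longleftrightarrow> F_rel scA P1 P2 d0 f g \<or> D_rel P1 P2 d1 wedge f g"

definition DX ::
  "('k::field \<Rightarrow> 'a::{ring,monoid_mult} \<Rightarrow> 'a) \<Rightarrow>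
   ('a, 'm::ab_group_add, 'x::ab_group_add) pivotal_data \<Rightarrow>
   ('a, 'n::ab_group_add, 'y::ab_group_add) pivotal_data \<Rightarrow>
   ('a \<Rightarrow> 'm) \<Rightarrow> ('m \<Rightarrow> 'n) \<Rightarrow> ('m \<Rightarrow> 'm \<Rightarrow> 'n) \<Rightarrow>
   ('k, ('k, 'a, 'm, 'x, 'n, 'y) falg set) module" where
  "DX scA P1 P2 d0 d1 wedge = presented_algebra (DX_rel scA P1 P2 d0 d1 wedge)"

definition DX_gen ::
  "('k::field \<Rightarrow> 'a::{ring,monoid_mult} \<Rightarrow> 'a) \<Rightarrow>
   ('a, 'm::ab_group_add, 'x::ab_group_add) pivotal_data \<Rightarrow>
   ('a, 'n::ab_group_add, 'y::ab_group_add) pivotal_data \<Rightarrow>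
   ('a \<Rightarrow> 'm) \<Rightarrow> ('m \<Rightarrow> 'n) \<Rightarrow> ('m \<Rightarrow> 'm \<Rightarrow> 'n) \<Rightarrow>
   ('a, 'm, 'x, 'n, 'y) gens \<Rightarrow> ('k, 'a, 'm, 'x, 'n, 'y) falg set" where
  "DX_gen scA P1 P2 d0 d1 wedge g =
     rel_ideal (DX_rel scA P1 P2 d0 d1 wedge) +>\<^bsub>free_algebra\<^esub> gen g"

text \<open>The values on generators prescribed for the coproduct and the counit of \<open>D\<XX>\<close>. Since both are
  determined by multiplicativity from these, at most one bialgebroid structure has them. \<open>\<pi> g\<close> is the class
  of the generator \<open>g\<close> in \<open>B\<close>.\<close>

definition DX_coalgebra ::
  "('a::{ring,monoid_mult}, 'm::ab_group_add, 'x::ab_group_add) pivotal_data \<Rightarrow>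
   ('a, 'n::ab_group_add, 'y::ab_group_add) pivotal_data \<Rightarrow>
   ('k::field, 'b) module \<Rightarrow> (('a, 'm, 'x, 'n, 'y) gens \<Rightarrow> 'b) \<Rightarrow>
   ('b \<Rightarrow> ('b \<times> 'b \<Rightarrow>\<^sub>0 'k) set) \<Rightarrow> ('b \<Rightarrow> 'a) \<Rightarrow> bool" where
  "DX_coalgebra P1 P2 B \<pi> \<Delta> \<epsilon> \<longleftrightarrow>
     (\<forall>a b. pure (\<pi> (El a), \<pi> (Bar b)) \<in> \<Delta> (\<pi> (El a) \<otimes>\<^bsub>B\<^esub> \<pi> (Bar b))) \<and>
     (\<forall>a b. \<epsilon> (\<pi> (El a) \<otimes>\<^bsub>B\<^esub> \<pi> (Bar b)) = a * b) \<and>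
     (\<forall>x w. (\<Sum>(wi, xi)\<leftarrow>coev P1. pure (\<pi> (XO1 x wi), \<pi> (XO1 xi w))) \<in> \<Delta> (\<pi> (XO1 x w))) \<and>
     (\<forall>x w. \<epsilon> (\<pi> (XO1 x w)) = ev P1 x w) \<and>
     (\<forall>w x. (\<Sum>(yj, rj)\<leftarrow>coevr P1. pure (\<pi> (OX1 w yj), \<pi> (OX1 rj x))) \<in> \<Delta> (\<pi> (OX1 w x))) \<and>
     (\<forall>w x. \<epsilon> (\<pi> (OX1 w x)) = evr P1 w x) \<and>
     (\<forall>x. pure (\<pi> (Vf x), \<one>\<^bsub>B\<^esub>) + (\<Sum>(wi, xi)\<leftarrow>coev P1. pure (\<pi> (XO1 x wi), \<pi> (Vf xi)))
          \<in> \<Delta> (\<pi> (Vf x))) \<and>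
     (\<forall>x. \<epsilon> (\<pi> (Vf x)) = 0) \<and>
     (\<forall>x w. (\<Sum>(wi, xi)\<leftarrow>coev P2. pure (\<pi> (XO2 x wi), \<pi> (XO2 xi w))) \<in> \<Delta> (\<pi> (XO2 x w))) \<and>
     (\<forall>x w. \<epsilon> (\<pi> (XO2 x w)) = ev P2 x w) \<and>
     (\<forall>w x. (\<Sum>(yj, rj)\<leftarrow>coevr P2. pure (\<pi> (OX2 w yj), \<pi> (OX2 rj x))) \<in> \<Delta> (\<pi> (OX2 w x))) \<and>
     (\<forall>w x. \<epsilon> (\<pi> (OX2 w x)) = evr P2 w x)"

end

theory Submission
  imports Defs
begin

text \<open>
  \<open>B = D\<XX>\<close> is a quotient of a free algebra, so a representation of \<open>B\<close> is a family of operators for the generators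
  that satisfies the defining relations. The coproduct comes from the representation \<open>\<Phi>\<close> of \<open>B\<close> on \<open>B \<diamondop> B\<close> given by
  \<open>\<Phi> b (u \<diamondop> v) = b\<^sub>(\<^sub>1\<^sub>)u \<diamondop> b\<^sub>(\<^sub>2\<^sub>)v\<close>, and the counit from a representation on \<open>A\<close>. Then \<open>\<beta> (u \<otimes> v) = \<Phi> u (1 \<diamondop> v)\<close>, and the
  inverse of \<open>\<beta>\<close> is \<open>u \<diamondop> v \<mapsto> \<Gamma> u (1 \<otimes> v)\<close> for a right representation \<open>\<Gamma>\<close> on the tensor product over \<open>A\<^sup>o\<^sup>p\<close>, in which
  the generators act as multiplication, from the right in the first factor and from the left in the second, by
  \<open>(x, \<omega>) \<mapsto> (x, \<rho>\<^sub>j) \<otimes> (\<omega>, y\<^sub>j)\<close>, \<open>(\<omega>, x) \<mapsto> (\<omega>, x\<^sub>i) \<otimes> (x, \<omega>\<^sub>i)\<close> and \<open>x \<mapsto> x \<otimes> 1 - (x, \<rho>\<^sub>j) \<otimes> (\<omega>\<^sub>i, y\<^sub>j) \<bullet> x\<^sub>i\<close>.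
  That the two maps are inverse to each other passes to products, so it is enough to verify it on generators.
  The map \<open>\<theta>\<close> is reduced to \<open>\<beta>\<close> by a symmetry of the relations, which replaces \<open>A\<close> by \<open>A\<^sup>o\<^sup>p\<close>, exchanges \<open>(x, \<omega>)\<close>
  with \<open>(\<omega>, x)\<close>, sends \<open>w \<and> v\<close> to \<open>- v \<and> w\<close> and \<open>x\<close> to \<open>(\<omega>\<^sub>i, x) \<bullet> x\<^sub>i\<close>.
\<close>

section \<open>Dual pairs and calculi\<close>

text \<open>The product of \<open>B\<close> does not descend to all of
  \<open>B \<diamondop> B\<close>, so the coproduct cannot be an algebra map into it. Operators on
  \<open>B \<diamondop> B\<close> do form a ring, and there each defining relation becomes an
  identity that can be tested on tensors. The right representation \<open>\<Gamma>\<close> encodes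
  the translation map b -> b_+ \<otimes> b_-, the inverse of \<beta> on b \<diamondop> 1: it
  satisfies (bc)_+ \<otimes> (bc)_- = b_+ c_+ \<otimes> c_- b_-, whence the multiplication from
  opposite sides and the reversed order. Quotients are images of linear idempotents, so the unit of
  \<open>B\<close> acts as an idempotent and not as the identity. The work lies in showing that the
  relations survive each passage: to \<open>B \<diamondop> B\<close>, to the tensor product over the
  opposite algebra, to \<open>A\<close>, and to the mirror image. The mirror image interchanges the
  third and the fourth relation, but for the first two it is a computation, and
  \<open>\<Gamma>\<close> needs its result already for \<beta>. Pivotality of the wedge enters in
  two places: in the mirror image of the calculus and in the fourth relation for
  \<open>\<Gamma>\<close>.\<close>

lemma additive_sum:
  fixes f :: "'u::ab_group_add \<Rightarrow> 'v::ab_group_add"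
  assumes "\<And>x y. f (x + y) = f x + f y"
  shows "f (sum g A) = (\<Sum>i\<in>A. f (g i))"
proof -
  have "f 0 + f 0 = f 0" using assms[of 0 0] by simp
  hence "f 0 = 0" by simp
  thus ?thesis by (induction A rule: infinite_finite_induct) (auto simp: assms)
qed

lemma additive_zero:
  fixes f :: "'u::ab_group_add \<Rightarrow> 'v::ab_group_add"
  assumes "\<And>x y. f (x + y) = f x + f y"
  shows "f 0 = 0"
  using additive_sum[of f "\<lambda>_. 0" "{}", OF assms] by simp

lemma additive_minus:
  fixes f :: "'u::ab_group_add \<Rightarrow> 'v::ab_group_add"
  assumes "\<And>x y. f (x + y) = f x + f y"
  shows "f (- x) = - f x"
  using assms[of x "- x"] additive_zero[of f, OF assms] by (simp add: eq_neg_iff_add_eq_0 add.commute)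

lemma additive_diff:
  fixes f :: "'u::ab_group_add \<Rightarrow> 'v::ab_group_add"
  assumes "\<And>x y. f (x + y) = f x + f y"
  shows "f (x - y) = f x - f y"
  using assms[of x "- y"] additive_minus[of f, OF assms] by simp

text \<open>The part of a pivotal bimodule that enters the relations, in a form that admits a mirror image: \<open>O\<close> and \<open>X\<close>
  stand for \<open>\<Omega>\<close> and \<open>\<XX>\<close>, \<open>el\<close> and \<open>er\<close> for the two evaluations, and the dual bases are \<open>om i \<otimes> xi i\<close> for \<open>i < nc\<close> and
  \<open>up j \<otimes> rh j\<close> for \<open>j < nd\<close>.\<close>

record ('a, 'm, 'x) dual_data =
  lO :: "'a \<Rightarrow> 'm \<Rightarrow> 'm"
  rO :: "'m \<Rightarrow> 'a \<Rightarrow> 'm"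
  lX :: "'a \<Rightarrow> 'x \<Rightarrow> 'x"
  rX :: "'x \<Rightarrow> 'a \<Rightarrow> 'x"
  el :: "'x \<Rightarrow> 'm \<Rightarrow> 'a"
  er :: "'m \<Rightarrow> 'x \<Rightarrow> 'a"
  nc :: nat
  om :: "nat \<Rightarrow> 'm"
  xi :: "nat \<Rightarrow> 'x"
  nd :: nat
  up :: "nat \<Rightarrow> 'x"
  rh :: "nat \<Rightarrow> 'm"

text \<open>The same bimodule over the opposite algebra. A left dual becomes a right dual, so the
  two evaluations and the two dual bases change places.\<close>

definition mirror :: "('a, 'm, 'x) dual_data \<Rightarrow> ('a, 'm, 'x) dual_data" where
  "mirror P = \<lparr>lO = \<lambda>a w. rO P w a, rO = \<lambda>w a. lO P a w, lX = \<lambda>a x. rX P x a, rX = \<lambda>x a. lX P a x,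
     el = \<lambda>x w. er P w x, er = \<lambda>w x. el P x w, nc = nd P, om = rh P, xi = up P,
     nd = nc P, up = xi P, rh = om P\<rparr>"

lemma mirror_simps [simp]:
  "lO (mirror P) a w = rO P w a" "rO (mirror P) w a = lO P a w"
  "lX (mirror P) a x = rX P x a" "rX (mirror P) x a = lX P a x"
  "el (mirror P) x w = er P w x" "er (mirror P) w x = el P x w"
  "nc (mirror P) = nd P" "om (mirror P) = rh P" "xi (mirror P) = up P"
  "nd (mirror P) = nc P" "up (mirror P) = xi P" "rh (mirror P) = om P"
  by (simp_all add: mirror_def)

lemma mirror_mirror [simp]: "mirror (mirror P) = P"
  by (simp add: mirror_def)

text \<open>The product of \<open>A\<close> is a parameter and not the class operation, because the
  mirror image needs the opposite product on the same type.\<close>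

locale dual_pair =
  fixes mu :: "'a::ab_group_add \<Rightarrow> 'a \<Rightarrow> 'a" and one :: 'a
    and P :: "('a, 'm::ab_group_add, 'x::ab_group_add) dual_data"
  assumes mu_addl: "mu (a + b) c = mu a c + mu b c" and mu_addr: "mu a (b + c) = mu a b + mu a c"
    and mu_assoc: "mu (mu a b) c = mu a (mu b c)"
    and mu_onel: "mu one a = a" and mu_oner: "mu a one = a"
    and lO_addl: "lO P (a + b) w = lO P a w + lO P b w"
    and lO_addr: "lO P a (w + v) = lO P a w + lO P a v"
    and lO_mu: "lO P (mu a b) w = lO P a (lO P b w)" and lO_one: "lO P one w = w"
    and rO_addl: "rO P (w + v) a = rO P w a + rO P v a"
    and rO_addr: "rO P w (a + b) = rO P w a + rO P w b"
    and rO_mu: "rO P w (mu a b) = rO P (rO P w a) b" and rO_one: "rO P w one = w"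
    and lrO: "rO P (lO P a w) b = lO P a (rO P w b)"
    and lX_addl: "lX P (a + b) x = lX P a x + lX P b x"
    and lX_addr: "lX P a (x + y) = lX P a x + lX P a y"
    and lX_mu: "lX P (mu a b) x = lX P a (lX P b x)" and lX_one: "lX P one x = x"
    and rX_addl: "rX P (x + y) a = rX P x a + rX P y a"
    and rX_addr: "rX P x (a + b) = rX P x a + rX P x b"
    and rX_mu: "rX P x (mu a b) = rX P (rX P x a) b" and rX_one: "rX P x one = x"
    and lrX: "rX P (lX P a x) b = lX P a (rX P x b)"
    and el_addl: "el P (x + y) w = el P x w + el P y w"
    and el_addr: "el P x (w + v) = el P x w + el P x v"
    and el_lX: "el P (lX P a x) w = mu a (el P x w)"
    and el_bal: "el P (rX P x a) w = el P x (lO P a w)"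
    and el_rO: "el P x (rO P w a) = mu (el P x w) a"
    and er_addl: "er P (w + v) x = er P w x + er P v x"
    and er_addr: "er P w (x + y) = er P w x + er P w y"
    and er_lO: "er P (lO P a w) x = mu a (er P w x)"
    and er_bal: "er P (rO P w a) x = er P w (lX P a x)"
    and er_rX: "er P w (rX P x a) = mu (er P w x) a"
    and coev_O: "(\<Sum>i<nc P. rO P (om P i) (el P (xi P i) w)) = w"
    and coev_X: "(\<Sum>i<nc P. lX P (el P x (om P i)) (xi P i)) = x"
    and coevr_O: "(\<Sum>j<nd P. lO P (er P w (up P j)) (rh P j)) = w"
    and coevr_X: "(\<Sum>j<nd P. rX P (up P j) (er P (rh P j) x)) = x"
begin

lemma mirror: "dual_pair (\<lambda>a b. mu b a) one (mirror P)"
  by unfold_locales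
    (simp_all add: mu_addl mu_addr mu_assoc mu_onel mu_oner lO_addl lO_addr lO_mu lO_one rO_addl rO_addr
      rO_mu rO_one lX_addl lX_addr lX_mu lX_one rX_addl rX_addr rX_mu rX_one lrO lrX el_addl el_addr el_lX
      el_bal el_rO er_addl er_addr er_lO er_bal er_rX coev_O coev_X coevr_O coevr_X)

lemma collapse:
  fixes f :: "'m \<Rightarrow> 'z::ab_group_add"
  assumes "\<And>w v. f (w + v) = f w + f v"
  shows "(\<Sum>i<nc P. f (rO P (om P i) (el P (xi P i) w))) = f w"
    and "(\<Sum>j<nd P. f (lO P (er P w (up P j)) (rh P j))) = f w"
  by (simp_all add: additive_sum[of f, OF assms, symmetric] coev_O coevr_O)

lemma collapseX:
  fixes f :: "'x \<Rightarrow> 'z::ab_group_add"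
  assumes "\<And>x y. f (x + y) = f x + f y"
  shows "(\<Sum>i<nc P. f (lX P (el P x (om P i)) (xi P i))) = f x"
    and "(\<Sum>j<nd P. f (rX P (up P j) (er P (rh P j) x))) = f x"
  by (simp_all add: additive_sum[of f, OF assms, symmetric] coev_X coevr_X)

text \<open>The element \<open>coev(1)\<close> commutes with \<open>a\<close>, tested by balanced
  maps. Insert the dual basis once more, move the coefficient across \<open>f\<close>, and contract
  the basis that was there before.\<close>

lemma central:
  fixes f :: "'m \<Rightarrow> 'x \<Rightarrow> 'z::ab_group_add"
  assumes 1: "\<And>w v x. f (w + v) x = f w x + f v x" and 2: "\<And>w x y. f w (x + y) = f w x + f w y"
    and b: "\<And>w a x. f (rO P w a) x = f w (lX P a x)"
  shows "(\<Sum>i<nc P. f (lO P a (om P i)) (xi P i)) = (\<Sum>i<nc P. f (om P i) (rX P (xi P i) a))"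
proof -
  have "(\<Sum>i<nc P. f (lO P a (om P i)) (xi P i))
      = (\<Sum>i<nc P. \<Sum>k<nc P. f (rO P (om P k) (el P (xi P k) (lO P a (om P i)))) (xi P i))"
    by (simp add: collapse(1)[of "\<lambda>w. f w _", OF 1])
  also have "\<dots> = (\<Sum>k<nc P. \<Sum>i<nc P. f (om P k) (lX P (el P (rX P (xi P k) a) (om P i)) (xi P i)))"
    by (subst sum.swap) (simp add: b el_bal)
  also have "\<dots> = (\<Sum>k<nc P. f (om P k) (rX P (xi P k) a))"
    by (simp add: collapseX(1)[of "f _", OF 2])
  finally show ?thesis .
qed

lemma centralr:
  fixes f :: "'x \<Rightarrow> 'm \<Rightarrow> 'z::ab_group_add"
  assumes 1: "\<And>w v x. f x (w + v) = f x w + f x v" and 2: "\<And>w x y. f (x + y) w = f x w + f y w"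
    and b: "\<And>w a x. f (rX P x a) w = f x (lO P a w)"
  shows "(\<Sum>i<nd P. f (lX P a (up P i)) (rh P i)) = (\<Sum>i<nd P. f (up P i) (rO P (rh P i) a))"
  using dual_pair.central[OF mirror, of "\<lambda>w x. f x w" a] by (simp add: 1 2 b)

end

text \<open>Images of \<open>H(\<Omega>)\<close> in a ring \<open>'r\<close>: \<open>s a\<close>, \<open>t a\<close>, \<open>xo x w\<close> and \<open>ox w x\<close> are the images of \<open>a\<close>, of \<open>a\<close> with a bar, of \<open>(x, \<omega>)\<close> and
  of \<open>(\<omega>, x)\<close>. The image \<open>s one\<close> of the unit need not be a unit of \<open>'r\<close>.\<close>

locale hst = dual_pair mu one P
  for mu :: "'a::ab_group_add \<Rightarrow> 'a \<Rightarrow> 'a" and one :: 'a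
    and P :: "('a, 'm::ab_group_add, 'x::ab_group_add) dual_data" +
  fixes s t :: "'a \<Rightarrow> 'r::ring" and xo :: "'x \<Rightarrow> 'm \<Rightarrow> 'r" and ox :: "'m \<Rightarrow> 'x \<Rightarrow> 'r"
  assumes s_add: "s (a + b) = s a + s b" and t_add: "t (a + b) = t a + t b"
    and s_mu: "s (mu a b) = s a * s b" and t_mu: "t (mu b a) = t a * t b"
    and s_one: "s one = t one" and st: "s a * t b = t b * s a"
    and xo_addl: "xo (x + y) w = xo x w + xo y w" and xo_addr: "xo x (w + v) = xo x w + xo x v"
    and ox_addl: "ox (w + v) x = ox w x + ox v x" and ox_addr: "ox w (x + y) = ox w x + ox w y"
    and sxo: "s a * xo x w = xo (lX P a x) w" and txo: "t a * xo x w = xo x (rO P w a)"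
    and xos: "xo x w * s b = xo (rX P x b) w" and xot: "xo x w * t b = xo x (lO P b w)"
    and sox: "s a * ox w x = ox (lO P a w) x" and tox: "t a * ox w x = ox w (rX P x a)"
    and oxs: "ox w x * s b = ox (rO P w b) x" and oxt: "ox w x * t b = ox w (lX P b x)"
    and H1: "(\<Sum>i<nc P. ox (om P i) x * xo (xi P i) w) = t (er P w x)"
    and H2: "(\<Sum>j<nd P. xo x (rh P j) * ox w (up P j)) = s (el P x w)"
    and H3: "(\<Sum>j<nd P. xo (up P j) w * ox (rh P j) x) = t (el P x w)"
    and H4: "(\<Sum>i<nc P. ox w (xi P i) * xo x (om P i)) = s (er P w x)"
begin

text \<open>Exchanging \<open>s\<close> with \<open>t\<close> and \<open>(x, w)\<close> with
  \<open>(w, x)\<close> permutes the bimodule rules and interchanges \<open>H1\<close> with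
  \<open>H2\<close> and \<open>H3\<close> with \<open>H4\<close>.\<close>

lemma mirror_hst: "hst (\<lambda>a b. mu b a) one (mirror P) t s (\<lambda>x w. ox w x) (\<lambda>w x. xo x w)"
proof -
  interpret M: dual_pair "\<lambda>a b. mu b a" one "mirror P" by (rule mirror)
  show ?thesis
    by unfold_locales
      (simp_all add: s_add t_add s_mu t_mu s_one[symmetric] st[symmetric] xo_addl xo_addr ox_addl ox_addr sxo txo xos xot sox
        tox oxs oxt H1 H2 H3 H4)
qed

lemma unit_simps:
  "s one * xo x w = xo x w" "xo x w * s one = xo x w" "s one * ox w x = ox w x" "ox w x * s one = ox w x"
  "s one * s a = s a" "s a * s one = s a" "s one * t a = t a" "t a * s one = t a"
  by (simp_all add: sxo sox xos oxs lX_one rX_one lO_one rO_one s_mu[symmetric] mu_onel mu_oner)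
     (simp_all add: s_one t_mu[symmetric] mu_onel mu_oner)

lemmas H_assoc = sxo txo xos xot sox tox oxs oxt

text \<open>Products are kept bracketed to the right, where the rules without a trailing factor
  would no longer match.\<close>

lemma H_assoc':
  "s a * (xo x w * z) = xo (lX P a x) w * z" "t a * (xo x w * z) = xo x (rO P w a) * z"
  "xo x w * (s b * z) = xo (rX P x b) w * z" "xo x w * (t b * z) = xo x (lO P b w) * z"
  "s a * (ox w x * z) = ox (lO P a w) x * z" "t a * (ox w x * z) = ox w (rX P x a) * z"
  "ox w x * (s b * z) = ox (rO P w b) x * z" "ox w x * (t b * z) = ox w (lX P b x) * z"
  by (simp_all add: H_assoc mult.assoc[symmetric])

lemma H_sum:
  "(\<Sum>i<nc P. ox (om P i) x * (xo (xi P i) w * z)) = t (er P w x) * z"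
  "(\<Sum>j<nd P. xo x (rh P j) * (ox w (up P j) * z)) = s (el P x w) * z"
  "(\<Sum>j<nd P. xo (up P j) w * (ox (rh P j) x * z)) = t (el P x w) * z"
  "(\<Sum>i<nc P. ox w (xi P i) * (xo x (om P i) * z)) = s (er P w x) * z"
  by (simp_all add: H1[symmetric] H2[symmetric] H3[symmetric] H4[symmetric] sum_distrib_right mult.assoc)

end

text \<open>The assumption \<open>pivotal\<close> is the condition on the wedge, paired with
  \<open>w\<close> and \<open>v\<close> through the nested evaluation x \<otimes> y \<mapsto>
  \<open>el P1 x (lO P1 (el P1 y w) v)\<close>. This form needs no tensor product, and it loses
  nothing because the dual bases recover an element of the tensor square from its pairings.\<close>

locale calc = A1: dual_pair mu one P1 + A2: dual_pair mu one P2
  for mu :: "'a::ab_group_add \<Rightarrow> 'a \<Rightarrow> 'a" and one :: 'a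
    and P1 :: "('a, 'm::ab_group_add, 'x::ab_group_add) dual_data"
    and P2 :: "('a, 'n::ab_group_add, 'y::ab_group_add) dual_data" +
  fixes d0 :: "'a \<Rightarrow> 'm" and d1 :: "'m \<Rightarrow> 'n" and wg :: "'m \<Rightarrow> 'm \<Rightarrow> 'n"
  assumes d0_add: "d0 (a + b) = d0 a + d0 b"
    and d1_add: "d1 (w + v) = d1 w + d1 v"
    and wg_addl: "wg (w + w') v = wg w v + wg w' v" and wg_addr: "wg w (v + v') = wg w v + wg w v'"
    and wg_bal: "wg (rO P1 w a) v = wg w (lO P1 a v)"
    and wg_l: "wg (lO P1 a w) v = lO P2 a (wg w v)" and wg_r: "wg w (rO P1 v a) = rO P2 (wg w v) a"
    and d0_mu: "d0 (mu a b) = rO P1 (d0 a) b + lO P1 a (d0 b)"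
    and d1_l: "d1 (lO P1 a w) = wg (d0 a) w + lO P2 a (d1 w)"
    and d1_r: "d1 (rO P1 w a) = rO P2 (d1 w) a - wg w (d0 a)"
    and d1_d0: "d1 (d0 a) = 0"
    and pivotal: "el P2 z (wg w v) = (\<Sum>i<nd P1. \<Sum>j<nd P1. el P1 (up P1 i)
      (lO P1 (el P1 (up P1 j) (lO P1 (er P2 (wg (rh P1 j) (rh P1 i)) z) w)) v))"
begin

text \<open>The pivotal condition in the form in which it is used: on balanced maps.\<close>

lemma pivotal_balanced:
  fixes f :: "'x \<Rightarrow> 'x \<Rightarrow> 'z::ab_group_add"
  assumes 1: "\<And>x y v. f (x + y) v = f x v + f y v" and 2: "\<And>x y v. f v (x + y) = f v x + f v y"
    and b: "\<And>x a y. f (rX P1 x a) y = f x (lX P1 a y)"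
  shows "(\<Sum>i<nc P1. \<Sum>j<nc P1. f (lX P1 (el P2 z (wg (om P1 i) (om P1 j))) (xi P1 j)) (xi P1 i))
    = (\<Sum>i<nd P1. \<Sum>j<nd P1. f (up P1 i) (rX P1 (up P1 j) (er P2 (wg (rh P1 j) (rh P1 i)) z)))"
proof -
  let ?e = "\<lambda>i j. er P2 (wg (rh P1 j) (rh P1 i)) z"
  \<comment> \<open>Expand both arguments in the basis \<open>xi\<close>; the coefficients are the
    nested pairings of \<open>pivotal\<close> at \<open>om k\<close> and
    \<open>om l\<close>.\<close>
  have "f (up P1 i) (rX P1 (up P1 j) (?e i j)) =
      (\<Sum>k<nc P1. \<Sum>l<nc P1. f (lX P1 (el P1 (up P1 i)
      (lO P1 (el P1 (up P1 j) (lO P1 (?e i j) (om P1 k))) (om P1 l))) (xi P1 l)) (xi P1 k))" for i j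
  proof -
    have "f (up P1 i) (rX P1 (up P1 j) (?e i j)) =
      (\<Sum>k<nc P1. f (up P1 i) (lX P1 (el P1 (rX P1 (up P1 j) (?e i j)) (om P1 k)) (xi P1 k)))"
      by (simp add: A1.collapseX(1)[of "f _", OF 2])
    also have "\<dots> = (\<Sum>k<nc P1. f (rX P1 (up P1 i) (el P1 (rX P1 (up P1 j) (?e i j)) (om P1 k))) (xi P1 k))"
      by (simp add: b)
    also have "\<dots> = (\<Sum>k<nc P1. \<Sum>l<nc P1. f (lX P1 (el P1 (rX P1 (up P1 i)
        (el P1 (rX P1 (up P1 j) (?e i j)) (om P1 k))) (om P1 l)) (xi P1 l)) (xi P1 k))"
      by (simp add: A1.collapseX(1)[of "\<lambda>x. f x _", OF 1])
    finally show ?thesis by (simp add: A1.el_bal)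
  qed
  hence "(\<Sum>i<nd P1. \<Sum>j<nd P1. f (up P1 i) (rX P1 (up P1 j) (?e i j))) =
    (\<Sum>i<nd P1. \<Sum>j<nd P1. \<Sum>k<nc P1. \<Sum>l<nc P1. f (lX P1 (el P1 (up P1 i)
      (lO P1 (el P1 (up P1 j) (lO P1 (?e i j) (om P1 k))) (om P1 l))) (xi P1 l)) (xi P1 k))"
    by simp
  also have "\<dots> = (\<Sum>k<nc P1. \<Sum>l<nc P1. \<Sum>i<nd P1. \<Sum>j<nd P1. f (lX P1 (el P1 (up P1 i)
      (lO P1 (el P1 (up P1 j) (lO P1 (?e i j) (om P1 k))) (om P1 l))) (xi P1 l)) (xi P1 k))"
    (is "(\<Sum>i<_. \<Sum>j<_. \<Sum>k<_. \<Sum>l<_. ?h i j k l) = _")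
  proof -
    have "(\<Sum>i<nd P1. \<Sum>j<nd P1. \<Sum>k<nc P1. \<Sum>l<nc P1. ?h i j k l)
      = (\<Sum>i<nd P1. \<Sum>k<nc P1. \<Sum>j<nd P1. \<Sum>l<nc P1. ?h i j k l)"
      by (intro sum.cong refl sum.swap)
    also have "\<dots> = (\<Sum>k<nc P1. \<Sum>i<nd P1. \<Sum>l<nc P1. \<Sum>j<nd P1. ?h i j k l)"
      by (subst sum.swap) (intro sum.cong refl sum.swap)
    also have "\<dots> = (\<Sum>k<nc P1. \<Sum>l<nc P1. \<Sum>i<nd P1. \<Sum>j<nd P1. ?h i j k l)"
      by (intro sum.cong refl sum.swap)
    finally show ?thesis .
  qed
  also have "\<dots> = (\<Sum>k<nc P1. \<Sum>l<nc P1. f (lX P1 (el P2 z (wg (om P1 k) (om P1 l))) (xi P1 l)) (xi P1 k))"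
    by (simp add: pivotal additive_sum[of "\<lambda>x. f x _", OF 1, symmetric] additive_sum[of "\<lambda>a. lX P1 a _", OF A1.lX_addl, symmetric])
  finally show ?thesis by simp
qed

lemma d0_one: "d0 one = 0"
  using d0_mu[of one one] by (simp add: A1.mu_onel A1.rO_one A1.lO_one)

text \<open>Over the opposite algebra the left and the right Leibniz rule for \<open>d1\<close>
  change places. Their wedge terms have opposite signs, so the reversed wedge has to carry a minus
  sign.\<close>

lemma mirror_calc: "calc (\<lambda>a b. mu b a) one (mirror P1) (mirror P2) d0 d1 (\<lambda>w v. - wg v w)"
proof -
  interpret M1: dual_pair "\<lambda>a b. mu b a" one "mirror P1" by (rule A1.mirror)
  interpret M2: dual_pair "\<lambda>a b. mu b a" one "mirror P2" by (rule A2.mirror)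
  have er_minus: "er P2 (- w) x = - er P2 w x" for w x
    by (rule additive_minus[of "\<lambda>w. er P2 w x", OF A2.er_addl])
  have el_minus: "el P2 x (- w) = - el P2 x w" for w x
    by (rule additive_minus[of "\<lambda>w. el P2 x w", OF A2.el_addr])
  have rO_minus: "rO P1 w (- a) = - rO P1 w a" for w a
    by (rule additive_minus[of "\<lambda>a. rO P1 w a", OF A1.rO_addr])
  have rO_minusl: "rO P1 (- w) a = - rO P1 w a" for w a
    by (rule additive_minus[of "\<lambda>w. rO P1 w a", OF A1.rO_addl])
  have er1_minus: "er P1 (- w) x = - er P1 w x" for w x
    by (rule additive_minus[of "\<lambda>w. er P1 w x", OF A1.er_addl])
  have lr2_minus: "lO P2 a (- w) = - lO P2 a w" "rO P2 (- w) a = - rO P2 w a" for a w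
    by (rule additive_minus[of "\<lambda>w. lO P2 a w", OF A2.lO_addr], rule additive_minus[of "\<lambda>w. rO P2 w a", OF A2.rO_addl])
  \<comment> \<open>Pivotality with the evaluations exchanged: \<open>pivotal_balanced\<close>
    replaces the bases \<open>om\<close>, \<open>xi\<close> by \<open>rh\<close>, \<open>up\<close>,
    and these contract against \<open>v\<close> and \<open>w\<close>.\<close>
  have piv: "er P2 (wg v w) z = (\<Sum>i<nc P1. \<Sum>j<nc P1. er P1 (rO P1 v
       (er P1 (rO P1 w (el P2 z (wg (om P1 i) (om P1 j)))) (xi P1 j))) (xi P1 i))" for w v z
  proof -
    let ?f = "\<lambda>x y. er P1 (rO P1 v (er P1 w x)) y"
    have "(\<Sum>i<nc P1. \<Sum>j<nc P1. ?f (lX P1 (el P2 z (wg (om P1 i) (om P1 j))) (xi P1 j)) (xi P1 i))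
      = (\<Sum>i<nd P1. \<Sum>j<nd P1. ?f (up P1 i) (rX P1 (up P1 j) (er P2 (wg (rh P1 j) (rh P1 i)) z)))"
      by (rule pivotal_balanced)
        (simp_all add: A1.er_addl A1.er_addr A1.rO_addr A1.er_rX A1.rO_mu A1.er_bal)
    also have "\<dots> = (\<Sum>i<nd P1. \<Sum>j<nd P1. er P2 (wg (lO P1 (er P1 (rO P1 v (er P1 w (up P1 i))) (up P1 j)) (rh P1 j)) (rh P1 i)) z)"
      by (simp add: A1.er_rX wg_l A2.er_lO)
    also have "\<dots> = (\<Sum>i<nd P1. er P2 (wg (rO P1 v (er P1 w (up P1 i))) (rh P1 i)) z)"
      by (simp add: A1.collapse(2)[of "\<lambda>u. er P2 (wg u _) z"] wg_addl A2.er_addl)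
    also have "\<dots> = er P2 (wg v w) z"
      by (simp add: wg_bal A1.collapse(2)[of "\<lambda>u. er P2 (wg v u) z"] wg_addr A2.er_addl)
    finally show ?thesis by (simp add: A1.er_bal)
  qed
  show ?thesis
    by unfold_locales
      (simp_all add: d0_add d1_add wg_addl wg_addr wg_bal wg_l wg_r d0_mu d1_l d1_r d1_d0 er_minus el_minus
        piv rO_minus rO_minusl er1_minus lr2_minus sum_negf)
qed

end

section \<open>The relations of \<open>D\<XX>\<close> in a ring\<close>

text \<open>Instances are the homomorphic images of \<open>D\<XX>\<close>. The ring is arbitrary
  because the locale serves for left and right multiplication on \<open>B\<close>, for operators on
  the tensor products and on \<open>A\<close>, and for the mirror images of these.\<close>

locale dx = calc mu one P1 P2 d0 d1 wg + K1: hst mu one P1 s t xo1 ox1 + K2: hst mu one P2 s t xo2 ox2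
  for mu :: "'a::ab_group_add \<Rightarrow> 'a \<Rightarrow> 'a" and one :: 'a
    and P1 :: "('a, 'm::ab_group_add, 'x::ab_group_add) dual_data"
    and P2 :: "('a, 'n::ab_group_add, 'y::ab_group_add) dual_data"
    and d0 :: "'a \<Rightarrow> 'm" and d1 :: "'m \<Rightarrow> 'n" and wg :: "'m \<Rightarrow> 'm \<Rightarrow> 'n"
    and s t :: "'a \<Rightarrow> 'r::ring"
    and xo1 :: "'x \<Rightarrow> 'm \<Rightarrow> 'r" and ox1 :: "'m \<Rightarrow> 'x \<Rightarrow> 'r"
    and xo2 :: "'y \<Rightarrow> 'n \<Rightarrow> 'r" and ox2 :: "'n \<Rightarrow> 'y \<Rightarrow> 'r" +
  fixes vf :: "'x \<Rightarrow> 'r"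
  assumes vf_add: "vf (x + y) = vf x + vf y"
    and svf: "s a * vf x = vf (lX P1 a x)"
    and vfs: "vf x * s a = vf (rX P1 x a) + s (el P1 x (d0 a))"
    and vft: "vf x * t a = t a * vf x + xo1 x (d0 a)"
    and D1: "(\<Sum>i<nc P1. s (el P2 z (d1 (om P1 i))) * vf (xi P1 i)) =
      (\<Sum>i<nc P1. \<Sum>j<nc P1. s (el P2 z (wg (om P1 i) (om P1 j))) * (vf (xi P1 j) * vf (xi P1 i)))"
    and D2: "(\<Sum>i<nc P1. \<Sum>j<nc P1. s (el P2 z (wg (om P1 i) (om P1 j))) *
        (vf (xi P1 j) * xo1 (xi P1 i) w + xo1 (xi P1 j) w * vf (xi P1 i))) =
      (\<Sum>i<nc P1. s (el P2 z (d1 (om P1 i))) * xo1 (xi P1 i) w) - xo2 z (d1 w)"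
    and D3: "(\<Sum>i<nc P1. \<Sum>j<nc P1. s (el P2 z (wg (om P1 i) (om P1 j))) *
        (xo1 (xi P1 j) v * xo1 (xi P1 i) w)) = xo2 z (wg w v)"
    and D4: "(\<Sum>i<nd P1. \<Sum>j<nd P1. t (er P2 (wg (rh P1 i) (rh P1 j)) z) *
        (ox1 w (up P1 i) * ox1 v (up P1 j))) = ox2 (wg w v) z"
begin

lemma vf_rules':
  "s a * (vf x * c) = vf (lX P1 a x) * c"
  "vf x * (s a * c) = vf (rX P1 x a) * c + s (el P1 x (d0 a)) * c"
  "vf x * (t a * c) = t a * (vf x * c) + xo1 x (d0 a) * c"
  by (simp_all add: mult.assoc[symmetric] svf vfs vft distrib_right)

lemma D4': "(\<Sum>i<nd P1. \<Sum>j<nd P1. t (er P2 (wg (rh P1 i) (rh P1 j)) z) *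
        (ox1 w (up P1 i) * (ox1 v (up P1 j) * c))) = ox2 (wg w v) z * c"
  by (simp add: D4[symmetric] sum_distrib_right mult.assoc)

lemma vf_unit: "s one * vf x = vf x" "vf x * s one = vf x"
proof -
  have "el P1 x 0 = 0" by (rule additive_zero) (rule A1.el_addr)
  moreover have "s 0 = 0" by (rule additive_zero) (rule K1.s_add)
  ultimately show "s one * vf x = vf x" "vf x * s one = vf x"
    by (simp_all add: svf vfs A1.lX_one A1.rX_one d0_one)
qed

text \<open>Contracting with \<open>ox2 (om P2 m) z\<close> turns the scalar coefficient of a
  relation for \<open>xi P2 m\<close> into a matrix entry of \<open>ox2\<close>. In this way
  \<open>D1\<close> and \<open>D2\<close> are carried to the mirror image.\<close>

lemma ox2_collapse:
  "(\<Sum>m<nc P2. ox2 (om P2 m) z * (s (el P2 (xi P2 m) \<theta>) * c)) = ox2 \<theta> z * c"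
proof -
  have "(\<Sum>m<nc P2. ox2 (om P2 m) z * s (el P2 (xi P2 m) \<theta>)) = ox2 \<theta> z"
    by (simp add: K2.oxs A2.collapse(1)[of "\<lambda>w. ox2 w z", OF K2.ox_addl])
  from this[symmetric] show ?thesis by (simp add: sum_distrib_right mult.assoc)
qed

text \<open>The counterpart of \<open>vf\<close> in the mirror image.\<close>

definition vfr :: "'x \<Rightarrow> 'r" where
  "vfr y = (\<Sum>l<nc P1. ox1 (om P1 l) y * vf (xi P1 l))"

lemma vfr_add: "vfr (x + y) = vfr x + vfr y"
  by (simp add: vfr_def K1.ox_addr distrib_right sum.distrib)

lemma t_vfr: "t a * vfr y = vfr (rX P1 y a)"
  by (simp add: vfr_def sum_distrib_left K1.H_assoc')

lemma vfr_t: "vfr y * t a = vfr (lX P1 a y) + t (er P1 (d0 a) y)"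
  by (simp add: vfr_def sum_distrib_right mult.assoc vft distrib_left sum.distrib K1.H_assoc' K1.H1)

text \<open>By centrality of \<open>coev(1)\<close> the scalar passes through the sum; the term with
  \<open>d0 a\<close> from \<open>vfs\<close> contracts to \<open>ox1 (d0 a) y\<close>.\<close>

lemma vfr_s: "vfr y * s a = s a * vfr y + ox1 (d0 a) y"
proof -
  have 1: "(\<Sum>l<nc P1. ox1 (om P1 l) y * vf (rX P1 (xi P1 l) a)) = (\<Sum>l<nc P1. ox1 (lO P1 a (om P1 l)) y * vf (xi P1 l))"
    by (rule A1.central[symmetric, of "\<lambda>w x. ox1 w y * vf x"])
      (simp_all add: K1.ox_addl vf_add distrib_left distrib_right svf[symmetric] K1.H_assoc')
  have 2: "(\<Sum>l<nc P1. ox1 (om P1 l) y * s (el P1 (xi P1 l) (d0 a))) = ox1 (d0 a) y"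
    by (simp add: K1.oxs A1.collapse(1)[of "\<lambda>w. ox1 w y", OF K1.ox_addl])
  show ?thesis
    by (simp add: vfr_def sum_distrib_right mult.assoc vfs distrib_left sum.distrib 1 2 sum_distrib_left K1.H_assoc')
qed

text \<open>The matrices \<open>xo1\<close> and \<open>ox1\<close> are inverse to each other. Read
  in the mirror image, the left side is the counterpart of \<open>vfr\<close>, so forming
  counterparts twice gives \<open>vf\<close> back.\<close>

lemma vf_vfr: "(\<Sum>j<nd P1. xo1 x (rh P1 j) * vfr (up P1 j)) = vf x"
proof -
  have "(\<Sum>j<nd P1. xo1 x (rh P1 j) * vfr (up P1 j)) =
    (\<Sum>l<nc P1. \<Sum>j<nd P1. xo1 x (rh P1 j) * (ox1 (om P1 l) (up P1 j) * vf (xi P1 l)))"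
    unfolding vfr_def sum_distrib_left by (rule sum.swap)
  also have "\<dots> = vf x"
    by (simp add: K1.H_sum svf A1.collapseX(1)[of vf, OF vf_add])
  finally show ?thesis .
qed

text \<open>This is \<open>D4\<close> at \<open>om P1 l\<close>, multiplied by
  \<open>vf (xi P1 l)\<close> from the right and summed over \<open>l\<close>.\<close>

lemma ox2_wg_vf: "(\<Sum>i<nd P1. \<Sum>j<nd P1. t (er P2 (wg (rh P1 i) (rh P1 j)) z) * (ox1 w (up P1 i) * vfr (up P1 j)))
   = (\<Sum>l<nc P1. ox2 (wg w (om P1 l)) z * vf (xi P1 l))"
proof -
  have "(\<Sum>l<nc P1. ox2 (wg w (om P1 l)) z * vf (xi P1 l)) = (\<Sum>l<nc P1. \<Sum>i<nd P1. \<Sum>j<nd P1.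
      t (er P2 (wg (rh P1 i) (rh P1 j)) z) * (ox1 w (up P1 i) * (ox1 (om P1 l) (up P1 j) * vf (xi P1 l))))"
    by (simp add: D4')
  also have "\<dots> = (\<Sum>i<nd P1. \<Sum>l<nc P1. \<Sum>j<nd P1.
      t (er P2 (wg (rh P1 i) (rh P1 j)) z) * (ox1 w (up P1 i) * (ox1 (om P1 l) (up P1 j) * vf (xi P1 l))))"
    by (rule sum.swap)
  also have "\<dots> = (\<Sum>i<nd P1. \<Sum>j<nd P1. \<Sum>l<nc P1.
      t (er P2 (wg (rh P1 i) (rh P1 j)) z) * (ox1 w (up P1 i) * (ox1 (om P1 l) (up P1 j) * vf (xi P1 l))))"
    by (intro sum.cong refl sum.swap)
  finally show ?thesis by (simp add: vfr_def sum_distrib_left)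
qed

text \<open>Conjugating the second relation by the matrices \<open>ox2\<close> and \<open>ox1\<close>, which are inverse to \<open>xo2\<close> and
  \<open>xo1\<close>, gives its mirror image.\<close>

lemma D2_mirror:
  "(\<Sum>i<nd P1. \<Sum>j<nd P1. t (er P2 (wg (rh P1 j) (rh P1 i)) z) *
        (vfr (up P1 j) * ox1 w (up P1 i) + ox1 w (up P1 j) * vfr (up P1 i))) =
   ox2 (d1 w) z - (\<Sum>i<nd P1. t (er P2 (d1 (rh P1 i)) z) * ox1 w (up P1 i))"
proof -
  let ?c = "\<lambda>i j. wg (om P1 i) (om P1 j)"
  let ?a = "\<lambda>i. el P1 (xi P1 i) w"
  let ?Y = "\<lambda>i j q. vf (xi P1 j) * xo1 (xi P1 i) (rh P1 q) + xo1 (xi P1 j) (rh P1 q) * vf (xi P1 i)"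
  let ?b = "\<lambda>q. ox1 w (up P1 q)"
  have A: "(\<Sum>m<nc P2. ox2 (om P2 m) z * ((\<Sum>i<nc P1. \<Sum>j<nc P1. s (el P2 (xi P2 m) (?c i j)) * ?Y i j q) * ?b q))
     = (\<Sum>i<nc P1. \<Sum>j<nc P1. ox2 (?c i j) z * (?Y i j q * ?b q))" for q
  proof -
    have "(\<Sum>m<nc P2. ox2 (om P2 m) z * ((\<Sum>i<nc P1. \<Sum>j<nc P1. s (el P2 (xi P2 m) (?c i j)) * ?Y i j q) * ?b q))
      = (\<Sum>m<nc P2. \<Sum>i<nc P1. \<Sum>j<nc P1. ox2 (om P2 m) z * (s (el P2 (xi P2 m) (?c i j)) * (?Y i j q * ?b q)))"
      by (simp only: sum_distrib_left sum_distrib_right mult.assoc)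
    also have "\<dots> = (\<Sum>i<nc P1. \<Sum>m<nc P2. \<Sum>j<nc P1. ox2 (om P2 m) z * (s (el P2 (xi P2 m) (?c i j)) * (?Y i j q * ?b q)))"
      by (rule sum.swap)
    also have "\<dots> = (\<Sum>i<nc P1. \<Sum>j<nc P1. \<Sum>m<nc P2. ox2 (om P2 m) z * (s (el P2 (xi P2 m) (?c i j)) * (?Y i j q * ?b q)))"
      by (intro sum.cong refl sum.swap)
    finally show ?thesis by (simp only: ox2_collapse)
  qed
  have B: "(\<Sum>m<nc P2. ox2 (om P2 m) z * (((\<Sum>i<nc P1. s (el P2 (xi P2 m) (d1 (om P1 i))) * xo1 (xi P1 i) (rh P1 q)) -
       xo2 (xi P2 m) (d1 (rh P1 q))) * ?b q))
     = (\<Sum>i<nc P1. ox2 (d1 (om P1 i)) z * (xo1 (xi P1 i) (rh P1 q) * ?b q)) - t (er P2 (d1 (rh P1 q)) z) * ?b q" for q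
  proof -
    have "(\<Sum>m<nc P2. ox2 (om P2 m) z * ((\<Sum>i<nc P1. s (el P2 (xi P2 m) (d1 (om P1 i))) * xo1 (xi P1 i) (rh P1 q)) * ?b q))
      = (\<Sum>m<nc P2. \<Sum>i<nc P1. ox2 (om P2 m) z * (s (el P2 (xi P2 m) (d1 (om P1 i))) * (xo1 (xi P1 i) (rh P1 q) * ?b q)))"
      by (simp only: sum_distrib_left sum_distrib_right mult.assoc)
    also have "\<dots> = (\<Sum>i<nc P1. \<Sum>m<nc P2. ox2 (om P2 m) z * (s (el P2 (xi P2 m) (d1 (om P1 i))) * (xo1 (xi P1 i) (rh P1 q) * ?b q)))"
      by (rule sum.swap)
    also have "\<dots> = (\<Sum>i<nc P1. ox2 (d1 (om P1 i)) z * (xo1 (xi P1 i) (rh P1 q) * ?b q))"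
      by (simp only: ox2_collapse)
    finally show ?thesis
      by (simp add: left_diff_distrib right_diff_distrib sum_subtractf K2.H_sum)
  qed
  \<comment> \<open>Relation \<open>D2\<close> for \<open>xi P2 m\<close> and
    \<open>rh P1 q\<close>, multiplied by \<open>ox2 (om P2 m) z\<close> from the left and by
    \<open>ox1 w (up P1 q)\<close> from the right, summed over \<open>m\<close> and
    \<open>q\<close>.\<close>
  have AB: "(\<Sum>q<nd P1. \<Sum>i<nc P1. \<Sum>j<nc P1. ox2 (?c i j) z * (?Y i j q * ?b q)) =
    (\<Sum>q<nd P1. (\<Sum>i<nc P1. ox2 (d1 (om P1 i)) z * (xo1 (xi P1 i) (rh P1 q) * ?b q)) - t (er P2 (d1 (rh P1 q)) z) * ?b q)"
    unfolding A[symmetric] B[symmetric] D2 ..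
  \<comment> \<open>Moving the coefficient into \<open>d1\<close> costs a wedge term by
    \<open>d1_r\<close>. The same term arises in \<open>L1\<close> from commuting \<open>vf\<close>
    past the scalar, and the two cancel in the end.\<close>
  have R: "(\<Sum>q<nd P1. (\<Sum>i<nc P1. ox2 (d1 (om P1 i)) z * (xo1 (xi P1 i) (rh P1 q) * ?b q)))
     = ox2 (d1 w) z + (\<Sum>i<nc P1. ox2 (wg (om P1 i) (d0 (?a i))) z)"
  proof -
    have "(\<Sum>q<nd P1. (\<Sum>i<nc P1. ox2 (d1 (om P1 i)) z * (xo1 (xi P1 i) (rh P1 q) * ?b q)))
      = (\<Sum>i<nc P1. \<Sum>q<nd P1. ox2 (d1 (om P1 i)) z * (xo1 (xi P1 i) (rh P1 q) * ?b q))" by (rule sum.swap)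
    also have "\<dots> = (\<Sum>i<nc P1. ox2 (d1 (rO P1 (om P1 i) (?a i)) + wg (om P1 i) (d0 (?a i))) z)"
      by (simp add: sum_distrib_left[symmetric] K1.H2 K2.oxs d1_r)
    also have "\<dots> = ox2 (d1 w) z + (\<Sum>i<nc P1. ox2 (wg (om P1 i) (d0 (?a i))) z)"
      by (simp add: K2.ox_addl sum.distrib A1.collapse(1)[of "\<lambda>w. ox2 (d1 w) z"] d1_add)
    finally show ?thesis .
  qed
  have L: "(\<Sum>q<nd P1. \<Sum>i<nc P1. \<Sum>j<nc P1. ox2 (?c i j) z * (?Y i j q * ?b q)) =
     (\<Sum>i<nc P1. \<Sum>j<nc P1. ox2 (?c i j) z * (vf (xi P1 j) * s (?a i))) +
     (\<Sum>q<nd P1. \<Sum>i<nc P1. \<Sum>j<nc P1. ox2 (?c i j) z * (xo1 (xi P1 j) (rh P1 q) * (vf (xi P1 i) * ?b q)))"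
  proof -
    have "(\<Sum>q<nd P1. \<Sum>i<nc P1. \<Sum>j<nc P1. ox2 (?c i j) z * (vf (xi P1 j) * (xo1 (xi P1 i) (rh P1 q) * ?b q)))
      = (\<Sum>i<nc P1. \<Sum>q<nd P1. \<Sum>j<nc P1. ox2 (?c i j) z * (vf (xi P1 j) * (xo1 (xi P1 i) (rh P1 q) * ?b q)))"
      by (rule sum.swap)
    also have "\<dots> = (\<Sum>i<nc P1. \<Sum>j<nc P1. \<Sum>q<nd P1. ox2 (?c i j) z * (vf (xi P1 j) * (xo1 (xi P1 i) (rh P1 q) * ?b q)))"
      by (intro sum.cong refl sum.swap)
    also have "\<dots> = (\<Sum>i<nc P1. \<Sum>j<nc P1. ox2 (?c i j) z * (vf (xi P1 j) * s (?a i)))"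
      by (simp add: sum_distrib_left[symmetric] K1.H2)
    finally show ?thesis by (simp add: distrib_left distrib_right sum.distrib mult.assoc)
  qed
  have L1: "(\<Sum>i<nc P1. \<Sum>j<nc P1. ox2 (?c i j) z * (vf (xi P1 j) * s (?a i))) =
     (\<Sum>l<nc P1. ox2 (wg w (om P1 l)) z * vf (xi P1 l)) + (\<Sum>i<nc P1. ox2 (wg (om P1 i) (d0 (?a i))) z)"
  proof -
    have 1: "(\<Sum>j<nc P1. ox2 (?c i j) z * s (el P1 (xi P1 j) (d0 (?a i)))) = ox2 (wg (om P1 i) (d0 (?a i))) z" for i
      by (simp add: K2.oxs wg_r[symmetric] A1.collapse(1)[of "\<lambda>v. ox2 (wg _ v) z"] wg_addr K2.ox_addl)
    have "(\<Sum>j<nc P1. ox2 (?c i j) z * vf (rX P1 (xi P1 j) (?a i))) =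
       (\<Sum>j<nc P1. ox2 (wg (rO P1 (om P1 i) (?a i)) (om P1 j)) z * vf (xi P1 j))" for i
      using A1.central[of "\<lambda>v x. ox2 (wg (om P1 i) v) z * vf x" "?a i"]
      by (simp add: wg_addr K2.ox_addl vf_add distrib_left distrib_right svf[symmetric] wg_r K2.H_assoc' wg_bal)
    hence "(\<Sum>i<nc P1. \<Sum>j<nc P1. ox2 (?c i j) z * vf (rX P1 (xi P1 j) (?a i))) =
       (\<Sum>j<nc P1. \<Sum>i<nc P1. ox2 (wg (rO P1 (om P1 i) (?a i)) (om P1 j)) z * vf (xi P1 j))"
      by (simp only:) (rule sum.swap)
    also have "\<dots> = (\<Sum>l<nc P1. ox2 (wg w (om P1 l)) z * vf (xi P1 l))"
      by (simp add: A1.collapse(1)[of "\<lambda>v. ox2 (wg v _) z * _"] wg_addl K2.ox_addl distrib_right)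
    finally show ?thesis by (simp add: vfs distrib_left sum.distrib 1)
  qed
  \<comment> \<open>Expand \<open>ox2\<close> by \<open>D4\<close> and collapse one
    \<open>ox1\<close> against \<open>xo1\<close> by \<open>H1\<close>. The scalar left over passes
    through the wedge by centrality of \<open>coevr(1)\<close> and is absorbed by the dual
    basis.\<close>
  have L2: "(\<Sum>i<nc P1. \<Sum>j<nc P1. ox2 (?c i j) z * (xo1 (xi P1 j) (rh P1 q) * (vf (xi P1 i) * ?b q)))
     = (\<Sum>a<nd P1. t (er P2 (wg (rh P1 a) (rh P1 q)) z) * (vfr (up P1 a) * ?b q))" for q
  proof -
    let ?e = "\<lambda>a b. t (er P2 (wg (rh P1 a) (rh P1 b)) z)"
    let ?r = "\<lambda>b. er P1 (rh P1 q) (up P1 b)"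
    let ?G = "\<lambda>i j a b. ?e a b * (ox1 (om P1 i) (up P1 a) * (ox1 (om P1 j) (up P1 b) * (xo1 (xi P1 j) (rh P1 q) * (vf (xi P1 i) * ?b q))))"
    have "(\<Sum>i<nc P1. \<Sum>j<nc P1. ox2 (?c i j) z * (xo1 (xi P1 j) (rh P1 q) * (vf (xi P1 i) * ?b q)))
      = (\<Sum>i<nc P1. \<Sum>j<nc P1. \<Sum>a<nd P1. \<Sum>b<nd P1. ?G i j a b)"
      by (simp only: D4')
    also have "\<dots> = (\<Sum>i<nc P1. \<Sum>a<nd P1. \<Sum>j<nc P1. \<Sum>b<nd P1. ?G i j a b)"
      by (intro sum.cong refl sum.swap)
    also have "\<dots> = (\<Sum>a<nd P1. \<Sum>i<nc P1. \<Sum>b<nd P1. \<Sum>j<nc P1. ?G i j a b)"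
      by (subst sum.swap) (intro sum.cong refl sum.swap)
    also have "\<dots> = (\<Sum>a<nd P1. \<Sum>i<nc P1. \<Sum>b<nd P1. ?e a b * (ox1 (om P1 i) (lX P1 (?r b) (up P1 a)) * (vf (xi P1 i) * ?b q)))"
      by (simp only: sum_distrib_left[symmetric] K1.H_sum K1.H_assoc' A1.lrX)
    also have "\<dots> = (\<Sum>a<nd P1. \<Sum>b<nd P1. \<Sum>i<nc P1. ?e a b * (ox1 (om P1 i) (lX P1 (?r b) (up P1 a)) * (vf (xi P1 i) * ?b q)))"
      by (intro sum.cong refl sum.swap)
    also have "\<dots> = (\<Sum>b<nd P1. \<Sum>a<nd P1. ?e a b * (vfr (lX P1 (?r b) (up P1 a)) * ?b q))"
      by (subst sum.swap) (simp add: vfr_def sum_distrib_left sum_distrib_right mult.assoc)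
    also have "\<dots> = (\<Sum>b<nd P1. \<Sum>a<nd P1. t (er P2 (wg (rO P1 (rh P1 a) (?r b)) (rh P1 b)) z) * (vfr (up P1 a) * ?b q))"
    proof (rule sum.cong[OF refl])
      fix b
      show "(\<Sum>a<nd P1. ?e a b * (vfr (lX P1 (?r b) (up P1 a)) * ?b q)) =
        (\<Sum>a<nd P1. t (er P2 (wg (rO P1 (rh P1 a) (?r b)) (rh P1 b)) z) * (vfr (up P1 a) * ?b q))"
        by (rule A1.centralr[of "\<lambda>y v. t (er P2 (wg v (rh P1 b)) z) * (vfr y * ?b q)"])
          (simp_all add: wg_addl A2.er_addl K1.t_add distrib_right distrib_left vfr_add t_vfr[symmetric] wg_l A2.er_lO K1.t_mu mult.assoc)
    qed
    also have "\<dots> = (\<Sum>a<nd P1. \<Sum>b<nd P1. t (er P2 (wg (rh P1 a) (lO P1 (?r b) (rh P1 b))) z) * (vfr (up P1 a) * ?b q))"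
      by (subst sum.swap) (simp add: wg_bal)
    also have "\<dots> = (\<Sum>a<nd P1. t (er P2 (wg (rh P1 a) (rh P1 q)) z) * (vfr (up P1 a) * ?b q))"
      by (simp add: A1.collapse(2)[of "\<lambda>v. t (er P2 (wg _ v) z) * _"] wg_addr A2.er_addl K1.t_add distrib_right)
    finally show ?thesis .
  qed
  have Z: "(\<Sum>i<nd P1. \<Sum>j<nd P1. t (er P2 (wg (rh P1 j) (rh P1 i)) z) *
        (vfr (up P1 j) * ox1 w (up P1 i) + ox1 w (up P1 j) * vfr (up P1 i))) =
     (\<Sum>q<nd P1. \<Sum>a<nd P1. t (er P2 (wg (rh P1 a) (rh P1 q)) z) * (vfr (up P1 a) * ?b q)) +
     (\<Sum>l<nc P1. ox2 (wg w (om P1 l)) z * vf (xi P1 l))"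
    unfolding ox2_wg_vf[symmetric] distrib_left sum.distrib
    by (rule arg_cong2[where f = "(+)"], rule refl, rule sum.swap)
  show ?thesis using AB unfolding L L1 L2 R sum_subtractf Z by (simp add: algebra_simps)
qed

text \<open>Take \<open>D2_mirror\<close> at \<open>om P1 k\<close>, multiply by
  \<open>vf (xi P1 k)\<close> from the right and sum over \<open>k\<close>. Besides the claim this
  produces \<open>D1\<close> contracted with \<open>ox2\<close>, whose two sides cancel.\<close>

lemma D1_mirror:
  "(\<Sum>i<nd P1. t (er P2 (d1 (rh P1 i)) z) * vfr (up P1 i)) =
   - (\<Sum>i<nd P1. \<Sum>j<nd P1. t (er P2 (wg (rh P1 j) (rh P1 i)) z) * (vfr (up P1 j) * vfr (up P1 i)))"
proof -
  let ?e = "\<lambda>a b. t (er P2 (wg (rh P1 a) (rh P1 b)) z)"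
  have 1: "(\<Sum>k<nc P1. (\<Sum>i<nd P1. \<Sum>j<nd P1. ?e j i *
        (vfr (up P1 j) * ox1 (om P1 k) (up P1 i) + ox1 (om P1 k) (up P1 j) * vfr (up P1 i))) * vf (xi P1 k))
     = (\<Sum>i<nd P1. \<Sum>j<nd P1. ?e j i * (vfr (up P1 j) * vfr (up P1 i))) +
       (\<Sum>k<nc P1. \<Sum>l<nc P1. ox2 (wg (om P1 k) (om P1 l)) z * (vf (xi P1 l) * vf (xi P1 k)))"
  proof -
    have "(\<Sum>k<nc P1. (\<Sum>i<nd P1. \<Sum>j<nd P1. ?e j i * (vfr (up P1 j) * ox1 (om P1 k) (up P1 i))) * vf (xi P1 k))
      = (\<Sum>k<nc P1. \<Sum>i<nd P1. \<Sum>j<nd P1. ?e j i * (vfr (up P1 j) * (ox1 (om P1 k) (up P1 i) * vf (xi P1 k))))"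
      by (simp add: sum_distrib_right mult.assoc)
    also have "\<dots> = (\<Sum>i<nd P1. \<Sum>k<nc P1. \<Sum>j<nd P1. ?e j i * (vfr (up P1 j) * (ox1 (om P1 k) (up P1 i) * vf (xi P1 k))))"
      by (rule sum.swap)
    also have "\<dots> = (\<Sum>i<nd P1. \<Sum>j<nd P1. \<Sum>k<nc P1. ?e j i * (vfr (up P1 j) * (ox1 (om P1 k) (up P1 i) * vf (xi P1 k))))"
      by (intro sum.cong refl sum.swap)
    also have "\<dots> = (\<Sum>i<nd P1. \<Sum>j<nd P1. ?e j i * (vfr (up P1 j) * vfr (up P1 i)))"
      by (simp add: sum_distrib_left[symmetric] vfr_def[of "up P1 i" for i, symmetric])
    finally have a: "(\<Sum>k<nc P1. (\<Sum>i<nd P1. \<Sum>j<nd P1. ?e j i * (vfr (up P1 j) * ox1 (om P1 k) (up P1 i))) * vf (xi P1 k)) =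
      (\<Sum>i<nd P1. \<Sum>j<nd P1. ?e j i * (vfr (up P1 j) * vfr (up P1 i)))" .
    have b: "(\<Sum>i<nd P1. \<Sum>j<nd P1. ?e j i * (ox1 v (up P1 j) * vfr (up P1 i))) =
       (\<Sum>l<nc P1. ox2 (wg v (om P1 l)) z * vf (xi P1 l))" for v
      by (subst sum.swap) (rule ox2_wg_vf)
    show ?thesis
      by (simp only: distrib_left sum.distrib distrib_right a b) (simp add: sum_distrib_right mult.assoc)
  qed
  have c1: "(\<Sum>m<nc P2. ox2 (om P2 m) z * (\<Sum>i<nc P1. s (el P2 (xi P2 m) (d1 (om P1 i))) * vf (xi P1 i))) =
      (\<Sum>i<nc P1. ox2 (d1 (om P1 i)) z * vf (xi P1 i))"
    unfolding sum_distrib_left by (subst sum.swap) (simp only: ox2_collapse)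
  have c2: "(\<Sum>m<nc P2. ox2 (om P2 m) z * (\<Sum>i<nc P1. \<Sum>j<nc P1. s (el P2 (xi P2 m) (wg (om P1 i) (om P1 j))) *
      (vf (xi P1 j) * vf (xi P1 i)))) =
      (\<Sum>i<nc P1. \<Sum>j<nc P1. ox2 (wg (om P1 i) (om P1 j)) z * (vf (xi P1 j) * vf (xi P1 i)))"
  proof -
    have "(\<Sum>m<nc P2. ox2 (om P2 m) z * (\<Sum>i<nc P1. \<Sum>j<nc P1. s (el P2 (xi P2 m) (wg (om P1 i) (om P1 j))) *
      (vf (xi P1 j) * vf (xi P1 i)))) = (\<Sum>i<nc P1. \<Sum>m<nc P2. \<Sum>j<nc P1. ox2 (om P2 m) z * (s (el P2 (xi P2 m) (wg (om P1 i) (om P1 j))) *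
      (vf (xi P1 j) * vf (xi P1 i))))"
      unfolding sum_distrib_left by (rule sum.swap)
    also have "\<dots> = (\<Sum>i<nc P1. \<Sum>j<nc P1. \<Sum>m<nc P2. ox2 (om P2 m) z * (s (el P2 (xi P2 m) (wg (om P1 i) (om P1 j))) *
      (vf (xi P1 j) * vf (xi P1 i))))"
      by (intro sum.cong refl sum.swap)
    finally show ?thesis by (simp only: ox2_collapse)
  qed
  have "(\<Sum>k<nc P1. ox2 (d1 (om P1 k)) z * vf (xi P1 k)) - (\<Sum>i<nd P1. t (er P2 (d1 (rh P1 i)) z) * vfr (up P1 i))
    = (\<Sum>k<nc P1. (ox2 (d1 (om P1 k)) z - (\<Sum>i<nd P1. t (er P2 (d1 (rh P1 i)) z) * ox1 (om P1 k) (up P1 i))) * vf (xi P1 k))"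
  proof -
    have "(\<Sum>k<nc P1. (\<Sum>i<nd P1. t (er P2 (d1 (rh P1 i)) z) * ox1 (om P1 k) (up P1 i)) * vf (xi P1 k))
      = (\<Sum>i<nd P1. t (er P2 (d1 (rh P1 i)) z) * vfr (up P1 i))"
      unfolding vfr_def sum_distrib_left sum_distrib_right by (subst sum.swap) (simp add: mult.assoc)
    thus ?thesis by (simp add: left_diff_distrib sum_subtractf)
  qed
  also have "\<dots> = (\<Sum>i<nd P1. \<Sum>j<nd P1. ?e j i * (vfr (up P1 j) * vfr (up P1 i))) +
       (\<Sum>k<nc P1. \<Sum>l<nc P1. ox2 (wg (om P1 k) (om P1 l)) z * (vf (xi P1 l) * vf (xi P1 k)))"
    unfolding D2_mirror[symmetric] by (rule 1)
  finally have "(\<Sum>i<nd P1. t (er P2 (d1 (rh P1 i)) z) * vfr (up P1 i)) +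
    (\<Sum>i<nd P1. \<Sum>j<nd P1. ?e j i * (vfr (up P1 j) * vfr (up P1 i))) = 0"
    unfolding c1[symmetric] c2[symmetric] D1 by (simp add: algebra_simps)
  thus ?thesis by (simp only: eq_neg_iff_add_eq_0)
qed

text \<open>The mirror image interchanges \<open>D3\<close> and \<open>D4\<close>; the mirror images
  of \<open>D1\<close> and \<open>D2\<close> are the two preceding lemmas.\<close>

lemma mirror_dx: "dx (\<lambda>a b. mu b a) one (mirror P1) (mirror P2) d0 d1 (\<lambda>w v. - wg v w) t s
    (\<lambda>x w. ox1 w x) (\<lambda>w x. xo1 x w) (\<lambda>x w. ox2 w x) (\<lambda>w x. xo2 x w) vfr"
proof -
  interpret M: calc "\<lambda>a b. mu b a" one "mirror P1" "mirror P2" d0 d1 "\<lambda>w v. - wg v w" by (rule mirror_calc)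
  interpret M1: hst "\<lambda>a b. mu b a" one "mirror P1" t s "\<lambda>x w. ox1 w x" "\<lambda>w x. xo1 x w" by (rule K1.mirror_hst)
  interpret M2: hst "\<lambda>a b. mu b a" one "mirror P2" t s "\<lambda>x w. ox2 w x" "\<lambda>w x. xo2 x w" by (rule K2.mirror_hst)
  have m1: "t (er P2 (- w) z) = - t (er P2 w z)" for w z
    by (rule additive_minus[of "\<lambda>w. t (er P2 w z)"]) (simp add: A2.er_addl K1.t_add)
  have m2: "s (el P2 z (- w)) = - s (el P2 z w)" for w z
    by (rule additive_minus[of "\<lambda>w. s (el P2 z w)"]) (simp add: A2.el_addr K1.s_add)
  have m3: "ox2 (- w) z = - ox2 w z" "xo2 z (- w) = - xo2 z w" for w z
    by (rule additive_minus[of "\<lambda>w. ox2 w z", OF K2.ox_addl], rule additive_minus[of "\<lambda>w. xo2 z w", OF K2.xo_addr])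
  have 3: "(\<Sum>i<nd P1. \<Sum>j<nd P1. t (er P2 (wg (rh P1 j) (rh P1 i)) z) * (ox1 v (up P1 j) * ox1 w (up P1 i)))
      = ox2 (wg v w) z" for z v w
    by (subst sum.swap) (rule D4)
  have 4: "(\<Sum>i<nc P1. \<Sum>j<nc P1. s (el P2 z (wg (om P1 j) (om P1 i))) * (xo1 (xi P1 i) w * xo1 (xi P1 j) v))
      = xo2 z (wg v w)" for z v w
    by (subst sum.swap) (rule D3)
  have 1: "(\<Sum>i<nd P1. vfr (rX P1 (up P1 i) (er P2 (d1 (rh P1 i)) z))) =
   - (\<Sum>i<nd P1. \<Sum>j<nd P1. t (er P2 (wg (rh P1 j) (rh P1 i)) z) * (vfr (up P1 j) * vfr (up P1 i)))" for z
    using D1_mirror by (simp only: t_vfr)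
  show ?thesis
    by unfold_locales
      (simp_all only: mirror_simps vfr_add t_vfr vfr_t vfr_s m1 m2 m3 minus_mult_left[symmetric] sum_negf
        1 D2_mirror 3 4 minus_diff_eq minus_minus)
qed

end

section \<open>Actions on balanced tensor products\<close>

lemma sum_rotate3:
  "(\<Sum>i\<in>A. \<Sum>j\<in>B. \<Sum>k\<in>C. f i j k) = (\<Sum>j\<in>B. \<Sum>k\<in>C. \<Sum>i\<in>A. f i j k)"
  by (subst sum.swap) (intro sum.cong refl sum.swap)

lemma sum_rotate4:
  "(\<Sum>i\<in>A. \<Sum>j\<in>B. \<Sum>k\<in>C. \<Sum>l\<in>D. f i j k l) = (\<Sum>k\<in>C. \<Sum>l\<in>D. \<Sum>i\<in>A. \<Sum>j\<in>B. f i j k l)"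
  by (subst sum_rotate3) (simp only: sum_rotate3[where A = A])

text \<open>Balanced maps on pairs of two realizations of the same algebra: elements of the first are multiplied
  from the right and elements of the second from the left.\<close>

locale bal_h = R: hst mu one P s t xo ox + L: hst mu one P s' t' xo' ox'
  for mu :: "'a::ab_group_add \<Rightarrow> 'a \<Rightarrow> 'a" and one :: 'a
    and P :: "('a, 'm::ab_group_add, 'x::ab_group_add) dual_data"
    and s t :: "'a \<Rightarrow> 'r::ring" and xo :: "'x \<Rightarrow> 'm \<Rightarrow> 'r" and ox :: "'m \<Rightarrow> 'x \<Rightarrow> 'r"
    and s' t' :: "'a \<Rightarrow> 'q::ring" and xo' :: "'x \<Rightarrow> 'm \<Rightarrow> 'q" and ox' :: "'m \<Rightarrow> 'x \<Rightarrow> 'q" +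
  fixes T :: "'r \<Rightarrow> 'q \<Rightarrow> 'w::ab_group_add"
  assumes T_addl: "T (u + u') v = T u v + T u' v" and T_addr: "T u (v + v') = T u v + T u v'"
    and T_bal: "T (u * t r) v = T u (t' r * v)"
    and T_unitl: "T (u * s one) v = T u v" and T_unitr: "T u (s' one * v) = T u v"
begin

lemmas T_suml = additive_sum[of "\<lambda>u. T u v" for v, OF T_addl]
lemmas T_sumr = additive_sum[of "T u" for u, OF T_addr]
lemmas T_diffl = additive_diff[of "\<lambda>u. T u v" for v, OF T_addl]
lemmas T_diffr = additive_diff[of "T u" for u, OF T_addr]

text \<open>This and the next three lemmas contract a dual basis that has left a scalar in
  \<open>t\<close> or \<open>t'\<close> behind. Where necessary, balancing first carries the scalar
  to the factor that can absorb it.\<close>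

lemma xo_push: "(\<Sum>m<nd P. T (u * xo z (rh P m)) (t' (er P \<theta> (up P m)) * y)) = T (u * xo z \<theta>) y"
proof -
  have "(\<Sum>m<nd P. T (u * xo z (rh P m)) (t' (er P \<theta> (up P m)) * y)) =
    (\<Sum>m<nd P. T (u * xo z (lO P (er P \<theta> (up P m)) (rh P m))) y)"
    by (simp add: T_bal[symmetric] mult.assoc R.xot)
  also have "\<dots> = T (u * xo z \<theta>) y"
    by (simp add: R.collapse(2)[of "\<lambda>v. T (u * xo z v) y"] R.xo_addr distrib_left T_addl)
  finally show ?thesis .
qed

lemma ox_push: "(\<Sum>i<nc P. T (u * (ox w (xi P i) * t (el P x (om P i)))) y) = T (u * ox w x) y"
  by (simp add: R.oxt R.collapseX(1)[of "\<lambda>v. T (u * ox w v) y"] R.ox_addr distrib_left T_addl)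

lemma xo_pull: "(\<Sum>m<nc P. T (u * t (el P (xi P m) \<theta>)) (xo' z (om P m) * y)) = T u (xo' z \<theta> * y)"
  by (simp add: T_bal L.H_assoc' R.collapse(1)[of "\<lambda>v. T u (xo' z v * y)"] L.xo_addr distrib_right T_addr)

lemma ox_pull: "(\<Sum>j<nd P. T (u * t (er P (rh P j) x)) (ox' w (up P j) * y)) = T u (ox' w x * y)"
  by (simp add: T_bal L.H_assoc' R.collapseX(2)[of "\<lambda>v. T u (ox' w v * y)"] L.ox_addr distrib_right T_addr)

lemma xo_bal: "T (u * xo x (lO P a w)) v = T (u * xo x w) (t' a * v)"
  by (simp only: R.xot[symmetric] mult.assoc[symmetric] T_bal)

lemma ox_bal: "T (u * ox w (lX P a x)) v = T (u * ox w x) (t' a * v)"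
  by (simp only: R.oxt[symmetric] mult.assoc[symmetric] T_bal)

text \<open>This makes the operator of \<open>(x, w)\<close> well defined on the balanced tensor
  product. It is the centrality of \<open>coevr(1)\<close>.\<close>

lemma takeuchi_xo:
  "(\<Sum>j<nd P. T (u * t r * xo x (rh P j)) (ox' w (up P j) * v)) =
   (\<Sum>j<nd P. T (u * xo x (rh P j)) (ox' w (up P j) * (t' r * v)))"
proof -
  have "(\<Sum>j<nd P. T (u * xo x (rh P j)) (ox' w (lX P r (up P j)) * v)) =
   (\<Sum>j<nd P. T (u * xo x (rO P (rh P j) r)) (ox' w (up P j) * v))"
    by (rule R.centralr[of "\<lambda>y \<rho>. T (u * xo x \<rho>) (ox' w y * v)" r])
      (simp_all add: R.xo_addr L.ox_addr distrib_left distrib_right T_addl T_addr xo_bal L.H_assoc')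
  thus ?thesis by (simp add: mult.assoc R.txo L.H_assoc')
qed

lemma takeuchi_ox:
  "(\<Sum>i<nc P. T (u * t r * ox w (xi P i)) (xo' x (om P i) * v)) =
   (\<Sum>i<nc P. T (u * ox w (xi P i)) (xo' x (om P i) * (t' r * v)))"
proof -
  have "(\<Sum>i<nc P. T (u * ox w (xi P i)) (xo' x (lO P r (om P i)) * v)) =
   (\<Sum>i<nc P. T (u * ox w (rX P (xi P i) r)) (xo' x (om P i) * v))"
    by (rule R.central[of "\<lambda>\<rho> y. T (u * ox w y) (xo' x \<rho> * v)" r])
      (simp_all add: R.ox_addr L.xo_addr distrib_left distrib_right T_addl T_addr ox_bal L.H_assoc')
  thus ?thesis by (simp add: mult.assoc R.tox L.H_assoc')
qed

end

text \<open>Right operators determined by their values on tensors; \<open>C\<close> is a set of operators on which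
  agreement on tensors implies equality.\<close>

locale gam_h = bal_h mu one P s t xo ox s' t' xo' ox' T
  for mu :: "'a::ab_group_add \<Rightarrow> 'a \<Rightarrow> 'a" and one :: 'a
    and P :: "('a, 'm::ab_group_add, 'x::ab_group_add) dual_data"
    and s t :: "'a \<Rightarrow> 'r::ring" and xo :: "'x \<Rightarrow> 'm \<Rightarrow> 'r" and ox :: "'m \<Rightarrow> 'x \<Rightarrow> 'r"
    and s' t' :: "'a \<Rightarrow> 'q::ring" and xo' :: "'x \<Rightarrow> 'm \<Rightarrow> 'q" and ox' :: "'m \<Rightarrow> 'x \<Rightarrow> 'q"
    and T :: "'r \<Rightarrow> 'q \<Rightarrow> 'w::ab_group_add" +
  fixes ap :: "'o::ring \<Rightarrow> 'w \<Rightarrow> 'w" and C :: "'o set"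
    and gs gt :: "'a \<Rightarrow> 'o" and gxo :: "'x \<Rightarrow> 'm \<Rightarrow> 'o" and gox :: "'m \<Rightarrow> 'x \<Rightarrow> 'o"
  assumes ap_add: "ap (X + Y) p = ap X p + ap Y p" and ap_mult: "ap (X * Y) p = ap Y (ap X p)"
    and ap_addw: "ap X (p + q) = ap X p + ap X q"
    and eqI: "X \<in> C \<Longrightarrow> Y \<in> C \<Longrightarrow> (\<And>u v. ap X (T u v) = ap Y (T u v)) \<Longrightarrow> X = Y"
    and C_add: "X \<in> C \<Longrightarrow> Y \<in> C \<Longrightarrow> X + Y \<in> C" and C_minus: "X \<in> C \<Longrightarrow> - X \<in> C"
    and C_mult: "X \<in> C \<Longrightarrow> Y \<in> C \<Longrightarrow> X * Y \<in> C"
    and C_gens: "gs a \<in> C" "gt a \<in> C" "gxo x w \<in> C" "gox w x \<in> C"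
    and ap_gs: "ap (gs a) (T u v) = T (u * s a) v" and ap_gt: "ap (gt a) (T u v) = T u (s' a * v)"
    and ap_gxo: "ap (gxo x w) (T u v) = (\<Sum>j<nd P. T (u * xo x (rh P j)) (ox' w (up P j) * v))"
    and ap_gox: "ap (gox w x) (T u v) = (\<Sum>i<nc P. T (u * ox w (xi P i)) (xo' x (om P i) * v))"
begin

lemma C_zero: "0 \<in> C"
  using C_add[OF C_gens(1)[of undefined] C_minus[OF C_gens(1)[of undefined]]] by simp

lemma C_sum: "(\<And>i. i \<in> I \<Longrightarrow> g i \<in> C) \<Longrightarrow> (\<Sum>i\<in>I. g i) \<in> C"
  by (induction I rule: infinite_finite_induct) (simp_all add: C_add C_zero)

lemma C_diff: "X \<in> C \<Longrightarrow> Y \<in> C \<Longrightarrow> X - Y \<in> C"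
  using C_add[of X "- Y"] C_minus[of Y] by simp

lemmas C_rules = C_add C_minus C_mult C_gens C_sum C_diff

lemmas ap_sum = additive_sum[of "\<lambda>X. ap X p" for p, OF ap_add]
lemmas ap_sumw = additive_sum[of "ap X" for X, OF ap_addw]
lemmas ap_diff = additive_diff[of "\<lambda>X. ap X p" for p, OF ap_add]
lemmas ap_diffw = additive_diff[of "ap X" for X, OF ap_addw]
lemmas ap_simps = ap_add ap_mult ap_addw ap_sum ap_sumw ap_diff ap_diffw ap_gs ap_gt ap_gxo ap_gox

text \<open>Two relations are used, one in each factor, with a contraction across \<open>T\<close>
  in between: \<open>H1\<close> and \<open>H4\<close> here and in \<open>gH4\<close>,
  \<open>H2\<close> and \<open>H3\<close> in the other two.\<close>

lemma gH1: "(\<Sum>i<nc P. gox (om P i) x * gxo (xi P i) w) = gt (er P w x)"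
proof (rule eqI)
  fix u v
  have "ap (\<Sum>i<nc P. gox (om P i) x * gxo (xi P i) w) (T u v) =
    (\<Sum>i<nc P. \<Sum>k<nc P. \<Sum>j<nd P. T (u * (ox (om P i) (xi P k) * xo (xi P i) (rh P j))) (ox' w (up P j) * (xo' x (om P k) * v)))"
    by (simp add: ap_simps mult.assoc)
  also have "\<dots> = (\<Sum>k<nc P. \<Sum>j<nd P. T (u * t (er P (rh P j) (xi P k))) (ox' w (up P j) * (xo' x (om P k) * v)))"
    by (subst sum_rotate3) (simp only: R.H1 T_suml[symmetric] sum_distrib_left[symmetric])
  also have "\<dots> = T u (t' 0 * v) + T u (s' (er P w x) * v)"
    by (simp add: ox_pull T_sumr[symmetric] L.H_sum additive_zero[of t', OF L.t_add] additive_zero[of "T u", OF T_addr])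
  finally show "ap (\<Sum>i<nc P. gox (om P i) x * gxo (xi P i) w) (T u v) = ap (gt (er P w x)) (T u v)"
    by (simp add: ap_simps additive_zero[of t', OF L.t_add] additive_zero[of "T u", OF T_addr])
qed (intro C_rules)+

lemma gH2: "(\<Sum>j<nd P. gxo x (rh P j) * gox w (up P j)) = gs (el P x w)"
proof (rule eqI)
  fix u v
  have "ap (\<Sum>j<nd P. gxo x (rh P j) * gox w (up P j)) (T u v) =
    (\<Sum>j<nd P. \<Sum>i<nd P. \<Sum>k<nc P. T (u * (xo x (rh P i) * ox w (xi P k))) (xo' (up P j) (om P k) * (ox' (rh P j) (up P i) * v)))"
    by (simp add: ap_simps mult.assoc)
  also have "\<dots> = (\<Sum>i<nd P. \<Sum>k<nc P. T ((u * xo x (rh P i)) * (ox w (xi P k) * t (el P (up P i) (om P k)))) v)"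
    by (subst sum_rotate3) (simp only: L.H_sum T_sumr[symmetric] T_bal[symmetric] mult.assoc)
  also have "\<dots> = T (u * s (el P x w)) v"
    unfolding ox_push by (simp only: mult.assoc T_suml[symmetric] sum_distrib_left[symmetric] R.H2)
  finally show "ap (\<Sum>j<nd P. gxo x (rh P j) * gox w (up P j)) (T u v) = ap (gs (el P x w)) (T u v)"
    by (simp add: ap_simps)
qed (intro C_rules)+

lemma gH3: "(\<Sum>j<nd P. gxo (up P j) w * gox (rh P j) x) = gt (el P x w)"
proof (rule eqI)
  fix u v
  have "ap (\<Sum>j<nd P. gxo (up P j) w * gox (rh P j) x) (T u v) =
    (\<Sum>j<nd P. \<Sum>i<nd P. \<Sum>k<nc P. T (u * (xo (up P j) (rh P i) * ox (rh P j) (xi P k))) (xo' x (om P k) * (ox' w (up P i) * v)))"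
    by (simp add: ap_simps mult.assoc)
  also have "\<dots> = (\<Sum>i<nd P. \<Sum>k<nc P. T (u * t (el P (xi P k) (rh P i))) (xo' x (om P k) * (ox' w (up P i) * v)))"
    by (subst sum_rotate3) (simp only: R.H3 T_suml[symmetric] sum_distrib_left[symmetric])
  also have "\<dots> = T u (s' (el P x w) * v)"
    unfolding xo_pull by (simp only: T_sumr[symmetric] L.H_sum)
  finally show "ap (\<Sum>j<nd P. gxo (up P j) w * gox (rh P j) x) (T u v) = ap (gt (el P x w)) (T u v)"
    by (simp add: ap_simps)
qed (intro C_rules)+

lemma gH4: "(\<Sum>i<nc P. gox w (xi P i) * gxo x (om P i)) = gs (er P w x)"
proof (rule eqI)
  fix u v
  have "ap (\<Sum>i<nc P. gox w (xi P i) * gxo x (om P i)) (T u v) =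
    (\<Sum>i<nc P. \<Sum>k<nc P. \<Sum>j<nd P. T (u * (ox w (xi P k) * xo x (rh P j))) (ox' (om P i) (up P j) * (xo' (xi P i) (om P k) * v)))"
    by (simp add: ap_simps mult.assoc)
  also have "\<dots> = (\<Sum>k<nc P. \<Sum>j<nd P. T ((u * ox w (xi P k)) * xo x (rh P j)) (t' (er P (om P k) (up P j)) * v))"
    by (subst sum_rotate3) (simp only: L.H_sum T_sumr[symmetric] mult.assoc)
  also have "\<dots> = T (u * s (er P w x)) v"
    unfolding xo_push by (simp only: mult.assoc T_suml[symmetric] sum_distrib_left[symmetric] R.H4)
  finally show "ap (\<Sum>i<nc P. gox w (xi P i) * gxo x (om P i)) (T u v) = ap (gs (er P w x)) (T u v)"
    by (simp add: ap_simps)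
qed (intro C_rules)+

lemma gam_hst: "hst mu one P gs gt gxo gox"
proof (unfold_locales, goal_cases)
  \<comment> \<open>The equation \<open>gs one = gt one\<close>: by \<open>T_unitl\<close> and
    \<open>T_unitr\<close> both sides fix every tensor.\<close>
  case 5 thus ?case by (rule eqI) (simp_all add: C_rules ap_simps T_unitl T_unitr)
qed (rule gH1 gH2 gH3 gH4 | (rule eqI, simp_all only: C_rules, simp add: ap_simps R.s_add R.t_add R.s_mu L.s_add L.s_mu
   R.xo_addl R.xo_addr R.ox_addl R.ox_addr L.xo_addl L.xo_addr L.ox_addl L.ox_addr T_addl T_addr mult.assoc
   distrib_left distrib_right sum.distrib R.H_assoc L.H_assoc'))+

end

locale gam = R: dx mu one P1 P2 d0 d1 wg s t xo1 ox1 xo2 ox2 vf + L: dx mu one P1 P2 d0 d1 wg s' t' xo1' ox1' xo2' ox2' vf' +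
  G1: gam_h mu one P1 s t xo1 ox1 s' t' xo1' ox1' T ap C gs gt gxo1 gox1 +
  G2: gam_h mu one P2 s t xo2 ox2 s' t' xo2' ox2' T ap C gs gt gxo2 gox2
  for mu :: "'a::ab_group_add \<Rightarrow> 'a \<Rightarrow> 'a" and one :: 'a
    and P1 :: "('a, 'm::ab_group_add, 'x::ab_group_add) dual_data"
    and P2 :: "('a, 'n::ab_group_add, 'y::ab_group_add) dual_data"
    and d0 :: "'a \<Rightarrow> 'm" and d1 :: "'m \<Rightarrow> 'n" and wg :: "'m \<Rightarrow> 'm \<Rightarrow> 'n"
    and s t :: "'a \<Rightarrow> 'r::ring"
    and xo1 :: "'x \<Rightarrow> 'm \<Rightarrow> 'r" and ox1 :: "'m \<Rightarrow> 'x \<Rightarrow> 'r"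
    and xo2 :: "'y \<Rightarrow> 'n \<Rightarrow> 'r" and ox2 :: "'n \<Rightarrow> 'y \<Rightarrow> 'r" and vf :: "'x \<Rightarrow> 'r"
    and s' t' :: "'a \<Rightarrow> 'q::ring"
    and xo1' :: "'x \<Rightarrow> 'm \<Rightarrow> 'q" and ox1' :: "'m \<Rightarrow> 'x \<Rightarrow> 'q"
    and xo2' :: "'y \<Rightarrow> 'n \<Rightarrow> 'q" and ox2' :: "'n \<Rightarrow> 'y \<Rightarrow> 'q" and vf' :: "'x \<Rightarrow> 'q"
    and T :: "'r \<Rightarrow> 'q \<Rightarrow> 'w::ab_group_add" and ap :: "'o::ring \<Rightarrow> 'w \<Rightarrow> 'w" and C :: "'o set"
    and gs gt :: "'a \<Rightarrow> 'o" and gxo1 :: "'x \<Rightarrow> 'm \<Rightarrow> 'o" and gox1 :: "'m \<Rightarrow> 'x \<Rightarrow> 'o"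
    and gxo2 :: "'y \<Rightarrow> 'n \<Rightarrow> 'o" and gox2 :: "'n \<Rightarrow> 'y \<Rightarrow> 'o" +
  fixes gvf :: "'x \<Rightarrow> 'o"
  assumes C_gvf: "gvf x \<in> C"
    and ap_gvf: "ap (gvf x) (T u v) = T (u * vf x) v - (\<Sum>j<nd P1. T (u * xo1 x (rh P1 j)) (L.vfr (up P1 j) * v))"
begin

lemmas C_rules = G1.C_rules G2.C_gens C_gvf
lemmas ap_simps = G1.ap_simps G2.ap_gxo G2.ap_gox ap_gvf
lemmas T_simps = G1.T_addl G1.T_addr G1.T_diffl G1.T_diffr

lemma vfr_rules':
  "t' a * (L.vfr y * c) = L.vfr (rX P1 y a) * c"
  "L.vfr y * (t' a * c) = L.vfr (lX P1 a y) * c + t' (er P1 (d0 a) y) * c"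
  "L.vfr y * (s' a * c) = s' a * (L.vfr y * c) + ox1' (d0 a) y * c"
  by (simp_all add: mult.assoc[symmetric] L.t_vfr L.vfr_t L.vfr_s distrib_right)

text \<open>\<open>D4\<close> splits \<open>ox2'\<close> in the second factor, and the scalar that
  it produces is pushed into \<open>xo2\<close> in the first.\<close>

lemma wedge_push: "(\<Sum>m<nd P2. T (u * xo2 \<zeta> (rh P2 m)) (ox2' (wg w v) (up P2 m) * y)) =
  (\<Sum>a<nd P1. \<Sum>b<nd P1. T (u * xo2 \<zeta> (wg (rh P1 a) (rh P1 b))) (ox1' w (up P1 a) * (ox1' v (up P1 b) * y)))"
  unfolding L.D4'[symmetric] G1.T_sumr by (subst sum_rotate3) (simp only: G2.xo_push)

text \<open>\<open>D3\<close> applies in the first factor. The product of two \<open>ox1'\<close>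
  left in the second is what \<open>D4\<close> makes of \<open>ox2'\<close> there.\<close>

lemma gD3: "(\<Sum>i<nc P1. \<Sum>j<nc P1. gs (el P2 z (wg (om P1 i) (om P1 j))) *
        (gxo1 (xi P1 j) v * gxo1 (xi P1 i) w)) = gxo2 z (wg w v)"
proof (rule G1.eqI)
  fix u y
  have "ap (\<Sum>i<nc P1. \<Sum>j<nc P1. gs (el P2 z (wg (om P1 i) (om P1 j))) *
        (gxo1 (xi P1 j) v * gxo1 (xi P1 i) w)) (T u y) =
    (\<Sum>i<nc P1. \<Sum>j<nc P1. \<Sum>p<nd P1. \<Sum>q<nd P1. T (u * (s (el P2 z (wg (om P1 i) (om P1 j))) *
       (xo1 (xi P1 j) (rh P1 p) * xo1 (xi P1 i) (rh P1 q)))) (ox1' w (up P1 q) * (ox1' v (up P1 p) * y)))"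
    by (simp add: ap_simps mult.assoc)
  also have "\<dots> = (\<Sum>p<nd P1. \<Sum>q<nd P1. T (u * xo2 z (wg (rh P1 q) (rh P1 p))) (ox1' w (up P1 q) * (ox1' v (up P1 p) * y)))"
    by (subst sum_rotate4) (simp only: G1.T_suml[symmetric] sum_distrib_left[symmetric] R.D3)
  also have "\<dots> = ap (gxo2 z (wg w v)) (T u y)"
    by (simp only: ap_simps wedge_push) (rule sum.swap)
  finally show "ap (\<Sum>i<nc P1. \<Sum>j<nc P1. gs (el P2 z (wg (om P1 i) (om P1 j))) *
        (gxo1 (xi P1 j) v * gxo1 (xi P1 i) w)) (T u y) = ap (gxo2 z (wg w v)) (T u y)" .
qed (intro C_rules)+

text \<open>Among the four relations this is the one that needs pivotality. The coefficient arrives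
  in the bases \<open>rh\<close>, \<open>up\<close>, whereas \<open>D3\<close> in the second factor
  asks for \<open>om\<close>, \<open>xi\<close>. In the first factor the opposite change is needed
  before \<open>D4\<close> applies.\<close>

lemma gD4: "(\<Sum>a<nd P1. \<Sum>b<nd P1. gt (er P2 (wg (rh P1 a) (rh P1 b)) z) *
        (gox1 w (up P1 a) * gox1 v (up P1 b))) = gox2 (wg w v) z"
proof (rule G1.eqI)
  fix u y
  let ?X = "\<Sum>a<nd P1. \<Sum>b<nd P1. gt (er P2 (wg (rh P1 a) (rh P1 b)) z) * (gox1 w (up P1 a) * gox1 v (up P1 b))"
  have "ap ?X (T u y) = (\<Sum>b<nd P1. \<Sum>a<nd P1. \<Sum>k<nc P1. \<Sum>l<nc P1. T (u * (ox1 w (xi P1 k) * ox1 v (xi P1 l)))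
      (xo1' (up P1 b) (om P1 l) * (xo1' (rX P1 (up P1 a) (er P2 (wg (rh P1 a) (rh P1 b)) z)) (om P1 k) * y)))"
    by (subst sum.swap) (simp add: ap_simps mult.assoc L.K1.H_assoc')
  also have "\<dots> = (\<Sum>k<nc P1. \<Sum>l<nc P1. T (u * (ox1 w (xi P1 k) * ox1 v (xi P1 l)))
      (\<Sum>b<nd P1. \<Sum>a<nd P1. xo1' (up P1 b) (om P1 l) * (xo1' (rX P1 (up P1 a) (er P2 (wg (rh P1 a) (rh P1 b)) z)) (om P1 k) * y)))"
    by (subst sum_rotate4) (simp only: G1.T_sumr[symmetric])
  also have "\<dots> = (\<Sum>k<nc P1. \<Sum>l<nc P1. T (u * (ox1 w (xi P1 k) * ox1 v (xi P1 l))) (xo2' z (wg (om P1 k) (om P1 l)) * y))"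
  proof (intro sum.cong refl)
    fix k l
    have "(\<Sum>b<nd P1. \<Sum>a<nd P1. xo1' (up P1 b) (om P1 l) * (xo1' (rX P1 (up P1 a) (er P2 (wg (rh P1 a) (rh P1 b)) z)) (om P1 k) * y)) =
      (\<Sum>i<nc P1. \<Sum>j<nc P1. xo1' (lX P1 (el P2 z (wg (om P1 i) (om P1 j))) (xi P1 j)) (om P1 l) * (xo1' (xi P1 i) (om P1 k) * y))"
      by (rule R.pivotal_balanced[of "\<lambda>x x'. xo1' x (om P1 l) * (xo1' x' (om P1 k) * y)", symmetric])
        (simp_all add: L.K1.xo_addl distrib_left distrib_right L.K1.H_assoc'[symmetric] mult.assoc)
    also have "\<dots> = xo2' z (wg (om P1 k) (om P1 l)) * y"
      by (simp add: L.D3[symmetric] sum_distrib_right mult.assoc L.K1.H_assoc')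
    finally show "T (u * (ox1 w (xi P1 k) * ox1 v (xi P1 l))) (\<Sum>b<nd P1. \<Sum>a<nd P1. xo1' (up P1 b) (om P1 l) *
       (xo1' (rX P1 (up P1 a) (er P2 (wg (rh P1 a) (rh P1 b)) z)) (om P1 k) * y)) =
       T (u * (ox1 w (xi P1 k) * ox1 v (xi P1 l))) (xo2' z (wg (om P1 k) (om P1 l)) * y)"
      by simp
  qed
  \<comment> \<open>Splitting \<open>xo2'\<close> by the dual basis of
    \<open>\<Omega>\<^sup>2\<close> moves the two forms \<open>om P1 k\<close> and
    \<open>om P1 l\<close> into a scalar of the first factor.\<close>
  also have "\<dots> = (\<Sum>k<nc P1. \<Sum>l<nc P1. \<Sum>m<nc P2. T (u * (ox1 w (xi P1 k) * ox1 v (lX P1 (el P2 (xi P2 m) (wg (om P1 k) (om P1 l))) (xi P1 l))))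
      (xo2' z (om P2 m) * y))"
    by (intro sum.cong refl) (subst G2.xo_pull[symmetric], simp only: mult.assoc R.K1.oxt)
  also have "\<dots> = (\<Sum>m<nc P2. T (u * (\<Sum>k<nc P1. \<Sum>l<nc P1. (ox1 w (xi P1 k) * ox1 v (lX P1 (el P2 (xi P2 m) (wg (om P1 k) (om P1 l))) (xi P1 l)))))
      (xo2' z (om P2 m) * y))"
    by (subst sum_rotate3[symmetric]) (simp only: G1.T_suml[symmetric] sum_distrib_left[symmetric])
  also have "\<dots> = (\<Sum>m<nc P2. T (u * ox2 (wg w v) (xi P2 m)) (xo2' z (om P2 m) * y))"
  proof (intro sum.cong refl)
    fix m
    have "(\<Sum>k<nc P1. \<Sum>l<nc P1. (ox1 w (xi P1 k) * ox1 v (lX P1 (el P2 (xi P2 m) (wg (om P1 k) (om P1 l))) (xi P1 l)))) =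
       (\<Sum>i<nd P1. \<Sum>j<nd P1. ox1 w (rX P1 (up P1 j) (er P2 (wg (rh P1 j) (rh P1 i)) (xi P2 m))) * ox1 v (up P1 i))"
      by (rule R.pivotal_balanced[of "\<lambda>x x'. ox1 w x' * ox1 v x"])
        (simp_all add: R.K1.ox_addr distrib_left distrib_right R.K1.oxt[symmetric] R.K1.tox[symmetric] mult.assoc)
    also have "\<dots> = ox2 (wg w v) (xi P2 m)"
      by (subst sum.swap) (simp add: R.D4[symmetric] R.K1.H_assoc')
    finally show "T (u * (\<Sum>k<nc P1. \<Sum>l<nc P1. (ox1 w (xi P1 k) * ox1 v (lX P1 (el P2 (xi P2 m) (wg (om P1 k) (om P1 l))) (xi P1 l)))))
      (xo2' z (om P2 m) * y) = T (u * ox2 (wg w v) (xi P2 m)) (xo2' z (om P2 m) * y)" by simp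
  qed
  finally show "ap ?X (T u y) = ap (gox2 (wg w v) z) (T u y)"
    by (simp add: ap_simps)
qed (intro C_rules)+

text \<open>\<open>D2\<close> and \<open>D3\<close> reduce the first factor. In the second factor
  vector fields occur only through \<open>vfr\<close>, so the relation needed there is
  \<open>D2_mirror\<close>.\<close>

lemma gD2: "(\<Sum>i<nc P1. \<Sum>j<nc P1. gs (el P2 z (wg (om P1 i) (om P1 j))) *
        (gvf (xi P1 j) * gxo1 (xi P1 i) w + gxo1 (xi P1 j) w * gvf (xi P1 i))) =
      (\<Sum>i<nc P1. gs (el P2 z (d1 (om P1 i))) * gxo1 (xi P1 i) w) - gxo2 z (d1 w)"
  (is "?X = ?Y")
proof (rule G1.eqI)
  fix u y
  let ?c = "\<lambda>i j. s (el P2 z (wg (om P1 i) (om P1 j)))"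
  have "ap ?X (T u y) = (\<Sum>i<nc P1. \<Sum>j<nc P1. \<Sum>q<nd P1. T (u * (?c i j * (vf (xi P1 j) * xo1 (xi P1 i) (rh P1 q) +
        xo1 (xi P1 j) (rh P1 q) * vf (xi P1 i)))) (ox1' w (up P1 q) * y))
     - ((\<Sum>i<nc P1. \<Sum>j<nc P1. \<Sum>p<nd P1. \<Sum>q<nd P1. T (u * (?c i j * (xo1 (xi P1 j) (rh P1 p) * xo1 (xi P1 i) (rh P1 q))))
         (ox1' w (up P1 q) * (L.vfr (up P1 p) * y)))
      + (\<Sum>i<nc P1. \<Sum>j<nc P1. \<Sum>p<nd P1. \<Sum>q<nd P1. T (u * (?c i j * (xo1 (xi P1 j) (rh P1 p) * xo1 (xi P1 i) (rh P1 q))))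
         (L.vfr (up P1 q) * (ox1' w (up P1 p) * y))))"
    by (simp add: ap_simps mult.assoc distrib_left distrib_right T_simps sum.distrib sum_subtractf algebra_simps)
  also have "\<dots> = (\<Sum>q<nd P1. T (u * ((\<Sum>i<nc P1. s (el P2 z (d1 (om P1 i))) * xo1 (xi P1 i) (rh P1 q)) - xo2 z (d1 (rh P1 q)))) (ox1' w (up P1 q) * y))
     - ((\<Sum>p<nd P1. \<Sum>q<nd P1. T (u * xo2 z (wg (rh P1 q) (rh P1 p))) (ox1' w (up P1 q) * (L.vfr (up P1 p) * y)))
      + (\<Sum>p<nd P1. \<Sum>q<nd P1. T (u * xo2 z (wg (rh P1 q) (rh P1 p))) (L.vfr (up P1 q) * (ox1' w (up P1 p) * y))))"
  proof -
    have "(\<Sum>i<nc P1. \<Sum>j<nc P1. \<Sum>q<nd P1. T (u * (?c i j * (vf (xi P1 j) * xo1 (xi P1 i) (rh P1 q) +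
        xo1 (xi P1 j) (rh P1 q) * vf (xi P1 i)))) (ox1' w (up P1 q) * y)) =
       (\<Sum>q<nd P1. T (u * ((\<Sum>i<nc P1. s (el P2 z (d1 (om P1 i))) * xo1 (xi P1 i) (rh P1 q)) - xo2 z (d1 (rh P1 q)))) (ox1' w (up P1 q) * y))"
      by (subst sum_rotate3[symmetric]) (simp only: G1.T_suml[symmetric] sum_distrib_left[symmetric] R.D2)
    moreover have "(\<Sum>i<nc P1. \<Sum>j<nc P1. \<Sum>p<nd P1. \<Sum>q<nd P1. T (u * (?c i j * (xo1 (xi P1 j) (rh P1 p) * xo1 (xi P1 i) (rh P1 q)))) (F p q))
       = (\<Sum>p<nd P1. \<Sum>q<nd P1. T (u * xo2 z (wg (rh P1 q) (rh P1 p))) (F p q))" for F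
      by (subst sum_rotate4) (simp only: G1.T_suml[symmetric] sum_distrib_left[symmetric] R.D3)
    ultimately show ?thesis by simp
  qed
  also have "\<dots> = (\<Sum>q<nd P1. \<Sum>i<nc P1. T (u * (s (el P2 z (d1 (om P1 i))) * xo1 (xi P1 i) (rh P1 q))) (ox1' w (up P1 q) * y))
     - ((\<Sum>q<nd P1. T (u * xo2 z (d1 (rh P1 q))) (ox1' w (up P1 q) * y)) +
      (\<Sum>p<nd P1. \<Sum>q<nd P1. T (u * xo2 z (wg (rh P1 q) (rh P1 p))) (ox1' w (up P1 q) * (L.vfr (up P1 p) * y) + L.vfr (up P1 q) * (ox1' w (up P1 p) * y))))"
    by (simp add: right_diff_distrib T_simps sum.distrib sum_subtractf sum_distrib_left G1.T_suml algebra_simps)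
  also have "\<dots> = (\<Sum>q<nd P1. \<Sum>i<nc P1. T (u * (s (el P2 z (d1 (om P1 i))) * xo1 (xi P1 i) (rh P1 q))) (ox1' w (up P1 q) * y))
     - (\<Sum>m<nd P2. T (u * xo2 z (rh P2 m)) (ox2' (d1 w) (up P2 m) * y))"
  proof -
    have "ox2' (d1 w) \<zeta> * y = (\<Sum>q<nd P1. t' (er P2 (d1 (rh P1 q)) \<zeta>) * (ox1' w (up P1 q) * y)) +
      (\<Sum>p<nd P1. \<Sum>q<nd P1. t' (er P2 (wg (rh P1 q) (rh P1 p)) \<zeta>) *
         (ox1' w (up P1 q) * (L.vfr (up P1 p) * y) + L.vfr (up P1 q) * (ox1' w (up P1 p) * y)))" for \<zeta>
    proof -
      have "ox2' (d1 w) \<zeta> = (\<Sum>q<nd P1. t' (er P2 (d1 (rh P1 q)) \<zeta>) * ox1' w (up P1 q)) +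
        (\<Sum>p<nd P1. \<Sum>q<nd P1. t' (er P2 (wg (rh P1 q) (rh P1 p)) \<zeta>) * (L.vfr (up P1 q) * ox1' w (up P1 p) + ox1' w (up P1 q) * L.vfr (up P1 p)))"
        unfolding L.D2_mirror by simp
      thus ?thesis by (simp add: distrib_right distrib_left sum_distrib_right mult.assoc sum.distrib algebra_simps)
    qed
    moreover have "(\<Sum>m<nd P2. \<Sum>q<nd P1. T (u * xo2 z (rh P2 m)) (t' (er P2 (\<theta> q) (up P2 m)) * F q)) = (\<Sum>q<nd P1. T (u * xo2 z (\<theta> q)) (F q))" for \<theta> F
      by (subst sum.swap) (simp only: G2.xo_push)
    moreover have "(\<Sum>m<nd P2. \<Sum>p<nd P1. \<Sum>q<nd P1. T (u * xo2 z (rh P2 m)) (t' (er P2 (\<theta> p q) (up P2 m)) * F p q)) =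
       (\<Sum>p<nd P1. \<Sum>q<nd P1. T (u * xo2 z (\<theta> p q)) (F p q))" for \<theta> F
      by (subst sum_rotate3) (simp only: G2.xo_push)
    ultimately show ?thesis
      by (simp only: G1.T_addr G1.T_sumr sum.distrib)
  qed
  also have "\<dots> = ap ?Y (T u y)"
    by (subst sum.swap) (simp add: ap_simps mult.assoc)
  finally show "ap ?X (T u y) = ap ?Y (T u y)" .
qed (intro C_rules)+

text \<open>A product of two \<open>gvf\<close> has terms with none, one and two \<open>vfr\<close>,
  which \<open>D1\<close>, \<open>D2\<close> and \<open>D3\<close> reduce in the first factor. What
  is left over is \<open>D1_mirror\<close> in the second factor, hence zero.\<close>

lemma gD1: "(\<Sum>i<nc P1. gs (el P2 z (d1 (om P1 i))) * gvf (xi P1 i)) =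
      (\<Sum>i<nc P1. \<Sum>j<nc P1. gs (el P2 z (wg (om P1 i) (om P1 j))) * (gvf (xi P1 j) * gvf (xi P1 i)))"
  (is "?X = ?Y")
proof (rule G1.eqI)
  fix u y
  let ?c = "\<lambda>i j. s (el P2 z (wg (om P1 i) (om P1 j)))"
  have "ap ?Y (T u y) = (\<Sum>i<nc P1. \<Sum>j<nc P1. T (u * (?c i j * (vf (xi P1 j) * vf (xi P1 i)))) y)
     - (\<Sum>i<nc P1. \<Sum>j<nc P1. \<Sum>p<nd P1. T (u * (?c i j * (vf (xi P1 j) * xo1 (xi P1 i) (rh P1 p) +
        xo1 (xi P1 j) (rh P1 p) * vf (xi P1 i)))) (L.vfr (up P1 p) * y))
     + (\<Sum>i<nc P1. \<Sum>j<nc P1. \<Sum>p<nd P1. \<Sum>q<nd P1. T (u * (?c i j * (xo1 (xi P1 j) (rh P1 p) * xo1 (xi P1 i) (rh P1 q))))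
         (L.vfr (up P1 q) * (L.vfr (up P1 p) * y)))"
    by (simp add: ap_simps mult.assoc distrib_left distrib_right T_simps sum.distrib sum_subtractf algebra_simps)
  also have "\<dots> = (\<Sum>i<nc P1. T (u * (s (el P2 z (d1 (om P1 i))) * vf (xi P1 i))) y)
     - (\<Sum>p<nd P1. T (u * ((\<Sum>i<nc P1. s (el P2 z (d1 (om P1 i))) * xo1 (xi P1 i) (rh P1 p)) - xo2 z (d1 (rh P1 p)))) (L.vfr (up P1 p) * y))
     + (\<Sum>p<nd P1. \<Sum>q<nd P1. T (u * xo2 z (wg (rh P1 q) (rh P1 p))) (L.vfr (up P1 q) * (L.vfr (up P1 p) * y)))"
  proof -
    have "(\<Sum>i<nc P1. \<Sum>j<nc P1. T (u * (?c i j * (vf (xi P1 j) * vf (xi P1 i)))) y) =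
      (\<Sum>i<nc P1. T (u * (s (el P2 z (d1 (om P1 i))) * vf (xi P1 i))) y)"
      by (simp only: G1.T_suml[symmetric] sum_distrib_left[symmetric] R.D1)
    moreover have "(\<Sum>i<nc P1. \<Sum>j<nc P1. \<Sum>q<nd P1. T (u * (?c i j * (vf (xi P1 j) * xo1 (xi P1 i) (rh P1 q) +
        xo1 (xi P1 j) (rh P1 q) * vf (xi P1 i)))) (L.vfr (up P1 q) * y)) =
       (\<Sum>q<nd P1. T (u * ((\<Sum>i<nc P1. s (el P2 z (d1 (om P1 i))) * xo1 (xi P1 i) (rh P1 q)) - xo2 z (d1 (rh P1 q)))) (L.vfr (up P1 q) * y))"
      by (subst sum_rotate3[symmetric]) (simp only: G1.T_suml[symmetric] sum_distrib_left[symmetric] R.D2)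
    moreover have "(\<Sum>i<nc P1. \<Sum>j<nc P1. \<Sum>p<nd P1. \<Sum>q<nd P1. T (u * (?c i j * (xo1 (xi P1 j) (rh P1 p) * xo1 (xi P1 i) (rh P1 q)))) (F p q))
       = (\<Sum>p<nd P1. \<Sum>q<nd P1. T (u * xo2 z (wg (rh P1 q) (rh P1 p))) (F p q))" for F
      by (subst sum_rotate4) (simp only: G1.T_suml[symmetric] sum_distrib_left[symmetric] R.D3)
    ultimately show ?thesis by simp
  qed
  also have "\<dots> = (\<Sum>i<nc P1. T (u * (s (el P2 z (d1 (om P1 i))) * vf (xi P1 i))) y)
     - (\<Sum>p<nd P1. \<Sum>i<nc P1. T (u * (s (el P2 z (d1 (om P1 i))) * xo1 (xi P1 i) (rh P1 p))) (L.vfr (up P1 p) * y))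
     + ((\<Sum>p<nd P1. T (u * xo2 z (d1 (rh P1 p))) (L.vfr (up P1 p) * y)) +
        (\<Sum>p<nd P1. \<Sum>q<nd P1. T (u * xo2 z (wg (rh P1 q) (rh P1 p))) (L.vfr (up P1 q) * (L.vfr (up P1 p) * y))))"
    by (simp add: right_diff_distrib T_simps sum.distrib sum_subtractf sum_distrib_left G1.T_suml algebra_simps)
  also have "(\<Sum>p<nd P1. T (u * xo2 z (d1 (rh P1 p))) (L.vfr (up P1 p) * y)) +
        (\<Sum>p<nd P1. \<Sum>q<nd P1. T (u * xo2 z (wg (rh P1 q) (rh P1 p))) (L.vfr (up P1 q) * (L.vfr (up P1 p) * y))) =
     (\<Sum>m<nd P2. T (u * xo2 z (rh P2 m)) ((\<Sum>p<nd P1. t' (er P2 (d1 (rh P1 p)) (up P2 m)) * (L.vfr (up P1 p) * y)) +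
        (\<Sum>p<nd P1. \<Sum>q<nd P1. t' (er P2 (wg (rh P1 q) (rh P1 p)) (up P2 m)) * (L.vfr (up P1 q) * (L.vfr (up P1 p) * y)))))"
  proof -
    have "(\<Sum>m<nd P2. \<Sum>q<nd P1. T (u * xo2 z (rh P2 m)) (t' (er P2 (\<theta> q) (up P2 m)) * F q)) = (\<Sum>q<nd P1. T (u * xo2 z (\<theta> q)) (F q))" for \<theta> F
      by (subst sum.swap) (simp only: G2.xo_push)
    moreover have "(\<Sum>m<nd P2. \<Sum>p<nd P1. \<Sum>q<nd P1. T (u * xo2 z (rh P2 m)) (t' (er P2 (\<theta> p q) (up P2 m)) * F p q)) =
       (\<Sum>p<nd P1. \<Sum>q<nd P1. T (u * xo2 z (\<theta> p q)) (F p q))" for \<theta> F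
      by (subst sum_rotate3) (simp only: G2.xo_push)
    ultimately show ?thesis by (simp only: G1.T_addr G1.T_sumr sum.distrib)
  qed
  also have "\<dots> = 0"
  proof -
    have "(\<Sum>p<nd P1. t' (er P2 (d1 (rh P1 p)) \<zeta>) * (L.vfr (up P1 p) * y)) +
        (\<Sum>p<nd P1. \<Sum>q<nd P1. t' (er P2 (wg (rh P1 q) (rh P1 p)) \<zeta>) * (L.vfr (up P1 q) * (L.vfr (up P1 p) * y))) =
       ((\<Sum>p<nd P1. t' (er P2 (d1 (rh P1 p)) \<zeta>) * L.vfr (up P1 p)) +
        (\<Sum>p<nd P1. \<Sum>q<nd P1. t' (er P2 (wg (rh P1 q) (rh P1 p)) \<zeta>) * (L.vfr (up P1 q) * L.vfr (up P1 p)))) * y" for \<zeta>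
      by (simp only: distrib_right sum_distrib_right mult.assoc)
    also have "\<dots> \<zeta> = 0" for \<zeta> by (simp only: L.D1_mirror) simp
    finally show ?thesis by (simp add: additive_zero[of "T u" for u, OF G1.T_addr])
  qed
  finally show "ap ?X (T u y) = ap ?Y (T u y)"
    by (subst (asm) sum.swap) (simp add: ap_simps mult.assoc sum_subtractf)
qed (intro C_rules)+

lemma gam_dx: "dx mu one P1 P2 d0 d1 wg gs gt gxo1 gox1 gxo2 gox2 gvf"
proof -
  interpret I1: hst mu one P1 gs gt gxo1 gox1 by (rule G1.gam_hst)
  interpret I2: hst mu one P2 gs gt gxo2 gox2 by (rule G2.gam_hst)
  show ?thesis
    by unfold_locales
     (rule gD1 gD2 gD3 gD4 | (rule G1.eqI, simp_all only: C_rules, simp add: ap_simps R.vf_add R.svf R.vfs R.vft vfr_rules' R.K1.xo_addl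
       distrib_left distrib_right T_simps sum.distrib sum_subtractf mult.assoc R.K1.H_assoc algebra_simps))+
qed

end

section \<open>The coproduct followed by the translation map\<close>

context gam_h
begin

text \<open>This is b_(1)+ \<otimes> b_(1)- b_(2) = b \<otimes> 1 for b = \<open>(x, w)\<close>, one
  half of the inversion of \<beta> on this generator.\<close>

lemma cop_gxo: "(\<Sum>i<nc P. ap (gxo x (om P i)) (T u (xo' (xi P i) w * v))) = T (u * xo x w) v"
proof -
  have "(\<Sum>i<nc P. ap (gxo x (om P i)) (T u (xo' (xi P i) w * v))) =
    (\<Sum>j<nd P. T (u * xo x (rh P j)) (t' (er P w (up P j)) * v))"
    by (simp only: ap_gxo) (subst sum.swap, simp only: T_sumr[symmetric] L.H_sum)
  thus ?thesis by (simp only: xo_push)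
qed

lemma cop_gox: "(\<Sum>j<nd P. ap (gox w (up P j)) (T u (ox' (rh P j) x * v))) = T (u * ox w x) v"
proof -
  have "(\<Sum>j<nd P. ap (gox w (up P j)) (T u (ox' (rh P j) x * v))) =
    (\<Sum>i<nc P. T (u * ox w (xi P i)) (t' (el P x (om P i)) * v))"
    by (simp only: ap_gox) (subst sum.swap, simp only: T_sumr[symmetric] L.H_sum)
  thus ?thesis by (simp only: T_bal[symmetric] mult.assoc ox_push)
qed

end

context gam
begin

text \<open>The subtracted terms of \<open>gvf\<close> are cancelled by the second part of the
  coproduct of \<open>x\<close>.\<close>

lemma cop_gvf: "ap (gvf x) (T u v) + (\<Sum>i<nc P1. ap (gxo1 x (om P1 i)) (T u (vf' (xi P1 i) * v))) = T (u * vf x) v"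
  by (simp only: G1.ap_gxo) (subst sum.swap, simp add: ap_gvf L.vfr_def sum_distrib_right mult.assoc G1.T_sumr)

end

section \<open>The left action on \<open>B \<diamondop> B\<close>\<close>

locale del_h = hst mu one P s t xo ox
  for mu :: "'a::ab_group_add \<Rightarrow> 'a \<Rightarrow> 'a" and one :: 'a
    and P :: "('a, 'm::ab_group_add, 'x::ab_group_add) dual_data"
    and s t :: "'a \<Rightarrow> 'r::ring" and xo :: "'x \<Rightarrow> 'm \<Rightarrow> 'r" and ox :: "'m \<Rightarrow> 'x \<Rightarrow> 'r" +
  fixes D :: "'r \<Rightarrow> 'r \<Rightarrow> 'w::ab_group_add"
  assumes D_addl: "D (u + u') v = D u v + D u' v" and D_addr: "D u (v + v') = D u v + D u v'"
    and D_bal: "D (t r * u) v = D u (s r * v)"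
    and D_unitl: "D (s one * u) v = D u v" and D_unitr: "D u (s one * v) = D u v"
begin

lemmas D_suml = additive_sum[of "\<lambda>u. D u v" for v, OF D_addl]
lemmas D_sumr = additive_sum[of "D u" for u, OF D_addr]
lemmas D_diffl = additive_diff[of "\<lambda>u. D u v" for v, OF D_addl]
lemmas D_diffr = additive_diff[of "D u" for u, OF D_addr]

lemma xo_col: "(\<Sum>i<nc P. D (xo x (om P i) * u) (s (el P (xi P i) \<theta>) * v)) = D (xo x \<theta> * u) v"
  by (simp add: D_bal[symmetric] H_assoc' collapse(1)[of "\<lambda>w. D (xo x w * u) v"] xo_addr distrib_right D_addl)

lemma ox_col: "(\<Sum>j<nd P. D (ox w (up P j) * u) (s (er P (rh P j) x) * v)) = D (ox w x * u) v"
  by (simp add: D_bal[symmetric] H_assoc' collapseX(2)[of "\<lambda>x. D (ox w x * u) v"] ox_addr distrib_right D_addl)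

lemma xo_cor: "(\<Sum>i<nc P. D (t (el P x (om P i)) * u) (xo (xi P i) w * v)) = D u (xo x w * v)"
  by (simp add: D_bal H_assoc' collapseX(1)[of "\<lambda>x. D u (xo x w * v)"] xo_addl distrib_right D_addr)

lemma ox_cor: "(\<Sum>j<nd P. D (t (er P w (up P j)) * u) (ox (rh P j) x * v)) = D u (ox w x * v)"
  by (simp add: D_bal H_assoc' collapse(2)[of "\<lambda>w. D u (ox w x * v)"] ox_addl distrib_right D_addr)

lemma xo_dbal: "D (xo x (rO P w a) * u) v = D (xo x w * u) (s a * v)"
  by (simp only: H_assoc'(2)[symmetric] D_bal)

lemma ox_dbal: "D (ox w (rX P x a) * u) v = D (ox w x * u) (s a * v)"
  by (simp only: H_assoc'(6)[symmetric] D_bal)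

text \<open>The Takeuchi condition for the coproduct of \<open>(x, w)\<close>, which is the
  centrality of \<open>coev(1)\<close>.\<close>

lemma takeuchi_dxo:
  "(\<Sum>i<nc P. D (xo x (om P i) * (t r * u)) (xo (xi P i) w * v)) =
   (\<Sum>i<nc P. D (xo x (om P i) * u) (xo (xi P i) w * (s r * v)))"
proof -
  have "(\<Sum>i<nc P. D (xo x (lO P r (om P i)) * u) (xo (xi P i) w * v)) =
    (\<Sum>i<nc P. D (xo x (om P i) * u) (xo (rX P (xi P i) r) w * v))"
    by (rule central[of "\<lambda>w' x'. D (xo x w' * u) (xo x' w * v)" r])
      (simp_all add: xo_addl xo_addr D_addl D_addr distrib_right xo_dbal H_assoc')
  thus ?thesis by (simp add: H_assoc')
qed

lemma takeuchi_dox: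
  "(\<Sum>j<nd P. D (ox w (up P j) * (t r * u)) (ox (rh P j) x * v)) =
   (\<Sum>j<nd P. D (ox w (up P j) * u) (ox (rh P j) x * (s r * v)))"
proof -
  have "(\<Sum>j<nd P. D (ox w (lX P r (up P j)) * u) (ox (rh P j) x * v)) =
    (\<Sum>j<nd P. D (ox w (up P j) * u) (ox (rO P (rh P j) r) x * v))"
    by (rule centralr[of "\<lambda>x' w'. D (ox w x' * u) (ox w' x * v)" r])
      (simp_all add: ox_addl ox_addr D_addl D_addr distrib_right ox_dbal H_assoc')
  thus ?thesis by (simp add: H_assoc')
qed

end

locale delta_h = del_h mu one P s t xo ox D
  for mu :: "'a::ab_group_add \<Rightarrow> 'a \<Rightarrow> 'a" and one :: 'a
    and P :: "('a, 'm::ab_group_add, 'x::ab_group_add) dual_data"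
    and s t :: "'a \<Rightarrow> 'r::ring" and xo :: "'x \<Rightarrow> 'm \<Rightarrow> 'r" and ox :: "'m \<Rightarrow> 'x \<Rightarrow> 'r"
    and D :: "'r \<Rightarrow> 'r \<Rightarrow> 'w::ab_group_add" +
  fixes ap :: "'o::ring \<Rightarrow> 'w \<Rightarrow> 'w" and C :: "'o set"
    and fs ft :: "'a \<Rightarrow> 'o" and fxo :: "'x \<Rightarrow> 'm \<Rightarrow> 'o" and fox :: "'m \<Rightarrow> 'x \<Rightarrow> 'o"
  assumes ap_add: "ap (X + Y) p = ap X p + ap Y p" and ap_mult: "ap (X * Y) p = ap X (ap Y p)"
    and ap_addw: "ap X (p + q) = ap X p + ap X q"
    and eqI: "X \<in> C \<Longrightarrow> Y \<in> C \<Longrightarrow> (\<And>u v. ap X (D u v) = ap Y (D u v)) \<Longrightarrow> X = Y"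
    and C_add: "X \<in> C \<Longrightarrow> Y \<in> C \<Longrightarrow> X + Y \<in> C" and C_minus: "X \<in> C \<Longrightarrow> - X \<in> C"
    and C_mult: "X \<in> C \<Longrightarrow> Y \<in> C \<Longrightarrow> X * Y \<in> C"
    and C_gens: "fs a \<in> C" "ft a \<in> C" "fxo x w \<in> C" "fox w x \<in> C"
    and ap_fs: "ap (fs a) (D u v) = D (s a * u) v" and ap_ft: "ap (ft a) (D u v) = D u (t a * v)"
    and ap_fxo: "ap (fxo x w) (D u v) = (\<Sum>i<nc P. D (xo x (om P i) * u) (xo (xi P i) w * v))"
    and ap_fox: "ap (fox w x) (D u v) = (\<Sum>j<nd P. D (ox w (up P j) * u) (ox (rh P j) x * v))"
begin

lemma C_zero: "0 \<in> C"
  using C_add[OF C_gens(1)[of undefined] C_minus[OF C_gens(1)[of undefined]]] by simp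

lemma C_sum: "(\<And>i. i \<in> I \<Longrightarrow> g i \<in> C) \<Longrightarrow> (\<Sum>i\<in>I. g i) \<in> C"
  by (induction I rule: infinite_finite_induct) (simp_all add: C_add C_zero)

lemma C_diff: "X \<in> C \<Longrightarrow> Y \<in> C \<Longrightarrow> X - Y \<in> C"
  using C_add[of X "- Y"] C_minus[of Y] by simp

lemmas C_rules = C_add C_minus C_mult C_gens C_sum C_diff

lemmas ap_sum = additive_sum[of "\<lambda>X. ap X p" for p, OF ap_add]
lemmas ap_sumw = additive_sum[of "ap X" for X, OF ap_addw]
lemmas ap_diff = additive_diff[of "\<lambda>X. ap X p" for p, OF ap_add]
lemmas ap_simps = ap_add ap_mult ap_addw ap_sum ap_sumw ap_diff ap_fs ap_ft ap_fxo ap_fox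

text \<open>Both factors are multiplied from the left, so each of the four relations follows from
  itself: it is used once in either factor, with a contraction across \<open>D\<close> in
  between.\<close>

lemma dH1: "(\<Sum>i<nc P. fox (om P i) x * fxo (xi P i) w) = ft (er P w x)"
proof (rule eqI)
  fix u v
  have "ap (\<Sum>i<nc P. fox (om P i) x * fxo (xi P i) w) (D u v) =
    (\<Sum>i<nc P. \<Sum>k<nc P. \<Sum>j<nd P. D ((ox (om P i) (up P j) * xo (xi P i) (om P k)) * u) (ox (rh P j) x * (xo (xi P k) w * v)))"
    by (simp add: ap_simps mult.assoc)
  also have "\<dots> = (\<Sum>k<nc P. \<Sum>j<nd P. D (t (er P (om P k) (up P j)) * u) (ox (rh P j) x * (xo (xi P k) w * v)))"
    by (subst sum_rotate3) (simp only: H1 D_suml[symmetric] sum_distrib_right[symmetric])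
  also have "\<dots> = D u (t (er P w x) * v)"
    unfolding ox_cor by (simp only: D_sumr[symmetric] H_sum)
  finally show "ap (\<Sum>i<nc P. fox (om P i) x * fxo (xi P i) w) (D u v) = ap (ft (er P w x)) (D u v)"
    by (simp add: ap_simps)
qed (intro C_rules)+

lemma dH2: "(\<Sum>j<nd P. fxo x (rh P j) * fox w (up P j)) = fs (el P x w)"
proof (rule eqI)
  fix u v
  have "ap (\<Sum>j<nd P. fxo x (rh P j) * fox w (up P j)) (D u v) =
    (\<Sum>j<nd P. \<Sum>k<nd P. \<Sum>i<nc P. D (xo x (om P i) * (ox w (up P k) * u)) (xo (xi P i) (rh P j) * (ox (rh P k) (up P j) * v)))"
    by (simp add: ap_simps)
  also have "\<dots> = (\<Sum>k<nd P. \<Sum>i<nc P. D (xo x (om P i) * (ox w (up P k) * u)) (s (el P (xi P i) (rh P k)) * v))"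
    by (subst sum_rotate3) (simp only: H_sum D_sumr[symmetric])
  also have "\<dots> = D (s (el P x w) * u) v"
    unfolding xo_col by (simp only: D_suml[symmetric] H_sum)
  finally show "ap (\<Sum>j<nd P. fxo x (rh P j) * fox w (up P j)) (D u v) = ap (fs (el P x w)) (D u v)"
    by (simp add: ap_simps)
qed (intro C_rules)+

lemma dH3: "(\<Sum>j<nd P. fxo (up P j) w * fox (rh P j) x) = ft (el P x w)"
proof (rule eqI)
  fix u v
  have "ap (\<Sum>j<nd P. fxo (up P j) w * fox (rh P j) x) (D u v) =
    (\<Sum>j<nd P. \<Sum>k<nd P. \<Sum>i<nc P. D ((xo (up P j) (om P i) * ox (rh P j) (up P k)) * u) (xo (xi P i) w * (ox (rh P k) x * v)))"
    by (simp add: ap_simps mult.assoc)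
  also have "\<dots> = (\<Sum>k<nd P. \<Sum>i<nc P. D (t (el P (up P k) (om P i)) * u) (xo (xi P i) w * (ox (rh P k) x * v)))"
    by (subst sum_rotate3) (simp only: H3 D_suml[symmetric] sum_distrib_right[symmetric])
  also have "\<dots> = D u (t (el P x w) * v)"
    unfolding xo_cor by (simp only: D_sumr[symmetric] H_sum)
  finally show "ap (\<Sum>j<nd P. fxo (up P j) w * fox (rh P j) x) (D u v) = ap (ft (el P x w)) (D u v)"
    by (simp add: ap_simps)
qed (intro C_rules)+

lemma dH4: "(\<Sum>i<nc P. fox w (xi P i) * fxo x (om P i)) = fs (er P w x)"
proof (rule eqI)
  fix u v
  have "ap (\<Sum>i<nc P. fox w (xi P i) * fxo x (om P i)) (D u v) =
    (\<Sum>i<nc P. \<Sum>k<nc P. \<Sum>j<nd P. D (ox w (up P j) * (xo x (om P k) * u)) (ox (rh P j) (xi P i) * (xo (xi P k) (om P i) * v)))"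
    by (simp add: ap_simps)
  also have "\<dots> = (\<Sum>k<nc P. \<Sum>j<nd P. D (ox w (up P j) * (xo x (om P k) * u)) (s (er P (rh P j) (xi P k)) * v))"
    by (subst sum_rotate3) (simp only: H_sum D_sumr[symmetric])
  also have "\<dots> = D (s (er P w x) * u) v"
    unfolding ox_col by (simp only: D_suml[symmetric] H_sum)
  finally show "ap (\<Sum>i<nc P. fox w (xi P i) * fxo x (om P i)) (D u v) = ap (fs (er P w x)) (D u v)"
    by (simp add: ap_simps)
qed (intro C_rules)+

lemma delta_hst: "hst mu one P fs ft fxo fox"
proof (unfold_locales, goal_cases)
  case 5 thus ?case by (rule eqI) (simp_all add: C_rules ap_simps D_unitl D_unitr s_one[symmetric])
qed (rule dH1 dH2 dH3 dH4 | (rule eqI, simp_all only: C_rules, simp add: ap_simps s_add t_add s_mu t_mu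
   xo_addl xo_addr ox_addl ox_addr D_addl D_addr mult.assoc
   distrib_left distrib_right sum.distrib H_assoc H_assoc'))+

text \<open>The other half of the inversion: b_+(1) \<diamondop> b_+(2) b_- = b \<diamondop> 1 for b
  = \<open>(x, w)\<close>.\<close>

lemma trans_fxo: "(\<Sum>j<nd P. ap (fxo x (rh P j)) (D u (ox w (up P j) * v))) = D (xo x w * u) v"
  by (simp only: ap_fxo) (subst sum.swap, simp only: D_sumr[symmetric] H_sum xo_col)

lemma trans_fox: "(\<Sum>i<nc P. ap (fox w (xi P i)) (D u (xo x (om P i) * v))) = D (ox w x * u) v"
  by (simp only: ap_fox) (subst sum.swap, simp only: D_sumr[symmetric] H_sum ox_col)

end

locale delta = dx mu one P1 P2 d0 d1 wg s t xo1 ox1 xo2 ox2 vf +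
  G1: delta_h mu one P1 s t xo1 ox1 D ap C fs ft fxo1 fox1 +
  G2: delta_h mu one P2 s t xo2 ox2 D ap C fs ft fxo2 fox2
  for mu :: "'a::ab_group_add \<Rightarrow> 'a \<Rightarrow> 'a" and one :: 'a
    and P1 :: "('a, 'm::ab_group_add, 'x::ab_group_add) dual_data"
    and P2 :: "('a, 'n::ab_group_add, 'y::ab_group_add) dual_data"
    and d0 :: "'a \<Rightarrow> 'm" and d1 :: "'m \<Rightarrow> 'n" and wg :: "'m \<Rightarrow> 'm \<Rightarrow> 'n"
    and s t :: "'a \<Rightarrow> 'r::ring"
    and xo1 :: "'x \<Rightarrow> 'm \<Rightarrow> 'r" and ox1 :: "'m \<Rightarrow> 'x \<Rightarrow> 'r"
    and xo2 :: "'y \<Rightarrow> 'n \<Rightarrow> 'r" and ox2 :: "'n \<Rightarrow> 'y \<Rightarrow> 'r" and vf :: "'x \<Rightarrow> 'r"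
    and D :: "'r \<Rightarrow> 'r \<Rightarrow> 'w::ab_group_add" and ap :: "'o::ring \<Rightarrow> 'w \<Rightarrow> 'w" and C :: "'o set"
    and fs ft :: "'a \<Rightarrow> 'o" and fxo1 :: "'x \<Rightarrow> 'm \<Rightarrow> 'o" and fox1 :: "'m \<Rightarrow> 'x \<Rightarrow> 'o"
    and fxo2 :: "'y \<Rightarrow> 'n \<Rightarrow> 'o" and fox2 :: "'n \<Rightarrow> 'y \<Rightarrow> 'o" +
  fixes fvf :: "'x \<Rightarrow> 'o"
  assumes C_fvf: "fvf x \<in> C"
    and ap_fvf: "ap (fvf x) (D u v) = D (vf x * u) v + (\<Sum>i<nc P1. D (xo1 x (om P1 i) * u) (vf (xi P1 i) * v))"
begin

lemmas C_rules = G1.C_rules G2.C_gens C_fvf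
lemmas ap_simps = G1.ap_simps G2.ap_fxo G2.ap_fox ap_fvf
lemmas D_simps = G1.D_addl G1.D_addr G1.D_diffl G1.D_diffr

lemma xo_col2: "(\<Sum>m<nc P2. \<Sum>q\<in>A. D (xo2 z (om P2 m) * u) (s (el P2 (xi P2 m) (\<theta> q)) * F q)) = (\<Sum>q\<in>A. D (xo2 z (\<theta> q) * u) (F q))"
  by (subst sum.swap) (simp only: G2.xo_col)

lemma xo_col3: "(\<Sum>m<nc P2. \<Sum>p\<in>A. \<Sum>q\<in>B. D (xo2 z (om P2 m) * u) (s (el P2 (xi P2 m) (\<theta> p q)) * F p q)) =
   (\<Sum>p\<in>A. \<Sum>q\<in>B. D (xo2 z (\<theta> p q) * u) (F p q))"
  by (subst sum_rotate3) (simp only: G2.xo_col)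

lemma D3': "(\<Sum>i<nc P1. \<Sum>j<nc P1. s (el P2 z (wg (om P1 i) (om P1 j))) *
        (xo1 (xi P1 j) v * (xo1 (xi P1 i) w * c))) = xo2 z (wg w v) * c"
  by (simp add: D3[symmetric] sum_distrib_right mult.assoc)

lemma dD3: "(\<Sum>i<nc P1. \<Sum>j<nc P1. fs (el P2 z (wg (om P1 i) (om P1 j))) *
        (fxo1 (xi P1 j) v * fxo1 (xi P1 i) w)) = fxo2 z (wg w v)" (is "?X = ?Y")
proof (rule G1.eqI)
  fix u y
  have "ap ?X (D u y) =
    (\<Sum>i<nc P1. \<Sum>j<nc P1. \<Sum>q<nc P1. \<Sum>p<nc P1. D ((s (el P2 z (wg (om P1 i) (om P1 j))) *
       (xo1 (xi P1 j) (om P1 p) * xo1 (xi P1 i) (om P1 q))) * u) (xo1 (xi P1 p) v * (xo1 (xi P1 q) w * y)))"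
    by (simp add: ap_simps mult.assoc)
  also have "\<dots> = (\<Sum>q<nc P1. \<Sum>p<nc P1. D (xo2 z (wg (om P1 q) (om P1 p)) * u) (xo1 (xi P1 p) v * (xo1 (xi P1 q) w * y)))"
    by (subst sum_rotate4) (simp only: G1.D_suml[symmetric] sum_distrib_right[symmetric] D3)
  also have "\<dots> = ap ?Y (D u y)"
    by (simp only: ap_simps D3'[symmetric] G1.D_sumr xo_col3)
  finally show "ap ?X (D u y) = ap ?Y (D u y)" .
qed (intro C_rules)+

text \<open>\<open>D4\<close> is used in the second factor and, after \<open>ox2\<close> has been
  split by a dual basis, again in the first. In contrast to \<open>gD4\<close>, all coefficients
  stay in the bases \<open>rh\<close>, \<open>up\<close>.\<close>

lemma dD4: "(\<Sum>i<nd P1. \<Sum>j<nd P1. ft (er P2 (wg (rh P1 i) (rh P1 j)) z) *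
        (fox1 w (up P1 i) * fox1 v (up P1 j))) = fox2 (wg w v) z" (is "?X = ?Y")
proof (rule G1.eqI)
  fix u y
  have "ap ?X (D u y) = (\<Sum>i<nd P1. \<Sum>j<nd P1. \<Sum>q<nd P1. \<Sum>p<nd P1. D (ox1 w (up P1 p) * (ox1 v (up P1 q) * u))
     ((t (er P2 (wg (rh P1 i) (rh P1 j)) z) * (ox1 (rh P1 p) (up P1 i) * ox1 (rh P1 q) (up P1 j))) * y))"
    by (simp add: ap_simps mult.assoc)
  also have "\<dots> = (\<Sum>q<nd P1. \<Sum>p<nd P1. D (ox1 w (up P1 p) * (ox1 v (up P1 q) * u)) (ox2 (wg (rh P1 p) (rh P1 q)) z * y))"
    by (subst sum_rotate4) (simp only: G1.D_sumr[symmetric] sum_distrib_right[symmetric] D4)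
  also have "\<dots> = (\<Sum>m<nd P2. \<Sum>p<nd P1. \<Sum>q<nd P1. D ((t (er P2 (wg (rh P1 p) (rh P1 q)) (up P2 m)) *
      (ox1 w (up P1 p) * ox1 v (up P1 q))) * u) (ox2 (rh P2 m) z * y))"
    by (subst sum_rotate3, subst sum.swap) (simp only: mult.assoc G2.ox_cor)
  also have "\<dots> = ap ?Y (D u y)"
    by (simp only: ap_simps G1.D_suml[symmetric] sum_distrib_right[symmetric] D4)
  finally show "ap ?X (D u y) = ap ?Y (D u y)" .
qed (intro C_rules)+

text \<open>The coproduct of \<open>(z, d1 w)\<close> has \<open>xo2 (xi P2 m) (d1 w)\<close> as its
  second leg. Solving \<open>D2\<close> for it gives scalar coefficients, which contract into
  \<open>xo2\<close> in the first factor.\<close>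

lemma D2_expand: "(\<Sum>m<nc P2. D (xo2 z (om P2 m) * u) (xo2 (xi P2 m) (d1 w) * y)) =
   (\<Sum>q<nc P1. D (xo2 z (d1 (om P1 q)) * u) (xo1 (xi P1 q) w * y)) -
   (\<Sum>q<nc P1. \<Sum>p<nc P1. D (xo2 z (wg (om P1 q) (om P1 p)) * u) ((vf (xi P1 p) * xo1 (xi P1 q) w + xo1 (xi P1 p) w * vf (xi P1 q)) * y))"
proof -
  have "xo2 \<zeta> (d1 w) = (\<Sum>i<nc P1. s (el P2 \<zeta> (d1 (om P1 i))) * xo1 (xi P1 i) w) -
     (\<Sum>i<nc P1. \<Sum>j<nc P1. s (el P2 \<zeta> (wg (om P1 i) (om P1 j))) *
        (vf (xi P1 j) * xo1 (xi P1 i) w + xo1 (xi P1 j) w * vf (xi P1 i)))" for \<zeta>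
    unfolding D2 by simp
  thus ?thesis
    by (simp only: left_diff_distrib sum_distrib_right mult.assoc G1.D_diffr G1.D_sumr sum_subtractf xo_col2 xo_col3)
qed

lemma dD2: "(\<Sum>i<nc P1. \<Sum>j<nc P1. fs (el P2 z (wg (om P1 i) (om P1 j))) *
        (fvf (xi P1 j) * fxo1 (xi P1 i) w + fxo1 (xi P1 j) w * fvf (xi P1 i))) =
      (\<Sum>i<nc P1. fs (el P2 z (d1 (om P1 i))) * fxo1 (xi P1 i) w) - fxo2 z (d1 w)"
  (is "?X = ?Y")
proof (rule G1.eqI)
  fix u y
  let ?c = "\<lambda>i j. s (el P2 z (wg (om P1 i) (om P1 j)))"
  have X1: "(\<Sum>i<nc P1. \<Sum>j<nc P1. \<Sum>q<nc P1. D (?c i j * (vf (xi P1 j) * xo1 (xi P1 i) (om P1 q) +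
        xo1 (xi P1 j) (om P1 q) * vf (xi P1 i)) * u) (F q)) =
       (\<Sum>q<nc P1. D (((\<Sum>i<nc P1. s (el P2 z (d1 (om P1 i))) * xo1 (xi P1 i) (om P1 q)) - xo2 z (d1 (om P1 q))) * u) (F q))" for F
    by (subst sum_rotate3[symmetric]) (simp only: G1.D_suml[symmetric] sum_distrib_right[symmetric] D2)
  have X2: "(\<Sum>i<nc P1. \<Sum>j<nc P1. \<Sum>q<nc P1. \<Sum>p<nc P1. D (?c i j * (xo1 (xi P1 j) (om P1 p) * xo1 (xi P1 i) (om P1 q)) * u) (F q p)) =
       (\<Sum>q<nc P1. \<Sum>p<nc P1. D (xo2 z (wg (om P1 q) (om P1 p)) * u) (F q p))" for F
    by (subst sum_rotate4) (simp only: G1.D_suml[symmetric] sum_distrib_right[symmetric] D3)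
  have "ap ?X (D u y) = (\<Sum>i<nc P1. \<Sum>j<nc P1. \<Sum>q<nc P1. D (?c i j * (vf (xi P1 j) * xo1 (xi P1 i) (om P1 q) +
        xo1 (xi P1 j) (om P1 q) * vf (xi P1 i)) * u) (xo1 (xi P1 q) w * y)) +
     (\<Sum>i<nc P1. \<Sum>j<nc P1. \<Sum>q<nc P1. \<Sum>p<nc P1. D (?c i j * (xo1 (xi P1 j) (om P1 p) * xo1 (xi P1 i) (om P1 q)) * u)
        ((vf (xi P1 p) * xo1 (xi P1 q) w + xo1 (xi P1 p) w * vf (xi P1 q)) * y))"
    by (simp add: ap_simps mult.assoc distrib_left distrib_right D_simps sum.distrib algebra_simps)
  also have "\<dots> = ap ?Y (D u y)"
    unfolding X1 X2
    by (simp only: ap_simps D2_expand left_diff_distrib D_simps sum_subtractf sum_distrib_right G1.D_suml mult.assoc)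
       (subst (2) sum.swap, simp)
  finally show "ap ?X (D u y) = ap ?Y (D u y)" .
qed (intro C_rules)+

text \<open>\<open>D1\<close> in the second factor, after its scalar coefficients have been
  contracted into \<open>xo2\<close> in the first.\<close>

lemma D1_expand: "(\<Sum>q<nc P1. D (xo2 z (d1 (om P1 q)) * u) (vf (xi P1 q) * y)) =
   (\<Sum>q<nc P1. \<Sum>p<nc P1. D (xo2 z (wg (om P1 q) (om P1 p)) * u) (vf (xi P1 p) * (vf (xi P1 q) * y)))"
proof -
  have "(\<Sum>m<nc P2. D (xo2 z (om P2 m) * u) ((\<Sum>q<nc P1. s (el P2 (xi P2 m) (d1 (om P1 q))) * vf (xi P1 q)) * y)) =
    (\<Sum>m<nc P2. D (xo2 z (om P2 m) * u) ((\<Sum>q<nc P1. \<Sum>p<nc P1. s (el P2 (xi P2 m) (wg (om P1 q) (om P1 p))) *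
      (vf (xi P1 p) * vf (xi P1 q))) * y))"
    by (simp only: D1)
  thus ?thesis
    by (simp only: sum_distrib_right mult.assoc G1.D_sumr xo_col2 xo_col3)
qed

text \<open>The terms of the product are sorted by the number of vector fields in the first factor:
  two, one and none. \<open>D1\<close>, \<open>D2\<close> and \<open>D3\<close> apply there, and the
  surplus of \<open>D2\<close> cancels against the last group by \<open>D1_expand\<close>.\<close>

lemma dD1: "(\<Sum>i<nc P1. fs (el P2 z (d1 (om P1 i))) * fvf (xi P1 i)) =
      (\<Sum>i<nc P1. \<Sum>j<nc P1. fs (el P2 z (wg (om P1 i) (om P1 j))) * (fvf (xi P1 j) * fvf (xi P1 i)))"
  (is "?X = ?Y")
proof (rule G1.eqI)
  fix u y
  let ?c = "\<lambda>i j. s (el P2 z (wg (om P1 i) (om P1 j)))"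
  have X0: "(\<Sum>i<nc P1. \<Sum>j<nc P1. D (?c i j * (vf (xi P1 j) * vf (xi P1 i)) * u) y) =
      (\<Sum>i<nc P1. D (s (el P2 z (d1 (om P1 i))) * vf (xi P1 i) * u) y)"
    by (simp only: G1.D_suml[symmetric] sum_distrib_right[symmetric] D1)
  have X1: "(\<Sum>i<nc P1. \<Sum>j<nc P1. \<Sum>q<nc P1. D (?c i j * (vf (xi P1 j) * xo1 (xi P1 i) (om P1 q) +
        xo1 (xi P1 j) (om P1 q) * vf (xi P1 i)) * u) (F q)) =
       (\<Sum>q<nc P1. D (((\<Sum>i<nc P1. s (el P2 z (d1 (om P1 i))) * xo1 (xi P1 i) (om P1 q)) - xo2 z (d1 (om P1 q))) * u) (F q))" for F
    by (subst sum_rotate3[symmetric]) (simp only: G1.D_suml[symmetric] sum_distrib_right[symmetric] D2)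
  have X2: "(\<Sum>i<nc P1. \<Sum>j<nc P1. \<Sum>q<nc P1. \<Sum>p<nc P1. D (?c i j * (xo1 (xi P1 j) (om P1 p) * xo1 (xi P1 i) (om P1 q)) * u) (F q p)) =
       (\<Sum>q<nc P1. \<Sum>p<nc P1. D (xo2 z (wg (om P1 q) (om P1 p)) * u) (F q p))" for F
    by (subst sum_rotate4) (simp only: G1.D_suml[symmetric] sum_distrib_right[symmetric] D3)
  have "ap ?Y (D u y) = (\<Sum>i<nc P1. \<Sum>j<nc P1. D (?c i j * (vf (xi P1 j) * vf (xi P1 i)) * u) y) +
     (\<Sum>i<nc P1. \<Sum>j<nc P1. \<Sum>q<nc P1. D (?c i j * (vf (xi P1 j) * xo1 (xi P1 i) (om P1 q) +
        xo1 (xi P1 j) (om P1 q) * vf (xi P1 i)) * u) (vf (xi P1 q) * y)) +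
     (\<Sum>i<nc P1. \<Sum>j<nc P1. \<Sum>q<nc P1. \<Sum>p<nc P1. D (?c i j * (xo1 (xi P1 j) (om P1 p) * xo1 (xi P1 i) (om P1 q)) * u)
        (vf (xi P1 p) * (vf (xi P1 q) * y)))"
    by (simp add: ap_simps mult.assoc distrib_left distrib_right D_simps sum.distrib algebra_simps)
  also have "\<dots> = ap ?X (D u y)"
    unfolding X0 X1 X2 D1_expand[symmetric]
    by (simp only: ap_simps left_diff_distrib D_simps sum_subtractf sum_distrib_right G1.D_suml mult.assoc sum.distrib)
       (subst (2) sum.swap, simp)
  finally show "ap ?X (D u y) = ap ?Y (D u y)" by simp
qed (intro C_rules)+

lemma delta_dx: "dx mu one P1 P2 d0 d1 wg fs ft fxo1 fox1 fxo2 fox2 fvf"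
proof -
  interpret I1: hst mu one P1 fs ft fxo1 fox1 by (rule G1.delta_hst)
  interpret I2: hst mu one P2 fs ft fxo2 fox2 by (rule G2.delta_hst)
  show ?thesis
    by unfold_locales
     (rule dD1 dD2 dD3 dD4 | (rule G1.eqI, simp_all only: C_rules, simp add: ap_simps vf_add svf vfs vft vf_rules' K1.xo_addl
       distrib_left distrib_right D_simps sum.distrib mult.assoc K1.H_assoc K1.H_assoc' algebra_simps))+
qed

text \<open>By \<open>vf_vfr\<close> the subtracted sum is the part of the coproduct of
  \<open>x\<close> that has the vector field in the second factor.\<close>

lemma trans_fvf: "ap (fvf x) (D u v) - (\<Sum>j<nd P1. ap (fxo1 x (rh P1 j)) (D u (vfr (up P1 j) * v))) = D (vf x * u) v"
proof -
  have "(\<Sum>j<nd P1. ap (fxo1 x (rh P1 j)) (D u (vfr (up P1 j) * v))) =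
    (\<Sum>i<nc P1. D (xo1 x (om P1 i) * u) ((\<Sum>j<nd P1. xo1 (xi P1 i) (rh P1 j) * vfr (up P1 j)) * v))"
    by (simp only: G1.ap_fxo) (subst sum.swap, simp only: G1.D_sumr sum_distrib_right mult.assoc)
  thus ?thesis by (simp add: ap_fvf vf_vfr)
qed

text \<open>The coproduct of \<open>vfr y\<close> is that of a vector field with the two factors
  exchanged, as the mirror image requires.\<close>

lemma ap_fvfr: "(\<Sum>l<nc P1. ap (fox1 (om P1 l) y) (ap (fvf (xi P1 l)) (D u v))) =
   D u (vfr y * v) + (\<Sum>j<nd P1. D (vfr (up P1 j) * u) (ox1 (rh P1 j) y * v))"
proof -
  have "(\<Sum>l<nc P1. ap (fox1 (om P1 l) y) (ap (fvf (xi P1 l)) (D u v))) =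
    (\<Sum>l<nc P1. \<Sum>j<nd P1. D (ox1 (om P1 l) (up P1 j) * (vf (xi P1 l) * u)) (ox1 (rh P1 j) y * v)) +
    (\<Sum>l<nc P1. \<Sum>i<nc P1. \<Sum>j<nd P1. D (ox1 (om P1 l) (up P1 j) * (xo1 (xi P1 l) (om P1 i) * u)) (ox1 (rh P1 j) y * (vf (xi P1 i) * v)))"
    by (simp add: ap_simps sum.distrib)
  also have "(\<Sum>l<nc P1. \<Sum>j<nd P1. D (ox1 (om P1 l) (up P1 j) * (vf (xi P1 l) * u)) (ox1 (rh P1 j) y * v)) =
    (\<Sum>j<nd P1. D (vfr (up P1 j) * u) (ox1 (rh P1 j) y * v))"
    by (subst sum.swap) (simp add: vfr_def sum_distrib_right G1.D_suml mult.assoc)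
  also have "(\<Sum>l<nc P1. \<Sum>i<nc P1. \<Sum>j<nd P1. D (ox1 (om P1 l) (up P1 j) * (xo1 (xi P1 l) (om P1 i) * u)) (ox1 (rh P1 j) y * (vf (xi P1 i) * v))) =
    (\<Sum>i<nc P1. \<Sum>j<nd P1. D (t (er P1 (om P1 i) (up P1 j)) * u) (ox1 (rh P1 j) y * (vf (xi P1 i) * v)))"
    by (subst sum_rotate3) (simp only: G1.D_suml[symmetric] K1.H_sum)
  also have "\<dots> = D u (vfr y * v)"
    by (simp only: G1.ox_cor) (simp add: vfr_def sum_distrib_right G1.D_sumr mult.assoc)
  finally show ?thesis by simp
qed

end

section \<open>The Takeuchi condition for vector fields\<close>

locale del = dx mu one P1 P2 d0 d1 wg s t xo1 ox1 xo2 ox2 vf + G1: del_h mu one P1 s t xo1 ox1 D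
  for mu :: "'a::ab_group_add \<Rightarrow> 'a \<Rightarrow> 'a" and one :: 'a
    and P1 :: "('a, 'm::ab_group_add, 'x::ab_group_add) dual_data"
    and P2 :: "('a, 'n::ab_group_add, 'y::ab_group_add) dual_data"
    and d0 :: "'a \<Rightarrow> 'm" and d1 :: "'m \<Rightarrow> 'n" and wg :: "'m \<Rightarrow> 'm \<Rightarrow> 'n"
    and s t :: "'a \<Rightarrow> 'r::ring"
    and xo1 :: "'x \<Rightarrow> 'm \<Rightarrow> 'r" and ox1 :: "'m \<Rightarrow> 'x \<Rightarrow> 'r"
    and xo2 :: "'y \<Rightarrow> 'n \<Rightarrow> 'r" and ox2 :: "'n \<Rightarrow> 'y \<Rightarrow> 'r" and vf :: "'x \<Rightarrow> 'r"
    and D :: "'r \<Rightarrow> 'r \<Rightarrow> 'w::ab_group_add"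
begin

text \<open>Commuting \<open>vf\<close> past \<open>t r\<close> on one side and past
  \<open>s r\<close> on the other produces the same term with \<open>d0 r\<close>, so the two
  deviations from linearity compensate each other.\<close>

lemma takeuchi_dvf:
  "D (vf x * (t r * u)) v + (\<Sum>i<nc P1. D (xo1 x (om P1 i) * (t r * u)) (vf (xi P1 i) * v)) =
   D (vf x * u) (s r * v) + (\<Sum>i<nc P1. D (xo1 x (om P1 i) * u) (vf (xi P1 i) * (s r * v)))"
proof -
  have "(\<Sum>i<nc P1. D (xo1 x (lO P1 r (om P1 i)) * u) (vf (xi P1 i) * v)) =
    (\<Sum>i<nc P1. D (xo1 x (om P1 i) * u) (vf (rX P1 (xi P1 i) r) * v))"
    by (rule A1.central[of "\<lambda>w' x'. D (xo1 x w' * u) (vf x' * v)" r])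
      (simp_all add: K1.xo_addr vf_add G1.D_addl G1.D_addr distrib_right G1.xo_dbal vf_rules')
  thus ?thesis
    by (simp add: vf_rules' K1.H_assoc' G1.D_addl G1.D_addr sum.distrib G1.xo_col G1.D_bal)
qed

end

locale bal = R: dx mu one P1 P2 d0 d1 wg s t xo1 ox1 xo2 ox2 vf + L: dx mu one P1 P2 d0 d1 wg s' t' xo1' ox1' xo2' ox2' vf' +
  G1: bal_h mu one P1 s t xo1 ox1 s' t' xo1' ox1' T
  for mu :: "'a::ab_group_add \<Rightarrow> 'a \<Rightarrow> 'a" and one :: 'a
    and P1 :: "('a, 'm::ab_group_add, 'x::ab_group_add) dual_data"
    and P2 :: "('a, 'n::ab_group_add, 'y::ab_group_add) dual_data"
    and d0 :: "'a \<Rightarrow> 'm" and d1 :: "'m \<Rightarrow> 'n" and wg :: "'m \<Rightarrow> 'm \<Rightarrow> 'n"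
    and s t :: "'a \<Rightarrow> 'r::ring"
    and xo1 :: "'x \<Rightarrow> 'm \<Rightarrow> 'r" and ox1 :: "'m \<Rightarrow> 'x \<Rightarrow> 'r"
    and xo2 :: "'y \<Rightarrow> 'n \<Rightarrow> 'r" and ox2 :: "'n \<Rightarrow> 'y \<Rightarrow> 'r" and vf :: "'x \<Rightarrow> 'r"
    and s' t' :: "'a \<Rightarrow> 'q::ring"
    and xo1' :: "'x \<Rightarrow> 'm \<Rightarrow> 'q" and ox1' :: "'m \<Rightarrow> 'x \<Rightarrow> 'q"
    and xo2' :: "'y \<Rightarrow> 'n \<Rightarrow> 'q" and ox2' :: "'n \<Rightarrow> 'y \<Rightarrow> 'q" and vf' :: "'x \<Rightarrow> 'q"
    and T :: "'r \<Rightarrow> 'q \<Rightarrow> 'w::ab_group_add"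
begin

text \<open>The analogue of \<open>takeuchi_dvf\<close> for the translation map: \<open>vft\<close>
  in the first factor and \<open>vfr_t\<close> in the second produce the same term with
  \<open>d0 r\<close>.\<close>

lemma takeuchi_vf:
  "T (u * t r * vf x) v - (\<Sum>j<nd P1. T (u * t r * xo1 x (rh P1 j)) (L.vfr (up P1 j) * v)) =
   T (u * vf x) (t' r * v) - (\<Sum>j<nd P1. T (u * xo1 x (rh P1 j)) (L.vfr (up P1 j) * (t' r * v)))"
proof -
  have vfr_t: "L.vfr y * (t' a * c) = L.vfr (lX P1 a y) * c + t' (er P1 (d0 a) y) * c" for y a c
    by (simp add: mult.assoc[symmetric] L.vfr_t distrib_right)
  have 1: "(\<Sum>j<nd P1. T (u * xo1 x (rh P1 j)) (L.vfr (lX P1 r (up P1 j)) * v)) =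
   (\<Sum>j<nd P1. T (u * xo1 x (rO P1 (rh P1 j) r)) (L.vfr (up P1 j) * v))"
    by (rule R.A1.centralr[of "\<lambda>y \<rho>. T (u * xo1 x \<rho>) (L.vfr y * v)" r])
      (simp_all add: R.K1.xo_addr L.vfr_add distrib_left distrib_right G1.T_addl G1.T_addr G1.xo_bal mult.assoc[symmetric] L.t_vfr)
  have 2: "T (u * t r * vf x) v = T (u * vf x) (t' r * v) - T (u * xo1 x (d0 r)) v"
    by (simp add: G1.T_bal[symmetric] mult.assoc R.vft distrib_left G1.T_addl)
  show ?thesis
    by (simp add: 2 vfr_t G1.T_addr sum.distrib 1 G1.xo_push) (simp add: mult.assoc R.K1.txo)
qed

end

section \<open>Counit identities and the representation on \<open>A\<close>\<close>

context hst
begin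

text \<open>The counit identity on a generator with an element \<open>r\<close> inserted:
  \<epsilon>(b_(1) r) b_(2) = b r. The case \<open>r = one\<close> would not be enough for an
  induction over products.\<close>

lemma counit_left_xo: "(\<Sum>i<nc P. s (el P x (lO P r (om P i))) * xo (xi P i) w) = xo x w * s r"
  by (simp add: sxo xos el_bal[symmetric] collapseX(1)[of "\<lambda>x. xo x w"] xo_addl)

lemma counit_right_xo: "(\<Sum>i<nc P. t (el P (xi P i) (lO P r w)) * xo x (om P i)) = xo x w * t r"
  by (simp add: txo xot collapse(1)[of "xo x"] xo_addr)

lemma counit_left_ox: "(\<Sum>j<nd P. s (er P (rO P w r) (up P j)) * ox (rh P j) x) = ox w x * s r"
  by (simp add: sox oxs collapse(2)[of "\<lambda>w. ox w x"] ox_addl)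

lemma counit_right_ox: "(\<Sum>j<nd P. t (er P (rO P (rh P j) r) x) * ox w (up P j)) = ox w x * t r"
  by (simp add: tox oxt er_bal collapseX(2)[of "ox w"] ox_addr)

end

context dx
begin

lemma counit_left_vf: "s (el P1 x (d0 r)) + (\<Sum>i<nc P1. s (el P1 x (lO P1 r (om P1 i))) * vf (xi P1 i)) = vf x * s r"
  by (simp add: svf vfs A1.el_bal[symmetric] A1.collapseX(1)[of vf] vf_add)

lemma counit_right_vf: "t r * vf x + (\<Sum>i<nc P1. t (el P1 (xi P1 i) (d0 r)) * xo1 x (om P1 i)) = vf x * t r"
  by (simp add: K1.txo vft A1.collapse(1)[of "xo1 x"] K1.xo_addr)

end

text \<open>The counit as a representation: b sends \<open>r\<close> to \<epsilon>(b r). The map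
  \<open>E\<close> embeds \<open>A\<close> in the space on which the operators live.\<close>

locale counit_h = dual_pair mu one P
  for mu :: "'a::ab_group_add \<Rightarrow> 'a \<Rightarrow> 'a" and one :: 'a
    and P :: "('a, 'm::ab_group_add, 'x::ab_group_add) dual_data" +
  fixes E :: "'a \<Rightarrow> 'w::ab_group_add" and ap :: "'o::ring \<Rightarrow> 'w \<Rightarrow> 'w" and C :: "'o set"
    and es et :: "'a \<Rightarrow> 'o" and exo :: "'x \<Rightarrow> 'm \<Rightarrow> 'o" and eox :: "'m \<Rightarrow> 'x \<Rightarrow> 'o"
  assumes E_add: "E (a + b) = E a + E b"
    and ap_add: "ap (X + Y) p = ap X p + ap Y p" and ap_mult: "ap (X * Y) p = ap X (ap Y p)"
    and ap_addw: "ap X (p + q) = ap X p + ap X q"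
    and eqI: "X \<in> C \<Longrightarrow> Y \<in> C \<Longrightarrow> (\<And>r. ap X (E r) = ap Y (E r)) \<Longrightarrow> X = Y"
    and C_add: "X \<in> C \<Longrightarrow> Y \<in> C \<Longrightarrow> X + Y \<in> C" and C_minus: "X \<in> C \<Longrightarrow> - X \<in> C"
    and C_mult: "X \<in> C \<Longrightarrow> Y \<in> C \<Longrightarrow> X * Y \<in> C"
    and C_gens: "es a \<in> C" "et a \<in> C" "exo x w \<in> C" "eox w x \<in> C"
    and ap_es: "ap (es a) (E r) = E (mu a r)" and ap_et: "ap (et a) (E r) = E (mu r a)"
    and ap_exo: "ap (exo x w) (E r) = E (el P x (lO P r w))"
    and ap_eox: "ap (eox w x) (E r) = E (er P (rO P w r) x)"
begin

lemma C_zero: "0 \<in> C"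
  using C_add[OF C_gens(1)[of undefined] C_minus[OF C_gens(1)[of undefined]]] by simp

lemma C_sum: "(\<And>i. i \<in> I \<Longrightarrow> g i \<in> C) \<Longrightarrow> (\<Sum>i\<in>I. g i) \<in> C"
  by (induction I rule: infinite_finite_induct) (simp_all add: C_add C_zero)

lemma C_diff: "X \<in> C \<Longrightarrow> Y \<in> C \<Longrightarrow> X - Y \<in> C"
  using C_add[of X "- Y"] C_minus[of Y] by simp

lemmas C_rules = C_add C_minus C_mult C_gens C_sum C_diff

lemmas ap_sum = additive_sum[of "\<lambda>X. ap X p" for p, OF ap_add]
lemmas ap_sumw = additive_sum[of "ap X" for X, OF ap_addw]
lemmas ap_diff = additive_diff[of "\<lambda>X. ap X p" for p, OF ap_add]
lemmas E_sum = additive_sum[of E, OF E_add]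
lemmas E_diff = additive_diff[of E, OF E_add]
lemmas ap_simps = ap_add ap_mult ap_addw ap_sum ap_sumw ap_diff ap_es ap_et ap_exo ap_eox
  E_sum[symmetric] E_diff[symmetric] E_add[symmetric]

lemma counit_hst: "hst mu one P es et exo eox"
proof (unfold_locales, goal_cases)
  case 19
  show ?case by (rule eqI) (simp_all only: C_rules, simp add: ap_simps er_addl collapse(1)[of "\<lambda>v. er P v _"] er_lO)
next
  case 20
  show ?case by (rule eqI) (simp_all only: C_rules, simp add: ap_simps el_addr collapse(2)[of "\<lambda>v. el P _ v"] el_rO)
next
  case 21
  show ?case by (rule eqI) (simp_all only: C_rules, simp add: ap_simps el_bal[symmetric] er_bal el_addl collapseX(2)[of "\<lambda>x. el P x _"] el_lX)
next
  case 22
  show ?case by (rule eqI) (simp_all only: C_rules, simp add: ap_simps er_bal el_bal[symmetric] er_addr collapseX(1)[of "\<lambda>x. er P _ x"] er_rX)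
qed ((rule eqI, simp_all only: C_rules, simp add: ap_simps mu_addl mu_addr mu_assoc mu_onel mu_oner el_addl el_addr er_addl er_addr
   lO_addr rO_addl el_lX el_rO el_bal er_lO er_rX er_bal lO_mu rO_mu lX_mu rX_mu lrO[symmetric] lrX[symmetric])+)

end

locale counit = calc mu one P1 P2 d0 d1 wg +
  G1: counit_h mu one P1 E ap C es et exo1 eox1 + G2: counit_h mu one P2 E ap C es et exo2 eox2
  for mu :: "'a::ab_group_add \<Rightarrow> 'a \<Rightarrow> 'a" and one :: 'a
    and P1 :: "('a, 'm::ab_group_add, 'x::ab_group_add) dual_data"
    and P2 :: "('a, 'n::ab_group_add, 'y::ab_group_add) dual_data"
    and d0 :: "'a \<Rightarrow> 'm" and d1 :: "'m \<Rightarrow> 'n" and wg :: "'m \<Rightarrow> 'm \<Rightarrow> 'n"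
    and E :: "'a \<Rightarrow> 'w::ab_group_add" and ap :: "'o::ring \<Rightarrow> 'w \<Rightarrow> 'w" and C :: "'o set"
    and es et :: "'a \<Rightarrow> 'o" and exo1 :: "'x \<Rightarrow> 'm \<Rightarrow> 'o" and eox1 :: "'m \<Rightarrow> 'x \<Rightarrow> 'o"
    and exo2 :: "'y \<Rightarrow> 'n \<Rightarrow> 'o" and eox2 :: "'n \<Rightarrow> 'y \<Rightarrow> 'o" +
  fixes evf :: "'x \<Rightarrow> 'o"
  assumes C_evf: "evf x \<in> C"
    and ap_evf: "ap (evf x) (E r) = E (el P1 x (d0 r))"
begin

lemmas C_rules = G1.C_rules G2.C_gens C_evf
lemmas ap_simps = G1.ap_simps G2.ap_exo G2.ap_eox ap_evf

lemma wedge_collapse: "(\<Sum>j<nc P1. mu (el P2 z (wg v (om P1 j))) (el P1 (xi P1 j) \<theta>)) = el P2 z (wg v \<theta>)"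
  by (simp add: A2.el_rO[symmetric] wg_r[symmetric] A1.collapse(1)[of "\<lambda>u. el P2 z (wg v u)"] A2.el_addr wg_addr)

text \<open>Since \<open>d1\<close> is not right linear, contracting its values with the dual basis
  leaves the wedge term of \<open>d1_r\<close> behind.\<close>

lemma d1_collapse: "(\<Sum>i<nc P1. mu (el P2 z (d1 (om P1 i))) (el P1 (xi P1 i) \<theta>)) =
   el P2 z (d1 \<theta>) + (\<Sum>i<nc P1. el P2 z (wg (om P1 i) (d0 (el P1 (xi P1 i) \<theta>))))"
proof -
  have "(\<Sum>i<nc P1. mu (el P2 z (d1 (om P1 i))) (el P1 (xi P1 i) \<theta>)) =
    (\<Sum>i<nc P1. el P2 z (d1 (rO P1 (om P1 i) (el P1 (xi P1 i) \<theta>)) + wg (om P1 i) (d0 (el P1 (xi P1 i) \<theta>))))"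
    by (simp add: d1_r A2.el_rO)
  thus ?thesis
    by (simp add: A2.el_addr sum.distrib A1.collapse(1)[of "\<lambda>u. el P2 z (d1 u)"] d1_add)
qed

lemma wedge_left_collapse: "(\<Sum>i<nc P1. el P2 z (wg (om P1 i) (lO P1 (el P1 (xi P1 i) \<theta>) v))) = el P2 z (wg \<theta> v)"
  by (simp add: wg_bal[symmetric] A1.collapse(1)[of "\<lambda>u. el P2 z (wg u v)"] A2.el_addr wg_addl)

lemma eD4: "(\<Sum>i<nd P1. \<Sum>j<nd P1. et (er P2 (wg (rh P1 i) (rh P1 j)) z) *
        (eox1 w (up P1 i) * eox1 v (up P1 j))) = eox2 (wg w v) z" (is "?X = ?Y")
proof (rule G1.eqI)
  fix r
  let ?b = "\<lambda>j. er P1 (rO P1 v r) (up P1 j)"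
  have "ap ?X (E r) = E (\<Sum>i<nd P1. \<Sum>j<nd P1. mu (er P1 (rO P1 w (?b j)) (up P1 i)) (er P2 (wg (rh P1 i) (rh P1 j)) z))"
    by (simp add: ap_simps)
  also have "\<dots> = E (\<Sum>j<nd P1. \<Sum>i<nd P1. er P2 (wg (lO P1 (er P1 (rO P1 w (?b j)) (up P1 i)) (rh P1 i)) (rh P1 j)) z)"
    by (subst sum.swap) (simp add: A2.er_lO[symmetric] wg_l[symmetric])
  also have "\<dots> = E (\<Sum>j<nd P1. er P2 (wg w (lO P1 (?b j) (rh P1 j))) z)"
    by (simp add: A1.collapse(2)[of "\<lambda>u. er P2 (wg u _) z"] A2.er_addl wg_addl wg_bal)
  also have "\<dots> = ap ?Y (E r)"
    by (simp add: A1.collapse(2)[of "\<lambda>u. er P2 (wg w u) z"] A2.er_addl wg_addr ap_simps wg_r)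
  finally show "ap ?X (E r) = ap ?Y (E r)" .
qed (intro C_rules)+

lemma counit_dx: "dx mu one P1 P2 d0 d1 wg es et exo1 eox1 exo2 eox2 evf"
proof -
  interpret I1: hst mu one P1 es et exo1 eox1 by (rule G1.counit_hst)
  interpret I2: hst mu one P2 es et exo2 eox2 by (rule G2.counit_hst)
  show ?thesis
  proof (unfold_locales, goal_cases)
    \<comment> \<open>On \<open>A\<close> the first relation amounts to
      \<open>d1 (d0 r) = 0\<close>, the other terms being equal by \<open>wedge_collapse\<close> and
      \<open>d1_collapse\<close>.\<close>
    case (5 z)
    show ?case by (rule G1.eqI) (simp_all only: C_rules, simp add: ap_simps wedge_collapse d1_collapse d1_d0
      additive_zero[of "el P2 z", OF A2.el_addr])
  next
    case (6 z w)
    show ?case by (rule G1.eqI) (simp_all only: C_rules, simp add: ap_simps A1.mu_addr sum.distrib wedge_collapse d1_collapse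
      wedge_left_collapse d1_l A2.el_addr add.commute)
  next
    case (7 z v w)
    show ?case by (rule G1.eqI) (simp_all only: C_rules, simp add: ap_simps wedge_collapse wedge_left_collapse wg_l)
  next
    case 8
    show ?case by (rule eD4)
  qed (rule G1.eqI, simp_all only: C_rules, simp add: ap_simps A1.el_addl A1.el_addr A1.el_lX A1.el_rO A1.el_bal d0_mu add.commute)+
qed

end

section \<open>Vector spaces with a basis and free algebras\<close>

interpretation free_pair: vector_space_pair "cscale :: 'k::field \<Rightarrow> ('s \<Rightarrow>\<^sub>0 'k) \<Rightarrow> _" "cscale :: 'k::field \<Rightarrow> ('r \<Rightarrow>\<^sub>0 'k) \<Rightarrow> _" ..

lemmas cscale_simps [simp] = free_vs.scale_right_distrib free_vs.scale_left_distrib free_vs.scale_scale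
  free_vs.scale_one free_vs.scale_right_diff_distrib free_vs.scale_zero_right free_vs.scale_zero_left
  free_vs.scale_minus_right free_vs.scale_minus_left

definition klin :: "(('s \<Rightarrow>\<^sub>0 'k::field) \<Rightarrow> ('r \<Rightarrow>\<^sub>0 'k)) \<Rightarrow> bool" where
  "klin f \<longleftrightarrow> (\<forall>p q. f (p + q) = f p + f q) \<and> (\<forall>k p. f (cscale k p) = cscale k (f p))"

lemma klinI: "(\<And>p q. f (p + q) = f p + f q) \<Longrightarrow> (\<And>k p. f (cscale k p) = cscale k (f p)) \<Longrightarrow> klin f"
  by (simp add: klin_def)

lemma klin_add: "klin f \<Longrightarrow> f (p + q) = f p + f q"
  and klin_scale: "klin f \<Longrightarrow> f (cscale k p) = cscale k (f p)"
  by (simp_all add: klin_def)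

lemma klin_zero: "klin f \<Longrightarrow> f 0 = 0"
  by (rule additive_zero) (rule klin_add)

lemma klin_minus: "klin f \<Longrightarrow> f (- p) = - f p"
  by (rule additive_minus) (rule klin_add)

lemma klin_diff: "klin f \<Longrightarrow> f (p - q) = f p - f q"
  by (rule additive_diff) (rule klin_add)

lemma klin_sum: "klin f \<Longrightarrow> f (sum g A) = (\<Sum>i\<in>A. f (g i))"
  by (rule additive_sum) (rule klin_add)

lemma klin_sum_list: "klin f \<Longrightarrow> f (sum_list (map g xs)) = sum_list (map (\<lambda>x. f (g x)) xs)"
  by (induction xs) (simp_all add: klin_zero klin_add)

lemma klin_comp: "klin f \<Longrightarrow> klin g \<Longrightarrow> klin (\<lambda>p. f (g p))"
  by (simp add: klin_def)

lemma cscale_sum: "cscale k (sum g A) = (\<Sum>i\<in>A. cscale k (g i))"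
  by (rule additive_sum) simp

lemma single_eq_cscale: "Poly_Mapping.single s k = cscale k (pure s)"
  by (rule poly_mapping_eqI) (simp add: lookup_single when_def)

lemma pm_expand: "p = (\<Sum>s\<in>Poly_Mapping.keys p. cscale (Poly_Mapping.lookup p s) (pure s))"
proof (rule poly_mapping_eqI)
  fix u
  have "Poly_Mapping.lookup (\<Sum>s\<in>Poly_Mapping.keys p. cscale (Poly_Mapping.lookup p s) (pure s)) u =
    (\<Sum>s\<in>Poly_Mapping.keys p. if s = u then Poly_Mapping.lookup p s else 0)"
    unfolding lookup_sum by (intro sum.cong) (auto simp: lookup_single when_def)
  thus "Poly_Mapping.lookup p u = Poly_Mapping.lookup (\<Sum>s\<in>Poly_Mapping.keys p. cscale (Poly_Mapping.lookup p s) (pure s)) u"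
    by (simp add: in_keys_iff)
qed

lemma cscale_multl: "cscale k p * q = cscale k (p * q)" for p :: "'s::monoid_add \<Rightarrow>\<^sub>0 'k::field"
  by (simp add: cscale_def mult_map_scale_conv_mult mult.assoc)

lemma pm_induct [case_names zero pure add scale]:
  assumes "P 0" "\<And>s. P (pure s)" "\<And>p q. P p \<Longrightarrow> P q \<Longrightarrow> P (p + q)" "\<And>k p. P p \<Longrightarrow> P (cscale k p)"
  shows "P p"
proof -
  have "P (\<Sum>s\<in>A. cscale (Poly_Mapping.lookup p s) (pure s))" for A
    by (induction A rule: infinite_finite_induct) (simp_all add: assms)
  thus ?thesis by (subst pm_expand)
qed

lemma klin_eqI: "klin f \<Longrightarrow> klin g \<Longrightarrow> (\<And>s. f (pure s) = g (pure s)) \<Longrightarrow> f p = g p"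
  by (induction p rule: pm_induct) (simp_all add: klin_zero klin_add klin_scale)

text \<open>A scalar is a multiple of the unit, and that commutes with every basis element even if
  the monoid is not commutative.\<close>

lemma cscale_multr: "p * cscale k q = cscale k (p * q)" for p :: "'s::monoid_add \<Rightarrow>\<^sub>0 'k::field"
proof -
  have "p * Poly_Mapping.single 0 k = Poly_Mapping.single 0 k * p"
  proof (induction p rule: pm_induct)
    case (scale l p)
    have k: "Poly_Mapping.single 0 k * x = cscale k x" for x :: "'s \<Rightarrow>\<^sub>0 'k"
      by (simp add: cscale_def mult_map_scale_conv_mult)
    have "cscale l p * Poly_Mapping.single 0 k = cscale l (cscale k p)"
      using scale by (simp only: cscale_multl k)
    also have "\<dots> = cscale k (cscale l p)"
      by (simp only: free_vs.scale_scale mult.commute)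
    finally show ?case by (simp only: k)
  qed (simp_all add: mult_single distrib_left distrib_right)
  thus ?thesis
    by (simp add: cscale_def mult_map_scale_conv_mult mult.assoc[symmetric])
qed

definition lext :: "('s \<Rightarrow> ('r \<Rightarrow>\<^sub>0 'k::field)) \<Rightarrow> ('s \<Rightarrow>\<^sub>0 'k) \<Rightarrow> ('r \<Rightarrow>\<^sub>0 'k)" where
  "lext h p = (\<Sum>s\<in>Poly_Mapping.keys p. cscale (Poly_Mapping.lookup p s) (h s))"

lemma lext_superset:
  assumes "finite A" "Poly_Mapping.keys p \<subseteq> A"
  shows "lext h p = (\<Sum>s\<in>A. cscale (Poly_Mapping.lookup p s) (h s))"
  unfolding lext_def by (rule sum.mono_neutral_left) (use assms in \<open>auto simp: in_keys_iff\<close>)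

lemma klin_lext: "klin (lext h)"
proof (rule klinI)
  fix p q :: "'a \<Rightarrow>\<^sub>0 'b" and k
  let ?A = "Poly_Mapping.keys p \<union> Poly_Mapping.keys q"
  have "Poly_Mapping.keys (p + q) \<subseteq> ?A" by (rule Poly_Mapping.keys_add)
  thus "lext h (p + q) = lext h p + lext h q"
    by (simp add: lext_superset[of ?A] Poly_Mapping.lookup_add sum.distrib)
  have "Poly_Mapping.keys (cscale k p) \<subseteq> Poly_Mapping.keys p" by (auto simp: in_keys_iff)
  thus "lext h (cscale k p) = cscale k (lext h p)"
    by (simp add: lext_superset[of "Poly_Mapping.keys p"] cscale_sum)
qed

lemma lext_pure [simp]: "lext h (pure s) = h s"
  by (simp add: lext_def)

lemma pushforward_lext: "pushforward g = lext (\<lambda>s. pure (g s))"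
  by (rule ext) (simp add: pushforward_def lext_def single_eq_cscale[of _ "Poly_Mapping.lookup _ _"])

lemma klin_pushforward: "klin (pushforward g)"
  by (simp add: pushforward_lext klin_lext)

lemma pushforward_pure [simp]: "pushforward g (pure s) = pure (g s)"
  by (simp add: pushforward_lext)

lemma span_induct_klin:
  assumes "x \<in> free_vs.span S" "klin f" "free_vs.subspace M" "\<And>s. s \<in> S \<Longrightarrow> f s \<in> M"
  shows "f x \<in> M"
  using assms(1)
proof (induction rule: free_vs.span_induct_alt)
  case base
  show ?case using free_vs.subspace_0[OF assms(3)] klin_zero[OF assms(2)] by simp
next
  case (step c x y)
  show ?case
    using assms(4)[OF step(1)] step(2)
    by (simp add: klin_add[OF assms(2)] klin_scale[OF assms(2)] free_vs.subspace_add[OF assms(3)] free_vs.subspace_scale[OF assms(3)])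
qed

lemma span_zero_klin:
  assumes "x \<in> free_vs.span S" "klin f" "\<And>s. s \<in> S \<Longrightarrow> f s = 0"
  shows "f x = 0"
  using span_induct_klin[OF assms(1,2), of "{0}"] assms(3) by (simp add: free_vs.subspace_single_0)

text \<open>A linear idempotent with kernel \<open>N\<close>, which turns congruence modulo \<open>N\<close> into equality.\<close>

definition nf :: "('s \<Rightarrow>\<^sub>0 'k::field) set \<Rightarrow> ('s \<Rightarrow>\<^sub>0 'k) \<Rightarrow> ('s \<Rightarrow>\<^sub>0 'k)" where
  "nf N = (SOME f. klin f \<and> (\<forall>p. f p = 0 \<longleftrightarrow> p \<in> N) \<and> (\<forall>p. f (f p) = f p))"

text \<open>Take p - \<open>g p\<close> for a linear projection \<open>g\<close> onto
  \<open>N\<close>; such a projection comes from extending a basis of \<open>N\<close>.\<close>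

lemma nf_exists:
  fixes N :: "('s \<Rightarrow>\<^sub>0 'k::field) set"
  assumes "free_vs.subspace N"
  shows "\<exists>f. klin f \<and> (\<forall>p. f p = 0 \<longleftrightarrow> p \<in> N) \<and> (\<forall>p. f (f p) = f p)"
proof -
  have "Vector_Spaces.linear cscale cscale (\<lambda>p::'s \<Rightarrow>\<^sub>0 'k. p)"
    using free_vs.linear_id by (simp add: id_def)
  from free_pair.linear_exists_left_inverse_on[OF this assms] obtain g :: "('s \<Rightarrow>\<^sub>0 'k) \<Rightarrow> ('s \<Rightarrow>\<^sub>0 'k)"
    where g: "range g \<subseteq> N" "Vector_Spaces.linear cscale cscale g" "\<And>v. v \<in> N \<Longrightarrow> g v = v"
    by (metis inj_onI)
  have gl: "klin g"
    by (rule klinI) (simp_all add: free_pair.linear_add[OF g(2)] free_pair.linear_scale[OF g(2)])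
  have gN: "g p \<in> N" for p using g(1) by auto
  have "klin (\<lambda>p. p - g p)"
    by (rule klinI) (simp_all add: klin_add[OF gl] klin_scale[OF gl])
  moreover have "p - g p = 0 \<longleftrightarrow> p \<in> N" for p
    using g(3)[of p] gN[of p] by auto
  moreover have "(p - g p) - g (p - g p) = p - g p" for p
    by (simp add: klin_diff[OF gl] g(3) gN)
  ultimately show ?thesis by (intro exI[of _ "\<lambda>p. p - g p"]) auto
qed

lemma
  assumes "free_vs.subspace N"
  shows klin_nf: "klin (nf N)" and nf_zero_iff: "nf N p = 0 \<longleftrightarrow> p \<in> N" and nf_nf: "nf N (nf N p) = nf N p"
proof -
  have "klin (nf N) \<and> (\<forall>p. nf N p = 0 \<longleftrightarrow> p \<in> N) \<and> (\<forall>p. nf N (nf N p) = nf N p)"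
    unfolding nf_def by (rule someI_ex[OF nf_exists[OF assms]])
  thus "klin (nf N)" "nf N p = 0 \<longleftrightarrow> p \<in> N" "nf N (nf N p) = nf N p" by blast+
qed

lemma nf_eq_iff: "free_vs.subspace N \<Longrightarrow> nf N p = nf N q \<longleftrightarrow> p - q \<in> N"
  using nf_zero_iff[of N "p - q"] by (simp add: klin_diff[OF klin_nf])

lemma klin_nf_absorb:
  assumes "free_vs.subspace N" "klin f" "\<And>p. p \<in> N \<Longrightarrow> f p = 0"
  shows "f (nf N p) = f p"
proof -
  have "nf N p - p \<in> N" using nf_nf[OF assms(1)] nf_eq_iff[OF assms(1)] by blast
  thus ?thesis using assms(3) klin_diff[OF assms(2)] by fastforce
qed

section \<open>Rings of linear operators\<close>

typedef (overloaded) ('k::field, 's) lop = "{f :: ('s \<Rightarrow>\<^sub>0 'k) \<Rightarrow> ('s \<Rightarrow>\<^sub>0 'k). klin f}"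
  morphisms app Lop
  by (rule exI[of _ "\<lambda>p. 0"]) (simp add: klin_def)

setup_lifting type_definition_lop

text \<open>With operators as an instance of \<open>ring\<close>, the locales of relations apply to
  them directly.\<close>

instantiation lop :: (field, type) ring
begin

lift_definition zero_lop :: "('a, 'b) lop" is "\<lambda>p. 0" by (simp add: klin_def)
lift_definition plus_lop :: "('a, 'b) lop \<Rightarrow> ('a, 'b) lop \<Rightarrow> ('a, 'b) lop" is "\<lambda>f g p. f p + g p"
  by (simp add: klin_def)
lift_definition uminus_lop :: "('a, 'b) lop \<Rightarrow> ('a, 'b) lop" is "\<lambda>f p. - f p"
  by (simp add: klin_def)
lift_definition minus_lop :: "('a, 'b) lop \<Rightarrow> ('a, 'b) lop \<Rightarrow> ('a, 'b) lop" is "\<lambda>f g p. f p - g p"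
  by (simp add: klin_def)
lift_definition times_lop :: "('a, 'b) lop \<Rightarrow> ('a, 'b) lop \<Rightarrow> ('a, 'b) lop" is "\<lambda>f g p. f (g p)"
  by (simp add: klin_def)

instance
  by standard (transfer, auto simp: fun_eq_iff klin_def algebra_simps)+

end

lift_definition lop_scale :: "'k::field \<Rightarrow> ('k, 's) lop \<Rightarrow> ('k, 's) lop" is "\<lambda>k f p. cscale k (f p)"
  by (simp add: klin_def mult.commute)

lemma app_simps: "app 0 p = 0" "app (X + Y) p = app X p + app Y p" "app (- X) p = - app X p"
  "app (X - Y) p = app X p - app Y p" "app (X * Y) p = app X (app Y p)" "app (lop_scale k X) p = cscale k (app X p)"
  by (simp_all add: zero_lop.rep_eq plus_lop.rep_eq uminus_lop.rep_eq minus_lop.rep_eq times_lop.rep_eq lop_scale.rep_eq)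

lemma klin_app: "klin (app X)"
  using app[of X] by simp

lemma app_Lop: "klin f \<Longrightarrow> app (Lop f) = f"
  by (simp add: Lop_inverse)

lemma lop_eqI: "(\<And>p. app X p = app Y p) \<Longrightarrow> X = Y"
  by (simp add: app_inject[symmetric] fun_eq_iff)

text \<open>In the opposite ring the maps that reverse products, right multiplication and
  \<open>\<Gamma>\<close>, become homomorphisms.\<close>

datatype 'a opp = Opp (unop: 'a)

instantiation opp :: (ring) ring
begin

definition "0 = Opp 0"
definition "X + Y = Opp (unop X + unop Y)"
definition "- X = Opp (- unop X)"
definition "X - Y = Opp (unop X - unop Y)"
definition "X * Y = Opp (unop Y * unop X)"

instance
  by standard (simp_all add: zero_opp_def plus_opp_def uminus_opp_def minus_opp_def times_opp_def algebra_simps)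

end

lemma unop_simps: "unop 0 = 0" "unop (X + Y) = unop X + unop Y" "unop (- X) = - unop X"
  "unop (X - Y) = unop X - unop Y" "unop (X * Y) = unop Y * unop X"
  by (simp_all add: zero_opp_def plus_opp_def uminus_opp_def minus_opp_def times_opp_def)

section \<open>Homomorphisms out of a free algebra\<close>

locale kring =
  fixes sc :: "'k::field \<Rightarrow> 'q::ring \<Rightarrow> 'q"
  assumes sc_addl: "sc (k + l) a = sc k a + sc l a" and sc_addr: "sc k (a + b) = sc k a + sc k b"
    and sc_sc: "sc k (sc l a) = sc (k * l) a" and sc_one: "sc 1 a = a"
    and sc_multl: "sc k a * b = sc k (a * b)" and sc_multr: "a * sc k b = sc k (a * b)"

interpretation kl: kring lop_scale
  by unfold_locales (rule lop_eqI, simp add: app_simps klin_scale[OF klin_app] mult.commute)+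

interpretation ko: kring "\<lambda>k X. Opp (lop_scale k (unop X))"
  by unfold_locales (simp_all add: unop_simps plus_opp_def times_opp_def kl.sc_addl kl.sc_addr kl.sc_sc kl.sc_one kl.sc_multl kl.sc_multr)

text \<open>The unit \<open>e\<close> of the image need not be a unit of the ring \<open>'q\<close>.\<close>

locale free_lift = kring sc for sc :: "'k::field \<Rightarrow> 'q::ring \<Rightarrow> 'q" +
  fixes e :: 'q and G :: "'g \<Rightarrow> 'q"
  assumes eG: "e * G g = G g" and Ge: "G g * e = G g" and ee: "e * e = e"
begin

lemma sc_zerol: "sc 0 a = 0"
  using sc_addl[of 0 0 a] by simp

lemmas sc_sum = additive_sum[of "sc k" for k, OF sc_addr]

definition wlift :: "'g word \<Rightarrow> 'q" where
  "wlift w = foldr (\<lambda>g a. G g * a) (letters w) e"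

definition lift :: "('g word \<Rightarrow>\<^sub>0 'k) \<Rightarrow> 'q" where
  "lift f = (\<Sum>w\<in>Poly_Mapping.keys f. sc (Poly_Mapping.lookup f w) (wlift w))"

lemma e_wlift: "e * wlift w = wlift w"
  unfolding wlift_def by (cases "letters w") (simp_all add: ee mult.assoc[symmetric] eG)

lemma wlift_plus: "wlift (v + w) = wlift v * wlift w"
proof -
  have "foldr (\<lambda>g a. G g * a) (xs @ letters w) e = foldr (\<lambda>g a. G g * a) xs e * wlift w" for xs
    by (induction xs) (simp_all add: mult.assoc e_wlift, simp add: wlift_def)
  thus ?thesis by (simp add: wlift_def plus_word_def)
qed

lemma lift_superset:
  assumes "finite A" "Poly_Mapping.keys p \<subseteq> A"
  shows "lift p = (\<Sum>s\<in>A. sc (Poly_Mapping.lookup p s) (wlift s))"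
  unfolding lift_def by (rule sum.mono_neutral_left) (use assms in \<open>auto simp: in_keys_iff sc_zerol\<close>)

lemma lift_add: "lift (p + q) = lift p + lift q"
proof -
  let ?A = "Poly_Mapping.keys p \<union> Poly_Mapping.keys q"
  have "Poly_Mapping.keys (p + q) \<subseteq> ?A" by (rule Poly_Mapping.keys_add)
  thus ?thesis
    by (simp add: lift_superset[of ?A] Poly_Mapping.lookup_add sum.distrib sc_addl)
qed

lemma lift_cscale: "lift (cscale k p) = sc k (lift p)"
proof -
  have "Poly_Mapping.keys (cscale k p) \<subseteq> Poly_Mapping.keys p" by (auto simp: in_keys_iff)
  thus ?thesis
    by (simp add: lift_superset[of "Poly_Mapping.keys p"] sc_sum sc_sc)
qed

lemmas lift_zero = additive_zero[of lift, OF lift_add]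
lemmas lift_diff = additive_diff[of lift, OF lift_add]
lemmas lift_sum = additive_sum[of lift, OF lift_add]

lemma lift_pure: "lift (pure w) = wlift w"
  by (simp add: lift_def sc_one)

lemma lift_one: "lift 1 = e"
proof -
  have "lift 1 = lift (pure 0)" by (simp only: single_one)
  thus ?thesis by (simp only: lift_pure) (simp add: wlift_def zero_word_def)
qed

lemma lift_gen: "lift (gen g) = G g"
  by (simp add: gen_def lift_pure wlift_def Ge)

lemma lift_mult: "lift (p * q) = lift p * lift q"
proof (induction p rule: pm_induct)
  case (pure v)
  show ?case
  proof (induction q rule: pm_induct)
    case (pure w)
    show ?case by (simp add: mult_single lift_pure wlift_plus)
  next
    case (scale k q)
    thus ?case by (simp add: lift_cscale cscale_multr sc_multr)
  qed (simp_all add: lift_zero lift_add distrib_left)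
next
  case (scale k p)
  thus ?case by (simp add: lift_cscale cscale_multl sc_multl)
qed (simp_all add: lift_zero lift_add distrib_right)

end

section \<open>Quotients of a free algebra\<close>

lemma free_algebra_simps [simp]:
  "carrier free_algebra = UNIV" "mult free_algebra = (*)" "one free_algebra = 1" "zero free_algebra = 0"
  "add free_algebra = (+)" "smult free_algebra = cscale"
  by (simp_all add: free_algebra_def)

lemma ring_free_algebra: "ring (free_algebra :: ('k::field, 'g word \<Rightarrow>\<^sub>0 'k) module)"
proof (rule ringI)
  show "abelian_group (free_algebra :: ('k, 'g word \<Rightarrow>\<^sub>0 'k) module)"
  proof (rule abelian_groupI)
    fix x :: "'g word \<Rightarrow>\<^sub>0 'k"
    show "\<exists>y\<in>carrier free_algebra. y \<oplus>\<^bsub>free_algebra\<^esub> x = \<zero>\<^bsub>free_algebra\<^esub>"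
      by (intro bexI[of _ "- x"]) simp_all
  qed (simp_all add: algebra_simps)
  show "Group.monoid (free_algebra :: ('k, 'g word \<Rightarrow>\<^sub>0 'k) module)"
    by (rule monoidI) (simp_all add: algebra_simps)
qed (simp_all add: algebra_simps)

locale quotient_ideal =
  fixes I :: "('g word \<Rightarrow>\<^sub>0 'k::field) set"
  assumes ideal_I: "ideal I free_algebra"
begin

definition B :: "('k, ('g word \<Rightarrow>\<^sub>0 'k) set) module" where
  "B = quotient_algebra free_algebra I"

definition q :: "('g word \<Rightarrow>\<^sub>0 'k) \<Rightarrow> ('g word \<Rightarrow>\<^sub>0 'k) set" where
  "q f = I +>\<^bsub>free_algebra\<^esub> f"

interpretation I: ideal I free_algebra by (rule ideal_I)

lemma I_add: "f \<in> I \<Longrightarrow> g \<in> I \<Longrightarrow> f + g \<in> I"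
  using additive_subgroup.a_closed[OF I.is_additive_subgroup] by simp

lemma I_mult: "f \<in> I \<Longrightarrow> g * f \<in> I" "f \<in> I \<Longrightarrow> f * g \<in> I"
  using I.I_l_closed I.I_r_closed by simp_all

lemma I_zero: "0 \<in> I"
  using additive_subgroup.zero_closed[OF I.is_additive_subgroup] by simp

lemma I_scale: "f \<in> I \<Longrightarrow> cscale k f \<in> I"
  using I_mult(1)[of f "cscale k 1"] by (simp add: cscale_multl)

lemma I_minus: "f \<in> I \<Longrightarrow> - f \<in> I"
  using I_scale[of f "-1"] by simp

lemma I_diff: "f \<in> I \<Longrightarrow> g \<in> I \<Longrightarrow> f - g \<in> I"
  using I_add[OF _ I_minus, of f g] by simp

lemma subspace_I: "free_vs.subspace I"
  by (rule free_vs.subspaceI) (simp_all add: I_zero I_add I_scale)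

lemma q_alt: "q f = {h. h - f \<in> I}"
proof -
  have "q f = (\<Union>h\<in>I. {h + f})" by (simp add: q_def a_r_coset_def')
  also have "\<dots> = {h. h - f \<in> I}"
    by auto
  finally show ?thesis .
qed

lemma q_eq_iff: "q f = q g \<longleftrightarrow> f - g \<in> I"
proof
  assume "q f = q g"
  moreover have "f \<in> q f" by (simp add: q_alt I_zero)
  ultimately show "f - g \<in> I" by (simp add: q_alt)
next
  assume fg: "f - g \<in> I"
  have "h - f \<in> I \<longleftrightarrow> h - g \<in> I" for h
    using I_add[of "h - f" "f - g"] I_diff[of "h - g" "f - g"] fg by auto
  thus "q f = q g" by (simp add: q_alt)
qed

lemma q_nf: "q (nf I f) = q f"
  using nf_nf[OF subspace_I] by (simp add: q_eq_iff nf_eq_iff[OF subspace_I, symmetric])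

lemma B_simps: "carrier B = carrier (free_algebra Quot I)" "mult B = mult (free_algebra Quot I)"
  "one B = one (free_algebra Quot I)" "zero B = zero (free_algebra Quot I)" "add B = add (free_algebra Quot I)"
  "smult B k X = (\<Union>x\<in>X. q (cscale k x))"
  by (simp_all add: B_def quotient_algebra_def ring.extend_def module.fields_def q_def)

lemma carrier_B: "carrier B = range q"
  by (auto simp: B_simps FactRing_def A_RCOSETS_def' q_def)

lemma q_closed [simp]: "q f \<in> carrier B"
  by (simp add: carrier_B)

lemma q_mult: "mult B (q f) (q g) = q (f * g)"
  using I.rcoset_mult_add[of f g] by (simp add: B_simps FactRing_def q_def)

lemma q_add: "add B (q f) (q g) = q (f + g)"
  using I.a_rcos_sum[of f g] by (simp add: B_simps FactRing_def q_def)

lemma q_one: "one B = q 1"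
  by (simp add: B_simps FactRing_def q_def)

lemma q_zero: "zero B = q 0"
  by (simp add: B_simps FactRing_def q_alt)

lemma q_scale: "smult B k (q f) = q (cscale k f)"
proof -
  have "q (cscale k x) = q (cscale k f)" if "x \<in> q f" for x
    unfolding q_eq_iff using I_scale[of "x - f" k] that by (simp add: q_alt)
  moreover have "f \<in> q f" by (simp add: q_alt I_zero)
  ultimately show ?thesis unfolding B_simps by blast
qed

lemma ring_B: "ring B"
proof -
  have r: "ring (free_algebra Quot I)" by (rule I.quotient_is_ring)
  \<comment> \<open>The predicate \<open>ring\<close> depends on the ring fields alone, and these
    \<open>B\<close> shares with the factor ring.\<close>
  have "ring B = ring (free_algebra Quot I)"
    unfolding ring_def abelian_group_def abelian_monoid_def abelian_group_axioms_def monoid_def ring_axioms_def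
      comm_monoid_def comm_monoid_axioms_def comm_group_def group_def group_axioms_def Units_def
    by (simp add: B_simps)
  thus ?thesis using r by simp
qed

lemma record_k_algebra_B: "record_k_algebra B"
proof -
  interpret ring B by (rule ring_B)
  show ?thesis
    by unfold_locales (auto simp: carrier_B q_mult q_add q_scale cscale_multl cscale_multr)
qed

lemma q_sum: "finite A \<Longrightarrow> (\<Oplus>\<^bsub>B\<^esub>u\<in>A. q (h u)) = q (sum h A)"
proof -
  interpret ring B by (rule ring_B)
  show "finite A \<Longrightarrow> ?thesis"
    by (induction A rule: finite_induct) (simp_all add: q_zero q_add)
qed

definition rp :: "('g word \<Rightarrow>\<^sub>0 'k) set \<Rightarrow> ('g word \<Rightarrow>\<^sub>0 'k)" where
  "rp b = (SOME f. q f = b)"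

lemma q_rp: "b \<in> carrier B \<Longrightarrow> q (rp b) = b"
  unfolding rp_def carrier_B by (rule someI_ex) auto

lemma rp_q: "rp (q f) - f \<in> I"
  using q_rp[of "q f"] by (simp add: q_eq_iff)

end

section \<open>Balanced tensor products of a quotient of a free algebra\<close>

text \<open>A balanced tensor product through its universal property: \<open>D_ext\<close> gives
  existence and \<open>D_eq\<close> uniqueness of the linear map induced by a balanced bilinear one.
  A quadruple in \<open>RF\<close> identifies two tensors. The target is again \<open>'z\<close>, as
  all tensor products sit in the same vector space, and so induced maps are operators of type
  \<open>lop\<close>.\<close>

locale btensor =
  fixes I :: "('g word \<Rightarrow>\<^sub>0 'k::field) set"
    and RF :: "(('g word \<Rightarrow>\<^sub>0 'k) \<times> ('g word \<Rightarrow>\<^sub>0 'k) \<times> ('g word \<Rightarrow>\<^sub>0 'k) \<times> ('g word \<Rightarrow>\<^sub>0 'k)) set"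
    and pr :: "('z \<Rightarrow>\<^sub>0 'k) \<Rightarrow> ('z \<Rightarrow>\<^sub>0 'k)"
    and D :: "('g word \<Rightarrow>\<^sub>0 'k) \<Rightarrow> ('g word \<Rightarrow>\<^sub>0 'k) \<Rightarrow> ('z \<Rightarrow>\<^sub>0 'k)"
  assumes klin_pr: "klin pr" and pr_pr: "pr (pr p) = pr p" and pr_D: "pr (D f g) = D f g"
    and klin_Dl: "klin (\<lambda>f. D f g)" and klin_Dr: "klin (D f)"
    and D_Il: "f \<in> I \<Longrightarrow> D f g = 0" and D_Ir: "g \<in> I \<Longrightarrow> D f g = 0"
    and D_RF: "(f, g, f', g') \<in> RF \<Longrightarrow> D f g = D f' g'"
    and D_ext: "(\<And>g. klin (\<lambda>f. h f g)) \<Longrightarrow> (\<And>f. klin (h f)) \<Longrightarrow> (\<And>f g. f \<in> I \<Longrightarrow> h f g = 0) \<Longrightarrow>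
      (\<And>f g. g \<in> I \<Longrightarrow> h f g = 0) \<Longrightarrow> (\<And>f g f' g'. (f, g, f', g') \<in> RF \<Longrightarrow> h f g = h f' g') \<Longrightarrow>
      \<exists>X. (\<forall>p. app X (pr p) = app X p) \<and> (\<forall>f g. app X (D f g) = (h f g :: 'z \<Rightarrow>\<^sub>0 'k))"
    and D_eq: "klin F \<Longrightarrow> klin G \<Longrightarrow> (\<And>p. F (pr p) = F p) \<Longrightarrow> (\<And>p. G (pr p) = G p) \<Longrightarrow>
      (\<And>f g. F (D f g) = (G (D f g) :: 'z \<Rightarrow>\<^sub>0 'k)) \<Longrightarrow> F p = G p"

section \<open>Construction of the balanced tensor products\<close>

locale tensor_rels = quotient_ideal I
  for I :: "('g word \<Rightarrow>\<^sub>0 'k::field) set" +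
  fixes RF :: "(('g word \<Rightarrow>\<^sub>0 'k) \<times> ('g word \<Rightarrow>\<^sub>0 'k) \<times> ('g word \<Rightarrow>\<^sub>0 'k) \<times> ('g word \<Rightarrow>\<^sub>0 'k)) set"
begin

abbreviation CC :: "(('g word \<Rightarrow>\<^sub>0 'k) set \<times> ('g word \<Rightarrow>\<^sub>0 'k) set) set" where
  "CC \<equiv> carrier B \<times> carrier B"

definition N :: "(('g word \<Rightarrow>\<^sub>0 'k) set \<times> ('g word \<Rightarrow>\<^sub>0 'k) set \<Rightarrow>\<^sub>0 'k) set" where
  "N = free_vs.span (bilinear_rels (carrier B) (add B) (smult B) (carrier B) (add B) (smult B) \<union>
     {pure (q f, q g) - pure (q f', q g') | f g f' g'. (f, g, f', g') \<in> RF})"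

text \<open>Pairs outside the carrier are added to \<open>N\<close>, so that \<open>pr\<close> kills them.\<close>

definition N' :: "(('g word \<Rightarrow>\<^sub>0 'k) set \<times> ('g word \<Rightarrow>\<^sub>0 'k) set \<Rightarrow>\<^sub>0 'k) set" where
  "N' = free_vs.span (N \<union> {pure u | u. u \<notin> CC})"

definition pr :: "(('g word \<Rightarrow>\<^sub>0 'k) set \<times> ('g word \<Rightarrow>\<^sub>0 'k) set \<Rightarrow>\<^sub>0 'k) \<Rightarrow> (('g word \<Rightarrow>\<^sub>0 'k) set \<times> ('g word \<Rightarrow>\<^sub>0 'k) set \<Rightarrow>\<^sub>0 'k)" where
  "pr = nf N'"

definition Ten :: "('g word \<Rightarrow>\<^sub>0 'k) \<Rightarrow> ('g word \<Rightarrow>\<^sub>0 'k) \<Rightarrow> (('g word \<Rightarrow>\<^sub>0 'k) set \<times> ('g word \<Rightarrow>\<^sub>0 'k) set \<Rightarrow>\<^sub>0 'k)" where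
  "Ten f g = pr (pure (q f, q g))"

text \<open>Restriction to pairs in the carrier. It does not change the class of a vector, and so
  gives every class a representative supported there.\<close>

definition cr :: "(('g word \<Rightarrow>\<^sub>0 'k) set \<times> ('g word \<Rightarrow>\<^sub>0 'k) set \<Rightarrow>\<^sub>0 'k) \<Rightarrow> (('g word \<Rightarrow>\<^sub>0 'k) set \<times> ('g word \<Rightarrow>\<^sub>0 'k) set \<Rightarrow>\<^sub>0 'k)" where
  "cr = lext (\<lambda>u. if u \<in> CC then pure u else 0)"

lemma subspace_N: "free_vs.subspace N" and subspace_N': "free_vs.subspace N'"
  by (simp_all add: N_def N'_def free_vs.subspace_span)

lemma klin_pr: "klin pr" and pr_pr: "pr (pr p) = pr p"
  unfolding pr_def by (rule klin_nf[OF subspace_N'], rule nf_nf[OF subspace_N'])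

lemma pr_zero_iff: "pr p = 0 \<longleftrightarrow> p \<in> N'"
  unfolding pr_def by (rule nf_zero_iff[OF subspace_N'])

lemma klin_cr: "klin cr"
  by (simp add: cr_def klin_lext)

lemma cr_pure: "cr (pure u) = (if u \<in> CC then pure u else 0)"
  unfolding cr_def by (rule lext_pure)

lemma cr_id: "Poly_Mapping.keys p \<subseteq> CC \<Longrightarrow> cr p = p"
  by (subst (2) pm_expand) (auto simp: cr_def lext_def intro!: sum.cong)

lemma keys_cr: "Poly_Mapping.keys (cr p) \<subseteq> CC"
proof (induction p rule: pm_induct)
  case (add p q)
  thus ?case using Poly_Mapping.keys_add[of "cr p" "cr q"] by (simp add: klin_add[OF klin_cr]) blast
next
  case (scale k p)
  thus ?case by (auto simp: klin_scale[OF klin_cr] in_keys_iff)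
qed (simp_all add: klin_zero[OF klin_cr] cr_pure)

lemma cr_gens:
  "n \<in> bilinear_rels (carrier B) (add B) (smult B) (carrier B) (add B) (smult B) \<union>
     {pure (q f, q g) - pure (q f', q g') | f g f' g'. (f, g, f', g') \<in> RF} \<Longrightarrow> cr n = n"
  by (auto simp: bilinear_rels_def carrier_B q_add q_scale klin_diff[OF klin_cr] klin_scale[OF klin_cr] cr_pure)

lemma cr_N: "n \<in> N \<Longrightarrow> cr n = n"
proof -
  assume n: "n \<in> N"
  have k: "klin (\<lambda>n. cr n - n)" by (rule klinI) (simp_all add: klin_add[OF klin_cr] klin_scale[OF klin_cr])
  have "cr n - n = 0"
    using n unfolding N_def by (rule span_zero_klin[OF _ k]) (simp only: cr_gens diff_self)
  thus "cr n = n" by simp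
qed

lemma keys_N: "n \<in> N \<Longrightarrow> Poly_Mapping.keys n \<subseteq> CC"
  using cr_N keys_cr by metis

text \<open>The map \<open>cr\<close> fixes \<open>N\<close> and kills the added pairs, so it sends
  \<open>N'\<close> into \<open>N\<close>; and it fixes \<open>p\<close>.\<close>

lemma N'_N: "p \<in> N' \<Longrightarrow> Poly_Mapping.keys p \<subseteq> CC \<Longrightarrow> p \<in> N"
proof -
  assume p: "p \<in> N'" "Poly_Mapping.keys p \<subseteq> CC"
  have "cr p \<in> N"
    using p(1) unfolding N'_def
    by (rule span_induct_klin[OF _ klin_cr subspace_N]) (auto simp: cr_N cr_pure free_vs.subspace_0[OF subspace_N])
  thus ?thesis using cr_id[OF p(2)] by simp
qed

lemma N_N': "p \<in> N \<Longrightarrow> p \<in> N'"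
  unfolding N'_def by (rule free_vs.span_base) simp

lemma pr_eq_iff:
  assumes "Poly_Mapping.keys p \<subseteq> CC" "Poly_Mapping.keys r \<subseteq> CC"
  shows "pr p = pr r \<longleftrightarrow> p - r \<in> N"
proof -
  have "pr p = pr r \<longleftrightarrow> p - r \<in> N'"
    unfolding pr_def by (rule nf_eq_iff[OF subspace_N'])
  moreover have "Poly_Mapping.keys (p - r) \<subseteq> CC"
    using keys_cr[of "p - r"] by (simp add: klin_diff[OF klin_cr] cr_id[OF assms(1)] cr_id[OF assms(2)])
  ultimately show ?thesis using N'_N N_N' by blast
qed

lemma pr_junk: "u \<notin> CC \<Longrightarrow> pr (pure u) = 0"
  unfolding pr_zero_iff N'_def by (rule free_vs.span_base) blast

lemma pr_cr: "pr (cr p) = pr p"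
  by (rule klin_eqI[where f = "\<lambda>p. pr (cr p)" and g = pr])
    (auto simp: klin_comp[OF klin_pr klin_cr] klin_pr cr_pure pr_junk klin_zero[OF klin_pr])

lemma pr_eq_N: "p - r \<in> N \<Longrightarrow> pr p = pr r"
  unfolding pr_def by (simp add: nf_eq_iff[OF subspace_N'] N_N')

lemma N_base:
  "n \<in> bilinear_rels (carrier B) (add B) (smult B) (carrier B) (add B) (smult B) \<Longrightarrow> n \<in> N"
  unfolding N_def by (rule free_vs.span_base) (rule UnI1)

lemma Ten_add: "Ten (f + f') g = Ten f g + Ten f' g" "Ten f (g + g') = Ten f g + Ten f g'"
proof -
  have "pure (add B (q f) (q f'), q g) - pure (q f, q g) - pure (q f', q g) \<in> N"
    by (rule N_base, unfold bilinear_rels_def, use q_closed in blast)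
  hence "pr (pure (q (f + f'), q g)) = pr (pure (q f, q g) + pure (q f', q g))"
    by (intro pr_eq_N) (simp add: q_add diff_diff_add)
  thus "Ten (f + f') g = Ten f g + Ten f' g" by (simp add: Ten_def klin_add[OF klin_pr])
  have "pure (q f, add B (q g) (q g')) - pure (q f, q g) - pure (q f, q g') \<in> N"
    by (rule N_base, unfold bilinear_rels_def, use q_closed in blast)
  hence "pr (pure (q f, q (g + g'))) = pr (pure (q f, q g) + pure (q f, q g'))"
    by (intro pr_eq_N) (simp add: q_add diff_diff_add)
  thus "Ten f (g + g') = Ten f g + Ten f g'" by (simp add: Ten_def klin_add[OF klin_pr])
qed

lemma Ten_scale: "Ten (cscale k f) g = cscale k (Ten f g)" "Ten f (cscale k g) = cscale k (Ten f g)"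
proof -
  have "pure (smult B k (q f), q g) - cscale k (pure (q f, q g)) \<in> N"
    by (rule N_base, unfold bilinear_rels_def, use q_closed in blast)
  hence "pr (pure (q (cscale k f), q g)) = pr (cscale k (pure (q f, q g)))"
    by (intro pr_eq_N) (simp add: q_scale)
  thus "Ten (cscale k f) g = cscale k (Ten f g)" by (simp add: Ten_def klin_scale[OF klin_pr])
  have "pure (q f, smult B k (q g)) - cscale k (pure (q f, q g)) \<in> N"
    by (rule N_base, unfold bilinear_rels_def, use q_closed in blast)
  hence "pr (pure (q f, q (cscale k g))) = pr (cscale k (pure (q f, q g)))"
    by (intro pr_eq_N) (simp add: q_scale)
  thus "Ten f (cscale k g) = cscale k (Ten f g)" by (simp add: Ten_def klin_scale[OF klin_pr])
qed

lemma klin_Ten: "klin (\<lambda>f. Ten f g)" "klin (Ten f)"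
  by (rule klinI; simp add: Ten_add Ten_scale)+

lemma Ten_cong: "q f = q f' \<Longrightarrow> q g = q g' \<Longrightarrow> Ten f g = Ten f' g'"
  by (simp add: Ten_def)

lemma Ten_I: "f \<in> I \<Longrightarrow> Ten f g = 0" "g \<in> I \<Longrightarrow> Ten f g = 0"
  using Ten_cong[of f 0 g g] Ten_cong[of f f g 0] klin_zero[OF klin_Ten(1)] klin_zero[OF klin_Ten(2)]
  by (simp_all add: q_eq_iff)

lemma Ten_RF: "(f, g, f', g') \<in> RF \<Longrightarrow> Ten f g = Ten f' g'"
  unfolding Ten_def by (rule pr_eq_N) (auto simp: N_def intro!: free_vs.span_base)

text \<open>The function \<open>h\<close> takes elements of the free algebra, so representatives are
  chosen by \<open>rp\<close>; vanishing of \<open>h\<close> on the ideal makes the result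
  independent of the choice.\<close>

definition extend :: "(('g word \<Rightarrow>\<^sub>0 'k) \<Rightarrow> ('g word \<Rightarrow>\<^sub>0 'k) \<Rightarrow> ('z \<Rightarrow>\<^sub>0 'k)) \<Rightarrow>
    (('g word \<Rightarrow>\<^sub>0 'k) set \<times> ('g word \<Rightarrow>\<^sub>0 'k) set \<Rightarrow>\<^sub>0 'k) \<Rightarrow> ('z \<Rightarrow>\<^sub>0 'k)" where
  "extend h = lext (\<lambda>u. if u \<in> CC then h (rp (fst u)) (rp (snd u)) else 0)"

lemma klin_extend: "klin (extend h)"
  by (simp add: extend_def klin_lext)

lemma extend_junk: "u \<notin> CC \<Longrightarrow> extend h (pure u) = 0"
  unfolding extend_def lext_pure by simp

lemma
  assumes "\<And>g. klin (\<lambda>f. h f g)" "\<And>f. klin (h f)" "\<And>f g. f \<in> I \<Longrightarrow> h f g = 0" "\<And>f g. g \<in> I \<Longrightarrow> h f g = 0"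
  shows extend_pure: "extend h (pure (q f, q g)) = h f g"
    and extend_N: "(\<And>f g f' g'. (f, g, f', g') \<in> RF \<Longrightarrow> h f g = h f' g') \<Longrightarrow> n \<in> N \<Longrightarrow> extend h n = 0"
    and extend_pr: "(\<And>f g f' g'. (f, g, f', g') \<in> RF \<Longrightarrow> h f g = h f' g') \<Longrightarrow> extend h (pr p) = extend h p"
    and extend_Ten: "(\<And>f g f' g'. (f, g, f', g') \<in> RF \<Longrightarrow> h f g = h f' g') \<Longrightarrow> extend h (Ten f g) = h f g"
proof -
  have "h (rp (q f)) g' = h f g'" for f g'
    using assms(3)[OF rp_q] by (simp add: klin_diff[OF assms(1)])
  moreover have "h f' (rp (q g)) = h f' g" for f' g
    using assms(4)[OF rp_q] by (simp add: klin_diff[OF assms(2)])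
  ultimately have p: "extend h (pure (q f, q g)) = h f g" for f g
    by (simp add: extend_def)
  show "extend h (pure (q f, q g)) = h f g" by (rule p)
  assume RF: "\<And>f g f' g'. (f, g, f', g') \<in> RF \<Longrightarrow> h f g = h f' g'"
  have N: "extend h n = 0" if "n \<in> N" for n
    using that unfolding N_def
    by (rule span_zero_klin[OF _ klin_extend])
      (auto simp: bilinear_rels_def carrier_B q_add q_scale klin_diff[OF klin_extend] klin_scale[OF klin_extend] p
         klin_add[OF assms(1)] klin_add[OF assms(2)] klin_scale[OF assms(1)] klin_scale[OF assms(2)] RF)
  thus "n \<in> N \<Longrightarrow> extend h n = 0" .
  have "extend h n = 0" if "n \<in> N'" for n
    using that unfolding N'_def
    by (rule span_zero_klin[OF _ klin_extend]) (auto simp: N extend_junk)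
  thus pr: "extend h (pr p) = extend h p" for p
    unfolding pr_def by (rule klin_nf_absorb[OF subspace_N' klin_extend])
  show "extend h (Ten f g) = h f g" by (simp add: Ten_def pr p)
qed

lemma Ten_eq:
  assumes "klin F" "klin G" "\<And>p. F (pr p) = F p" "\<And>p. G (pr p) = G p" "\<And>f g. F (Ten f g) = G (Ten f g)"
  shows "F p = G p"
proof (rule klin_eqI[OF assms(1,2)])
  fix u
  show "F (pure u) = G (pure u)"
  proof (cases "u \<in> CC")
    case True
    then obtain f g where u: "u = (q f, q g)" by (auto simp: carrier_B)
    show ?thesis
      using assms(5)[of f g] by (simp add: Ten_def assms(3,4) u)
  next
    case False
    have "F (pr (pure u)) = G (pr (pure u))"
      by (simp add: pr_junk[OF False] klin_zero[OF assms(1)] klin_zero[OF assms(2)])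
    thus ?thesis by (simp add: assms(3,4))
  qed
qed

lemma pr_Ten: "pr (Ten f g) = Ten f g"
  by (simp add: Ten_def pr_pr)

lemma btensor: "btensor I RF pr Ten"
proof
  fix h :: "('g word \<Rightarrow>\<^sub>0 'k) \<Rightarrow> ('g word \<Rightarrow>\<^sub>0 'k) \<Rightarrow> (('g word \<Rightarrow>\<^sub>0 'k) set \<times> ('g word \<Rightarrow>\<^sub>0 'k) set \<Rightarrow>\<^sub>0 'k)"
  assume h: "\<And>g. klin (\<lambda>f. h f g)" "\<And>f. klin (h f)" "\<And>f g. f \<in> I \<Longrightarrow> h f g = 0" "\<And>f g. g \<in> I \<Longrightarrow> h f g = 0"
    "\<And>f g f' g'. (f, g, f', g') \<in> RF \<Longrightarrow> h f g = h f' g'"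
  have "extend h (pr p) = extend h p" for p by (rule extend_pr) (fact h)+
  moreover have "extend h (Ten f g) = h f g" for f g by (rule extend_Ten) (fact h)+
  ultimately show "\<exists>X. (\<forall>p. app X (pr p) = app X p) \<and> (\<forall>f g. app X (Ten f g) = h f g)"
    by (intro exI[of _ "Lop (extend h)"]) (simp add: app_Lop[OF klin_extend])
next
  show "F p = G p" if "klin F" "klin G" "\<And>p. F (pr p) = F p" "\<And>p. G (pr p) = G p" "\<And>f g. F (Ten f g) = G (Ten f g)"
    for F G :: "(('g word \<Rightarrow>\<^sub>0 'k) set \<times> ('g word \<Rightarrow>\<^sub>0 'k) set \<Rightarrow>\<^sub>0 'k) \<Rightarrow> (('g word \<Rightarrow>\<^sub>0 'k) set \<times> ('g word \<Rightarrow>\<^sub>0 'k) set \<Rightarrow>\<^sub>0 'k)" and p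
    by (rule Ten_eq[OF that])
qed (auto intro: klin_pr klin_Ten Ten_RF simp: pr_pr pr_Ten Ten_I)

end

text \<open>The two families of balanced tensor products: \<open>rel_dia\<close> for \<open>B \<diamondop> B\<close>, and \<open>rel_op\<close> for the tensor
  products over \<open>A\<^sup>o\<^sup>p\<close> and, with \<open>\<sigma>\<close> in place of \<open>\<tau>\<close>, for \<open>B \<odot> B\<close>.\<close>

definition rel_dia :: "('a \<Rightarrow> 'f) \<Rightarrow> ('a \<Rightarrow> 'f) \<Rightarrow> ('f \<times> 'f \<times> 'f \<times> 'f::times) set" where
  "rel_dia \<sigma> \<tau> = {(\<tau> r * f, g, f, \<sigma> r * g) | r f g. True}"

definition rel_op :: "('a \<Rightarrow> 'f) \<Rightarrow> ('f \<times> 'f \<times> 'f \<times> 'f::times) set" where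
  "rel_op \<tau> = {(f * \<tau> r, g, f, \<tau> r * g) | r f g. True}"

text \<open>With the tensor factors exchanged, \<open>\<sigma>\<close> and \<open>\<tau>\<close>
  change roles. This brings \<theta> under the treatment of \<beta>.\<close>

lemma btensor_flip:
  fixes D :: "('g word \<Rightarrow>\<^sub>0 'k::field) \<Rightarrow> ('g word \<Rightarrow>\<^sub>0 'k) \<Rightarrow> ('z \<Rightarrow>\<^sub>0 'k)"
  assumes "btensor I (rel_dia \<sigma> \<tau>) pr D"
  shows "btensor I (rel_dia \<tau> \<sigma>) pr (\<lambda>f g. D g f)"
proof -
  interpret btensor I "rel_dia \<sigma> \<tau>" pr D by (rule assms)
  show ?thesis
  proof
    fix f g f' g' assume "(f, g, f', g') \<in> rel_dia \<tau> \<sigma>"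
    thus "D g f = D g' f'" by (auto simp: rel_dia_def intro!: D_RF[symmetric])
  next
    fix h :: "('g word \<Rightarrow>\<^sub>0 'k) \<Rightarrow> ('g word \<Rightarrow>\<^sub>0 'k) \<Rightarrow> ('z \<Rightarrow>\<^sub>0 'k)"
    assume h: "\<And>g. klin (\<lambda>f. h f g)" "\<And>f. klin (h f)" "\<And>f g. f \<in> I \<Longrightarrow> h f g = 0" "\<And>f g. g \<in> I \<Longrightarrow> h f g = 0"
      "\<And>f g f' g'. (f, g, f', g') \<in> rel_dia \<tau> \<sigma> \<Longrightarrow> h f g = h f' g'"
    have "\<exists>X. (\<forall>p. app X (pr p) = app X p) \<and> (\<forall>f g. app X (D f g) = h g f)"
    proof (rule D_ext)
      fix f g f' g' assume "(f, g, f', g') \<in> rel_dia \<sigma> \<tau>"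
      then obtain r where "f = \<tau> r * f'" "g' = \<sigma> r * g" by (auto simp: rel_dia_def)
      moreover have "(\<sigma> r * g, f', g, \<tau> r * f') \<in> rel_dia \<tau> \<sigma>" unfolding rel_dia_def by blast
      ultimately show "h g f = h g' f'" using h(5) by metis
    qed (simp_all add: h)
    thus "\<exists>X. (\<forall>p. app X (pr p) = app X p) \<and> (\<forall>f g. app X (D g f) = h f g)" by blast
  next
    show "F p = G p" if "klin F" "klin G" "\<And>p. F (pr p) = F p" "\<And>p. G (pr p) = G p" "\<And>f g. F (D g f) = (G (D g f) :: 'z \<Rightarrow>\<^sub>0 'k)"
      for F G p using that by (rule D_eq)
  qed (simp_all add: klin_pr pr_pr pr_D klin_Dl klin_Dr D_Il D_Ir)
qed

section \<open>Inverting the canonical maps\<close>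

lemma falg_induct [case_names zero one gen add scale]:
  fixes f :: "'g word \<Rightarrow>\<^sub>0 'k::field"
  assumes "P 0" "P 1" "\<And>g f. P f \<Longrightarrow> P (gen g * f)" "\<And>f h. P f \<Longrightarrow> P h \<Longrightarrow> P (f + h)" "\<And>k f. P f \<Longrightarrow> P (cscale k f)"
  shows "P f"
proof (induction f rule: pm_induct)
  case (pure w)
  have "P (pure (Word gs))" for gs
  proof (induction gs)
    case Nil
    have "(pure (Word []) :: 'g word \<Rightarrow>\<^sub>0 'k) = 1" by (simp add: zero_word_def[symmetric])
    thus ?case using assms(2) by (simp only:)
  next
    case (Cons g gs)
    have "(pure (Word (g # gs)) :: 'g word \<Rightarrow>\<^sub>0 'k) = gen g * pure (Word gs)"
      by (simp add: gen_def mult_single plus_word_def)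
    thus ?case using assms(3)[OF Cons] by (simp only:)
  qed
  thus ?case by (cases w) simp
qed (use assms in auto)

lemma klin_cscale: "klin (cscale k)"
  by (rule klinI) (simp_all add: mult.commute)

text \<open>The map \<open>\<beta>\<close> is \<open>T f g \<mapsto> \<Phi> f (D 1 g)\<close>, where \<open>\<Phi>\<close> is the left action of \<open>B\<close> on \<open>B \<diamondop> B\<close>. Its inverse is
  \<open>D f g \<mapsto> \<Gamma> f (T 1 g)\<close> for a right action \<open>\<Gamma>\<close> on the other tensor product. That they are inverse to each
  other are conditions on the elements of \<open>B\<close> which pass to sums and products.\<close>

locale half_hopf = D: btensor I "rel_dia \<sigma> \<tau>" pD D + T: btensor I "rel_op \<tau>" pT T
  for I :: "('g word \<Rightarrow>\<^sub>0 'k::field) set" and \<sigma> \<tau> :: "'a \<Rightarrow> ('g word \<Rightarrow>\<^sub>0 'k)"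
    and pD :: "('z \<Rightarrow>\<^sub>0 'k) \<Rightarrow> ('z \<Rightarrow>\<^sub>0 'k)" and D
    and pT :: "('z \<Rightarrow>\<^sub>0 'k) \<Rightarrow> ('z \<Rightarrow>\<^sub>0 'k)" and T +
  fixes \<Phi> \<Gamma> :: "('g word \<Rightarrow>\<^sub>0 'k) \<Rightarrow> ('k, 'z) lop"
    and Rm Lm :: "('g word \<Rightarrow>\<^sub>0 'k) \<Rightarrow> ('k, 'z) lop"
  assumes I_mult: "f \<in> I \<Longrightarrow> g * f \<in> I" "f \<in> I \<Longrightarrow> f * g \<in> I"
    and zero_I: "0 \<in> I"
    and Phi_add: "\<Phi> (f + g) = \<Phi> f + \<Phi> g" and Phi_scale: "\<Phi> (cscale k f) = lop_scale k (\<Phi> f)"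
    and Phi_mult: "\<Phi> (f * g) = \<Phi> f * \<Phi> g" and Phi_one: "app (\<Phi> 1) p = pD p"
    and Phi_I: "f \<in> I \<Longrightarrow> \<Phi> f = 0" and Phi_pD: "app (\<Phi> f) (pD p) = app (\<Phi> f) p"
    and pD_Phi: "pD (app (\<Phi> f) p) = app (\<Phi> f) p"
    and Phi_tau: "app (\<Phi> (\<tau> r)) (D f g) = D f (\<tau> r * g)"
    and Gam_add: "\<Gamma> (f + g) = \<Gamma> f + \<Gamma> g" and Gam_scale: "\<Gamma> (cscale k f) = lop_scale k (\<Gamma> f)"
    and Gam_mult: "\<Gamma> (f * g) = \<Gamma> g * \<Gamma> f" and Gam_one: "app (\<Gamma> 1) p = pT p"
    and Gam_I: "f \<in> I \<Longrightarrow> \<Gamma> f = 0" and Gam_pT: "app (\<Gamma> f) (pT p) = app (\<Gamma> f) p"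
    and pT_Gam: "pT (app (\<Gamma> f) p) = app (\<Gamma> f) p"
    and Gam_tau: "app (\<Gamma> (\<tau> r)) (T f g) = T f (\<sigma> r * g)"
    and Rm_D: "app (Rm h) (D f g) = D (f * h) g" and Rm_pD: "app (Rm h) (pD p) = app (Rm h) p"
    and Rm_Phi: "app (Rm h) (app (\<Phi> f) p) = app (\<Phi> f) (app (Rm h) p)"
    and Lm_T: "app (Lm h) (T f g) = T (h * f) g" and Lm_pT: "app (Lm h) (pT p) = app (Lm h) p"
    and Lm_Gam: "app (Lm h) (app (\<Gamma> f) p) = app (\<Gamma> f) (app (Lm h) p)"
begin

definition \<beta> :: "('k, 'z) lop" where
  "\<beta> = (SOME X. (\<forall>p. app X (pT p) = app X p) \<and> (\<forall>f g. app X (T f g) = app (\<Phi> f) (D 1 g)))"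

definition \<beta>i :: "('k, 'z) lop" where
  "\<beta>i = (SOME X. (\<forall>p. app X (pD p) = app X p) \<and> (\<forall>f g. app X (D f g) = app (\<Gamma> f) (T 1 g)))"

lemma beta_pT: "app \<beta> (pT p) = app \<beta> p" and beta_T: "app \<beta> (T f g) = app (\<Phi> f) (D 1 g)"
proof -
  have "\<exists>X. (\<forall>p. app X (pT p) = app X p) \<and> (\<forall>f g. app X (T f g) = app (\<Phi> f) (D 1 g))"
  proof (rule T.D_ext)
    fix f g f' g' assume "(f, g, f', g') \<in> rel_op \<tau>"
    thus "app (\<Phi> f) (D 1 g) = app (\<Phi> f') (D 1 g')"
      by (auto simp: rel_op_def Phi_mult app_simps Phi_tau)
  qed (auto intro!: klinI simp: Phi_add Phi_scale app_simps klin_add[OF D.klin_Dr] klin_scale[OF D.klin_Dr]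
       klin_add[OF klin_app] klin_scale[OF klin_app] klin_zero[OF klin_app] Phi_I D.D_Ir)
  from someI_ex[OF this] show "app \<beta> (pT p) = app \<beta> p" "app \<beta> (T f g) = app (\<Phi> f) (D 1 g)"
    unfolding \<beta>_def by blast+
qed

lemma betai_pD: "app \<beta>i (pD p) = app \<beta>i p" and betai_D: "app \<beta>i (D f g) = app (\<Gamma> f) (T 1 g)"
proof -
  have "\<exists>X. (\<forall>p. app X (pD p) = app X p) \<and> (\<forall>f g. app X (D f g) = app (\<Gamma> f) (T 1 g))"
  proof (rule D.D_ext)
    fix f g f' g' assume "(f, g, f', g') \<in> rel_dia \<sigma> \<tau>"
    thus "app (\<Gamma> f) (T 1 g) = app (\<Gamma> f') (T 1 g')"
      by (auto simp: rel_dia_def Gam_mult app_simps Gam_tau)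
  qed (auto intro!: klinI simp: Gam_add Gam_scale app_simps klin_add[OF T.klin_Dr] klin_scale[OF T.klin_Dr]
       klin_add[OF klin_app] klin_scale[OF klin_app] klin_zero[OF klin_app] Gam_I T.D_Ir)
  from someI_ex[OF this] show "app \<beta>i (pD p) = app \<beta>i p" "app \<beta>i (D f g) = app (\<Gamma> f) (T 1 g)"
    unfolding \<beta>i_def by blast+
qed

lemma Rm_mult: "app (Rm (f * g)) p = app (Rm g) (app (Rm f) p)"
  by (rule D.D_eq) (simp_all add: klin_app klin_comp[OF klin_app klin_app] Rm_pD Rm_D mult.assoc)

lemma Rm_add: "app (Rm (f + g)) p = app (Rm f) p + app (Rm g) p"
  by (rule D.D_eq[where F = "app (Rm (f + g))" and G = "\<lambda>p. app (Rm f) p + app (Rm g) p"])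
    (simp_all add: klin_app klin_def[of "\<lambda>p. _ p + _ p"] klin_add[OF klin_app] klin_scale[OF klin_app] Rm_pD Rm_D
      distrib_left klin_add[OF D.klin_Dl])

lemma Rm_scale: "app (Rm (cscale k f)) p = cscale k (app (Rm f) p)"
  by (rule D.D_eq[where F = "app (Rm (cscale k f))" and G = "\<lambda>p. cscale k (app (Rm f) p)"])
    (simp_all add: klin_app klin_comp[OF klin_cscale klin_app] klin_add[OF klin_app] klin_scale[OF klin_app] Rm_pD Rm_D
      cscale_multr klin_scale[OF D.klin_Dl] mult.commute)

lemma Rm_one: "app (Rm 1) p = pD p"
  by (rule D.D_eq) (simp_all add: klin_app D.klin_pr Rm_pD Rm_D D.pr_pr D.pr_D)

lemma Lm_mult: "app (Lm (f * g)) p = app (Lm f) (app (Lm g) p)"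
  by (rule T.D_eq) (simp_all add: klin_app klin_comp[OF klin_app klin_app] Lm_pT Lm_T mult.assoc)

lemma Lm_add: "app (Lm (f + g)) p = app (Lm f) p + app (Lm g) p"
  by (rule T.D_eq[where F = "app (Lm (f + g))" and G = "\<lambda>p. app (Lm f) p + app (Lm g) p"])
    (simp_all add: klin_app klin_def[of "\<lambda>p. _ p + _ p"] klin_add[OF klin_app] klin_scale[OF klin_app] Lm_pT Lm_T
      distrib_right klin_add[OF T.klin_Dl])

lemma Lm_scale: "app (Lm (cscale k f)) p = cscale k (app (Lm f) p)"
  by (rule T.D_eq[where F = "app (Lm (cscale k f))" and G = "\<lambda>p. cscale k (app (Lm f) p)"])
    (simp_all add: klin_app klin_comp[OF klin_cscale klin_app] klin_add[OF klin_app] klin_scale[OF klin_app] Lm_pT Lm_T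
      cscale_multl klin_scale[OF T.klin_Dl] mult.commute)

lemma Lm_one: "app (Lm 1) p = pT p"
  by (rule T.D_eq) (simp_all add: klin_app T.klin_pr Lm_pT Lm_T T.pr_pr T.pr_D)

text \<open>At \<open>T 1 v\<close> and \<open>D 1 v\<close> these are the two inversion identities
  for \<open>b\<close>. Stated as intertwining properties for all \<open>p\<close>, they can be
  composed, which the identities themselves cannot.\<close>

definition good :: "('g word \<Rightarrow>\<^sub>0 'k) \<Rightarrow> bool" where
  "good b \<longleftrightarrow> (\<forall>p. app \<beta> (app (\<Gamma> b) p) = app (Rm b) (app \<beta> p)) \<and>
     (\<forall>p. app \<beta>i (app (\<Phi> b) p) = app (Lm b) (app \<beta>i p))"

lemma pT_betai: "pT (app \<beta>i p) = app \<beta>i p"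
  by (rule D.D_eq[where F = "\<lambda>p. pT (app \<beta>i p)" and G = "app \<beta>i"])
    (simp_all add: klin_comp[OF T.klin_pr klin_app] klin_app betai_pD betai_D pT_Gam)

lemma pD_beta: "pD (app \<beta> p) = app \<beta> p"
  by (rule T.D_eq[where F = "\<lambda>p. pD (app \<beta> p)" and G = "app \<beta>"])
    (simp_all add: klin_comp[OF D.klin_pr klin_app] klin_app beta_pT beta_T pD_Phi)

lemma good_one: "good 1"
  by (simp add: good_def Gam_one Phi_one Rm_one Lm_one beta_pT betai_pD pT_betai pD_beta)

lemma good_add: "good f \<Longrightarrow> good g \<Longrightarrow> good (f + g)"
  by (simp add: good_def Gam_add Phi_add app_simps klin_add[OF klin_app] Rm_add Lm_add)

lemma good_scale: "good f \<Longrightarrow> good (cscale k f)"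
  by (simp add: good_def Gam_scale Phi_scale app_simps klin_scale[OF klin_app] Rm_scale Lm_scale)

lemma good_mult: "good f \<Longrightarrow> good g \<Longrightarrow> good (f * g)"
  by (simp add: good_def Gam_mult Phi_mult app_simps Rm_mult Lm_mult)

lemma good_I: "f \<in> I \<Longrightarrow> good f"
proof -
  assume f: "f \<in> I"
  have z: "klin (\<lambda>p::'z \<Rightarrow>\<^sub>0 'k. 0 :: 'z \<Rightarrow>\<^sub>0 'k)" by (simp add: klin_def)
  have "app (Rm f) p = 0" for p
    by (rule D.D_eq[where F = "app (Rm f)" and G = "\<lambda>p. 0"]) (simp_all add: klin_app z Rm_pD Rm_D D.D_Il I_mult f)
  moreover have "app (Lm f) p = 0" for p
    by (rule T.D_eq[where F = "app (Lm f)" and G = "\<lambda>p. 0"]) (simp_all add: klin_app z Lm_pT Lm_T T.D_Il I_mult f)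
  ultimately show ?thesis
    by (simp add: good_def Phi_I[OF f] Gam_I[OF f] app_simps klin_zero[OF klin_app])
qed

lemma good_zero: "good 0"
  by (rule good_I) (rule zero_I)

lemma good_sum: "(\<And>i. i \<in> A \<Longrightarrow> good (h i)) \<Longrightarrow> good (sum h A)"
  by (induction A rule: infinite_finite_induct) (simp_all add: good_zero good_add)

lemma good_cong: "f - g \<in> I \<Longrightarrow> good g \<Longrightarrow> good f"
  using good_add[OF good_I[of "f - g"], of g] by simp

lemma goodI:
  assumes "\<And>u v. app \<beta> (app (\<Gamma> b) (T u v)) = app (\<Phi> u) (D b v)"
    and "\<And>u v. app \<beta>i (app (\<Phi> b) (D u v)) = app (\<Gamma> u) (T b v)"
  shows "good b"
proof -
  have "app \<beta> (app (\<Gamma> b) p) = app (Rm b) (app \<beta> p)" for p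
    by (rule T.D_eq[where F = "\<lambda>p. app \<beta> (app (\<Gamma> b) p)" and G = "\<lambda>p. app (Rm b) (app \<beta> p)"])
      (simp_all add: klin_comp[OF klin_app klin_app] Gam_pT beta_pT assms(1) beta_T Rm_Phi Rm_D)
  moreover have "app \<beta>i (app (\<Phi> b) p) = app (Lm b) (app \<beta>i p)" for p
    by (rule D.D_eq[where F = "\<lambda>p. app \<beta>i (app (\<Phi> b) p)" and G = "\<lambda>p. app (Lm b) (app \<beta>i p)"])
      (simp_all add: klin_comp[OF klin_app klin_app] Phi_pD betai_pD assms(2) betai_D Lm_Gam Lm_T)
  ultimately show ?thesis by (simp add: good_def)
qed

lemma beta_inverse:
  assumes "\<And>g. good (gen g)"
  shows "app \<beta> (app \<beta>i p) = pD p" "app \<beta>i (app \<beta> p) = pT p"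
proof -
  have g: "good f" for f
    by (induction f rule: falg_induct) (simp_all add: good_zero good_one good_add good_scale good_mult assms)
  show "app \<beta> (app \<beta>i p) = pD p"
    by (rule D.D_eq[where F = "\<lambda>p. app \<beta> (app \<beta>i p)" and G = pD])
      (use g in \<open>simp_all add: klin_comp[OF klin_app klin_app] D.klin_pr betai_pD D.pr_pr betai_D good_def beta_T Phi_one Rm_D D.pr_D\<close>)
  show "app \<beta>i (app \<beta> p) = pT p"
    by (rule T.D_eq[where F = "\<lambda>p. app \<beta>i (app \<beta> p)" and G = pT])
      (use g in \<open>simp_all add: klin_comp[OF klin_app klin_app] T.klin_pr beta_pT T.pr_pr beta_T good_def betai_D Gam_one Lm_T T.pr_D\<close>)
qed

text \<open>The lists \<open>tr\<close> and \<open>cp\<close> hold the tensors b_+ \<otimes> b_- and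
  b_(1) \<diamondop> b_(2). The last two hypotheses are the identities b_+(1) \<diamondop> b_+(2)
  b_- = b \<diamondop> 1 and b_(1)+ \<otimes> b_(1)- b_(2) = b \<otimes> 1.\<close>

lemma good_lists:
  assumes "\<And>u v. app (\<Gamma> b) (T u v) = (\<Sum>(a, c)\<leftarrow>tr. T (u * a) (c * v))"
    and "\<And>u v. app (\<Phi> b) (D u v) = (\<Sum>(a, c)\<leftarrow>cp. D (a * u) (c * v))"
    and "\<And>v. (\<Sum>(a, c)\<leftarrow>tr. app (\<Phi> a) (D 1 (c * v))) = D b v"
    and "\<And>v. (\<Sum>(a, c)\<leftarrow>cp. app (\<Gamma> a) (T 1 (c * v))) = T b v"
  shows "good b"
proof (rule goodI)
  show "app \<beta> (app (\<Gamma> b) (T u v)) = app (\<Phi> u) (D b v)" for u v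
    by (simp add: assms(1) assms(3)[symmetric] klin_sum_list[OF klin_app] split_def beta_T Phi_mult app_simps)
  show "app \<beta>i (app (\<Phi> b) (D u v)) = app (\<Gamma> u) (T b v)" for u v
    by (simp add: assms(2) assms(4)[symmetric] klin_sum_list[OF klin_app] split_def betai_D Gam_mult app_simps)
qed

end

section \<open>Bialgebroids from an action on \<open>B \<diamondop> B\<close>\<close>

lemma rel_diaE: "(f, g, f', g') \<in> rel_dia \<sigma> \<tau> \<Longrightarrow> (\<And>r. f = \<tau> r * f' \<Longrightarrow> g' = \<sigma> r * g \<Longrightarrow> P) \<Longrightarrow> P"
  by (auto simp: rel_dia_def)

lemma rel_opE: "(f, g, f', g') \<in> rel_op \<tau> \<Longrightarrow> (\<And>r. f = f' * \<tau> r \<Longrightarrow> g' = \<tau> r * g \<Longrightarrow> P) \<Longrightarrow> P"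
  by (auto simp: rel_op_def)

section \<open>Cosets as vectors fixed by the idempotent\<close>

context tensor_rels
begin

text \<open>Cosets of \<open>N\<close> correspond to the vectors fixed by \<open>pr\<close>;
  \<open>cls\<close> and \<open>val\<close> are the two directions.\<close>

definition cls :: "(('g word \<Rightarrow>\<^sub>0 'k) set \<times> ('g word \<Rightarrow>\<^sub>0 'k) set \<Rightarrow>\<^sub>0 'k) \<Rightarrow> (('g word \<Rightarrow>\<^sub>0 'k) set \<times> ('g word \<Rightarrow>\<^sub>0 'k) set \<Rightarrow>\<^sub>0 'k) set" where
  "cls w = {p. Poly_Mapping.keys p \<subseteq> CC \<and> pr p = w}"

definition val :: "(('g word \<Rightarrow>\<^sub>0 'k) set \<times> ('g word \<Rightarrow>\<^sub>0 'k) set \<Rightarrow>\<^sub>0 'k) set \<Rightarrow> (('g word \<Rightarrow>\<^sub>0 'k) set \<times> ('g word \<Rightarrow>\<^sub>0 'k) set \<Rightarrow>\<^sub>0 'k)" where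
  "val X = pr (SOME p. p \<in> X)"

lemma keys_add_CC: "Poly_Mapping.keys p \<subseteq> CC \<Longrightarrow> Poly_Mapping.keys r \<subseteq> CC \<Longrightarrow> Poly_Mapping.keys (p + r) \<subseteq> CC"
  using Poly_Mapping.keys_add[of p r] by blast

lemma coset_cls: "Poly_Mapping.keys p \<subseteq> CC \<Longrightarrow> coset N p = cls (pr p)"
proof -
  assume p: "Poly_Mapping.keys p \<subseteq> CC"
  have "Poly_Mapping.keys r \<subseteq> CC" if "r - p \<in> N" for r
    using keys_add_CC[OF keys_N[OF that] p] by simp
  thus ?thesis using pr_eq_iff[OF _ p] by (auto simp: coset_def cls_def)
qed

lemma cr_in_cls: "pr w = w \<Longrightarrow> cr w \<in> cls w"
  by (simp add: cls_def keys_cr pr_cr)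

lemma tensors_cls: "quotient_space CC N = cls ` {w. pr w = w}"
proof
  show "quotient_space CC N \<subseteq> cls ` {w. pr w = w}"
    by (auto simp: quotient_space_def coset_cls pr_pr)
  show "cls ` {w. pr w = w} \<subseteq> quotient_space CC N"
  proof safe
    fix w assume w: "pr w = w"
    have "cls w = coset N (cr w)" by (simp add: coset_cls keys_cr pr_cr w)
    thus "cls w \<in> quotient_space CC N" using keys_cr by (auto simp: quotient_space_def)
  qed
qed

lemma val_cls: "pr w = w \<Longrightarrow> val (cls w) = w"
proof -
  assume "pr w = w"
  hence "(SOME p. p \<in> cls w) \<in> cls w" using cr_in_cls someI[of "\<lambda>p. p \<in> cls w"] by blast
  thus ?thesis by (simp add: val_def cls_def)
qed

lemma coset_add_cls:
  assumes "pr v = v" "pr w = w"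
  shows "coset_add (cls v) (cls w) = cls (v + w)"
proof safe
  fix p assume "p \<in> coset_add (cls v) (cls w)"
  then obtain p1 p2 where "p = p1 + p2" "p1 \<in> cls v" "p2 \<in> cls w" unfolding coset_add_def by blast
  thus "p \<in> cls (v + w)" using keys_add_CC[of p1 p2] by (simp add: cls_def klin_add[OF klin_pr])
next
  fix p assume p: "p \<in> cls (v + w)"
  have "p - cr w \<in> cls v"
    using p cr_in_cls[OF assms(2)] keys_cr[of "p - cr w"]
    by (simp add: cls_def klin_diff[OF klin_pr] klin_diff[OF klin_cr] cr_id)
  thus "p \<in> coset_add (cls v) (cls w)"
    using cr_in_cls[OF assms(2)] unfolding coset_add_def
    by (intro CollectI exI[of _ "p - cr w"] exI[of _ "cr w"]) simp
qed

end

text \<open>Mutually inverse operators between the images of two idempotents are transported to the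
  coset spaces in which the Hopf condition is formulated.\<close>

lemma tensors_bij:
  assumes "quotient_ideal I"
    and XO: "\<And>p. app X (tensor_rels.pr I Ro p) = app X p" and DX: "\<And>p. tensor_rels.pr I Rd (app X p) = app X p"
    and OY: "\<And>p. tensor_rels.pr I Ro (app Y p) = app Y p"
    and YX: "\<And>p. app Y (app X p) = tensor_rels.pr I Ro p" and XY: "\<And>p. app X (app Y p) = tensor_rels.pr I Rd p"
  defines "C \<equiv> carrier (quotient_ideal.B I) \<times> carrier (quotient_ideal.B I)"
  shows "\<exists>\<beta>. bij_betw \<beta> (quotient_space C (tensor_rels.N I Ro)) (quotient_space C (tensor_rels.N I Rd)) \<and>
    (\<forall>Z\<in>quotient_space C (tensor_rels.N I Ro). \<forall>Z'\<in>quotient_space C (tensor_rels.N I Ro).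
       \<beta> (coset_add Z Z') = coset_add (\<beta> Z) (\<beta> Z')) \<and>
    (\<forall>p. Poly_Mapping.keys p \<subseteq> C \<longrightarrow> \<beta> (coset (tensor_rels.N I Ro) p) = tensor_rels.cls I Rd (app X p))"
proof -
  interpret O: tensor_rels I Ro by (rule tensor_rels.intro) (rule assms)
  interpret D: tensor_rels I Rd by (rule tensor_rels.intro) (rule assms)
  let ?b = "\<lambda>Z. D.cls (app X (O.val Z))"
  let ?c = "\<lambda>Z. O.cls (app Y (D.val Z))"
  have "bij_betw ?b (quotient_space C O.N) (quotient_space C D.N)"
    unfolding C_def O.tensors_cls D.tensors_cls
    by (rule bij_betw_byWitness[where f' = ?c]) (auto simp: O.val_cls D.val_cls DX OY XY YX)
  moreover have "?b (coset_add Z Z') = coset_add (?b Z) (?b Z')"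
    if "Z \<in> quotient_space C O.N" "Z' \<in> quotient_space C O.N" for Z Z'
  proof -
    from that obtain v w where vw: "O.pr v = v" "O.pr w = w" "Z = O.cls v" "Z' = O.cls w"
      by (auto simp: C_def O.tensors_cls)
    have "O.pr (v + w) = v + w" by (simp add: klin_add[OF O.klin_pr] vw)
    thus ?thesis
      by (simp add: vw O.coset_add_cls O.val_cls D.coset_add_cls DX klin_add[OF klin_app])
  qed
  moreover have "?b (coset O.N p) = D.cls (app X p)" if "Poly_Mapping.keys p \<subseteq> C" for p
    using that unfolding C_def by (simp add: O.coset_cls O.val_cls O.pr_pr XO)
  ultimately show ?thesis by (intro exI[of _ ?b]) simp
qed

section \<open>The bialgebroid of a presented algebra\<close>

locale gen_algebra = quotient_ideal I
  for I :: "('g word \<Rightarrow>\<^sub>0 'k::field) set" +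
  fixes scA :: "'k \<Rightarrow> 'a::{ring,monoid_mult} \<Rightarrow> 'a" and sg tg :: "'a \<Rightarrow> 'g"
    and cop :: "'g \<Rightarrow> ('g \<times> 'g) list"
    and \<Phi> :: "('g word \<Rightarrow>\<^sub>0 'k) \<Rightarrow> ('k, ('g word \<Rightarrow>\<^sub>0 'k) set \<times> ('g word \<Rightarrow>\<^sub>0 'k) set) lop"
  assumes Ae: "Ae_ring scA B (\<lambda>a. q (gen (sg a))) (\<lambda>a. q (gen (tg a)))"
begin

abbreviation \<sigma> :: "'a \<Rightarrow> ('g word \<Rightarrow>\<^sub>0 'k)" where "\<sigma> a \<equiv> gen (sg a)"
abbreviation \<tau> :: "'a \<Rightarrow> ('g word \<Rightarrow>\<^sub>0 'k)" where "\<tau> a \<equiv> gen (tg a)"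

sublocale A: Ae_ring scA B "\<lambda>a. q (\<sigma> a)" "\<lambda>a. q (\<tau> a)" by (rule Ae)
sublocale TD: tensor_rels I "rel_dia \<sigma> \<tau>" by unfold_locales
sublocale TO: tensor_rels I "rel_op \<tau>" by unfold_locales
sublocale TT: tensor_rels I "rel_op \<sigma>" by unfold_locales

lemma dia_null: "A.dia_null = TD.N"
proof -
  have "{(pure (q (\<tau> r) \<otimes>\<^bsub>B\<^esub> b, c) - pure (b, q (\<sigma> r) \<otimes>\<^bsub>B\<^esub> c) :: _ \<Rightarrow>\<^sub>0 'k) | r b c. b \<in> carrier B \<and> c \<in> carrier B} =
    {(pure (q f, q g) - pure (q f', q g') :: _ \<Rightarrow>\<^sub>0 'k) | f g f' g'. (f, g, f', g') \<in> rel_dia \<sigma> \<tau>}" (is "?L = ?R")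
  proof
    show "?L \<subseteq> ?R" by (auto simp: carrier_B q_mult rel_dia_def) blast
    show "?R \<subseteq> ?L" unfolding rel_dia_def by (auto simp: q_mult[symmetric]) (use q_closed in blast)+
  qed
  thus ?thesis by (simp only: A.dia_null_def A.tensor_null_def TD.N_def)
qed

lemma op_null: "A.op_null = TO.N"
proof -
  have "{(pure (b \<otimes>\<^bsub>B\<^esub> q (\<tau> r), c) - pure (b, q (\<tau> r) \<otimes>\<^bsub>B\<^esub> c) :: _ \<Rightarrow>\<^sub>0 'k) | r b c. b \<in> carrier B \<and> c \<in> carrier B} =
    {(pure (q f, q g) - pure (q f', q g') :: _ \<Rightarrow>\<^sub>0 'k) | f g f' g'. (f, g, f', g') \<in> rel_op \<tau>}" (is "?L = ?R")
  proof
    show "?L \<subseteq> ?R" by (auto simp: carrier_B q_mult rel_op_def) blast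
    show "?R \<subseteq> ?L" unfolding rel_op_def by (auto simp: q_mult[symmetric]) (use q_closed in blast)+
  qed
  thus ?thesis by (simp only: A.op_null_def A.tensor_null_def TO.N_def)
qed

lemma odot_null: "A.odot_null = TT.N"
proof -
  have "{(pure (b \<otimes>\<^bsub>B\<^esub> q (\<sigma> r), c) - pure (b, q (\<sigma> r) \<otimes>\<^bsub>B\<^esub> c) :: _ \<Rightarrow>\<^sub>0 'k) | r b c. b \<in> carrier B \<and> c \<in> carrier B} =
    {(pure (q f, q g) - pure (q f', q g') :: _ \<Rightarrow>\<^sub>0 'k) | f g f' g'. (f, g, f', g') \<in> rel_op \<sigma>}" (is "?L = ?R")
  proof
    show "?L \<subseteq> ?R" by (auto simp: carrier_B q_mult rel_op_def) blast
    show "?R \<subseteq> ?L" unfolding rel_op_def by (auto simp: q_mult[symmetric]) (use q_closed in blast)+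
  qed
  thus ?thesis by (simp only: A.odot_null_def A.tensor_null_def TT.N_def)
qed

end

text \<open>\<open>\<Phi>\<close> is the action on \<open>B \<diamondop> B\<close> and
  \<open>E f r\<close> stands for \<epsilon>(f r). Coassociativity and the counit identities are
  demanded on generators only, and coassociativity already for the lists, before any relation is
  imposed.\<close>

locale gen_coalgebra = gen_algebra I scA sg tg cop \<Phi>
  for I :: "('g word \<Rightarrow>\<^sub>0 'k::field) set"
    and scA :: "'k \<Rightarrow> 'a::{ring,monoid_mult} \<Rightarrow> 'a" and sg tg :: "'a \<Rightarrow> 'g"
    and cop :: "'g \<Rightarrow> ('g \<times> 'g) list"
    and \<Phi> :: "('g word \<Rightarrow>\<^sub>0 'k) \<Rightarrow> ('k, ('g word \<Rightarrow>\<^sub>0 'k) set \<times> ('g word \<Rightarrow>\<^sub>0 'k) set) lop" +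
  fixes E :: "('g word \<Rightarrow>\<^sub>0 'k) \<Rightarrow> 'a \<Rightarrow> 'a"
  assumes Phi_add: "\<Phi> (f + g) = \<Phi> f + \<Phi> g" and Phi_scale: "\<Phi> (cscale k f) = lop_scale k (\<Phi> f)"
    and Phi_mult: "\<Phi> (f * g) = \<Phi> f * \<Phi> g" and Phi_one: "app (\<Phi> 1) p = TD.pr p"
    and Phi_I: "f \<in> I \<Longrightarrow> \<Phi> f = 0" and Phi_pr: "app (\<Phi> f) (TD.pr p) = app (\<Phi> f) p"
    and pr_Phi: "TD.pr (app (\<Phi> f) p) = app (\<Phi> f) p"
    and Phi_gen: "app (\<Phi> (gen z)) (TD.Ten f h) = (\<Sum>(a, b)\<leftarrow>cop z. TD.Ten (gen a * f) (gen b * h))"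
    and cop_s: "cop (sg a) = [(sg a, sg 1)]" and cop_t: "cop (tg a) = [(sg 1, tg a)]"
    and cop_assoc: "(\<Sum>(a, b)\<leftarrow>cop z. \<Sum>(c, d)\<leftarrow>cop a. F c d b) =
       (\<Sum>(a, b)\<leftarrow>cop z. \<Sum>(c, d)\<leftarrow>cop b. (F a c d ::
          ('g word \<Rightarrow>\<^sub>0 'k) set \<times> ('g word \<Rightarrow>\<^sub>0 'k) set \<times> ('g word \<Rightarrow>\<^sub>0 'k) set \<Rightarrow>\<^sub>0 'k))"
    and E_add: "E (f + g) r = E f r + E g r"
    and E_scale: "E (cscale k f) r = scA k (E f r)" and E_mult: "E (f * g) r = E f (E g r)"
    and E_one: "E 1 r = r" and E_I: "f \<in> I \<Longrightarrow> E f r = 0"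
    and E_s: "E (gen (sg a)) r = a * r" and E_t: "E (gen (tg a)) r = r * a"
    and counit_l: "q (\<Sum>(a, b)\<leftarrow>cop z. gen (sg (E (gen a) r)) * gen b) = q (gen z * gen (sg r))"
    and counit_r: "q (\<Sum>(a, b)\<leftarrow>cop z. gen (tg (E (gen b) r)) * gen a) = q (gen z * gen (tg r))"
begin

abbreviation D :: "('g word \<Rightarrow>\<^sub>0 'k) \<Rightarrow> ('g word \<Rightarrow>\<^sub>0 'k) \<Rightarrow> (('g word \<Rightarrow>\<^sub>0 'k) set \<times> ('g word \<Rightarrow>\<^sub>0 'k) set \<Rightarrow>\<^sub>0 'k)" where
  "D \<equiv> TD.Ten"

lemma q_s1: "q (\<sigma> 1 * f) = q f"
  using A.s_one A.t_one by (simp add: q_mult[symmetric] q_one) (simp add: q_mult)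

lemma D_s1: "D (\<sigma> 1 * f) g = D f g" "D f (\<sigma> 1 * g) = D f g"
  by (simp_all add: TD.Ten_def q_s1)

lemma Phi_s: "app (\<Phi> (\<sigma> r)) (D f g) = D (\<sigma> r * f) g"
  and Phi_t: "app (\<Phi> (\<tau> r)) (D f g) = D f (\<tau> r * g)"
  by (simp_all add: Phi_gen cop_s cop_t D_s1)

lemma D_bal: "D (\<tau> r * f) g = D f (\<sigma> r * g)"
  by (rule TD.Ten_RF) (auto simp: rel_dia_def)

text \<open>The balancing relations concern multiplication from the left, so right multiplication by
  any pure tensor is well defined on \<open>B \<diamondop> B\<close>.\<close>

definition Rm :: "('g word \<Rightarrow>\<^sub>0 'k) \<Rightarrow> ('g word \<Rightarrow>\<^sub>0 'k) \<Rightarrow> ('k, ('g word \<Rightarrow>\<^sub>0 'k) set \<times> ('g word \<Rightarrow>\<^sub>0 'k) set) lop" where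
  "Rm a b = Lop (TD.extend (\<lambda>f g. D (f * a) (g * b)))"

lemma Rm_conds:
  "klin (\<lambda>f. D (f * a) (g * b))" "klin (\<lambda>g. D (f * a) (g * b))" "f \<in> I \<Longrightarrow> D (f * a) (g * b) = 0"
  "g \<in> I \<Longrightarrow> D (f * a) (g * b) = 0" "(f, g, f', g') \<in> rel_dia \<sigma> \<tau> \<Longrightarrow> D (f * a) (g * b) = D (f' * a) (g' * b)"
proof -
  show "klin (\<lambda>f. D (f * a) (g * b))" "klin (\<lambda>g. D (f * a) (g * b))"
    by (auto intro!: klinI simp: distrib_right TD.Ten_add cscale_multl TD.Ten_scale)
  show "f \<in> I \<Longrightarrow> D (f * a) (g * b) = 0" "g \<in> I \<Longrightarrow> D (f * a) (g * b) = 0"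
    by (simp_all add: I_mult TD.Ten_I)
  show "(f, g, f', g') \<in> rel_dia \<sigma> \<tau> \<Longrightarrow> D (f * a) (g * b) = D (f' * a) (g' * b)"
    by (erule rel_diaE) (simp add: mult.assoc D_bal)
qed

lemma Rm_D: "app (Rm a b) (D f g) = D (f * a) (g * b)"
  unfolding Rm_def app_Lop[OF TD.klin_extend] by (rule TD.extend_Ten) (rule Rm_conds; assumption?)+

lemma Rm_pr: "app (Rm a b) (TD.pr p) = app (Rm a b) p"
  unfolding Rm_def app_Lop[OF TD.klin_extend] by (rule TD.extend_pr) (rule Rm_conds; assumption?)+

lemma Rm_pure: "app (Rm a b) (pure (q f, q g)) = D (f * a) (g * b)"
  unfolding Rm_def app_Lop[OF TD.klin_extend] by (rule TD.extend_pure) (rule Rm_conds; assumption?)+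

lemma pr_Rm: "TD.pr (app (Rm a b) p) = app (Rm a b) p"
  by (rule TD.Ten_eq[where F = "\<lambda>p. TD.pr (app (Rm a b) p)" and G = "app (Rm a b)"])
    (simp_all add: klin_comp[OF TD.klin_pr klin_app] klin_app Rm_pr Rm_D TD.pr_Ten)

lemma Rm_Phi: "app (Rm a b) (app (\<Phi> f) p) = app (\<Phi> f) (app (Rm a b) p)"
proof (induction f arbitrary: p rule: falg_induct)
  case zero
  thus ?case using Phi_I[OF I_zero] by (simp add: app_simps klin_zero[OF klin_app])
next
  case one
  thus ?case by (simp add: Phi_one Rm_pr pr_Rm)
next
  case (gen g f)
  have "app (Rm a b) (app (\<Phi> (gen g)) p) = app (\<Phi> (gen g)) (app (Rm a b) p)" for p
    by (rule TD.Ten_eq[where F = "\<lambda>p. app (Rm a b) (app (\<Phi> (gen g)) p)" and G = "\<lambda>p. app (\<Phi> (gen g)) (app (Rm a b) p)"])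
      (simp_all add: klin_comp[OF klin_app klin_app] Phi_pr Rm_pr Phi_gen Rm_D klin_sum_list[OF klin_app] split_def mult.assoc)
  thus ?case by (simp add: Phi_mult app_simps gen)
qed (simp_all add: Phi_add Phi_scale app_simps klin_add[OF klin_app] klin_scale[OF klin_app])

definition \<Delta> :: "('g word \<Rightarrow>\<^sub>0 'k) set \<Rightarrow> (('g word \<Rightarrow>\<^sub>0 'k) set \<times> ('g word \<Rightarrow>\<^sub>0 'k) set \<Rightarrow>\<^sub>0 'k) set" where
  "\<Delta> b = TD.cls (app (\<Phi> (rp b)) (D 1 1))"

definition \<epsilon> :: "('g word \<Rightarrow>\<^sub>0 'k) set \<Rightarrow> 'a" where
  "\<epsilon> b = E (rp b) 1"

lemma Phi_cong: "q f = q g \<Longrightarrow> \<Phi> f = \<Phi> g"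
  using Phi_I[of "f - g"] additive_diff[of \<Phi>, OF Phi_add] by (simp add: q_eq_iff)

lemma E_cong: "q f = q g \<Longrightarrow> E f r = E g r"
  using E_I[of "f - g" r] additive_diff[of "\<lambda>f. E f r", OF E_add] by (simp add: q_eq_iff)

lemma Delta_q: "\<Delta> (q f) = TD.cls (app (\<Phi> f) (D 1 1))"
  using Phi_cong[OF q_rp[OF q_closed]] by (simp add: \<Delta>_def)

lemma eps_q: "\<epsilon> (q f) = E f 1"
  using E_cong[OF q_rp[OF q_closed]] by (simp add: \<epsilon>_def)

lemma in_Delta: "p \<in> \<Delta> (q f) \<longleftrightarrow> Poly_Mapping.keys p \<subseteq> TD.CC \<and> TD.pr p = app (\<Phi> f) (D 1 1)"
  by (simp add: Delta_q TD.cls_def)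

lemma carrier_eq:
  fixes F G :: "(('g word \<Rightarrow>\<^sub>0 'k) set \<times> ('g word \<Rightarrow>\<^sub>0 'k) set \<Rightarrow>\<^sub>0 'k) \<Rightarrow> ('z \<Rightarrow>\<^sub>0 'k)"
  assumes "klin F" "klin G" "\<And>f g. F (pure (q f, q g)) = G (pure (q f, q g))" "Poly_Mapping.keys p \<subseteq> TD.CC"
  shows "F p = G p"
proof -
  have "F (TD.cr p) = G (TD.cr p)"
    by (rule klin_eqI[where f = "\<lambda>p. F (TD.cr p)" and g = "\<lambda>p. G (TD.cr p)"])
      (auto simp: klin_comp[OF assms(1) TD.klin_cr] klin_comp[OF assms(2) TD.klin_cr] TD.cr_pure assms(3) carrier_B
        klin_zero[OF assms(1)] klin_zero[OF assms(2)])
  thus ?thesis by (simp add: TD.cr_id[OF assms(4)])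
qed

lemma keys_pushforward:
  assumes "Poly_Mapping.keys p \<subseteq> S" "\<And>u. u \<in> S \<Longrightarrow> h u \<in> S'"
  shows "Poly_Mapping.keys (pushforward h p) \<subseteq> S'"
proof -
  have "Poly_Mapping.keys (pushforward h p) \<subseteq> (\<Union>u\<in>Poly_Mapping.keys p. Poly_Mapping.keys (Poly_Mapping.single (h u) (Poly_Mapping.lookup p u)))"
    unfolding pushforward_def by (rule keys_sum)
  also have "\<dots> \<subseteq> S'" using assms by auto
  finally show ?thesis .
qed

lemma pushforward_right:
  assumes "Poly_Mapping.keys p \<subseteq> TD.CC"
  shows "TD.pr (pushforward (\<lambda>(u, v). (u \<otimes>\<^bsub>B\<^esub> q f, v \<otimes>\<^bsub>B\<^esub> q g)) p) = app (Rm f g) (TD.pr p)"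
  unfolding Rm_pr
  by (rule carrier_eq[OF klin_comp[OF TD.klin_pr klin_pushforward] klin_app _ assms])
    (simp add: Rm_pure q_mult TD.Ten_def[symmetric])

lemma pushforward_st:
  assumes "Poly_Mapping.keys p \<subseteq> TD.CC"
  shows "TD.pr (pushforward (\<lambda>(u, v). (q (\<sigma> r) \<otimes>\<^bsub>B\<^esub> u, q (\<tau> a) \<otimes>\<^bsub>B\<^esub> v)) p) = app (\<Phi> (\<sigma> r * \<tau> a)) (TD.pr p)"
  unfolding Phi_pr
  by (rule carrier_eq[OF klin_comp[OF TD.klin_pr klin_pushforward] klin_app _ assms])
    (subst Phi_pr[symmetric], simp add: Phi_mult app_simps TD.Ten_def[symmetric] Phi_s Phi_t q_mult)

text \<open>For a pure tensor \<open>r\<close>, multiplying \<open>p\<close> by it is an operator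
  \<open>Rm\<close>, which commutes with \<open>\<Phi> f\<close>; so the product represents
  \<open>\<Phi> f\<close> applied to \<open>r\<close>. As \<open>p\<close> is an arbitrary
  representative, this includes the Takeuchi condition.\<close>

lemma pr_tensor_mult:
  assumes p: "Poly_Mapping.keys p \<subseteq> TD.CC" "TD.pr p = app (\<Phi> f) (D 1 1)"
    and r: "Poly_Mapping.keys r \<subseteq> TD.CC"
  shows "TD.pr (A.tensor_mult p r) = app (\<Phi> f) (TD.pr r)"
proof -
  have "A.tensor_mult p r = lext (\<lambda>u. lext (\<lambda>v. pure (fst u \<otimes>\<^bsub>B\<^esub> fst v, snd u \<otimes>\<^bsub>B\<^esub> snd v)) r) p"
    unfolding A.tensor_mult_def lext_def cscale_sum
    by (intro sum.cong refl) (simp add: single_eq_cscale[of _ "Poly_Mapping.lookup _ _ * _"])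
  \<comment> \<open>Let the outer linear extension run over \<open>r\<close>, so that
    \<open>r\<close> may be taken pure.\<close>
  also have "\<dots> = lext (\<lambda>v. lext (\<lambda>u. pure (fst u \<otimes>\<^bsub>B\<^esub> fst v, snd u \<otimes>\<^bsub>B\<^esub> snd v)) p) r"
    unfolding lext_def cscale_sum by (subst sum.swap) (simp add: mult.commute)
  finally have "TD.pr (A.tensor_mult p r) = TD.pr (lext (\<lambda>v. pushforward (\<lambda>u. (fst u \<otimes>\<^bsub>B\<^esub> fst v, snd u \<otimes>\<^bsub>B\<^esub> snd v)) p) r)"
    by (simp add: pushforward_lext)
  also have "\<dots> = app (\<Phi> f) r"
  proof (rule carrier_eq[OF klin_comp[OF TD.klin_pr klin_lext] klin_app _ r])
    fix g h
    have "TD.pr (pushforward (\<lambda>(u, v). (u \<otimes>\<^bsub>B\<^esub> q g, v \<otimes>\<^bsub>B\<^esub> q h)) p) = app (\<Phi> f) (pure (q g, q h))"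
      using Phi_pr[of f "pure (q g, q h)"]
      by (simp add: pushforward_right[OF p(1)] p(2) Rm_Phi Rm_D TD.Ten_def[symmetric])
    thus "TD.pr (lext (\<lambda>v. pushforward (\<lambda>u. (fst u \<otimes>\<^bsub>B\<^esub> fst v, snd u \<otimes>\<^bsub>B\<^esub> snd v)) p) (pure (q g, q h))) = app (\<Phi> f) (pure (q g, q h))"
      by (simp add: split_def)
  qed
  finally show ?thesis by (simp add: Phi_pr)
qed

lemma keys_tensor_mult:
  assumes "Poly_Mapping.keys p \<subseteq> TD.CC" "Poly_Mapping.keys r \<subseteq> TD.CC"
  shows "Poly_Mapping.keys (A.tensor_mult p r) \<subseteq> TD.CC"
proof -
  have "Poly_Mapping.keys (A.tensor_mult p r) \<subseteq> (\<Union>u\<in>Poly_Mapping.keys p. \<Union>v\<in>Poly_Mapping.keys r.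
     Poly_Mapping.keys (Poly_Mapping.single (fst u \<otimes>\<^bsub>B\<^esub> fst v, snd u \<otimes>\<^bsub>B\<^esub> snd v) (Poly_Mapping.lookup p u * Poly_Mapping.lookup r v)))"
    unfolding A.tensor_mult_def by (rule order_trans[OF keys_sum UN_mono[OF subset_refl keys_sum]])
  also have "\<dots> \<subseteq> TD.CC"
    using assms by (auto split: if_splits intro!: A.m_closed)
  finally show ?thesis .
qed

end

lemma klin_sum_list_fun: "(\<And>x. klin (F x)) \<Longrightarrow> klin (\<lambda>p. \<Sum>x\<leftarrow>xs. F x p)"
  by (induction xs) (auto simp: klin_def)

lemma klin_const_zero: "klin (\<lambda>p. 0)"
  by (simp add: klin_def)

lemma klin_plus: "klin f \<Longrightarrow> klin g \<Longrightarrow> klin (\<lambda>p. f p + g p)"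
  by (simp add: klin_def)

lemma klin_cscale_comp: "klin f \<Longrightarrow> klin (\<lambda>p. cscale k (f p))"
  by (rule klin_comp[OF klin_cscale])

section \<open>Coassociativity\<close>

context gen_coalgebra
begin

lemma subspace_dia3: "free_vs.subspace A.dia3_null"
  by (simp add: A.dia3_null_def free_vs.subspace_span)

definition p3 :: "(('g word \<Rightarrow>\<^sub>0 'k) set \<times> ('g word \<Rightarrow>\<^sub>0 'k) set \<times> ('g word \<Rightarrow>\<^sub>0 'k) set \<Rightarrow>\<^sub>0 'k) \<Rightarrow> _" where
  "p3 = nf A.dia3_null"

lemma klin_p3: "klin p3"
  unfolding p3_def by (rule klin_nf[OF subspace_dia3])

lemma p3_zero_iff: "p3 x = 0 \<longleftrightarrow> x \<in> A.dia3_null"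
  unfolding p3_def by (rule nf_zero_iff[OF subspace_dia3])

text \<open>The maps p \<mapsto> p \<otimes> h and, for \<open>ay\<close>, p \<mapsto> h \<otimes> p
  into the threefold tensor product.\<close>

definition ax where "ax h p = p3 (pushforward (\<lambda>(b, c). (b, c, q h)) (TD.cr p))"
definition ay where "ay h p = p3 (pushforward (\<lambda>(c, e). (q h, c, e)) (TD.cr p))"
definition T3 where "T3 f g h = p3 (pure (q f, q g, q h))"

lemma klin_ax: "klin (ax h)" and klin_ay: "klin (ay h)"
  unfolding ax_def ay_def
  by (rule klin_comp[OF klin_p3 klin_comp[OF klin_pushforward TD.klin_cr]])+

lemma cr_N': "p \<in> TD.N' \<Longrightarrow> TD.cr p \<in> A.dia_null"
  using TD.N'_N[OF _ TD.keys_cr] by (simp add: dia_null TD.pr_zero_iff[symmetric] TD.pr_cr)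

lemma ax_pr: "ax h (TD.pr p) = ax h p"
proof -
  have "ax h p = 0" if "p \<in> TD.N'" for p
    unfolding ax_def p3_zero_iff A.dia3_null_def using cr_N'[OF that] q_closed by (blast intro: free_vs.span_base)
  thus ?thesis unfolding TD.pr_def by (intro klin_nf_absorb TD.subspace_N' klin_ax)
qed

lemma ay_pr: "ay h (TD.pr p) = ay h p"
proof -
  have "ay h p = 0" if "p \<in> TD.N'" for p
    unfolding ay_def p3_zero_iff A.dia3_null_def using cr_N'[OF that] q_closed by (blast intro: free_vs.span_base)
  thus ?thesis unfolding TD.pr_def by (intro klin_nf_absorb TD.subspace_N' klin_ay)
qed

lemma ax_D: "ax h (D f g) = T3 f g h" and ay_D: "ay f (D g h) = T3 f g h"
  by (simp_all only: TD.Ten_def ax_pr ay_pr) (simp_all add: ax_def ay_def TD.cr_pure T3_def)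

lemma ax_carrier: "Poly_Mapping.keys p \<subseteq> TD.CC \<Longrightarrow> p3 (pushforward (\<lambda>(b, c). (b, c, q h)) p) = ax h p"
  and ay_carrier: "Poly_Mapping.keys p \<subseteq> TD.CC \<Longrightarrow> p3 (pushforward (\<lambda>(c, e). (q h, c, e)) p) = ay h p"
  by (simp_all add: ax_def ay_def TD.cr_id)

lemma klin_T3: "klin (\<lambda>f. T3 f g h)" "klin (\<lambda>g. T3 f g h)" "klin (\<lambda>h. T3 f g h)"
  using klin_comp[OF klin_ax TD.klin_Ten(1), of h g] klin_comp[OF klin_ax TD.klin_Ten(2), of h f]
    klin_comp[OF klin_ay TD.klin_Ten(2), of f g]
  by (simp_all add: ax_D ay_D)

lemma T3_I: "h \<in> I \<Longrightarrow> T3 f g h = 0" "f \<in> I \<Longrightarrow> T3 f g h = 0"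
  using TD.Ten_I(2)[of h g] TD.Ten_I(1)[of f g] klin_zero[OF klin_ay] klin_zero[OF klin_ax]
  by (simp_all add: ax_D[symmetric]) (simp_all add: ax_D ay_D[symmetric])

lemma T3_bal: "T3 (\<tau> r * f) g h = T3 f (\<sigma> r * g) h" "T3 f (\<tau> r * g) h = T3 f g (\<sigma> r * h)"
proof -
  show "T3 (\<tau> r * f) g h = T3 f (\<sigma> r * g) h" unfolding ax_D[symmetric] D_bal ..
  show "T3 f (\<tau> r * g) h = T3 f g (\<sigma> r * h)" unfolding ay_D[symmetric] D_bal ..
qed

lemma klin_ax_index: "klin (\<lambda>h. ax h p)"
proof (rule klinI)
  show "ax (h + h') p = ax h p + ax h' p" for h h'
    by (rule TD.Ten_eq[where F = "ax (h + h')" and G = "\<lambda>p. ax h p + ax h' p"])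
      (simp_all add: klin_ax klin_plus ax_pr ax_D klin_add[OF klin_T3(3)])
  show "ax (cscale k h) p = cscale k (ax h p)" for k h
    by (rule TD.Ten_eq[where F = "ax (cscale k h)" and G = "\<lambda>p. cscale k (ax h p)"])
      (simp_all add: klin_ax klin_cscale_comp ax_pr ax_D klin_scale[OF klin_T3(3)])
qed

lemma klin_ay_index: "klin (\<lambda>h. ay h p)"
proof (rule klinI)
  show "ay (h + h') p = ay h p + ay h' p" for h h'
    by (rule TD.Ten_eq[where F = "ay (h + h')" and G = "\<lambda>p. ay h p + ay h' p"])
      (simp_all add: klin_ay klin_plus ay_pr ay_D klin_add[OF klin_T3(1)])
  show "ay (cscale k h) p = cscale k (ay h p)" for k h
    by (rule TD.Ten_eq[where F = "ay (cscale k h)" and G = "\<lambda>p. cscale k (ay h p)"])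
      (simp_all add: klin_ay klin_cscale_comp ay_pr ay_D klin_scale[OF klin_T3(1)])
qed

lemma ax_I: "h \<in> I \<Longrightarrow> ax h p = 0" and ay_I: "h \<in> I \<Longrightarrow> ay h p = 0"
  by (rule TD.Ten_eq[where F = "ax h" and G = "\<lambda>p. 0"], simp_all add: klin_ax klin_const_zero ax_pr ax_D T3_I)
    (rule TD.Ten_eq[where F = "ay h" and G = "\<lambda>p. 0"], simp_all add: klin_ay klin_const_zero ay_pr ay_D T3_I)

lemma ax_tau: "ax h (app (\<Phi> (\<tau> r)) p) = ax (\<sigma> r * h) p"
  by (rule TD.Ten_eq[where F = "\<lambda>p. ax h (app (\<Phi> (\<tau> r)) p)" and G = "ax (\<sigma> r * h)"])
    (simp_all add: klin_comp[OF klin_ax klin_app] klin_ax Phi_pr ax_pr Phi_t ax_D T3_bal)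

lemma ay_sigma: "ay h (app (\<Phi> (\<sigma> r)) p) = ay (\<tau> r * h) p"
  by (rule TD.Ten_eq[where F = "\<lambda>p. ay h (app (\<Phi> (\<sigma> r)) p)" and G = "ay (\<tau> r * h)"])
    (simp_all add: klin_comp[OF klin_ay klin_app] klin_ay Phi_pr ay_pr Phi_s ay_D T3_bal)

text \<open>The maps \<open>\<Delta> \<otimes> id\<close> and \<open>id \<otimes> \<Delta>\<close>.\<close>

definition "copl = TD.extend (\<lambda>f l. ax l (app (\<Phi> f) (D 1 1)))"
definition "copr = TD.extend (\<lambda>f l. ay f (app (\<Phi> l) (D 1 1)))"

lemma copl_conds:
  "klin (\<lambda>f. ax l (app (\<Phi> f) (D 1 1)))" "klin (\<lambda>l. ax l (app (\<Phi> f) (D 1 1)))"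
  "f \<in> I \<Longrightarrow> ax l (app (\<Phi> f) (D 1 1)) = 0" "l \<in> I \<Longrightarrow> ax l (app (\<Phi> f) (D 1 1)) = 0"
  "(f, l, f', l') \<in> rel_dia \<sigma> \<tau> \<Longrightarrow> ax l (app (\<Phi> f) (D 1 1)) = ax l' (app (\<Phi> f') (D 1 1))"
proof -
  show "klin (\<lambda>f. ax l (app (\<Phi> f) (D 1 1)))"
    by (rule klinI) (simp_all add: Phi_add Phi_scale app_simps klin_add[OF klin_ax] klin_scale[OF klin_ax])
  show "klin (\<lambda>l. ax l (app (\<Phi> f) (D 1 1)))" by (rule klin_ax_index)
  show "f \<in> I \<Longrightarrow> ax l (app (\<Phi> f) (D 1 1)) = 0" by (simp add: Phi_I app_simps klin_zero[OF klin_ax])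
  show "l \<in> I \<Longrightarrow> ax l (app (\<Phi> f) (D 1 1)) = 0" by (rule ax_I)
  show "(f, l, f', l') \<in> rel_dia \<sigma> \<tau> \<Longrightarrow> ax l (app (\<Phi> f) (D 1 1)) = ax l' (app (\<Phi> f') (D 1 1))"
    by (erule rel_diaE) (simp add: Phi_mult app_simps ax_tau)
qed

lemma copr_conds:
  "klin (\<lambda>f. ay f (app (\<Phi> l) (D 1 1)))" "klin (\<lambda>l. ay f (app (\<Phi> l) (D 1 1)))"
  "f \<in> I \<Longrightarrow> ay f (app (\<Phi> l) (D 1 1)) = 0" "l \<in> I \<Longrightarrow> ay f (app (\<Phi> l) (D 1 1)) = 0"
  "(f, l, f', l') \<in> rel_dia \<sigma> \<tau> \<Longrightarrow> ay f (app (\<Phi> l) (D 1 1)) = ay f' (app (\<Phi> l') (D 1 1))"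
proof -
  show "klin (\<lambda>l. ay f (app (\<Phi> l) (D 1 1)))"
    by (rule klinI) (simp_all add: Phi_add Phi_scale app_simps klin_add[OF klin_ay] klin_scale[OF klin_ay])
  show "klin (\<lambda>f. ay f (app (\<Phi> l) (D 1 1)))" by (rule klin_ay_index)
  show "l \<in> I \<Longrightarrow> ay f (app (\<Phi> l) (D 1 1)) = 0" by (simp add: Phi_I app_simps klin_zero[OF klin_ay])
  show "f \<in> I \<Longrightarrow> ay f (app (\<Phi> l) (D 1 1)) = 0" by (rule ay_I)
  show "(f, l, f', l') \<in> rel_dia \<sigma> \<tau> \<Longrightarrow> ay f (app (\<Phi> l) (D 1 1)) = ay f' (app (\<Phi> l') (D 1 1))"
    by (erule rel_diaE) (simp add: Phi_mult app_simps ay_sigma)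
qed

lemma klin_copl: "klin copl" and klin_copr: "klin copr"
  by (simp_all add: copl_def copr_def TD.klin_extend)

lemma copl_simps: "copl (pure (q f, q l)) = ax l (app (\<Phi> f) (D 1 1))" "copl (TD.pr p) = copl p"
    "copl (D f l) = ax l (app (\<Phi> f) (D 1 1))"
proof -
  show "copl (pure (q f, q l)) = ax l (app (\<Phi> f) (D 1 1))"
    unfolding copl_def by (rule TD.extend_pure) (blast intro: copl_conds)+
  show "copl (TD.pr p) = copl p"
    unfolding copl_def by (rule TD.extend_pr) (blast intro: copl_conds)+
  show "copl (D f l) = ax l (app (\<Phi> f) (D 1 1))"
    unfolding copl_def by (rule TD.extend_Ten) (blast intro: copl_conds)+
qed

lemma copr_simps: "copr (pure (q f, q l)) = ay f (app (\<Phi> l) (D 1 1))" "copr (TD.pr p) = copr p"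
    "copr (D f l) = ay f (app (\<Phi> l) (D 1 1))"
proof -
  show "copr (pure (q f, q l)) = ay f (app (\<Phi> l) (D 1 1))"
    unfolding copr_def by (rule TD.extend_pure) (blast intro: copr_conds)+
  show "copr (TD.pr p) = copr p"
    unfolding copr_def by (rule TD.extend_pr) (blast intro: copr_conds)+
  show "copr (D f l) = ay f (app (\<Phi> l) (D 1 1))"
    unfolding copr_def by (rule TD.extend_Ten) (blast intro: copr_conds)+
qed

text \<open>A generator acts on threefold tensors through its iterated coproduct, here with the
  coproduct applied to the first leg.\<close>

definition act3 where "act3 z f g h = (\<Sum>(a, b)\<leftarrow>cop z. ax (gen b * h) (app (\<Phi> (gen a)) (D f g)))"

text \<open>Coassociativity on generators: the iterated coproduct may equally be formed in the
  second leg.\<close>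

lemma act3_alt: "act3 z f g h = (\<Sum>(a, b)\<leftarrow>cop z. ay (gen a * f) (app (\<Phi> (gen b)) (D g h)))"
proof -
  have "act3 z f g h = (\<Sum>(a, b)\<leftarrow>cop z. \<Sum>(c, d)\<leftarrow>cop a. T3 (gen c * f) (gen d * g) (gen b * h))"
    by (simp add: act3_def Phi_gen klin_sum_list[OF klin_ax] split_def ax_D)
  also have "\<dots> = (\<Sum>(a, b)\<leftarrow>cop z. \<Sum>(c, d)\<leftarrow>cop b. T3 (gen a * f) (gen c * g) (gen d * h))"
    by (rule cop_assoc)
  finally show ?thesis by (simp add: Phi_gen klin_sum_list[OF klin_ay] split_def ay_D)
qed

definition "carrier3 = {(a, b, c). a \<in> carrier B \<and> b \<in> carrier B \<and> c \<in> carrier B}"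

definition Act3 where "Act3 z = lext (\<lambda>(a, b, c). if (a, b, c) \<in> carrier3 then act3 z (rp a) (rp b) (rp c) else 0)"

lemma klin_Act3: "klin (Act3 z)"
  by (simp add: Act3_def klin_lext)

lemma klin_act3: "klin (\<lambda>f. act3 z f g h)" "klin (\<lambda>g. act3 z f g h)" "klin (\<lambda>h. act3 z f g h)"
  unfolding act3_alt[of z f g]
  unfolding act3_def split_def
  by (rule klin_sum_list_fun, rule klin_comp[OF klin_ax], rule klin_comp[OF klin_app], rule TD.klin_Ten)+
    (rule klin_sum_list_fun, rule klin_comp[OF klin_ay], rule klin_comp[OF klin_app], rule TD.klin_Ten)

lemma act3_I: "f \<in> I \<Longrightarrow> act3 z f g h = 0" "g \<in> I \<Longrightarrow> act3 z f g h = 0" "h \<in> I \<Longrightarrow> act3 z f g h = 0"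
proof -
  show "f \<in> I \<Longrightarrow> act3 z f g h = 0" "g \<in> I \<Longrightarrow> act3 z f g h = 0"
    by (simp_all add: act3_def TD.Ten_I klin_zero[OF klin_app] klin_zero[OF klin_ax] split_def)
  show "h \<in> I \<Longrightarrow> act3 z f g h = 0"
    by (simp add: act3_alt TD.Ten_I klin_zero[OF klin_app] klin_zero[OF klin_ay] split_def)
qed

lemma Act3_pure: "Act3 z (pure (q f, q g, q h)) = act3 z f g h"
proof -
  have "act3 z (rp (q f)) g' h' = act3 z f g' h'" for g' h'
    using act3_I(1)[OF rp_q, of z f g' h'] by (simp add: klin_diff[OF klin_act3(1)])
  moreover have "act3 z f' (rp (q g)) h' = act3 z f' g h'" for f' h'
    using act3_I(2)[OF rp_q, of z f' g h'] by (simp add: klin_diff[OF klin_act3(2)])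
  moreover have "act3 z f' g' (rp (q h)) = act3 z f' g' h" for f' g'
    using act3_I(3)[OF rp_q, of z f' g' h] by (simp add: klin_diff[OF klin_act3(3)])
  ultimately show ?thesis by (simp add: Act3_def carrier3_def)
qed

text \<open>The definition of \<open>act3\<close> shows that balancing is respected in the first two
  places, and \<open>act3_alt\<close> shows it for the last two.\<close>

lemma Act3_p3: "Act3 z (p3 x) = Act3 z x"
proof -
  have 1: "Act3 z (pushforward (\<lambda>(b, c). (b, c, e)) n) = 0" if n: "n \<in> A.dia_null" and "e \<in> carrier B" for n e
  proof -
    from that(2) obtain h where e: "e = q h" by (auto simp: carrier_B)
    have c: "(f, g, f', g') \<in> rel_dia \<sigma> \<tau> \<Longrightarrow> act3 z f g h = act3 z f' g' h" for f g f' g'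
      by (erule rel_diaE) (simp add: act3_def D_bal)
    have "Act3 z (pushforward (\<lambda>(b, c). (b, c, e)) n) = TD.extend (\<lambda>f g. act3 z f g h) n"
      by (rule carrier_eq[OF klin_comp[OF klin_Act3 klin_pushforward] TD.klin_extend])
        (subst TD.extend_pure, (blast intro: klin_act3 act3_I)+, simp add: e Act3_pure, rule TD.keys_N[OF n[unfolded dia_null]])
    also have "\<dots> = 0"
      by (rule TD.extend_N) (blast intro: klin_act3 act3_I c n[unfolded dia_null])+
    finally show ?thesis .
  qed
  have 2: "Act3 z (pushforward (\<lambda>(c, e). (b, c, e)) n) = 0" if n: "n \<in> A.dia_null" and "b \<in> carrier B" for n b
  proof -
    from that(2) obtain h where e: "b = q h" by (auto simp: carrier_B)
    have c: "(f, g, f', g') \<in> rel_dia \<sigma> \<tau> \<Longrightarrow> act3 z h f g = act3 z h f' g'" for f g f' g'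
      by (erule rel_diaE) (simp add: act3_alt D_bal)
    have "Act3 z (pushforward (\<lambda>(c, e). (b, c, e)) n) = TD.extend (\<lambda>f g. act3 z h f g) n"
      by (rule carrier_eq[OF klin_comp[OF klin_Act3 klin_pushforward] TD.klin_extend])
        (subst TD.extend_pure, (blast intro: klin_act3 act3_I)+, simp add: e Act3_pure, rule TD.keys_N[OF n[unfolded dia_null]])
    also have "\<dots> = 0"
      by (rule TD.extend_N) (blast intro: klin_act3 act3_I c n[unfolded dia_null])+
    finally show ?thesis .
  qed
  have "Act3 z x = 0" if "x \<in> A.dia3_null" for x
    using that unfolding A.dia3_null_def
    by (rule span_zero_klin[OF _ klin_Act3]) (use 1 2 in blast)
  thus ?thesis unfolding p3_def by (intro klin_nf_absorb subspace_dia3 klin_Act3)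
qed

lemma Act3_T3: "Act3 z (T3 f g h) = act3 z f g h"
  by (simp add: T3_def Act3_p3 Act3_pure)

lemma Act3_ax: "Act3 z (ax h p) = (\<Sum>(a, b)\<leftarrow>cop z. ax (gen b * h) (app (\<Phi> (gen a)) p))"
  by (rule TD.Ten_eq[where F = "\<lambda>p. Act3 z (ax h p)" and G = "\<lambda>p. \<Sum>(a, b)\<leftarrow>cop z. ax (gen b * h) (app (\<Phi> (gen a)) p)"])
    (auto intro!: klin_comp[OF klin_Act3 klin_ax] klin_sum_list_fun klin_comp[OF klin_ax klin_app]
      simp: ax_pr Phi_pr ax_D Act3_T3 act3_def split_def)

lemma Act3_ay: "Act3 z (ay h p) = (\<Sum>(a, b)\<leftarrow>cop z. ay (gen a * h) (app (\<Phi> (gen b)) p))"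
  by (rule TD.Ten_eq[where F = "\<lambda>p. Act3 z (ay h p)" and G = "\<lambda>p. \<Sum>(a, b)\<leftarrow>cop z. ay (gen a * h) (app (\<Phi> (gen b)) p)"])
    (auto intro!: klin_comp[OF klin_Act3 klin_ay] klin_sum_list_fun klin_comp[OF klin_ay klin_app]
      simp: ay_pr Phi_pr ay_D Act3_T3 act3_alt split_def)

lemma copl_gen: "copl (app (\<Phi> (gen z)) p) = Act3 z (copl p)"
  by (rule TD.Ten_eq[where F = "\<lambda>p. copl (app (\<Phi> (gen z)) p)" and G = "\<lambda>p. Act3 z (copl p)"])
    (simp_all add: klin_comp[OF klin_copl klin_app] klin_comp[OF klin_Act3 klin_copl] Phi_pr copl_simps Phi_gen
      klin_sum_list[OF klin_copl] Act3_ax split_def Phi_mult app_simps)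

lemma copr_gen: "copr (app (\<Phi> (gen z)) p) = Act3 z (copr p)"
  by (rule TD.Ten_eq[where F = "\<lambda>p. copr (app (\<Phi> (gen z)) p)" and G = "\<lambda>p. Act3 z (copr p)"])
    (simp_all add: klin_comp[OF klin_copr klin_app] klin_comp[OF klin_Act3 klin_copr] Phi_pr copr_simps Phi_gen
      klin_sum_list[OF klin_copr] Act3_ay split_def Phi_mult app_simps)

text \<open>Both maps intertwine the action of a generator with \<open>Act3\<close> and agree on 1
  \<diamondop> 1, so induction over words applies.\<close>

lemma copl_copr: "copl (app (\<Phi> f) (D 1 1)) = copr (app (\<Phi> f) (D 1 1))"
proof (induction f rule: falg_induct)
  case zero
  show ?case by (simp add: Phi_I[OF I_zero] app_simps klin_zero[OF klin_copl] klin_zero[OF klin_copr])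
next
  case one
  show ?case by (simp add: Phi_one copl_simps copr_simps TD.pr_Ten ax_D ay_D)
qed (simp_all add: Phi_mult app_simps copl_gen copr_gen Phi_add Phi_scale klin_add[OF klin_copl] klin_add[OF klin_copr]
   klin_scale[OF klin_copl] klin_scale[OF klin_copr])

lemma coassoc:
  assumes Dc: "\<And>c. c \<in> carrier B \<Longrightarrow> Dc c \<in> \<Delta> c" and p: "p \<in> \<Delta> (q f)"
  shows "A.linear_tensor Dc (\<lambda>(u, v) (u1, u2). (u1, u2, v)) fst p
      - A.linear_tensor Dc (\<lambda>(u, v) (v1, v2). (u, v1, v2)) snd p \<in> A.dia3_null"
proof -
  from p have k: "Poly_Mapping.keys p \<subseteq> TD.CC" and pp: "TD.pr p = app (\<Phi> f) (D 1 1)" by (simp_all add: in_Delta)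
  have Dk: "Poly_Mapping.keys (Dc (q g)) \<subseteq> TD.CC" "TD.pr (Dc (q g)) = app (\<Phi> g) (D 1 1)" for g
    using Dc[of "q g"] by (simp_all add: in_Delta)
  have "p3 (A.linear_tensor Dc (\<lambda>(u, v) (u1, u2). (u1, u2, v)) fst p) = copl p"
    unfolding A.linear_tensor_def lext_def[symmetric]
  proof (rule carrier_eq[OF klin_comp[OF klin_p3 klin_lext] klin_copl _ k])
    fix g h
    show "p3 (lext (\<lambda>u. pushforward ((\<lambda>(u, v) (u1, u2). (u1, u2, v)) u) (Dc (fst u))) (pure (q g, q h))) = copl (pure (q g, q h))"
      using ax_carrier[OF Dk(1), of h g] ax_pr[of h "Dc (q g)"] by (simp add: copl_simps Dk(2))
  qed
  moreover have "p3 (A.linear_tensor Dc (\<lambda>(u, v) (v1, v2). (u, v1, v2)) snd p) = copr p"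
    unfolding A.linear_tensor_def lext_def[symmetric]
  proof (rule carrier_eq[OF klin_comp[OF klin_p3 klin_lext] klin_copr _ k])
    fix g h
    show "p3 (lext (\<lambda>u. pushforward ((\<lambda>(u, v) (v1, v2). (u, v1, v2)) u) (Dc (snd u))) (pure (q g, q h))) = copr (pure (q g, q h))"
      using ay_carrier[OF Dk(1), of g h] ay_pr[of g "Dc (q h)"] by (simp add: copr_simps Dk(2))
  qed
  moreover have "copl p = copr p"
    using copl_simps(2)[of p] copr_simps(2)[of p] by (simp add: pp copl_copr)
  ultimately show ?thesis by (simp add: p3_zero_iff[symmetric] klin_diff[OF klin_p3])
qed

section \<open>The counit axioms\<close>

abbreviation nI :: "('g word \<Rightarrow>\<^sub>0 'k) \<Rightarrow> ('g word \<Rightarrow>\<^sub>0 'k)" where "nI \<equiv> nf I"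

lemma klin_nI: "klin nI" by (rule klin_nf[OF subspace_I])

lemma nI_eq_iff: "nI f = nI g \<longleftrightarrow> q f = q g"
  by (simp add: nf_eq_iff[OF subspace_I] q_eq_iff)

lemma q_mult_cong: "q f = q f' \<Longrightarrow> q g = q g' \<Longrightarrow> q (f * g) = q (f' * g')"
  by (simp add: q_mult[symmetric])

lemma q_sigma_add: "q (\<sigma> (a + b)) = q (\<sigma> a + \<sigma> b)" and q_tau_add: "q (\<tau> (a + b)) = q (\<tau> a + \<tau> b)"
  and q_sigma_scale: "q (\<sigma> (scA k a)) = q (cscale k (\<sigma> a))" and q_tau_scale: "q (\<tau> (scA k a)) = q (cscale k (\<tau> a))"
  and q_sigma_mult: "q (\<sigma> (a * b)) = q (\<sigma> a * \<sigma> b)" and q_tau_mult: "q (\<tau> (b * a)) = q (\<tau> a * \<tau> b)"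
  using A.s_add[of a b] A.t_add[of a b] A.s_scale[of k a] A.t_scale[of k a] A.s_mult[of a b] A.t_mult[of b a]
  by (simp_all add: q_add q_scale q_mult)

lemma q_sigma_zero: "q (\<sigma> 0) = q 0" and q_tau_zero: "q (\<tau> 0) = q 0"
  using q_sigma_scale[of 0 0] q_tau_scale[of 0 0] by simp_all

text \<open>The map u \<diamondop> v \<mapsto> \<epsilon>(u) v. In \<open>counr\<close> it is the
  bar of \<epsilon>(v) times u. Elements of \<open>B\<close> are represented by their normal forms
  under \<open>nI\<close>.\<close>

definition "counl = TD.extend (\<lambda>f g. nI (\<sigma> (E f 1) * g))"
definition "counr = TD.extend (\<lambda>f g. nI (\<tau> (E g 1) * f))"

lemma nI_mult_add:
  "q h = q (h1 + h2) \<Longrightarrow> nI (h * f) = nI (h1 * f) + nI (h2 * f)"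
  "q h = q (cscale k h1) \<Longrightarrow> nI (h * f) = cscale k (nI (h1 * f))"
proof -
  show "q h = q (h1 + h2) \<Longrightarrow> nI (h * f) = nI (h1 * f) + nI (h2 * f)"
    using q_mult_cong[of h "h1 + h2" f f] by (simp add: klin_add[OF klin_nI, symmetric] nI_eq_iff distrib_right)
  show "q h = q (cscale k h1) \<Longrightarrow> nI (h * f) = cscale k (nI (h1 * f))"
    using q_mult_cong[of h "cscale k h1" f f] by (simp add: klin_scale[OF klin_nI, symmetric] nI_eq_iff cscale_multl)
qed

lemma nI_zero: "q h = q 0 \<Longrightarrow> nI (h * f) = 0"
  using q_mult_cong[of h 0 f f] nI_eq_iff[of "h * f" 0] klin_zero[OF klin_nI] by simp

lemma nI_I: "f \<in> I \<Longrightarrow> nI (h * f) = 0"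
  by (simp add: nf_zero_iff[OF subspace_I] I_mult)

lemma nI_mult_nI: "nI (h * nI f) = nI (h * f)"
  unfolding nI_eq_iff by (rule q_mult_cong) (simp_all add: q_nf)

lemma counl_conds:
  "klin (\<lambda>f. nI (\<sigma> (E f 1) * g))" "klin (\<lambda>g. nI (\<sigma> (E f 1) * g))"
  "f \<in> I \<Longrightarrow> nI (\<sigma> (E f 1) * g) = 0" "g \<in> I \<Longrightarrow> nI (\<sigma> (E f 1) * g) = 0"
  "(f, g, f', g') \<in> rel_dia \<sigma> \<tau> \<Longrightarrow> nI (\<sigma> (E f 1) * g) = nI (\<sigma> (E f' 1) * g')"
proof -
  show "klin (\<lambda>f. nI (\<sigma> (E f 1) * g))"
    by (rule klinI) (rule nI_mult_add, simp add: E_add E_scale q_sigma_add q_sigma_scale)+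
  show "klin (\<lambda>g. nI (\<sigma> (E f 1) * g))"
    by (rule klinI) (simp_all add: distrib_left cscale_multr klin_add[OF klin_nI] klin_scale[OF klin_nI])
  show "f \<in> I \<Longrightarrow> nI (\<sigma> (E f 1) * g) = 0" by (rule nI_zero) (simp add: E_I q_sigma_zero)
  show "g \<in> I \<Longrightarrow> nI (\<sigma> (E f 1) * g) = 0" by (rule nI_I)
  show "(f, g, f', g') \<in> rel_dia \<sigma> \<tau> \<Longrightarrow> nI (\<sigma> (E f 1) * g) = nI (\<sigma> (E f' 1) * g')"
    using q_mult_cong[OF q_sigma_mult, of g g] by (auto elim!: rel_diaE simp: E_mult E_t nI_eq_iff mult.assoc)
qed

lemma counr_conds:
  "klin (\<lambda>f. nI (\<tau> (E g 1) * f))" "klin (\<lambda>g. nI (\<tau> (E g 1) * f))"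
  "f \<in> I \<Longrightarrow> nI (\<tau> (E g 1) * f) = 0" "g \<in> I \<Longrightarrow> nI (\<tau> (E g 1) * f) = 0"
  "(f, g, f', g') \<in> rel_dia \<sigma> \<tau> \<Longrightarrow> nI (\<tau> (E g 1) * f) = nI (\<tau> (E g' 1) * f')"
proof -
  show "klin (\<lambda>g. nI (\<tau> (E g 1) * f))"
    by (rule klinI) (rule nI_mult_add, simp add: E_add E_scale q_tau_add q_tau_scale)+
  show "klin (\<lambda>f. nI (\<tau> (E g 1) * f))"
    by (rule klinI) (simp_all add: distrib_left cscale_multr klin_add[OF klin_nI] klin_scale[OF klin_nI])
  show "g \<in> I \<Longrightarrow> nI (\<tau> (E g 1) * f) = 0" by (rule nI_zero) (simp add: E_I q_tau_zero)
  show "f \<in> I \<Longrightarrow> nI (\<tau> (E g 1) * f) = 0" by (rule nI_I)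
  show "(f, g, f', g') \<in> rel_dia \<sigma> \<tau> \<Longrightarrow> nI (\<tau> (E g 1) * f) = nI (\<tau> (E g' 1) * f')"
    using q_mult_cong[OF q_tau_mult, of f' f'] by (auto elim!: rel_diaE simp: E_mult E_s nI_eq_iff mult.assoc)
qed

lemma klin_counl: "klin counl" and klin_counr: "klin counr"
  by (simp_all add: counl_def counr_def TD.klin_extend)

lemma counl_simps: "counl (pure (q f, q g)) = nI (\<sigma> (E f 1) * g)" "counl (TD.pr p) = counl p"
  "counl (D f g) = nI (\<sigma> (E f 1) * g)"
proof -
  show "counl (pure (q f, q g)) = nI (\<sigma> (E f 1) * g)"
    unfolding counl_def by (rule TD.extend_pure) (blast intro: counl_conds)+
  show "counl (TD.pr p) = counl p"
    unfolding counl_def by (rule TD.extend_pr) (blast intro: counl_conds)+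
  show "counl (D f g) = nI (\<sigma> (E f 1) * g)"
    unfolding counl_def by (rule TD.extend_Ten) (blast intro: counl_conds)+
qed

lemma counr_simps: "counr (pure (q f, q g)) = nI (\<tau> (E g 1) * f)" "counr (TD.pr p) = counr p"
  "counr (D f g) = nI (\<tau> (E g 1) * f)"
proof -
  show "counr (pure (q f, q g)) = nI (\<tau> (E g 1) * f)"
    unfolding counr_def by (rule TD.extend_pure) (blast intro: counr_conds)+
  show "counr (TD.pr p) = counr p"
    unfolding counr_def by (rule TD.extend_pr) (blast intro: counr_conds)+
  show "counr (D f g) = nI (\<tau> (E g 1) * f)"
    unfolding counr_def by (rule TD.extend_Ten) (blast intro: counr_conds)+
qed

lemma nI_nI: "nI (nI f) = nI f"
  by (rule nf_nf[OF subspace_I])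

lemma nI_counl: "nI (counl p) = counl p" and nI_counr: "nI (counr p) = counr p"
  by (rule TD.Ten_eq[where F = "\<lambda>p. nI (counl p)" and G = counl],
      simp_all add: klin_comp[OF klin_nI klin_counl] klin_counl counl_simps nI_nI)
    (rule TD.Ten_eq[where F = "\<lambda>p. nI (counr p)" and G = counr],
      simp_all add: klin_comp[OF klin_nI klin_counr] klin_counr counr_simps nI_nI)

lemma klin_multl: "klin (\<lambda>f. h * f)"
  by (rule klinI) (simp_all add: distrib_left cscale_multr)

text \<open>Use \<open>counit_l\<close> with \<open>r\<close> the counit of the first factor; this
  is the reason for the element \<open>r\<close> in the counit identities.\<close>

lemma counl_gen: "counl (app (\<Phi> (gen z)) p) = nI (gen z * counl p)"
proof (rule TD.Ten_eq[where F = "\<lambda>p. counl (app (\<Phi> (gen z)) p)" and G = "\<lambda>p. nI (gen z * counl p)"])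
  fix f g
  let ?r = "E f 1"
  have "counl (app (\<Phi> (gen z)) (D f g)) = nI (\<Sum>(a, b)\<leftarrow>cop z. \<sigma> (E (gen a) ?r) * (gen b * g))"
    by (simp add: Phi_gen klin_sum_list[OF klin_counl] klin_sum_list[OF klin_nI] counl_simps split_def E_mult)
  also have "(\<Sum>(a, b)\<leftarrow>cop z. \<sigma> (E (gen a) ?r) * (gen b * g)) = (\<Sum>(a, b)\<leftarrow>cop z. \<sigma> (E (gen a) ?r) * gen b) * g"
    by (simp add: sum_list_mult_const[symmetric] split_def mult.assoc)
  also have "nI \<dots> = nI ((gen z * \<sigma> ?r) * g)"
    unfolding nI_eq_iff by (rule q_mult_cong[OF counit_l refl])
  finally show "counl (app (\<Phi> (gen z)) (D f g)) = nI (gen z * counl (D f g))"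
    by (simp add: counl_simps nI_mult_nI mult.assoc)
qed (simp_all add: klin_comp[OF klin_counl klin_app] klin_comp[OF klin_nI klin_comp[OF klin_multl klin_counl]] Phi_pr counl_simps)

lemma counr_gen: "counr (app (\<Phi> (gen z)) p) = nI (gen z * counr p)"
proof (rule TD.Ten_eq[where F = "\<lambda>p. counr (app (\<Phi> (gen z)) p)" and G = "\<lambda>p. nI (gen z * counr p)"])
  fix f g
  let ?r = "E g 1"
  have "counr (app (\<Phi> (gen z)) (D f g)) = nI (\<Sum>(a, b)\<leftarrow>cop z. \<tau> (E (gen b) ?r) * (gen a * f))"
    by (simp add: Phi_gen klin_sum_list[OF klin_counr] klin_sum_list[OF klin_nI] counr_simps split_def E_mult)
  also have "(\<Sum>(a, b)\<leftarrow>cop z. \<tau> (E (gen b) ?r) * (gen a * f)) = (\<Sum>(a, b)\<leftarrow>cop z. \<tau> (E (gen b) ?r) * gen a) * f"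
    by (simp add: sum_list_mult_const[symmetric] split_def mult.assoc)
  also have "nI \<dots> = nI ((gen z * \<tau> ?r) * f)"
    unfolding nI_eq_iff by (rule q_mult_cong[OF counit_r refl])
  finally show "counr (app (\<Phi> (gen z)) (D f g)) = nI (gen z * counr (D f g))"
    by (simp add: counr_simps nI_mult_nI mult.assoc)
qed (simp_all add: klin_comp[OF klin_counr klin_app] klin_comp[OF klin_nI klin_comp[OF klin_multl klin_counr]] Phi_pr counr_simps)

lemma coun_Phi: "counl (app (\<Phi> f) p) = nI (f * counl p)" "counr (app (\<Phi> f) p) = nI (f * counr p)"
proof (induction f arbitrary: p rule: falg_induct)
  case zero
  {
    case 1
    show ?case by (simp add: Phi_I[OF I_zero] app_simps klin_zero[OF klin_counl] klin_zero[OF klin_nI])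
  next
    case 2
    show ?case by (simp add: Phi_I[OF I_zero] app_simps klin_zero[OF klin_counr] klin_zero[OF klin_nI])
  }
qed (simp_all add: Phi_one counl_simps counr_simps nI_counl nI_counr Phi_mult app_simps counl_gen counr_gen nI_mult_nI mult.assoc
   Phi_add Phi_scale klin_add[OF klin_counl] klin_add[OF klin_counr] klin_scale[OF klin_counl] klin_scale[OF klin_counr]
   distrib_right cscale_multl klin_add[OF klin_nI] klin_scale[OF klin_nI])

lemma coun_D11: "q (f * counl (D 1 1)) = q f" "q (f * counr (D 1 1)) = q f"
proof -
  have "q (\<sigma> 1) = q 1" "q (\<tau> 1) = q 1" using A.s_one A.t_one by (simp_all add: q_one)
  hence "q (counl (D 1 1)) = q 1" "q (counr (D 1 1)) = q 1"
    by (simp_all add: counl_simps counr_simps q_nf E_one)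
  thus "q (f * counl (D 1 1)) = q f" "q (f * counr (D 1 1)) = q f"
    using q_mult_cong[of f f _ 1] by simp_all
qed

lemma finsum_q:
  assumes "Poly_Mapping.keys p \<subseteq> TD.CC" "\<And>u. u \<in> TD.CC \<Longrightarrow> F u = q (h u)"
  shows "(\<Oplus>\<^bsub>B\<^esub>u\<in>Poly_Mapping.keys p. Poly_Mapping.lookup p u \<odot>\<^bsub>B\<^esub> F u) = q (lext h p)"
proof -
  have "(\<Oplus>\<^bsub>B\<^esub>u\<in>Poly_Mapping.keys p. Poly_Mapping.lookup p u \<odot>\<^bsub>B\<^esub> F u) =
     (\<Oplus>\<^bsub>B\<^esub>u\<in>Poly_Mapping.keys p. q (cscale (Poly_Mapping.lookup p u) (h u)))"
    by (rule A.finsum_cong') (use assms in \<open>auto simp: q_scale subset_iff\<close>)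
  thus ?thesis by (simp add: q_sum lext_def)
qed

lemma counit_left:
  assumes "p \<in> \<Delta> (q f)"
  shows "(\<Oplus>\<^bsub>B\<^esub>u\<in>Poly_Mapping.keys p. Poly_Mapping.lookup p u \<odot>\<^bsub>B\<^esub> (q (\<sigma> (\<epsilon> (fst u))) \<otimes>\<^bsub>B\<^esub> snd u)) = q f"
proof -
  from assms have k: "Poly_Mapping.keys p \<subseteq> TD.CC" and pp: "TD.pr p = app (\<Phi> f) (D 1 1)" by (simp_all add: in_Delta)
  let ?h = "\<lambda>u. \<sigma> (\<epsilon> (fst u)) * rp (snd u)"
  have "(\<Oplus>\<^bsub>B\<^esub>u\<in>Poly_Mapping.keys p. Poly_Mapping.lookup p u \<odot>\<^bsub>B\<^esub> (q (\<sigma> (\<epsilon> (fst u))) \<otimes>\<^bsub>B\<^esub> snd u)) = q (lext ?h p)"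
    by (rule finsum_q[OF k]) (auto simp: q_mult[symmetric] q_rp)
  also have "\<dots> = q (nI (lext ?h p))" by (simp add: q_nf)
  also have "nI (lext ?h p) = counl p"
    by (rule carrier_eq[OF klin_comp[OF klin_nI klin_lext] klin_counl _ k])
      (simp add: counl_simps eps_q nI_eq_iff q_mult[symmetric] q_rp)
  also have "q \<dots> = q f"
    using counl_simps(2)[of p, symmetric] by (simp add: pp coun_Phi q_nf coun_D11)
  finally show ?thesis .
qed

lemma counit_right:
  assumes "p \<in> \<Delta> (q f)"
  shows "(\<Oplus>\<^bsub>B\<^esub>u\<in>Poly_Mapping.keys p. Poly_Mapping.lookup p u \<odot>\<^bsub>B\<^esub> (q (\<tau> (\<epsilon> (snd u))) \<otimes>\<^bsub>B\<^esub> fst u)) = q f"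
proof -
  from assms have k: "Poly_Mapping.keys p \<subseteq> TD.CC" and pp: "TD.pr p = app (\<Phi> f) (D 1 1)" by (simp_all add: in_Delta)
  let ?h = "\<lambda>u. \<tau> (\<epsilon> (snd u)) * rp (fst u)"
  have "(\<Oplus>\<^bsub>B\<^esub>u\<in>Poly_Mapping.keys p. Poly_Mapping.lookup p u \<odot>\<^bsub>B\<^esub> (q (\<tau> (\<epsilon> (snd u))) \<otimes>\<^bsub>B\<^esub> fst u)) = q (lext ?h p)"
    by (rule finsum_q[OF k]) (auto simp: q_mult[symmetric] q_rp)
  also have "\<dots> = q (nI (lext ?h p))" by (simp add: q_nf)
  also have "nI (lext ?h p) = counr p"
    by (rule carrier_eq[OF klin_comp[OF klin_nI klin_lext] klin_counr _ k])
      (simp add: counr_simps eps_q nI_eq_iff q_mult[symmetric] q_rp)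
  also have "q \<dots> = q f"
    using counr_simps(2)[of p, symmetric] by (simp add: pp coun_Phi q_nf coun_D11)
  finally show ?thesis .
qed

section \<open>The axioms of a left bialgebroid and of a Hopf algebroid\<close>

lemma carrierE: "b \<in> carrier B \<Longrightarrow> (\<And>f. b = q f \<Longrightarrow> P) \<Longrightarrow> P"
  by (auto simp: carrier_B)

lemma left_bialgebroid: "left_bialgebroid scA B (\<lambda>a. q (\<sigma> a)) (\<lambda>a. q (\<tau> a)) \<Delta> \<epsilon>"
proof
  fix b assume "b \<in> carrier B"
  then obtain f where b: "b = q f" by (rule carrierE)
  show "\<Delta> b \<in> A.tensors A.dia_null"
    unfolding dia_null TD.tensors_cls by (auto simp: b Delta_q pr_Phi)
next
  fix b c assume "b \<in> carrier B" "c \<in> carrier B"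
  then obtain f g where bc: "b = q f" "c = q g" by (metis carrierE)
  show "\<Delta> (b \<oplus>\<^bsub>B\<^esub> c) = coset_add (\<Delta> b) (\<Delta> c)"
    by (simp add: bc q_add Delta_q TD.coset_add_cls pr_Phi Phi_add app_simps)
  show "\<epsilon> (b \<oplus>\<^bsub>B\<^esub> c) = \<epsilon> b + \<epsilon> c" by (simp add: bc q_add eps_q E_add)
  show "\<epsilon> (b \<otimes>\<^bsub>B\<^esub> c) = \<epsilon> (b \<otimes>\<^bsub>B\<^esub> q (\<sigma> (\<epsilon> c)))" "\<epsilon> (b \<otimes>\<^bsub>B\<^esub> c) = \<epsilon> (b \<otimes>\<^bsub>B\<^esub> q (\<tau> (\<epsilon> c)))"
    by (simp_all add: bc q_mult eps_q E_mult E_s E_t)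
  fix p r assume pr: "p \<in> \<Delta> b" "r \<in> \<Delta> c"
  show "A.tensor_mult p r \<in> \<Delta> (b \<otimes>\<^bsub>B\<^esub> c)"
    using pr by (simp add: bc q_mult in_Delta keys_tensor_mult pr_tensor_mult Phi_mult app_simps)
next
  fix b p r a assume "b \<in> carrier B" "p \<in> \<Delta> b"
  then obtain f where b: "b = q f" "p \<in> \<Delta> (q f)" by (metis carrierE)
  have k: "Poly_Mapping.keys p \<subseteq> TD.CC" and pp: "TD.pr p = app (\<Phi> f) (D 1 1)" using b(2) by (simp_all add: in_Delta)
  show "pushforward (\<lambda>(u, v). (q (\<sigma> r) \<otimes>\<^bsub>B\<^esub> u, q (\<tau> a) \<otimes>\<^bsub>B\<^esub> v)) p \<in> \<Delta> (q (\<sigma> r) \<otimes>\<^bsub>B\<^esub> q (\<tau> a) \<otimes>\<^bsub>B\<^esub> b)"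
    using keys_pushforward[OF k, of "\<lambda>(u, v). (q (\<sigma> r) \<otimes>\<^bsub>B\<^esub> u, q (\<tau> a) \<otimes>\<^bsub>B\<^esub> v)" TD.CC]
    by (auto simp: b(1) q_mult in_Delta pushforward_st[OF k] pp Phi_mult app_simps A.m_closed)
  have "app (Rm (\<sigma> r) (\<tau> a)) (D 1 1) = app (\<Phi> (\<sigma> r * \<tau> a)) (D 1 1)"
    by (simp add: Rm_D Phi_mult app_simps Phi_s Phi_t)
  thus "pushforward (\<lambda>(u, v). (u \<otimes>\<^bsub>B\<^esub> q (\<sigma> r), v \<otimes>\<^bsub>B\<^esub> q (\<tau> a))) p \<in> \<Delta> (b \<otimes>\<^bsub>B\<^esub> q (\<sigma> r) \<otimes>\<^bsub>B\<^esub> q (\<tau> a))"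
    using keys_pushforward[OF k, of "\<lambda>(u, v). (u \<otimes>\<^bsub>B\<^esub> q (\<sigma> r), v \<otimes>\<^bsub>B\<^esub> q (\<tau> a))" TD.CC]
    by (auto simp: b(1) q_mult in_Delta pushforward_right[OF k] pp Rm_Phi Phi_mult app_simps A.m_closed)
next
  fix b r a assume "b \<in> carrier B"
  then obtain f where b: "b = q f" by (rule carrierE)
  show "\<epsilon> (q (\<sigma> r) \<otimes>\<^bsub>B\<^esub> q (\<tau> a) \<otimes>\<^bsub>B\<^esub> b) = r * \<epsilon> b * a"
    by (simp add: b q_mult eps_q E_mult E_s E_t mult.assoc)
  show "\<epsilon> (b \<otimes>\<^bsub>B\<^esub> q (\<sigma> r)) = \<epsilon> (b \<otimes>\<^bsub>B\<^esub> q (\<tau> r))"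
    by (simp add: b q_mult eps_q E_mult E_s E_t)
next
  fix Dc b p assume Dc: "\<And>c. c \<in> carrier B \<Longrightarrow> Dc c \<in> \<Delta> c" and "b \<in> carrier B" "p \<in> \<Delta> b"
  then obtain f where "p \<in> \<Delta> (q f)" by (metis carrierE)
  from coassoc[OF Dc this]
  show "A.linear_tensor Dc (\<lambda>(u, v) (u1, u2). (u1, u2, v)) fst p - A.linear_tensor Dc (\<lambda>(u, v) (v1, v2). (u, v1, v2)) snd p \<in> A.dia3_null" .
next
  fix b p assume "b \<in> carrier B" "p \<in> \<Delta> b"
  then obtain f where b: "b = q f" "p \<in> \<Delta> (q f)" by (metis carrierE)
  show "(\<Oplus>\<^bsub>B\<^esub>u\<in>Poly_Mapping.keys p. Poly_Mapping.lookup p u \<odot>\<^bsub>B\<^esub> (q (\<sigma> (\<epsilon> (fst u))) \<otimes>\<^bsub>B\<^esub> snd u)) = b"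
    unfolding b(1) by (rule counit_left[OF b(2)])
  show "(\<Oplus>\<^bsub>B\<^esub>u\<in>Poly_Mapping.keys p. Poly_Mapping.lookup p u \<odot>\<^bsub>B\<^esub> (q (\<tau> (\<epsilon> (snd u))) \<otimes>\<^bsub>B\<^esub> fst u)) = b"
    unfolding b(1) by (rule counit_right[OF b(2)])
next
  show "pure (\<one>\<^bsub>B\<^esub>, \<one>\<^bsub>B\<^esub>) \<in> \<Delta> \<one>\<^bsub>B\<^esub>"
    by (simp add: q_one in_Delta Phi_one TD.pr_Ten) (simp add: TD.Ten_def)
  show "\<epsilon> \<one>\<^bsub>B\<^esub> = 1" by (simp add: q_one eps_q E_one)
qed

text \<open>\<open>X\<close> and \<open>Y\<close> are \<beta> and \<theta> as operators between the
  images of the idempotents, and \<open>X'\<close> and \<open>Y'\<close> are their inverses.\<close>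

lemma schauenburg:
  assumes X: "\<And>p. app X (TO.pr p) = app X p" "\<And>p. TD.pr (app X p) = app X p"
      "\<And>p. TO.pr (app X' p) = app X' p"
      "\<And>p. app X' (app X p) = TO.pr p" "\<And>p. app X (app X' p) = TD.pr p"
      "\<And>f g. app X (TO.Ten f g) = app (\<Phi> f) (D 1 g)"
    and Y: "\<And>p. app Y (TT.pr p) = app Y p" "\<And>p. TD.pr (app Y p) = app Y p"
      "\<And>p. TT.pr (app Y' p) = app Y' p"
      "\<And>p. app Y' (app Y p) = TT.pr p" "\<And>p. app Y (app Y' p) = TD.pr p"
      "\<And>f g. app Y (TT.Ten f g) = app (\<Phi> f) (D g 1)"
  shows "schauenburg_hopf_algebroid scA B (\<lambda>a. q (\<sigma> a)) (\<lambda>a. q (\<tau> a)) \<Delta> \<epsilon>"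
proof -
  interpret left_bialgebroid scA B "\<lambda>a. q (\<sigma> a)" "\<lambda>a. q (\<tau> a)" \<Delta> \<epsilon> by (rule left_bialgebroid)
  have kp: "Poly_Mapping.keys (pure (q f, q g) :: _ \<Rightarrow>\<^sub>0 'k) \<subseteq> TD.CC" for f g by simp
  show ?thesis
  proof
    obtain \<beta> where \<beta>: "bij_betw \<beta> (quotient_space TD.CC TO.N) (quotient_space TD.CC TD.N)"
       "\<forall>Z\<in>quotient_space TD.CC TO.N. \<forall>Z'\<in>quotient_space TD.CC TO.N. \<beta> (coset_add Z Z') = coset_add (\<beta> Z) (\<beta> Z')"
       "\<forall>p. Poly_Mapping.keys p \<subseteq> TD.CC \<longrightarrow> \<beta> (coset TO.N p) = TD.cls (app X p)"
      using tensors_bij[OF quotient_ideal_axioms, of X "rel_op \<tau>" "rel_dia \<sigma> \<tau>" X', OF X(1-5)] by blast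
    have "pushforward (\<lambda>(u, v). (u, v \<otimes>\<^bsub>B\<^esub> c)) p \<in> \<beta> (coset TO.N (pure (b, c)))"
      if bc: "b \<in> carrier B" "c \<in> carrier B" and p: "p \<in> \<Delta> b" for b c p
    proof -
      from bc obtain f g where fg: "b = q f" "c = q g" by (metis carrierE)
      have k: "Poly_Mapping.keys p \<subseteq> TD.CC" and pp: "TD.pr p = app (\<Phi> f) (D 1 1)" using p fg by (simp_all add: in_Delta)
      have "pushforward (\<lambda>(u, v). (u, v \<otimes>\<^bsub>B\<^esub> c)) p = pushforward (\<lambda>(u, v). (u \<otimes>\<^bsub>B\<^esub> q 1, v \<otimes>\<^bsub>B\<^esub> q g)) p"
        by (rule carrier_eq[OF klin_pushforward klin_pushforward _ k]) (simp add: q_mult fg)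
      moreover have "Poly_Mapping.keys (pushforward (\<lambda>(u, v). (u \<otimes>\<^bsub>B\<^esub> q 1, v \<otimes>\<^bsub>B\<^esub> q g)) p) \<subseteq> TD.CC"
        by (rule keys_pushforward[OF k]) (auto simp: A.m_closed)
      moreover have "app X (pure (b, c)) = app (Rm 1 g) (TD.pr p)"
        using X(1)[of "pure (q f, q g)"] X(6)[of f g] by (simp add: fg TO.Ten_def pp Rm_Phi Rm_D)
      ultimately show ?thesis
        using \<beta>(3) kp[of f g] by (simp add: fg TD.cls_def pushforward_right[OF k])
    qed
    with \<beta> show "\<exists>\<beta>. bij_betw \<beta> (A.tensors A.op_null) (A.tensors A.dia_null) \<and>
      (\<forall>X\<in>A.tensors A.op_null. \<forall>Y\<in>A.tensors A.op_null. \<beta> (coset_add X Y) = coset_add (\<beta> X) (\<beta> Y)) \<and>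
      (\<forall>b\<in>carrier B. \<forall>c\<in>carrier B. \<forall>p\<in>\<Delta> b.
         pushforward (\<lambda>(u, v). (u, v \<otimes>\<^bsub>B\<^esub> c)) p \<in> \<beta> (coset A.op_null (pure (b, c))))"
      unfolding op_null dia_null by (intro exI[of _ \<beta>]) simp
    obtain \<theta> where \<theta>: "bij_betw \<theta> (quotient_space TD.CC TT.N) (quotient_space TD.CC TD.N)"
       "\<forall>Z\<in>quotient_space TD.CC TT.N. \<forall>Z'\<in>quotient_space TD.CC TT.N. \<theta> (coset_add Z Z') = coset_add (\<theta> Z) (\<theta> Z')"
       "\<forall>p. Poly_Mapping.keys p \<subseteq> TD.CC \<longrightarrow> \<theta> (coset TT.N p) = TD.cls (app Y p)"
      using tensors_bij[OF quotient_ideal_axioms, of Y "rel_op \<sigma>" "rel_dia \<sigma> \<tau>" Y', OF Y(1-5)] by blast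
    have "pushforward (\<lambda>(u, v). (u \<otimes>\<^bsub>B\<^esub> c, v)) p \<in> \<theta> (coset TT.N (pure (b, c)))"
      if bc: "b \<in> carrier B" "c \<in> carrier B" and p: "p \<in> \<Delta> b" for b c p
    proof -
      from bc obtain f g where fg: "b = q f" "c = q g" by (metis carrierE)
      have k: "Poly_Mapping.keys p \<subseteq> TD.CC" and pp: "TD.pr p = app (\<Phi> f) (D 1 1)" using p fg by (simp_all add: in_Delta)
      have "pushforward (\<lambda>(u, v). (u \<otimes>\<^bsub>B\<^esub> c, v)) p = pushforward (\<lambda>(u, v). (u \<otimes>\<^bsub>B\<^esub> q g, v \<otimes>\<^bsub>B\<^esub> q 1)) p"
        by (rule carrier_eq[OF klin_pushforward klin_pushforward _ k]) (simp add: q_mult fg)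
      moreover have "Poly_Mapping.keys (pushforward (\<lambda>(u, v). (u \<otimes>\<^bsub>B\<^esub> q g, v \<otimes>\<^bsub>B\<^esub> q 1)) p) \<subseteq> TD.CC"
        by (rule keys_pushforward[OF k]) (auto simp: A.m_closed)
      moreover have "app Y (pure (b, c)) = app (Rm g 1) (TD.pr p)"
        using Y(1)[of "pure (q f, q g)"] Y(6)[of f g] by (simp add: fg TT.Ten_def pp Rm_Phi Rm_D)
      ultimately show ?thesis
        using \<theta>(3) kp[of f g] by (simp add: fg TD.cls_def pushforward_right[OF k])
    qed
    with \<theta> show "\<exists>\<theta>. bij_betw \<theta> (A.tensors A.odot_null) (A.tensors A.dia_null) \<and>
      (\<forall>X\<in>A.tensors A.odot_null. \<forall>Y\<in>A.tensors A.odot_null. \<theta> (coset_add X Y) = coset_add (\<theta> X) (\<theta> Y)) \<and>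
      (\<forall>b\<in>carrier B. \<forall>c\<in>carrier B. \<forall>p\<in>\<Delta> b.
         pushforward (\<lambda>(u, v). (u \<otimes>\<^bsub>B\<^esub> c, v)) p \<in> \<theta> (coset A.odot_null (pure (b, c))))"
      unfolding odot_null dia_null by (intro exI[of _ \<theta>]) simp
  qed
qed

end

section \<open>The data of \<open>D\<XX>\<close>\<close>

definition dual_of :: "('a, 'm, 'x) pivotal_data \<Rightarrow> ('a, 'm, 'x) dual_data" where
  "dual_of P = \<lparr>lO = lact (Om P), rO = ract (Om P), lX = lact (Xd P), rX = ract (Xd P), el = ev P, er = evr P,
     nc = length (coev P), om = \<lambda>i. fst (coev P ! i), xi = \<lambda>i. snd (coev P ! i),
     nd = length (coevr P), up = \<lambda>i. fst (coevr P ! i), rh = \<lambda>i. snd (coevr P ! i)\<rparr>"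

lemma dual_of_simps [simp]:
  "lO (dual_of P) = lact (Om P)" "rO (dual_of P) = ract (Om P)" "lX (dual_of P) = lact (Xd P)" "rX (dual_of P) = ract (Xd P)"
  "el (dual_of P) = ev P" "er (dual_of P) = evr P"
  by (simp_all add: dual_of_def)

lemma sum_coev: "(\<Sum>(w, x)\<leftarrow>coev P. f w x) = (\<Sum>i<nc (dual_of P). f (om (dual_of P) i) (xi (dual_of P) i))"
  and sum_coevr: "(\<Sum>(y, r)\<leftarrow>coevr P. h y r) = (\<Sum>i<nd (dual_of P). h (up (dual_of P) i) (rh (dual_of P) i))"
  by (simp_all add: dual_of_def sum_list_sum_nth atLeast0LessThan split_def)

lemma dual_pair_dual_of:
  assumes "pivotal_bimodule scA P"
  shows "dual_pair (*) 1 (dual_of P)"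
proof -
  interpret pivotal_bimodule scA P by (rule assms)
  \<comment> \<open>Membership in the duals is the source of additivity and linearity of the
    evaluations in the argument from \<open>\<Omega>\<close>.\<close>
  have l: "ev P x \<in> left_dual (Om P)" for x using ev_bij by (auto simp: bij_betw_def)
  have r: "(\<lambda>w. evr P w x) \<in> right_dual (Om P)" for x using evr_bij by (auto simp: bij_betw_def)
  show ?thesis
    by unfold_locales
      (use l r in \<open>simp_all add: left_dual_def right_dual_def distrib_left distrib_right mult.assoc
        \<Omega>.lact_add_left \<Omega>.lact_add_right \<Omega>.lact_mult \<Omega>.lact_one \<Omega>.ract_add_left \<Omega>.ract_add_right \<Omega>.ract_mult \<Omega>.ract_one \<Omega>.lact_ract
        \<XX>.lact_add_left \<XX>.lact_add_right \<XX>.lact_mult \<XX>.lact_one \<XX>.ract_add_left \<XX>.ract_add_right \<XX>.ract_mult \<XX>.ract_one \<XX>.lact_ract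
        ev_add ev_lact ev_balanced evr_add evr_ract evr_balanced[symmetric]
        coev_ev[unfolded sum_coev] ev_coev[unfolded sum_coev] evr_coevr[unfolded sum_coevr] coevr_evr[unfolded sum_coevr]\<close>)
qed

text \<open>The algebra \<open>A\<close> as a quotient of the vector space with basis \<open>A\<close>.\<close>

context k_algebra
begin

definition evA :: "('a \<Rightarrow>\<^sub>0 'k) \<Rightarrow> 'a" where
  "evA p = (\<Sum>s\<in>Poly_Mapping.keys p. scA (Poly_Mapping.lookup p s) s)"

text \<open>This identifies \<open>A\<close> with the image of an idempotent, so that the
  representation on \<open>A\<close> is also by operators of type \<open>lop\<close>.\<close>

definition emb :: "'a \<Rightarrow> ('a \<Rightarrow>\<^sub>0 'k)" where
  "emb r = nf {p. evA p = 0} (pure r)"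

lemma evA_superset:
  assumes "finite S" "Poly_Mapping.keys p \<subseteq> S"
  shows "evA p = (\<Sum>s\<in>S. scA (Poly_Mapping.lookup p s) s)"
  unfolding evA_def by (rule sum.mono_neutral_left) (use assms in \<open>auto simp: in_keys_iff\<close>)

lemma evA_add: "evA (p + p') = evA p + evA p'"
proof -
  let ?S = "Poly_Mapping.keys p \<union> Poly_Mapping.keys p'"
  have "Poly_Mapping.keys (p + p') \<subseteq> ?S" by (rule Poly_Mapping.keys_add)
  thus ?thesis by (simp add: evA_superset[of ?S] Poly_Mapping.lookup_add sum.distrib scale_left_distrib)
qed

lemma evA_scale: "evA (cscale k p) = scA k (evA p)"
proof -
  have "Poly_Mapping.keys (cscale k p) \<subseteq> Poly_Mapping.keys p" by (auto simp: in_keys_iff)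
  thus ?thesis by (simp add: evA_superset[of "Poly_Mapping.keys p"] scale_sum_right)
qed

lemma evA_pure [simp]: "evA (pure r) = r"
  by (simp add: evA_def)

lemmas evA_diff = additive_diff[of evA, OF evA_add]

lemma subspace_evA: "free_vs.subspace {p. evA p = 0}"
  by (rule free_vs.subspaceI) (simp_all add: evA_add evA_scale additive_zero[of evA, OF evA_add])

abbreviation nA :: "('a \<Rightarrow>\<^sub>0 'k) \<Rightarrow> ('a \<Rightarrow>\<^sub>0 'k)" where "nA \<equiv> nf {p. evA p = 0}"

lemma nA_eq_iff: "nA p = nA p' \<longleftrightarrow> evA p = evA p'"
  by (simp add: nf_eq_iff[OF subspace_evA] evA_diff)

lemma nA_nA: "nA (nA p) = nA p"
  by (rule nf_nf[OF subspace_evA])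

lemma klin_nA: "klin nA"
  by (rule klin_nf[OF subspace_evA])

lemma evA_nA: "evA (nA p) = evA p"
  using nA_nA[of p] by (simp only: nA_eq_iff)

lemma evA_emb [simp]: "evA (emb r) = r"
  by (simp add: emb_def evA_nA)

lemma emb_evA: "emb (evA p) = nA p"
  by (simp add: emb_def nA_eq_iff)

lemma emb_add: "emb (r + r') = emb r + emb r'"
  unfolding emb_def klin_add[OF klin_nA, symmetric] by (simp add: nA_eq_iff evA_add)

lemma emb_scale: "emb (scA k r) = cscale k (emb r)"
  unfolding emb_def klin_scale[OF klin_nA, symmetric] by (simp add: nA_eq_iff evA_scale)

lemma nA_emb: "nA (emb r) = emb r"
  by (simp add: emb_def nA_nA)

lemma emb_inj: "emb r = emb r' \<Longrightarrow> r = r'"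
  by (metis evA_emb)

lemmas emb_sum = additive_sum[of emb, OF emb_add]

end

text \<open>The condition on the wedge is an equality modulo \<open>bimod_tensor_null\<close>. The
  nested evaluation is balanced, so its linear extension kills that subspace and turns the condition
  into the assumption \<open>pivotal\<close>.\<close>

lemma calc_of_calculus:
  assumes "pivotal_bimodule scA P1" "pivotal_bimodule scA P2"
    and "calculus_data scA (Om P1) (Om P2) d0 d1 wg" and piv: "pivotal_morphism scA P1 P2 wg"
  shows "calc (*) 1 (dual_of P1) (dual_of P2) d0 d1 wg"
proof -
  interpret P1: pivotal_bimodule scA P1 by (rule assms)
  interpret P2: pivotal_bimodule scA P2 by (rule assms)
  interpret A1: dual_pair "(*)" 1 "dual_of P1" by (rule dual_pair_dual_of) (rule assms)
  interpret A2: dual_pair "(*)" 1 "dual_of P2" by (rule dual_pair_dual_of) (rule assms)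
  interpret c: calculus_data scA "Om P1" "Om P2" d0 d1 wg by (rule assms)
  have "ev P2 z (wg w v) = (\<Sum>i<nd (dual_of P1). \<Sum>j<nd (dual_of P1). ev P1 (up (dual_of P1) i)
      (lact (Om P1) (ev P1 (up (dual_of P1) j) (lact (Om P1) (evr P2 (wg (rh (dual_of P1) j) (rh (dual_of P1) i)) z) w)) v))" for z w v
  proof -
    let ?f = "\<lambda>x y. ev P1 x (lact (Om P1) (ev P1 y w) v)"
    \<comment> \<open>The values lie in \<open>A\<close>, and \<open>emb\<close> carries them into a
      vector space with a basis, as \<open>lext\<close> requires.\<close>
    let ?F = "lext (\<lambda>(x, y). P1.\<Omega>.emb (?f x y))"
    have ksc: "ev P1 (kact scA (Xd P1) k x) u = scA k (ev P1 x u)" for k x u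
      using A1.el_lX[of "scA k 1" x u] P1.\<Omega>.scale_mult_left[of k 1 "ev P1 x u"] by (simp add: kact_def)
    have ksl: "lact (Om P1) (scA k a) u = lact (Om P1) (scA k 1) (lact (Om P1) a u)" for k a u
      using A1.lO_mu[of "scA k 1" a u] P1.\<Omega>.scale_mult_left[of k 1 a] by simp
    \<comment> \<open>The evaluation is right linear in its second argument, so
      \<open>central\<close> first brings the scalar to the right.\<close>
    have ksr: "ev P1 x (lact (Om P1) (scA k 1) u) = scA k (ev P1 x u)" for k x u
      using P1.\<Omega>.central[of k u] A1.el_rO[of x u "scA k 1"] P1.\<Omega>.scale_mult_right[of "ev P1 x u" k 1] by simp
    have F: "klin ?F" by (rule klin_lext)
    have f1: "?f (x + x') y = ?f x y + ?f x' y" for x x' y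
      using A1.el_addl by simp
    have f2: "?f x (y + y') = ?f x y + ?f x y'" for x y y'
      using A1.el_addl A1.el_addr A1.lO_addl by simp
    have f3: "?f (kact scA (Xd P1) k x) y = scA k (?f x y)" for k x y by (rule ksc)
    have f4: "?f x (kact scA (Xd P1) k y) = scA k (?f x y)" for k x y
      by (subst ksc) (subst ksl, rule ksr)
    have f5: "?f (ract (Xd P1) x a) y = ?f x (lact (Xd P1) a y)" for x a y
      using A1.el_bal A1.el_lX A1.lO_mu by simp
    have Fp: "?F (pure (x, y)) = P1.\<Omega>.emb (?f x y)" for x y by simp
    have kill: "?F n = 0" if "n \<in> bimod_tensor_null scA (Xd P1) (Xd P1)" for n
      using that unfolding bimod_tensor_null_def
    proof (rule span_zero_klin[OF _ F])
      fix n assume "n \<in> bilinear_rels UNIV (+) (kact scA (Xd P1)) UNIV (+) (kact scA (Xd P1)) \<union>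
         {pure (ract (Xd P1) m a, n) - pure (m, lact (Xd P1) a n) | m a n. True}"
      thus "?F n = 0"
        unfolding bilinear_rels_def Un_iff mem_Collect_eq
        by (elim disjE exE conjE) (simp_all only: klin_diff[OF F] klin_scale[OF F] Fp f1 f2 f3 f4 f5
          P1.\<Omega>.emb_add P1.\<Omega>.emb_scale add_diff_cancel_left' diff_self)
    qed
    have "?F ((\<Sum>(wi, xi)\<leftarrow>coev P1. \<Sum>(wj, xj)\<leftarrow>coev P1. pure (lact (Xd P1) (ev P2 z (wg wi wj)) xj, xi))
        - (\<Sum>(yi, ri)\<leftarrow>coevr P1. \<Sum>(yj, rj)\<leftarrow>coevr P1. pure (yi, ract (Xd P1) yj (evr P2 (wg rj ri) z)))) = 0"
      using piv by (intro kill) (simp add: pivotal_morphism_def)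
    hence "P1.\<Omega>.emb (\<Sum>i<nc (dual_of P1). \<Sum>j<nc (dual_of P1). ?f (lact (Xd P1) (ev P2 z (wg (om (dual_of P1) i) (om (dual_of P1) j))) (xi (dual_of P1) j)) (xi (dual_of P1) i))
       = P1.\<Omega>.emb (\<Sum>i<nd (dual_of P1). \<Sum>j<nd (dual_of P1). ?f (up (dual_of P1) i) (ract (Xd P1) (up (dual_of P1) j) (evr P2 (wg (rh (dual_of P1) j) (rh (dual_of P1) i)) z)))"
      unfolding sum_coev sum_coevr by (simp add: klin_diff[OF F] klin_sum[OF F] P1.\<Omega>.emb_sum)
    hence "(\<Sum>i<nc (dual_of P1). \<Sum>j<nc (dual_of P1). ?f (lact (Xd P1) (ev P2 z (wg (om (dual_of P1) i) (om (dual_of P1) j))) (xi (dual_of P1) j)) (xi (dual_of P1) i))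
       = (\<Sum>i<nd (dual_of P1). \<Sum>j<nd (dual_of P1). ?f (up (dual_of P1) i) (ract (Xd P1) (up (dual_of P1) j) (evr P2 (wg (rh (dual_of P1) j) (rh (dual_of P1) i)) z)))"
      by (rule P1.\<Omega>.emb_inj)
    moreover have "(\<Sum>i<nc (dual_of P1). \<Sum>j<nc (dual_of P1). ?f (lact (Xd P1) (ev P2 z (wg (om (dual_of P1) i) (om (dual_of P1) j))) (xi (dual_of P1) j)) (xi (dual_of P1) i))
      = ev P2 z (wg w v)"
    proof -
      have "(\<Sum>i<nc (dual_of P1). \<Sum>j<nc (dual_of P1). ?f (lact (Xd P1) (ev P2 z (wg (om (dual_of P1) i) (om (dual_of P1) j))) (xi (dual_of P1) j)) (xi (dual_of P1) i))
        = (\<Sum>i<nc (dual_of P1). \<Sum>j<nc (dual_of P1). ev P2 z (wg (om (dual_of P1) i) (ract (Om P1) (om (dual_of P1) j) (ev P1 (xi (dual_of P1) j) (lact (Om P1) (ev P1 (xi (dual_of P1) i) w) v)))))"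
        using A1.el_lX A2.el_rO by (simp add: c.wedge_ract)
      also have "\<dots> = (\<Sum>i<nc (dual_of P1). ev P2 z (wg (om (dual_of P1) i) (lact (Om P1) (ev P1 (xi (dual_of P1) i) w) v)))"
        using A1.collapse(1)[of "\<lambda>u. ev P2 z (wg _ u)"] A2.el_addr by (simp add: c.wedge_add_right)
      also have "\<dots> = ev P2 z (wg w v)"
        using A1.collapse(1)[of "\<lambda>u. ev P2 z (wg u v)" w] A2.el_addr by (simp add: c.wedge_add_left c.wedge_balanced)
      finally show ?thesis .
    qed
    ultimately show ?thesis using A1.el_bal by simp
  qed
  thus ?thesis
    by unfold_locales (simp_all add: c.d0_add c.d1_add c.wedge_add_left c.wedge_add_right c.wedge_balanced c.wedge_lact c.wedge_ract
      c.d0_mult c.d1_lact c.d1_ract c.d1_d0)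
qed

section \<open>Homomorphisms from \<open>D\<XX>\<close>\<close>

locale algebra_hom = quotient_ideal I
  for I :: "('g word \<Rightarrow>\<^sub>0 'k::field) set" +
  fixes \<kappa> :: "('g word \<Rightarrow>\<^sub>0 'k) \<Rightarrow> 'q::ring"
  assumes kappa_add: "\<kappa> (f + g) = \<kappa> f + \<kappa> g" and kappa_mult: "\<kappa> (f * g) = \<kappa> f * \<kappa> g"
    and kappa_I: "f - g \<in> I \<Longrightarrow> \<kappa> f = \<kappa> g"
begin

lemmas kappa_sum = additive_sum[of \<kappa>, OF kappa_add]
lemmas kappa_diff = additive_diff[of \<kappa>, OF kappa_add]
lemmas kappa_zero = additive_zero[of \<kappa>, OF kappa_add]
lemmas kappa_fold = kappa_add[symmetric] kappa_mult[symmetric] kappa_sum[symmetric] kappa_diff[symmetric]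

end

text \<open>The unit may go to a proper idempotent, as it does for multiplication operators on
  normal forms.\<close>

locale algebra_hom_DX = algebra_hom I \<kappa>
  for I :: "('k::field, 'a::{ring,monoid_mult}, 'm::ab_group_add, 'x::ab_group_add, 'n::ab_group_add, 'y::ab_group_add) falg set"
    and \<kappa> :: "('k, 'a, 'm, 'x, 'n, 'y) falg \<Rightarrow> 'q::ring" +
  fixes scA :: "'k \<Rightarrow> 'a \<Rightarrow> 'a" and P1 :: "('a, 'm, 'x) pivotal_data" and P2 :: "('a, 'n, 'y) pivotal_data"
    and d0 d1 wg
  assumes calc: "calc (*) 1 (dual_of P1) (dual_of P2) d0 d1 wg"
    and DX_I: "DX_rel scA P1 P2 d0 d1 wg f g \<Longrightarrow> f - g \<in> I"
begin

lemma kappa_rel: "DX_rel scA P1 P2 d0 d1 wg f g \<Longrightarrow> \<kappa> f = \<kappa> g"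
  by (rule kappa_I[OF DX_I])

lemma kappa_Ae: "Ae_rel scA f g \<Longrightarrow> \<kappa> f = \<kappa> g"
  by (rule kappa_rel) (simp add: DX_rel_def F_rel_def)

lemma hst_kappa:
  assumes "dual_pair (*) 1 (dual_of P)"
    and TZ: "\<And>f g. TZ_rel scA P xo ox f g \<Longrightarrow> \<kappa> f = \<kappa> g" and H: "\<And>f g. H_rel P xo ox f g \<Longrightarrow> \<kappa> f = \<kappa> g"
  shows "hst (*) 1 (dual_of P) (\<lambda>a. \<kappa> (gA a)) (\<lambda>a. \<kappa> (gAbar a)) (\<lambda>x w. \<kappa> (xo x w)) (\<lambda>w x. \<kappa> (ox w x))"
proof -
  interpret dual_pair "(*)" 1 "dual_of P" by (rule assms)
  note Hs = H_rel.intros[unfolded sum_coev sum_coevr, THEN H]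
  show ?thesis
  proof (unfold_locales, goal_cases)
    case 5
    show ?case using kappa_Ae[OF Ae_rel.intros(4)] kappa_Ae[OF Ae_rel.intros(8)] by simp
  qed (unfold kappa_fold dual_of_simps,
    (rule Ae_rel.intros[THEN kappa_Ae] TZ_rel.intros[THEN TZ] Hs)+)
qed

lemma dx_kappa: "dx (*) 1 (dual_of P1) (dual_of P2) d0 d1 wg (\<lambda>a. \<kappa> (gA a)) (\<lambda>a. \<kappa> (gAbar a))
   (\<lambda>x w. \<kappa> (gXO1 x w)) (\<lambda>w x. \<kappa> (gOX1 w x)) (\<lambda>x w. \<kappa> (gXO2 x w)) (\<lambda>w x. \<kappa> (gOX2 w x)) (\<lambda>x. \<kappa> (gX1 x))"
proof -
  interpret calc "(*)" 1 "dual_of P1" "dual_of P2" d0 d1 wg by (rule calc)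
  interpret K1: hst "(*)" 1 "dual_of P1" "\<lambda>a. \<kappa> (gA a)" "\<lambda>a. \<kappa> (gAbar a)" "\<lambda>x w. \<kappa> (gXO1 x w)" "\<lambda>w x. \<kappa> (gOX1 w x)"
    by (rule hst_kappa) (unfold_locales, (rule kappa_rel, simp add: DX_rel_def F_rel_def)+)
  interpret K2: hst "(*)" 1 "dual_of P2" "\<lambda>a. \<kappa> (gA a)" "\<lambda>a. \<kappa> (gAbar a)" "\<lambda>x w. \<kappa> (gXO2 x w)" "\<lambda>w x. \<kappa> (gOX2 w x)"
    by (rule hst_kappa) (unfold_locales, (rule kappa_rel, simp add: DX_rel_def F_rel_def)+)
  have D: "D_rel P1 P2 d1 wg f g \<Longrightarrow> \<kappa> f = \<kappa> g" for f g
    by (rule kappa_rel) (simp add: DX_rel_def)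
  have X: "HX_rel P1 d0 f g \<Longrightarrow> \<kappa> f = \<kappa> g" for f g
    by (rule kappa_rel) (simp add: DX_rel_def F_rel_def)
  have T: "T_rel scA P1 f g \<Longrightarrow> \<kappa> f = \<kappa> g" for f g
    by (rule kappa_rel) (simp add: DX_rel_def F_rel_def)
  note Ds = D_rel.intros[unfolded sum_coev sum_coevr mult.assoc, THEN D]
  show ?thesis
  proof (unfold_locales, goal_cases)
    case (5 z)
    show ?case using Ds(1)[of z] by (simp add: kappa_diff kappa_sum kappa_mult kappa_zero)
  qed (unfold kappa_fold dual_of_simps, (rule T_rel.intros(1)[THEN T] HX_rel.intros[THEN X] Ds)+)
qed

end

lemma ideal_rel_ideal: "ideal (rel_ideal rel) free_algebra"
  unfolding rel_ideal_def by (rule ring.genideal_ideal[OF ring_free_algebra]) simp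

lemma rel_ideal_base: "rel f g \<Longrightarrow> f - g \<in> rel_ideal rel"
proof -
  assume "rel f g"
  hence "f - g \<in> {f - g | f g. rel f g}" by blast
  thus ?thesis
    unfolding rel_ideal_def using ring.genideal_self[OF ring_free_algebra, of "{f - g | f g. rel f g}"] by auto
qed

text \<open>The kernel of \<open>lift\<close> is an ideal that contains the differences f - g of
  related elements.\<close>

lemma (in free_lift) lift_rel_ideal:
  assumes "\<And>f g. rel f g \<Longrightarrow> lift f = lift g" and "f \<in> rel_ideal rel"
  shows "lift f = 0"
proof -
  have "ideal {f. lift f = 0} free_algebra"
  proof (rule idealI[OF ring_free_algebra])
    show "subgroup {f. lift f = 0} (add_monoid free_algebra)"
    proof (rule group.subgroupI[OF abelian_group.a_group])
      show "abelian_group (free_algebra :: ('k, 'g word \<Rightarrow>\<^sub>0 'k) module)"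
        using ring_free_algebra by (rule ring.is_abelian_group)
      fix a :: "'g word \<Rightarrow>\<^sub>0 'k" assume a: "a \<in> {f. lift f = 0}"
      interpret ring "free_algebra :: ('k, 'g word \<Rightarrow>\<^sub>0 'k) module" by (rule ring_free_algebra)
      have "\<ominus>\<^bsub>free_algebra\<^esub> a = - a" by (rule minus_equality) simp_all
      thus "inv\<^bsub>add_monoid free_algebra\<^esub> a \<in> {f. lift f = 0}"
        using a additive_minus[of lift, OF lift_add] by (simp add: a_inv_def)
    qed (auto simp: lift_add intro: exI[of _ 0] lift_zero)
  qed (simp_all add: lift_mult)
  hence "rel_ideal rel \<subseteq> {f. lift f = 0}"
    unfolding rel_ideal_def by (rule ring.genideal_minimal[OF ring_free_algebra]) (auto simp: lift_diff assms(1))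
  thus ?thesis using assms(2) by blast
qed

fun genmap :: "('a \<Rightarrow> 'q) \<Rightarrow> ('a \<Rightarrow> 'q) \<Rightarrow> ('x \<Rightarrow> 'm \<Rightarrow> 'q) \<Rightarrow> ('m \<Rightarrow> 'x \<Rightarrow> 'q) \<Rightarrow> ('y \<Rightarrow> 'n \<Rightarrow> 'q) \<Rightarrow> ('n \<Rightarrow> 'y \<Rightarrow> 'q) \<Rightarrow>
    ('x \<Rightarrow> 'q) \<Rightarrow> ('a, 'm, 'x, 'n, 'y) gens \<Rightarrow> 'q" where
  "genmap s t xo1 ox1 xo2 ox2 vf (El a) = s a"
| "genmap s t xo1 ox1 xo2 ox2 vf (Bar a) = t a"
| "genmap s t xo1 ox1 xo2 ox2 vf (XO1 x w) = xo1 x w"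
| "genmap s t xo1 ox1 xo2 ox2 vf (OX1 w x) = ox1 w x"
| "genmap s t xo1 ox1 xo2 ox2 vf (Vf x) = vf x"
| "genmap s t xo1 ox1 xo2 ox2 vf (XO2 z v) = xo2 z v"
| "genmap s t xo1 ox1 xo2 ox2 vf (OX2 v z) = ox2 v z"

text \<open>The converse of \<open>dx_kappa\<close>: a family that satisfies \<open>dx\<close> and
  respects scalars defines a homomorphism on \<open>D\<XX>\<close>.\<close>

locale lift_DX = kring sc + dx "(*)" 1 "dual_of P1" "dual_of P2" d0 d1 wg s t xo1 ox1 xo2 ox2 vf
  for sc :: "'k::field \<Rightarrow> 'q::ring \<Rightarrow> 'q" and scA :: "'k \<Rightarrow> 'a::{ring,monoid_mult} \<Rightarrow> 'a"
    and P1 :: "('a, 'm::ab_group_add, 'x::ab_group_add) pivotal_data"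
    and P2 :: "('a, 'n::ab_group_add, 'y::ab_group_add) pivotal_data"
    and d0 d1 wg and s t :: "'a \<Rightarrow> 'q" and xo1 ox1 xo2 ox2 vf +
  assumes s_sc: "s (scA k a) = sc k (s a)" and t_sc: "t (scA k a) = sc k (t a)"
begin

abbreviation G :: "('a, 'm, 'x, 'n, 'y) gens \<Rightarrow> 'q" where "G \<equiv> genmap s t xo1 ox1 xo2 ox2 vf"

sublocale free_lift sc "s 1" G
proof
  fix g :: "('a, 'm, 'x, 'n, 'y) gens"
  show "s 1 * G g = G g" "G g * s 1 = G g"
    by (cases g; simp add: K1.unit_simps K2.unit_simps vf_unit)+
  show "s 1 * s 1 = s 1" by (simp add: K1.unit_simps)
qed

lemma t_one: "t 1 = s 1" using K1.s_one by simp

text \<open>The field acts on bimodules through \<open>scA k 1\<close>, so this reduces to the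
  behaviour of \<open>s\<close> and \<open>t\<close> on scalars.\<close>

lemma kact_simps:
  "xo1 (kact scA (Xd P1) k x) w = sc k (xo1 x w)" "xo1 x (kact scA (Om P1) k w) = sc k (xo1 x w)"
  "ox1 (kact scA (Om P1) k w) x = sc k (ox1 w x)" "ox1 w (kact scA (Xd P1) k x) = sc k (ox1 w x)"
  "xo2 (kact scA (Xd P2) k z) v = sc k (xo2 z v)" "xo2 z (kact scA (Om P2) k v) = sc k (xo2 z v)"
  "ox2 (kact scA (Om P2) k v) z = sc k (ox2 v z)" "ox2 v (kact scA (Xd P2) k z) = sc k (ox2 v z)"
  "vf (kact scA (Xd P1) k x) = sc k (vf x)"
  using K1.sxo[of "scA k 1"] K1.xot[of _ _ "scA k 1"] K1.sox[of "scA k 1"] K1.oxt[of _ _ "scA k 1"]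
    K2.sxo[of "scA k 1"] K2.xot[of _ _ "scA k 1"] K2.sox[of "scA k 1"] K2.oxt[of _ _ "scA k 1"] svf[of "scA k 1"]
  by (simp_all add: kact_def s_sc t_sc t_one sc_multl sc_multr K1.unit_simps K2.unit_simps vf_unit)

lemmas lift_simps = lift_add lift_diff lift_mult lift_gen lift_cscale lift_sum lift_zero lift_one

lemma lift_TZ1: "TZ_rel scA P1 gXO1 gOX1 f g \<Longrightarrow> lift f = lift g"
  by (erule TZ_rel.cases) (simp_all add: lift_simps kact_simps K1.xo_addl K1.xo_addr K1.ox_addl K1.ox_addr K1.H_assoc)

lemma lift_TZ2: "TZ_rel scA P2 gXO2 gOX2 f g \<Longrightarrow> lift f = lift g"
  by (erule TZ_rel.cases) (simp_all add: lift_simps kact_simps K2.xo_addl K2.xo_addr K2.ox_addl K2.ox_addr K2.H_assoc)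

lemma lift_H1: "H_rel P1 gXO1 gOX1 f g \<Longrightarrow> lift f = lift g"
  by (erule H_rel.cases; hypsubst; unfold sum_coev sum_coevr)
    (simp_all add: lift_simps K1.H1[simplified] K1.H2[simplified] K1.H3[simplified] K1.H4[simplified])

lemma lift_H2: "H_rel P2 gXO2 gOX2 f g \<Longrightarrow> lift f = lift g"
  by (erule H_rel.cases; hypsubst; unfold sum_coev sum_coevr)
    (simp_all add: lift_simps K2.H1[simplified] K2.H2[simplified] K2.H3[simplified] K2.H4[simplified])

lemma lift_Ae: "Ae_rel scA f g \<Longrightarrow> lift f = lift g"
  by (erule Ae_rel.cases) (simp_all add: lift_simps K1.s_add K1.t_add K1.s_mu K1.t_mu s_sc t_sc t_one K1.st)

lemma lift_T: "T_rel scA P1 f g \<Longrightarrow> lift f = lift g"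
  by (erule T_rel.cases) (simp_all add: lift_simps vf_add kact_simps)

lemma lift_HX: "HX_rel P1 d0 f g \<Longrightarrow> lift f = lift g"
  by (erule HX_rel.cases) (simp_all add: lift_simps svf vfs vft)

lemma lift_D: "D_rel P1 P2 d1 wg f g \<Longrightarrow> lift f = lift g"
  by (erule D_rel.cases; hypsubst; unfold sum_coev sum_coevr mult.assoc)
    (simp_all add: lift_simps D1[simplified] D2[simplified] D3[simplified] D4[simplified])

lemma lift_DX: "DX_rel scA P1 P2 d0 d1 wg f g \<Longrightarrow> lift f = lift g"
  unfolding DX_rel_def F_rel_def
  by (elim disjE; (rule lift_Ae lift_TZ1 lift_TZ2 lift_H1 lift_H2 lift_T lift_HX lift_D; assumption))

lemma lift_I: "f \<in> rel_ideal (DX_rel scA P1 P2 d0 d1 wg) \<Longrightarrow> lift f = 0"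
  by (rule lift_rel_ideal[OF lift_DX])

end

section \<open>The coproduct and the counit of \<open>D\<XX>\<close>\<close>

locale DX_setup =
  fixes scA :: "'k::field \<Rightarrow> 'a::{ring,monoid_mult} \<Rightarrow> 'a"
    and P1 :: "('a, 'm::ab_group_add, 'x::ab_group_add) pivotal_data"
    and P2 :: "('a, 'n::ab_group_add, 'y::ab_group_add) pivotal_data"
    and d0 :: "'a \<Rightarrow> 'm" and d1 :: "'m \<Rightarrow> 'n" and wg :: "'m \<Rightarrow> 'm \<Rightarrow> 'n"
  assumes k_alg: "k_algebra scA" and piv1: "pivotal_bimodule scA P1" and piv2: "pivotal_bimodule scA P2"
    and calculus: "calculus_data scA (Om P1) (Om P2) d0 d1 wg" and piv_wg: "pivotal_morphism scA P1 P2 wg"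
begin

definition I :: "('k, 'a, 'm, 'x, 'n, 'y) falg set" where
  "I = rel_ideal (DX_rel scA P1 P2 d0 d1 wg)"

sublocale quotient_ideal I
  by (rule quotient_ideal.intro) (simp add: I_def ideal_rel_ideal)

lemma rel_I: "DX_rel scA P1 P2 d0 d1 wg f g \<Longrightarrow> f - g \<in> I"
  unfolding I_def by (rule rel_ideal_base)

lemma q_Ae: "Ae_rel scA f g \<Longrightarrow> q f = q g"
  unfolding q_eq_iff by (rule rel_I) (simp add: DX_rel_def F_rel_def)

lemma calc_dual: "calc (*) 1 (dual_of P1) (dual_of P2) d0 d1 wg"
  by (rule calc_of_calculus[OF piv1 piv2 calculus piv_wg])

lemma Ae_ring_DX: "Ae_ring scA B (\<lambda>a. q (gA a)) (\<lambda>a. q (gAbar a))"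
proof -
  interpret k_algebra scA by (rule k_alg)
  interpret record_k_algebra B by (rule record_k_algebra_B)
  show ?thesis
    by unfold_locales
      (unfold q_add q_mult q_scale q_one, (rule q_closed q_Ae[OF Ae_rel.intros(1)] q_Ae[OF Ae_rel.intros(2)]
       q_Ae[OF Ae_rel.intros(3)] q_Ae[OF Ae_rel.intros(4)] q_Ae[OF Ae_rel.intros(5)] q_Ae[OF Ae_rel.intros(6)]
       q_Ae[OF Ae_rel.intros(7)] q_Ae[OF Ae_rel.intros(8)] q_Ae[OF Ae_rel.intros(9)])+)
qed

text \<open>Left and right multiplication on \<open>B\<close>, realised on normal forms in the free
  algebra. By \<open>kl_inj\<close>, equations in \<open>B\<close> can be read off from
  operators.\<close>

definition \<kappa>l :: "('k, 'a, 'm, 'x, 'n, 'y) falg \<Rightarrow> ('k, ('a, 'm, 'x, 'n, 'y) gens word) lop" where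
  "\<kappa>l f = Lop (\<lambda>p. nf I (f * p))"

definition \<kappa>r :: "('k, 'a, 'm, 'x, 'n, 'y) falg \<Rightarrow> ('k, ('a, 'm, 'x, 'n, 'y) gens word) lop opp" where
  "\<kappa>r f = Opp (Lop (\<lambda>p. nf I (p * f)))"

lemma nI_cong: "q f = q g \<longleftrightarrow> nf I f = nf I g"
  by (simp add: nf_eq_iff[OF subspace_I] q_eq_iff)

lemma app_kl: "app (\<kappa>l f) p = nf I (f * p)"
proof -
  have "klin (\<lambda>p. nf I (f * p))"
    by (rule klinI) (simp_all add: distrib_left cscale_multr klin_add[OF klin_nf[OF subspace_I]] klin_scale[OF klin_nf[OF subspace_I]])
  thus ?thesis by (simp add: \<kappa>l_def app_Lop)
qed

lemma app_kr: "app (unop (\<kappa>r f)) p = nf I (p * f)"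
proof -
  have "klin (\<lambda>p. nf I (p * f))"
    by (rule klinI) (simp_all add: distrib_right cscale_multl klin_add[OF klin_nf[OF subspace_I]] klin_scale[OF klin_nf[OF subspace_I]])
  thus ?thesis by (simp add: \<kappa>r_def app_Lop)
qed

lemma nI_mult: "nf I (f * nf I g) = nf I (f * g)" "nf I (nf I f * g) = nf I (f * g)"
proof -
  have "nf I g - g \<in> I" "nf I f - f \<in> I" by (simp_all only: q_eq_iff[symmetric] q_nf)
  hence "f * (nf I g - g) \<in> I" "(nf I f - f) * g \<in> I" by (simp_all add: I_mult)
  thus "nf I (f * nf I g) = nf I (f * g)" "nf I (nf I f * g) = nf I (f * g)"
    by (simp_all add: nf_eq_iff[OF subspace_I] algebra_simps)
qed

sublocale Lh: algebra_hom_DX I \<kappa>l scA P1 P2 d0 d1 wg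
proof (intro algebra_hom_DX.intro algebra_hom.intro algebra_hom_axioms.intro algebra_hom_DX_axioms.intro)
  show "\<kappa>l (f + g) = \<kappa>l f + \<kappa>l g" "\<kappa>l (f * g) = \<kappa>l f * \<kappa>l g" for f g
    by (rule lop_eqI, simp add: app_kl app_simps distrib_right klin_add[OF klin_nf[OF subspace_I]] nI_mult mult.assoc)+
  show "\<kappa>l f = \<kappa>l g" if "f - g \<in> I" for f g
    by (rule lop_eqI) (use I_mult(2)[OF that] in \<open>simp add: app_kl nf_eq_iff[OF subspace_I] algebra_simps\<close>)
qed (rule quotient_ideal_axioms calc_dual rel_I; assumption?)+

sublocale Rh: algebra_hom_DX I \<kappa>r scA P1 P2 d0 d1 wg
proof (intro algebra_hom_DX.intro algebra_hom.intro algebra_hom_axioms.intro algebra_hom_DX_axioms.intro)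
  show "\<kappa>r (f + g) = \<kappa>r f + \<kappa>r g" "\<kappa>r (f * g) = \<kappa>r f * \<kappa>r g" for f g
    by (rule opp.expand, rule lop_eqI, simp add: unop_simps app_kr app_simps distrib_left klin_add[OF klin_nf[OF subspace_I]] nI_mult mult.assoc)+
  show "\<kappa>r f = \<kappa>r g" if "f - g \<in> I" for f g
    by (rule opp.expand, rule lop_eqI) (use I_mult(1)[OF that] in \<open>simp add: app_kr nf_eq_iff[OF subspace_I] algebra_simps\<close>)
qed (rule quotient_ideal_axioms calc_dual rel_I; assumption?)+

lemma kl_scale: "\<kappa>l (cscale k f) = lop_scale k (\<kappa>l f)"
  by (rule lop_eqI) (simp add: app_kl app_simps cscale_multl klin_scale[OF klin_nf[OF subspace_I]])

lemma kl_inj: "\<kappa>l f = \<kappa>l g \<Longrightarrow> q f = q g"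
  using app_kl[of f 1] app_kl[of g 1] by (simp add: nI_cong)

abbreviation "Q1 \<equiv> dual_of P1"
abbreviation "Q2 \<equiv> dual_of P2"
abbreviation "lA \<equiv> \<lambda>a. \<kappa>l (gA a)"
abbreviation "lB \<equiv> \<lambda>a. \<kappa>l (gAbar a)"
abbreviation "lXO1 \<equiv> \<lambda>x w. \<kappa>l (gXO1 x w)"
abbreviation "lOX1 \<equiv> \<lambda>w x. \<kappa>l (gOX1 w x)"
abbreviation "lXO2 \<equiv> \<lambda>x w. \<kappa>l (gXO2 x w)"
abbreviation "lOX2 \<equiv> \<lambda>w x. \<kappa>l (gOX2 w x)"
abbreviation "lX1 \<equiv> \<lambda>x. \<kappa>l (gX1 x)"
abbreviation "rA \<equiv> \<lambda>a. \<kappa>r (gA a)"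
abbreviation "rB \<equiv> \<lambda>a. \<kappa>r (gAbar a)"
abbreviation "rXO1 \<equiv> \<lambda>x w. \<kappa>r (gXO1 x w)"
abbreviation "rOX1 \<equiv> \<lambda>w x. \<kappa>r (gOX1 w x)"
abbreviation "rXO2 \<equiv> \<lambda>x w. \<kappa>r (gXO2 x w)"
abbreviation "rOX2 \<equiv> \<lambda>w x. \<kappa>r (gOX2 w x)"
abbreviation "rX1 \<equiv> \<lambda>x. \<kappa>r (gX1 x)"

sublocale Ld: dx "(*)" 1 Q1 Q2 d0 d1 wg lA lB
   lXO1 lOX1 lXO2 lOX2 lX1
  by (rule Lh.dx_kappa)

sublocale Rd: dx "(*)" 1 Q1 Q2 d0 d1 wg rA rB
   rXO1 rOX1 rXO2 rOX2 rX1
  by (rule Rh.dx_kappa)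

text \<open>Both legs are to be generators, so that coproducts can be iterated on lists; the unit is
  therefore written \<open>El 1\<close>.\<close>

fun cop :: "('a, 'm, 'x, 'n, 'y) gens \<Rightarrow> (('a, 'm, 'x, 'n, 'y) gens \<times> ('a, 'm, 'x, 'n, 'y) gens) list" where
  "cop (El a) = [(El a, El 1)]"
| "cop (Bar a) = [(El 1, Bar a)]"
| "cop (XO1 x w) = map (\<lambda>(v, y). (XO1 x v, XO1 y w)) (coev P1)"
| "cop (OX1 w x) = map (\<lambda>(y, v). (OX1 w y, OX1 v x)) (coevr P1)"
| "cop (Vf x) = (Vf x, El 1) # map (\<lambda>(v, y). (XO1 x v, Vf y)) (coev P1)"
| "cop (XO2 x w) = map (\<lambda>(v, y). (XO2 x v, XO2 y w)) (coev P2)"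
| "cop (OX2 w x) = map (\<lambda>(y, v). (OX2 w y, OX2 v x)) (coevr P2)"

lemma sum_cop:
  "(\<Sum>(a, b)\<leftarrow>cop (El r). F a b) = F (El r) (El 1)"
  "(\<Sum>(a, b)\<leftarrow>cop (Bar r). F a b) = F (El 1) (Bar r)"
  "(\<Sum>(a, b)\<leftarrow>cop (XO1 x w). F a b) = (\<Sum>i<nc Q1. F (XO1 x (om Q1 i)) (XO1 (xi Q1 i) w))"
  "(\<Sum>(a, b)\<leftarrow>cop (OX1 w x). F a b) = (\<Sum>j<nd Q1. F (OX1 w (up Q1 j)) (OX1 (rh Q1 j) x))"
  "(\<Sum>(a, b)\<leftarrow>cop (Vf x). F a b) = F (Vf x) (El 1) + (\<Sum>i<nc Q1. F (XO1 x (om Q1 i)) (Vf (xi Q1 i)))"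
  "(\<Sum>(a, b)\<leftarrow>cop (XO2 z v). F a b) = (\<Sum>i<nc Q2. F (XO2 z (om Q2 i)) (XO2 (xi Q2 i) v))"
  "(\<Sum>(a, b)\<leftarrow>cop (OX2 v z). F a b) = (\<Sum>j<nd Q2. F (OX2 v (up Q2 j)) (OX2 (rh Q2 j) z))"
  by (simp_all add: sum_coev[symmetric, of "\<lambda>v y. F (XO1 x v) (XO1 y w)"] sum_coev[symmetric, of "\<lambda>v y. F (XO1 x v) (Vf y)"]
     sum_coev[symmetric, of "\<lambda>v' y. F (XO2 z v') (XO2 y v)"] sum_coevr[symmetric, of "\<lambda>y v. F (OX1 w y) (OX1 v x)"]
     sum_coevr[symmetric, of "\<lambda>y v'. F (OX2 v y) (OX2 v' z)"] split_def comp_def)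

section \<open>The coproduct as a representation\<close>

sublocale TD: tensor_rels I "rel_dia (\<lambda>a. gA a) (\<lambda>a. gAbar a)" by unfold_locales
sublocale TO: tensor_rels I "rel_op (\<lambda>a. gAbar a)" by unfold_locales
sublocale TT: tensor_rels I "rel_op (\<lambda>a. gA a)" by unfold_locales

text \<open>A multiplication operator \<open>u\<close> stands for the element
  \<open>app u 1\<close>. In this way tensors are formed from elements of the operator ring, as the
  locale \<open>delta\<close> expects.\<close>

definition D where "D u v = TD.Ten (app u 1) (app v 1)"

lemma D_kl: "D (\<kappa>l f) (\<kappa>l g) = TD.Ten f g"
  unfolding D_def by (rule TD.Ten_cong) (simp_all add: app_kl q_nf)

lemma D_kl_mult: "D (\<kappa>l f * u) (\<kappa>l g * v) = TD.Ten (f * app u 1) (g * app v 1)"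
  "D (\<kappa>l f * u) v = TD.Ten (f * app u 1) (app v 1)" "D u (\<kappa>l g * v) = TD.Ten (app u 1) (g * app v 1)"
  unfolding D_def by (rule TD.Ten_cong; simp add: app_kl app_simps q_nf)+

lemma Ten_D: "TD.Ten f g = D (\<kappa>l f) (\<kappa>l g)" by (simp add: D_kl)

lemma q_gA_one: "q (gA 1 * f) = q f" "q (f * gA 1) = q f"
  using q_Ae[OF Ae_rel.intros(4)] by (simp_all add: q_mult[symmetric]) (simp_all add: q_mult)

lemma D_props:
  "D (u + u') v = D u v + D u' v" "D u (v + v') = D u v + D u v'"
  "D (\<kappa>l (gAbar r) * u) v = D u (\<kappa>l (gA r) * v)"
  "D (\<kappa>l (gA 1) * u) v = D u v" "D u (\<kappa>l (gA 1) * v) = D u v"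
proof -
  show "D (\<kappa>l (gAbar r) * u) v = D u (\<kappa>l (gA r) * v)"
    unfolding D_kl_mult by (rule TD.Ten_RF) (auto simp: rel_dia_def)
  show "D (\<kappa>l (gA 1) * u) v = D u v" "D u (\<kappa>l (gA 1) * v) = D u v"
    unfolding D_kl_mult unfolding D_def by (rule TD.Ten_cong; simp add: q_gA_one)+
qed (simp_all add: D_def app_simps TD.Ten_add)

sublocale Del1: del_h "(*)" 1 Q1 lA lB lXO1 lOX1 D
  by (intro del_h.intro Ld.K1.hst_axioms del_h_axioms.intro D_props)

sublocale Del2: del_h "(*)" 1 Q2 lA lB lXO2 lOX2 D
  by (intro del_h.intro Ld.K2.hst_axioms del_h_axioms.intro D_props)

sublocale Del: del "(*)" 1 Q1 Q2 d0 d1 wg lA lB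
   lXO1 lOX1 lXO2 lOX2 lX1 D
  by (intro del.intro Ld.dx_axioms Del1.del_h_axioms)

text \<open>This is what makes the operator \<open>gop g\<close> well defined on
  \<open>B \<diamondop> B\<close>.\<close>

lemma takeuchi: "(\<Sum>(a, b)\<leftarrow>cop g. TD.Ten (gen a * (gAbar r * f)) (gen b * h)) = (\<Sum>(a, b)\<leftarrow>cop g. TD.Ten (gen a * f) (gen b * (gA r * h)))"
proof (cases g)
  case (El a)
  have "D (\<kappa>l (gA a) * (\<kappa>l (gAbar r) * \<kappa>l f)) (\<kappa>l h) = D (\<kappa>l (gA a) * \<kappa>l f) (\<kappa>l (gA r) * \<kappa>l h)"
    by (simp only: mult.assoc[symmetric] Ld.K1.st) (simp only: mult.assoc D_props)
  thus ?thesis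
    by (simp only: El sum_cop Ten_D Lh.kappa_mult) (simp only: D_props)
next
  case (Bar a)
  have "D (\<kappa>l (gAbar r) * \<kappa>l f) (\<kappa>l (gAbar a) * \<kappa>l h) = D (\<kappa>l f) (\<kappa>l (gAbar a) * (\<kappa>l (gA r) * \<kappa>l h))"
    by (simp only: mult.assoc[symmetric] Ld.K1.st[symmetric]) (simp only: mult.assoc D_props)
  thus ?thesis
    by (simp only: Bar sum_cop Ten_D Lh.kappa_mult) (simp only: D_props)
next
  case (Vf x)
  show ?thesis
    using Del.takeuchi_dvf[of x r "\<kappa>l f" "\<kappa>l h"] by (simp only: Vf sum_cop Ten_D Lh.kappa_mult D_props)
qed (simp_all only: sum_cop Ten_D Lh.kappa_mult Del1.takeuchi_dxo Del1.takeuchi_dox Del2.takeuchi_dxo Del2.takeuchi_dox)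

definition gop :: "('a, 'm, 'x, 'n, 'y) gens \<Rightarrow> _" where
  "gop g = Lop (TD.extend (\<lambda>f h. \<Sum>(a, b)\<leftarrow>cop g. TD.Ten (gen a * f) (gen b * h)))"

lemma gop_conds:
  "klin (\<lambda>f. \<Sum>(a, b)\<leftarrow>cop g. TD.Ten (gen a * f) (gen b * h))" "klin (\<lambda>h. \<Sum>(a, b)\<leftarrow>cop g. TD.Ten (gen a * f) (gen b * h))"
  "f \<in> I \<Longrightarrow> (\<Sum>(a, b)\<leftarrow>cop g. TD.Ten (gen a * f) (gen b * h)) = 0"
  "h \<in> I \<Longrightarrow> (\<Sum>(a, b)\<leftarrow>cop g. TD.Ten (gen a * f) (gen b * h)) = 0"
  "(f, h, f', h') \<in> rel_dia (\<lambda>a. gA a) (\<lambda>a. gAbar a) \<Longrightarrow>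
     (\<Sum>(a, b)\<leftarrow>cop g. TD.Ten (gen a * f) (gen b * h)) = (\<Sum>(a, b)\<leftarrow>cop g. TD.Ten (gen a * f') (gen b * h'))"
proof -
  show "klin (\<lambda>f. \<Sum>(a, b)\<leftarrow>cop g. TD.Ten (gen a * f) (gen b * h))"
    unfolding split_def by (rule klin_sum_list_fun, rule klinI) (simp_all add: distrib_left cscale_multr TD.Ten_add TD.Ten_scale)
  show "klin (\<lambda>h. \<Sum>(a, b)\<leftarrow>cop g. TD.Ten (gen a * f) (gen b * h))"
    unfolding split_def by (rule klin_sum_list_fun, rule klinI) (simp_all add: distrib_left cscale_multr TD.Ten_add TD.Ten_scale)
  show "f \<in> I \<Longrightarrow> (\<Sum>(a, b)\<leftarrow>cop g. TD.Ten (gen a * f) (gen b * h)) = 0"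
    "h \<in> I \<Longrightarrow> (\<Sum>(a, b)\<leftarrow>cop g. TD.Ten (gen a * f) (gen b * h)) = 0"
    by (simp_all add: I_mult TD.Ten_I split_def)
  show "(f, h, f', h') \<in> rel_dia (\<lambda>a. gA a) (\<lambda>a. gAbar a) \<Longrightarrow>
     (\<Sum>(a, b)\<leftarrow>cop g. TD.Ten (gen a * f) (gen b * h)) = (\<Sum>(a, b)\<leftarrow>cop g. TD.Ten (gen a * f') (gen b * h'))"
    by (erule rel_diaE) (simp only: takeuchi)
qed

lemma gop_Ten: "app (gop g) (TD.Ten f h) = (\<Sum>(a, b)\<leftarrow>cop g. TD.Ten (gen a * f) (gen b * h))"
  unfolding gop_def app_Lop[OF TD.klin_extend] by (rule TD.extend_Ten) (blast intro: gop_conds)+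

lemma gop_pr: "app (gop g) (TD.pr p) = app (gop g) p"
  unfolding gop_def app_Lop[OF TD.klin_extend] by (rule TD.extend_pr) (blast intro: gop_conds)+

lemma gop_D: "app (gop g) (D u v) = (\<Sum>(a, b)\<leftarrow>cop g. D (\<kappa>l (gen a) * u) (\<kappa>l (gen b) * v))"
  by (simp only: D_kl_mult(1)) (simp only: D_def gop_Ten)

text \<open>Such operators factor through the idempotent, so they are determined by their values on
  tensors.\<close>

definition CD where "CD = {X. \<forall>p. app X (TD.pr p) = app X p}"

lemma CD_eqI:
  assumes "X \<in> CD" "Y \<in> CD" "\<And>u v. app X (D u v) = app Y (D u v)"
  shows "X = Y"
proof (rule lop_eqI)
  fix p
  show "app X p = app Y p"
  proof (rule TD.Ten_eq[where F = "app X" and G = "app Y"])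
    show "app X (TD.Ten f g) = app Y (TD.Ten f g)" for f g using assms(3)[of "\<kappa>l f" "\<kappa>l g"] by (simp add: D_kl)
  qed (use assms in \<open>simp_all add: klin_app CD_def\<close>)
qed

lemma CD_closed:
  "X \<in> CD \<Longrightarrow> Y \<in> CD \<Longrightarrow> X + Y \<in> CD" "X \<in> CD \<Longrightarrow> - X \<in> CD" "X \<in> CD \<Longrightarrow> Y \<in> CD \<Longrightarrow> X * Y \<in> CD" "gop g \<in> CD"
  by (simp_all add: CD_def app_simps gop_pr)

lemma delta_h_axioms1: "delta_h_axioms Q1 lA lB lXO1 lOX1 D app CD
   (\<lambda>a. gop (El a)) (\<lambda>a. gop (Bar a)) (\<lambda>x w. gop (XO1 x w)) (\<lambda>w x. gop (OX1 w x))"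
  by (intro delta_h_axioms.intro CD_eqI CD_closed)
    (simp_all only: app_simps klin_add[OF klin_app] gop_D sum_cop D_props)

lemma delta_h_axioms2: "delta_h_axioms Q2 lA lB lXO2 lOX2 D app CD
   (\<lambda>a. gop (El a)) (\<lambda>a. gop (Bar a)) (\<lambda>x w. gop (XO2 x w)) (\<lambda>w x. gop (OX2 w x))"
  by (intro delta_h_axioms.intro CD_eqI CD_closed)
    (simp_all only: app_simps klin_add[OF klin_app] gop_D sum_cop D_props)

sublocale De: delta "(*)" 1 Q1 Q2 d0 d1 wg lA lB
   lXO1 lOX1 lXO2 lOX2 lX1 D app CD
   "\<lambda>a. gop (El a)" "\<lambda>a. gop (Bar a)" "\<lambda>x w. gop (XO1 x w)" "\<lambda>w x. gop (OX1 w x)" "\<lambda>x w. gop (XO2 x w)" "\<lambda>w x. gop (OX2 w x)" "\<lambda>x. gop (Vf x)"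
  by (intro delta.intro delta_h.intro Ld.dx_axioms Del1.del_h_axioms Del2.del_h_axioms delta_h_axioms1 delta_h_axioms2 delta_axioms.intro CD_closed)
    (simp_all only: gop_D sum_cop D_props)

lemma kl_El_scale: "\<kappa>l (gA (scA k a)) = lop_scale k (\<kappa>l (gA a))" "\<kappa>l (gAbar (scA k a)) = lop_scale k (\<kappa>l (gAbar a))"
  by (simp_all only: kl_scale[symmetric] Lh.kappa_Ae[OF Ae_rel.intros(2)] Lh.kappa_Ae[OF Ae_rel.intros(6)])

lemma D_scale: "D (lop_scale k u) v = cscale k (D u v)" "D u (lop_scale k v) = cscale k (D u v)"
  by (simp_all add: D_def app_simps TD.Ten_scale)

sublocale PhiL: lift_DX lop_scale scA P1 P2 d0 d1 wg "\<lambda>a. gop (El a)" "\<lambda>a. gop (Bar a)" "\<lambda>x w. gop (XO1 x w)" "\<lambda>w x. gop (OX1 w x)"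
   "\<lambda>x w. gop (XO2 x w)" "\<lambda>w x. gop (OX2 w x)" "\<lambda>x. gop (Vf x)"
proof (intro lift_DX.intro lift_DX_axioms.intro kl.kring_axioms De.delta_dx)
  fix k a
  have s: "lop_scale k (gop g) \<in> CD" for g by (simp add: CD_def app_simps gop_pr)
  show "gop (El (scA k a)) = lop_scale k (gop (El a))"
    by (rule CD_eqI[OF CD_closed(4) s]) (simp add: app_simps gop_D D_props kl_El_scale kl.sc_multl D_scale)
  show "gop (Bar (scA k a)) = lop_scale k (gop (Bar a))"
    by (rule CD_eqI[OF CD_closed(4) s]) (simp add: app_simps gop_D D_props kl_El_scale kl.sc_multl D_scale)
qed

abbreviation \<Phi> where "\<Phi> \<equiv> PhiL.lift"

lemma Phi_gen: "\<Phi> (gen g) = gop g"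
  by (simp add: PhiL.lift_gen) (cases g; simp)

lemma Phi_one: "app (\<Phi> 1) p = TD.pr p"
proof (rule TD.Ten_eq[where F = "app (\<Phi> 1)" and G = TD.pr])
  show "app (\<Phi> 1) (TD.Ten f g) = TD.pr (TD.Ten f g)" for f g
    unfolding TD.pr_Ten by (simp add: PhiL.lift_one Ten_D gop_D D_props)
qed (simp_all add: klin_app TD.klin_pr TD.pr_pr PhiL.lift_one gop_pr)

lemma pr_gop: "TD.pr (app (gop g) p) = app (gop g) p"
  by (rule TD.Ten_eq[where F = "\<lambda>p. TD.pr (app (gop g) p)" and G = "app (gop g)"])
    (simp_all add: klin_comp[OF TD.klin_pr klin_app] klin_app gop_pr gop_Ten klin_sum_list[OF TD.klin_pr] split_def TD.pr_Ten)

lemma Phi_pr: "app (\<Phi> f) (TD.pr p) = app (\<Phi> f) p"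
  by (induction f arbitrary: p rule: falg_induct)
    (simp_all add: PhiL.lift_zero Phi_one TD.pr_pr PhiL.lift_mult Phi_gen PhiL.lift_add PhiL.lift_cscale app_simps)

lemma pr_Phi: "TD.pr (app (\<Phi> f) p) = app (\<Phi> f) p"
  by (induction f arbitrary: p rule: falg_induct)
    (simp_all add: PhiL.lift_zero Phi_one TD.pr_pr PhiL.lift_mult Phi_gen pr_gop PhiL.lift_add PhiL.lift_cscale app_simps
      klin_zero[OF TD.klin_pr] klin_add[OF TD.klin_pr] klin_scale[OF TD.klin_pr])

section \<open>The counit as a representation\<close>

sublocale Ak: k_algebra scA by (rule k_alg)

text \<open>The value is \<epsilon>(g r). For a vector field it is the derivative of
  \<open>r\<close> along it, and \<open>r = 1\<close> gives the prescribed counits.\<close>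

fun egen :: "('a, 'm, 'x, 'n, 'y) gens \<Rightarrow> 'a \<Rightarrow> 'a" where
  "egen (El a) r = a * r"
| "egen (Bar a) r = r * a"
| "egen (XO1 x w) r = ev P1 x (lact (Om P1) r w)"
| "egen (OX1 w x) r = evr P1 (ract (Om P1) w r) x"
| "egen (Vf x) r = ev P1 x (d0 r)"
| "egen (XO2 z v) r = ev P2 z (lact (Om P2) r v)"
| "egen (OX2 v z) r = evr P2 (ract (Om P2) v r) z"

lemma egen_add: "egen g (r + r') = egen g r + egen g r'"
  by (cases g) (simp_all add: distrib_left distrib_right Ld.A1.el_addr[simplified] Ld.A1.er_addl[simplified]
    Ld.A2.el_addr[simplified] Ld.A2.er_addl[simplified] Ld.A1.lO_addl[simplified] Ld.A1.rO_addr[simplified]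
    Ld.A2.lO_addl[simplified] Ld.A2.rO_addr[simplified] Ld.d0_add)

lemma kscale:
  fixes P :: "('a, 'o::ab_group_add, 'v::ab_group_add) pivotal_data"
  assumes "pivotal_bimodule scA P"
  shows "ev P x (lact (Om P) (scA k r) w) = scA k (ev P x (lact (Om P) r w))"
    and "evr P (ract (Om P) w (scA k r)) x = scA k (evr P (ract (Om P) w r) x)"
    and "ev P x (lact (Om P) (scA k 1) w) = scA k (ev P x w)"
proof -
  interpret pivotal_bimodule scA P by (rule assms)
  interpret d: dual_pair "(*)" 1 "dual_of P" by (rule dual_pair_dual_of) (rule assms)
  show *: "ev P x (lact (Om P) (scA k 1) w) = scA k (ev P x w)" for w
    using \<Omega>.central[of k w] d.el_rO[of x w "scA k 1"] Ak.scale_mult_right[of "ev P x w" k 1] by simp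
  show "ev P x (lact (Om P) (scA k r) w) = scA k (ev P x (lact (Om P) r w))"
    using \<Omega>.lact_mult[of "scA k 1" r w] Ak.scale_mult_left[of k 1 r] by (simp add: *)
  have "ract (Om P) w (scA k r) = lact (Om P) (scA k 1) (ract (Om P) w r)"
    using \<Omega>.ract_mult[of w r "scA k 1"] \<Omega>.central[of k "ract (Om P) w r"] Ak.scale_mult_right[of r k 1] by simp
  thus "evr P (ract (Om P) w (scA k r)) x = scA k (evr P (ract (Om P) w r) x)"
    using d.er_lO[of "scA k 1" "ract (Om P) w r" x] Ak.scale_mult_left[of k 1] by simp
qed

lemma egen_scale: "egen g (scA k r) = scA k (egen g r)"
  by (cases g) (simp_all add: Ak.scale_mult_left Ak.scale_mult_right kscale[OF piv1] kscale[OF piv2]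
    calculus_data.d0_scale[OF calculus] kact_def
    Ld.A1.lO_one[simplified])

definition eop :: "('a, 'm, 'x, 'n, 'y) gens \<Rightarrow> ('k, 'a) lop" where
  "eop g = Lop (\<lambda>p. Ak.emb (egen g (Ak.evA p)))"

lemma app_eop: "app (eop g) p = Ak.emb (egen g (Ak.evA p))"
proof -
  have "klin (\<lambda>p. Ak.emb (egen g (Ak.evA p)))"
    by (rule klinI) (simp_all add: Ak.evA_add Ak.evA_scale egen_add egen_scale Ak.emb_add Ak.emb_scale)
  thus ?thesis by (simp add: eop_def app_Lop)
qed

definition CE where "CE = {X. \<forall>p. app X (Ak.nA p) = app X p}"

lemma CE_eqI:
  assumes "X \<in> CE" "Y \<in> CE" "\<And>r. app X (Ak.emb r) = app Y (Ak.emb r)"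
  shows "X = Y"
proof (rule lop_eqI)
  fix p
  show "app X p = app Y p" using assms(3)[of "Ak.evA p"] assms(1,2) by (simp add: Ak.emb_evA CE_def)
qed

lemma nA_app_eop: "Ak.nA (app (eop g) p) = app (eop g) p"
  by (simp add: app_eop Ak.nA_emb)

lemma CE_closed:
  "X \<in> CE \<Longrightarrow> Y \<in> CE \<Longrightarrow> X + Y \<in> CE" "X \<in> CE \<Longrightarrow> - X \<in> CE" "X \<in> CE \<Longrightarrow> Y \<in> CE \<Longrightarrow> X * Y \<in> CE" "eop g \<in> CE"
  by (simp_all add: CE_def app_simps app_eop Ak.evA_nA)

sublocale Co: counit "(*)" 1 Q1 Q2 d0 d1 wg Ak.emb app CE
   "\<lambda>a. eop (El a)" "\<lambda>a. eop (Bar a)" "\<lambda>x w. eop (XO1 x w)" "\<lambda>w x. eop (OX1 w x)" "\<lambda>x w. eop (XO2 x w)" "\<lambda>w x. eop (OX2 w x)" "\<lambda>x. eop (Vf x)"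
  by (intro counit.intro counit_h.intro calc_dual Ld.A1.dual_pair_axioms Ld.A2.dual_pair_axioms counit_h_axioms.intro counit_axioms.intro
      CE_closed CE_eqI)
    (simp_all add: Ak.emb_add app_simps klin_add[OF klin_app] app_eop)

sublocale EL: lift_DX lop_scale scA P1 P2 d0 d1 wg "\<lambda>a. eop (El a)" "\<lambda>a. eop (Bar a)" "\<lambda>x w. eop (XO1 x w)" "\<lambda>w x. eop (OX1 w x)"
   "\<lambda>x w. eop (XO2 x w)" "\<lambda>w x. eop (OX2 w x)" "\<lambda>x. eop (Vf x)"
  by (intro lift_DX.intro lift_DX_axioms.intro kl.kring_axioms Co.counit_dx lop_eqI)
    (simp_all add: app_eop app_simps Ak.emb_scale Ak.scale_mult_left Ak.scale_mult_right)

definition Ef where "Ef f r = Ak.evA (app (EL.lift f) (Ak.emb r))"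

lemma EL_gen: "EL.lift (gen g) = eop g"
  by (simp add: EL.lift_gen) (cases g; simp)

text \<open>The image of \<open>emb\<close> is stable under the representation; from this follows
  that \<open>Ef (f * g) r = Ef f (Ef g r)\<close>.\<close>

lemma emb_Ef: "app (EL.lift f) (Ak.emb r) = Ak.emb (Ef f r)"
proof -
  have "Ak.nA (app (EL.lift f) (Ak.emb r)) = app (EL.lift f) (Ak.emb r)" for r
  proof (induction f rule: falg_induct)
    case one
    show ?case by (simp add: EL.lift_one nA_app_eop)
  qed (simp_all add: EL.lift_zero EL.lift_mult EL_gen nA_app_eop EL.lift_add EL.lift_cscale app_simps
      klin_zero[OF Ak.klin_nA] klin_add[OF Ak.klin_nA] klin_scale[OF Ak.klin_nA])
  thus ?thesis by (simp add: Ef_def Ak.emb_evA)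
qed

lemma Ef_gen: "Ef (gen g) r = egen g r"
  by (simp add: Ef_def EL_gen app_eop)

text \<open>Both sides have the same terms, up to the order of summation over the dual
  bases.\<close>

lemma cop_assoc: "(\<Sum>(a, b)\<leftarrow>cop z. \<Sum>(c, d)\<leftarrow>cop a. F c d b) =
    (\<Sum>(a, b)\<leftarrow>cop z. \<Sum>(c, d)\<leftarrow>cop b. (F a c d :: 'z::ab_group_add))"
proof (cases z)
  case (XO1 x w)
  show ?thesis by (simp only: XO1 sum_cop) (rule sum.swap)
next
  case (OX1 w x)
  show ?thesis by (simp only: OX1 sum_cop) (rule sum.swap)
next
  case (XO2 x w)
  show ?thesis by (simp only: XO2 sum_cop) (rule sum.swap)
next
  case (OX2 w x)
  show ?thesis by (simp only: OX2 sum_cop) (rule sum.swap)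
next
  case (Vf x)
  have "(\<Sum>i<nc Q1. \<Sum>j<nc Q1. F (XO1 x (om Q1 j)) (XO1 (xi Q1 j) (om Q1 i)) (Vf (xi Q1 i))) =
    (\<Sum>j<nc Q1. \<Sum>i<nc Q1. F (XO1 x (om Q1 j)) (XO1 (xi Q1 j) (om Q1 i)) (Vf (xi Q1 i)))"
    by (rule sum.swap)
  thus ?thesis by (simp only: Vf sum_cop sum.distrib add.assoc)
qed (simp_all only: sum_cop)

lemma counit_l: "q (\<Sum>(a, b)\<leftarrow>cop z. gen (El (Ef (gen a) r)) * gen b) = q (gen z * gen (El r))"
  by (rule kl_inj, cases z)
    (simp_all del: cop.simps add: sum_cop Ef_gen Lh.kappa_sum Lh.kappa_add Lh.kappa_mult Ld.K1.unit_simps Ld.vf_unit Ld.K1.s_mu[symmetric] Ld.K1.st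
      Ld.K1.counit_left_xo[simplified] Ld.K1.counit_left_ox[simplified] Ld.K2.counit_left_xo[simplified] Ld.K2.counit_left_ox[simplified]
      Ld.counit_left_vf[simplified])

lemma counit_r: "q (\<Sum>(a, b)\<leftarrow>cop z. gen (Bar (Ef (gen b) r)) * gen a) = q (gen z * gen (Bar r))"
  by (rule kl_inj, cases z)
    (simp_all del: cop.simps add: sum_cop Ef_gen Lh.kappa_sum Lh.kappa_add Lh.kappa_mult Ld.K1.unit_simps Ld.vf_unit Ld.K1.t_mu[symmetric] Ld.K1.st
      Ld.K1.counit_right_xo[simplified] Ld.K1.counit_right_ox[simplified] Ld.K2.counit_right_xo[simplified] Ld.K2.counit_right_ox[simplified]
      Ld.counit_right_vf[simplified])

sublocale GC: gen_coalgebra I scA El Bar cop \<Phi> Ef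
proof (intro gen_coalgebra.intro gen_algebra.intro gen_algebra_axioms.intro gen_coalgebra_axioms.intro)
  fix f g :: "('k, 'a, 'm, 'x, 'n, 'y) falg" and r k
  show "\<Phi> (f + g) = \<Phi> f + \<Phi> g" "\<Phi> (cscale k f) = lop_scale k (\<Phi> f)" "\<Phi> (f * g) = \<Phi> f * \<Phi> g"
    by (rule PhiL.lift_add PhiL.lift_cscale PhiL.lift_mult)+
  show "f \<in> I \<Longrightarrow> \<Phi> f = 0" unfolding I_def by (rule PhiL.lift_I)
  show "Ef (f + g) r = Ef f r + Ef g r" by (simp add: Ef_def EL.lift_add app_simps Ak.evA_add)
  show "Ef (cscale k f) r = scA k (Ef f r)" by (simp add: Ef_def EL.lift_cscale app_simps Ak.evA_scale)
  show "Ef (f * g) r = Ef f (Ef g r)" by (simp add: Ef_def[of "f * g"] EL.lift_mult app_simps emb_Ef)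
  show "Ef 1 r = r" by (simp add: Ef_def EL.lift_one app_eop)
  show "f \<in> I \<Longrightarrow> Ef f r = 0" using EL.lift_I[of f] additive_zero[of Ak.evA, OF Ak.evA_add] by (simp add: I_def Ef_def app_simps)
qed (rule quotient_ideal_axioms Ae_ring_DX counit_l counit_r cop_assoc Phi_one Phi_pr pr_Phi | simp add: Phi_gen gop_Ten Ef_gen)+

end

section \<open>The inverses of \<open>\<beta>\<close> and \<open>\<theta>\<close>\<close>

context DX_setup
begin

section \<open>Operators given by lists of tensors\<close>

lemma tensor_rels_op: "tensor_rels I"
  by unfold_locales

abbreviation TenT where "TenT \<tau> \<equiv> tensor_rels.Ten I (rel_op \<tau>)"
abbreviation prT where "prT \<tau> \<equiv> tensor_rels.pr I (rel_op \<tau>)"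

text \<open>As for \<open>D\<close>, but the first factor is multiplied from the right and so comes
  from the opposite ring. The parameter \<open>\<tau>\<close> covers the tensor product over the
  opposite algebra as well as \<open>B \<odot> B\<close>.\<close>

definition Tn where "Tn \<tau> u v = TenT \<tau> (app (unop u) 1) (app v 1)"

lemma Tn_kappa: "Tn \<tau> (\<kappa>r f) (\<kappa>l g) = TenT \<tau> f g"
  unfolding Tn_def by (rule tensor_rels.Ten_cong[OF tensor_rels_op]) (simp_all add: app_kl app_kr q_nf)

lemma Tn_mult: "Tn \<tau> (u * \<kappa>r f) (\<kappa>l g * v) = TenT \<tau> (app (unop u) 1 * f) (g * app v 1)"
  "Tn \<tau> (u * \<kappa>r f) v = TenT \<tau> (app (unop u) 1 * f) (app v 1)"
  "Tn \<tau> u (\<kappa>l g * v) = TenT \<tau> (app (unop u) 1) (g * app v 1)"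
  unfolding Tn_def by (rule tensor_rels.Ten_cong[OF tensor_rels_op]; simp add: app_kl app_kr app_simps unop_simps q_nf)+

lemma q_gAbar_one: "q (gAbar 1 * f) = q f" "q (f * gAbar 1) = q f"
  using q_Ae[OF Ae_rel.intros(8)] by (simp_all add: q_mult[symmetric]) (simp_all add: q_mult)

lemma Tn_props:
  "Tn \<tau> (u + u') v = Tn \<tau> u v + Tn \<tau> u' v" "Tn \<tau> u (v + v') = Tn \<tau> u v + Tn \<tau> u v'"
  "Tn \<tau> (u * \<kappa>r (\<tau> r)) v = Tn \<tau> u (\<kappa>l (\<tau> r) * v)"
  "Tn \<tau> (u * \<kappa>r (gA 1)) v = Tn \<tau> u v" "Tn \<tau> u (\<kappa>l (gA 1) * v) = Tn \<tau> u v"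
  "Tn \<tau> (u * \<kappa>r (gAbar 1)) v = Tn \<tau> u v" "Tn \<tau> u (\<kappa>l (gAbar 1) * v) = Tn \<tau> u v"
  "Tn \<tau> (u * \<kappa>r 1) v = Tn \<tau> u v" "Tn \<tau> u (\<kappa>l 1 * v) = Tn \<tau> u v"
proof -
  interpret T: tensor_rels I "rel_op \<tau>" by (rule tensor_rels_op)
  show "Tn \<tau> (u * \<kappa>r (\<tau> r)) v = Tn \<tau> u (\<kappa>l (\<tau> r) * v)"
    unfolding Tn_mult by (rule T.Ten_RF) (auto simp: rel_op_def)
  show "Tn \<tau> (u * \<kappa>r (gA 1)) v = Tn \<tau> u v" "Tn \<tau> u (\<kappa>l (gA 1) * v) = Tn \<tau> u v"
    "Tn \<tau> (u * \<kappa>r (gAbar 1)) v = Tn \<tau> u v" "Tn \<tau> u (\<kappa>l (gAbar 1) * v) = Tn \<tau> u v"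
    "Tn \<tau> (u * \<kappa>r 1) v = Tn \<tau> u v" "Tn \<tau> u (\<kappa>l 1 * v) = Tn \<tau> u v"
    unfolding Tn_mult unfolding Tn_def by (rule T.Ten_cong; simp add: q_gA_one q_gAbar_one)+
qed (simp_all add: Tn_def app_simps unop_simps tensor_rels.Ten_add[OF tensor_rels_op])

lemma Tn_minusl: "Tn \<tau> (- u) v = - Tn \<tau> u v"
  by (rule additive_minus[of "\<lambda>u. Tn \<tau> u v"]) (rule Tn_props)

text \<open>The condition under which multiplying the tensors of \<open>tr\<close> into the middle
  respects the balancing relations.\<close>

definition balanced where
  "balanced \<tau> tr \<longleftrightarrow> (\<forall>f r h. (\<Sum>(a, b)\<leftarrow>tr. TenT \<tau> (f * \<tau> r * a) (b * h)) = (\<Sum>(a, b)\<leftarrow>tr. TenT \<tau> (f * a) (b * (\<tau> r * h))))"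

lemma balancedI:
  assumes "\<And>u v r. (\<Sum>(a, b)\<leftarrow>tr. Tn \<tau> (u * \<kappa>r (\<tau> r) * \<kappa>r a) (\<kappa>l b * v)) = (\<Sum>(a, b)\<leftarrow>tr. Tn \<tau> (u * \<kappa>r a) (\<kappa>l b * (\<kappa>l (\<tau> r) * v)))"
  shows "balanced \<tau> tr"
  unfolding balanced_def
proof (intro allI)
  fix f r h
  show "(\<Sum>(a, b)\<leftarrow>tr. TenT \<tau> (f * \<tau> r * a) (b * h)) = (\<Sum>(a, b)\<leftarrow>tr. TenT \<tau> (f * a) (b * (\<tau> r * h)))"
    using assms[of "\<kappa>r f" r "\<kappa>l h"] by (simp only: Rh.kappa_mult[symmetric] Lh.kappa_mult[symmetric] Tn_kappa)
qed

definition trop where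
  "trop \<tau> tr = Opp (Lop (tensor_rels.extend I (\<lambda>f h. \<Sum>(a, b)\<leftarrow>tr. TenT \<tau> (f * a) (b * h))))"

definition Lt where
  "Lt \<tau> h = Lop (tensor_rels.extend I (\<lambda>f g. TenT \<tau> (h * f) g))"

lemma Lt_Ten: "app (Lt \<tau> h) (TenT \<tau> f g) = TenT \<tau> (h * f) g" and Lt_pr: "app (Lt \<tau> h) (prT \<tau> p) = app (Lt \<tau> h) p"
proof -
  interpret T: tensor_rels I "rel_op \<tau>" by (rule tensor_rels_op)
  have c: "klin (\<lambda>f. TenT \<tau> (h * f) g)" "klin (\<lambda>g. TenT \<tau> (h * f) g)" "f \<in> I \<Longrightarrow> TenT \<tau> (h * f) g = 0"
    "g \<in> I \<Longrightarrow> TenT \<tau> (h * f) g = 0" for f g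
    by (auto intro!: klinI simp: distrib_left cscale_multr T.Ten_add T.Ten_scale I_mult T.Ten_I)
  have b: "(f, g, f', g') \<in> rel_op \<tau> \<Longrightarrow> TenT \<tau> (h * f) g = TenT \<tau> (h * f') g'" for f g f' g'
    by (erule rel_opE, hypsubst, unfold mult.assoc[symmetric], rule T.Ten_RF) (auto simp: rel_op_def)
  show "app (Lt \<tau> h) (TenT \<tau> f g) = TenT \<tau> (h * f) g"
    unfolding Lt_def app_Lop[OF T.klin_extend] by (rule T.extend_Ten) (blast intro: c b)+
  show "app (Lt \<tau> h) (prT \<tau> p) = app (Lt \<tau> h) p"
    unfolding Lt_def app_Lop[OF T.klin_extend] by (rule T.extend_pr) (blast intro: c b)+
qed

lemma
  assumes "balanced \<tau> tr"
  shows trop_Ten: "app (unop (trop \<tau> tr)) (TenT \<tau> f h) = (\<Sum>(a, b)\<leftarrow>tr. TenT \<tau> (f * a) (b * h))"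
    and trop_pr: "app (unop (trop \<tau> tr)) (prT \<tau> p) = app (unop (trop \<tau> tr)) p"
proof -
  interpret T: tensor_rels I "rel_op \<tau>" by (rule tensor_rels_op)
  let ?h = "\<lambda>f h. \<Sum>(a, b)\<leftarrow>tr. TenT \<tau> (f * a) (b * h)"
  have c: "klin (\<lambda>f. ?h f g)" "klin (\<lambda>g. ?h f g)" "f \<in> I \<Longrightarrow> ?h f g = 0" "g \<in> I \<Longrightarrow> ?h f g = 0" for f g
    unfolding split_def by (auto intro!: klin_sum_list_fun klinI simp: distrib_left distrib_right cscale_multr cscale_multl T.Ten_add T.Ten_scale I_mult T.Ten_I)
  have b: "?h f g = ?h f' g'" if r: "(f, g, f', g') \<in> rel_op \<tau>" for f g f' g'
  proof -
    obtain r where "f = f' * \<tau> r" "g' = \<tau> r * g" using r by (rule rel_opE)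
    thus ?thesis using assms by (simp only: balanced_def)
  qed
  have u: "unop (trop \<tau> tr) = Lop (T.extend ?h)" by (simp add: trop_def)
  show "app (unop (trop \<tau> tr)) (TenT \<tau> f h) = ?h f h"
    unfolding u app_Lop[OF T.klin_extend] by (rule T.extend_Ten) (blast intro: c b)+
  show "app (unop (trop \<tau> tr)) (prT \<tau> p) = app (unop (trop \<tau> tr)) p"
    unfolding u app_Lop[OF T.klin_extend] by (rule T.extend_pr) (blast intro: c b)+
qed

lemma trop_Tn:
  assumes "balanced \<tau> tr"
  shows "app (unop (trop \<tau> tr)) (Tn \<tau> u v) = (\<Sum>(a, b)\<leftarrow>tr. Tn \<tau> (u * \<kappa>r a) (\<kappa>l b * v))"
  by (simp only: Tn_mult(1)) (simp only: Tn_def trop_Ten[OF assms])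

text \<open>Commutation with \<open>Lt\<close> is included so that, along with the conditions on the
  idempotent, it passes from generators to the whole representation.\<close>

definition CT where
  "CT \<tau> = {X. \<forall>p. app (unop X) (prT \<tau> p) = app (unop X) p \<and> prT \<tau> (app (unop X) p) = app (unop X) p \<and>
     (\<forall>h. app (Lt \<tau> h) (app (unop X) p) = app (unop X) (app (Lt \<tau> h) p))}"

lemma CT_trop:
  assumes "balanced \<tau> tr"
  shows "trop \<tau> tr \<in> CT \<tau>"
proof -
  interpret T: tensor_rels I "rel_op \<tau>" by (rule tensor_rels_op)
  have "prT \<tau> (app (unop (trop \<tau> tr)) p) = app (unop (trop \<tau> tr)) p" for p
    by (rule T.Ten_eq[where F = "\<lambda>p. prT \<tau> (app (unop (trop \<tau> tr)) p)" and G = "app (unop (trop \<tau> tr))"])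
      (simp_all add: klin_comp[OF T.klin_pr klin_app] klin_app trop_pr[OF assms] trop_Ten[OF assms] klin_sum_list[OF T.klin_pr] split_def T.pr_Ten)
  moreover have "app (Lt \<tau> h) (app (unop (trop \<tau> tr)) p) = app (unop (trop \<tau> tr)) (app (Lt \<tau> h) p)" for h p
    by (rule T.Ten_eq[where F = "\<lambda>p. app (Lt \<tau> h) (app (unop (trop \<tau> tr)) p)" and G = "\<lambda>p. app (unop (trop \<tau> tr)) (app (Lt \<tau> h) p)"])
      (simp_all add: klin_comp[OF klin_app klin_app] trop_pr[OF assms] trop_Ten[OF assms] klin_sum_list[OF klin_app] split_def Lt_Ten Lt_pr mult.assoc)
  ultimately show ?thesis by (simp add: CT_def trop_pr[OF assms])
qed

lemma CT_closed:
  "X \<in> CT \<tau> \<Longrightarrow> Y \<in> CT \<tau> \<Longrightarrow> X + Y \<in> CT \<tau>" "X \<in> CT \<tau> \<Longrightarrow> - X \<in> CT \<tau>" "X \<in> CT \<tau> \<Longrightarrow> Y \<in> CT \<tau> \<Longrightarrow> X * Y \<in> CT \<tau>"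
  "0 \<in> CT \<tau>" "X \<in> CT \<tau> \<Longrightarrow> Opp (lop_scale k (unop X)) \<in> CT \<tau>"
proof -
  interpret T: tensor_rels I "rel_op \<tau>" by (rule tensor_rels_op)
  note k = klin_add[OF T.klin_pr] klin_minus[OF T.klin_pr] klin_zero[OF T.klin_pr] klin_scale[OF T.klin_pr]
    klin_add[OF klin_app] klin_minus[OF klin_app] klin_zero[OF klin_app] klin_scale[OF klin_app]
  show "X \<in> CT \<tau> \<Longrightarrow> Y \<in> CT \<tau> \<Longrightarrow> X + Y \<in> CT \<tau>" "X \<in> CT \<tau> \<Longrightarrow> - X \<in> CT \<tau>" "X \<in> CT \<tau> \<Longrightarrow> Y \<in> CT \<tau> \<Longrightarrow> X * Y \<in> CT \<tau>"
    "0 \<in> CT \<tau>" "X \<in> CT \<tau> \<Longrightarrow> Opp (lop_scale k (unop X)) \<in> CT \<tau>"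
    by (simp_all add: CT_def app_simps unop_simps k)
qed

lemma CT_sum: "(\<And>i. i \<in> A \<Longrightarrow> g i \<in> CT \<tau>) \<Longrightarrow> (\<Sum>i\<in>A. g i) \<in> CT \<tau>"
  by (induction A rule: infinite_finite_induct) (simp_all add: CT_closed)

lemma CT_eqI:
  assumes "X \<in> CT \<tau>" "Y \<in> CT \<tau>" "\<And>u v. app (unop X) (Tn \<tau> u v) = app (unop Y) (Tn \<tau> u v)"
  shows "X = Y"
proof (rule opp.expand, rule lop_eqI)
  fix p
  show "app (unop X) p = app (unop Y) p"
  proof (rule tensor_rels.Ten_eq[OF tensor_rels_op, where F = "app (unop X)" and G = "app (unop Y)"])
    show "app (unop X) (TenT \<tau> f g) = app (unop Y) (TenT \<tau> f g)" for f g using assms(3)[of "\<kappa>r f" "\<kappa>l g"] by (simp add: Tn_kappa)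
  qed (use assms in \<open>simp_all add: klin_app CT_def\<close>)
qed

lemma lift_CT:
  assumes "free_lift (\<lambda>k X. Opp (lop_scale k (unop X))) e G" "e \<in> CT \<tau>" "\<And>g. G g \<in> CT \<tau>"
  shows "free_lift.lift (\<lambda>k X. Opp (lop_scale k (unop X))) e G f \<in> CT \<tau>"
proof -
  interpret free_lift "\<lambda>k X. Opp (lop_scale k (unop X))" e G by (rule assms)
  show ?thesis
    by (induction f rule: falg_induct) (simp_all add: lift_zero lift_one lift_mult lift_gen lift_add lift_cscale CT_closed assms)
qed

section \<open>The inverse of \<beta>\<close>

definition vfrF :: "'x \<Rightarrow> ('k, 'a, 'm, 'x, 'n, 'y) falg" where
  "vfrF y = (\<Sum>i<nc Q1. gOX1 (om Q1 i) y * gX1 (xi Q1 i))"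

lemma kappa_vfrF: "\<kappa>l (vfrF y) = Ld.vfr y" "\<kappa>r (vfrF y) = Rd.vfr y"
  by (simp_all only: vfrF_def Lh.kappa_sum Lh.kappa_mult Rh.kappa_sum Rh.kappa_mult Ld.vfr_def Rd.vfr_def)

lemmas kr_minus = additive_minus[of \<kappa>r, OF Rh.kappa_add]

text \<open>The tensors b_+ \<otimes> b_- of the generators. For \<open>Bar a\<close> the tensor is
  1 \<otimes> a, because the bar of \<open>a\<close> in the first factor of
  \<open>B \<diamondop> B\<close> equals \<open>a\<close> in the second.\<close>

fun trg :: "('a, 'm, 'x, 'n, 'y) gens \<Rightarrow> (('k, 'a, 'm, 'x, 'n, 'y) falg \<times> ('k, 'a, 'm, 'x, 'n, 'y) falg) list" where
  "trg (El a) = [(gA a, 1)]"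
| "trg (Bar a) = [(1, gA a)]"
| "trg (XO1 x w) = map (\<lambda>(y, v). (gXO1 x v, gOX1 w y)) (coevr P1)"
| "trg (OX1 w x) = map (\<lambda>(v, y). (gOX1 w y, gXO1 x v)) (coev P1)"
| "trg (Vf x) = (gX1 x, 1) # map (\<lambda>(y, v). (- gXO1 x v, vfrF y)) (coevr P1)"
| "trg (XO2 x w) = map (\<lambda>(y, v). (gXO2 x v, gOX2 w y)) (coevr P2)"
| "trg (OX2 w x) = map (\<lambda>(v, y). (gOX2 w y, gXO2 x v)) (coev P2)"

lemma sum_trg:
  "(\<Sum>(a, b)\<leftarrow>trg (El r). F a b) = F (gA r) 1"
  "(\<Sum>(a, b)\<leftarrow>trg (Bar r). F a b) = F 1 (gA r)"
  "(\<Sum>(a, b)\<leftarrow>trg (XO1 x w). F a b) = (\<Sum>j<nd Q1. F (gXO1 x (rh Q1 j)) (gOX1 w (up Q1 j)))"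
  "(\<Sum>(a, b)\<leftarrow>trg (OX1 w x). F a b) = (\<Sum>i<nc Q1. F (gOX1 w (xi Q1 i)) (gXO1 x (om Q1 i)))"
  "(\<Sum>(a, b)\<leftarrow>trg (Vf x). F a b) = F (gX1 x) 1 + (\<Sum>j<nd Q1. F (- gXO1 x (rh Q1 j)) (vfrF (up Q1 j)))"
  "(\<Sum>(a, b)\<leftarrow>trg (XO2 z v). F a b) = (\<Sum>j<nd Q2. F (gXO2 z (rh Q2 j)) (gOX2 v (up Q2 j)))"
  "(\<Sum>(a, b)\<leftarrow>trg (OX2 v z). F a b) = (\<Sum>i<nc Q2. F (gOX2 v (xi Q2 i)) (gXO2 z (om Q2 i)))"
  by (simp_all add: sum_coevr[symmetric, of "\<lambda>y v. F (gXO1 x v) (gOX1 w y)"] sum_coevr[symmetric, of "\<lambda>y v. F (- gXO1 x v) (vfrF y)"]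
     sum_coevr[symmetric, of "\<lambda>y v'. F (gXO2 z v') (gOX2 v y)"] sum_coev[symmetric, of "\<lambda>v y. F (gOX1 w y) (gXO1 x v)"]
     sum_coev[symmetric, of "\<lambda>v' y. F (gOX2 v y) (gXO2 z v')"] split_def comp_def)

abbreviation To where "To \<equiv> Tn (\<lambda>a. gAbar a)"

lemmas To_bal = Tn_props(3)[of "\<lambda>a. gAbar a"]

sublocale Bg1: bal_h "(*)" 1 Q1 rA rB rXO1 rOX1
    lA lB lXO1 lOX1 To
  by (intro bal_h.intro Rd.K1.hst_axioms Ld.K1.hst_axioms bal_h_axioms.intro Tn_props)

sublocale Bg2: bal_h "(*)" 1 Q2 rA rB rXO2 rOX2
    lA lB lXO2 lOX2 To
  by (intro bal_h.intro Rd.K2.hst_axioms Ld.K2.hst_axioms bal_h_axioms.intro Tn_props)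

sublocale Bg: bal "(*)" 1 Q1 Q2 d0 d1 wg rA rB
   rXO1 rOX1 rXO2 rOX2 rX1
   lA lB
   lXO1 lOX1 lXO2 lOX2 lX1 To
  by (intro bal.intro Rd.dx_axioms Ld.dx_axioms Bg1.bal_h_axioms)

lemma balanced_trg: "balanced (\<lambda>a. gAbar a) (trg g)"
proof (rule balancedI, cases g)
  fix u v r
  case (El a)
  have "To (u * \<kappa>r (gAbar r) * \<kappa>r (gA a)) v = To (u * \<kappa>r (gA a)) (\<kappa>l (gAbar r) * v)"
    by (simp only: mult.assoc Rd.K1.st[symmetric]) (simp only: mult.assoc[symmetric] To_bal)
  thus "(\<Sum>(a, b)\<leftarrow>trg g. To (u * \<kappa>r (gAbar r) * \<kappa>r a) (\<kappa>l b * v)) = (\<Sum>(a, b)\<leftarrow>trg g. To (u * \<kappa>r a) (\<kappa>l b * (\<kappa>l (gAbar r) * v)))"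
    by (simp only: El sum_trg Tn_props)
next
  fix u v r
  case (Bar a)
  have "To (u * \<kappa>r (gAbar r)) (\<kappa>l (gA a) * v) = To u (\<kappa>l (gA a) * (\<kappa>l (gAbar r) * v))"
    by (simp only: mult.assoc[symmetric] Ld.K1.st) (simp only: mult.assoc To_bal)
  thus "(\<Sum>(a, b)\<leftarrow>trg g. To (u * \<kappa>r (gAbar r) * \<kappa>r a) (\<kappa>l b * v)) = (\<Sum>(a, b)\<leftarrow>trg g. To (u * \<kappa>r a) (\<kappa>l b * (\<kappa>l (gAbar r) * v)))"
    by (simp only: Bar sum_trg Tn_props)
next
  fix u v r
  case (Vf x)
  show "(\<Sum>(a, b)\<leftarrow>trg g. To (u * \<kappa>r (gAbar r) * \<kappa>r a) (\<kappa>l b * v)) = (\<Sum>(a, b)\<leftarrow>trg g. To (u * \<kappa>r a) (\<kappa>l b * (\<kappa>l (gAbar r) * v)))"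
    using Bg.takeuchi_vf[of u r x v]
    by (simp only: Vf sum_trg Tn_props kr_minus mult_minus_right Tn_minusl kappa_vfrF sum_negf diff_conv_add_uminus)
qed (simp_all only: sum_trg Bg1.takeuchi_xo Bg1.takeuchi_ox Bg2.takeuchi_xo Bg2.takeuchi_ox)

definition gop\<Gamma> where "gop\<Gamma> g = trop (\<lambda>a. gAbar a) (trg g)"

lemma gopG_Tn: "app (unop (gop\<Gamma> g)) (To u v) = (\<Sum>(a, b)\<leftarrow>trg g. To (u * \<kappa>r a) (\<kappa>l b * v))"
  unfolding gop\<Gamma>_def by (rule trop_Tn[OF balanced_trg])

lemma CT_gopG: "gop\<Gamma> g \<in> CT (\<lambda>a. gAbar a)"
  unfolding gop\<Gamma>_def by (rule CT_trop[OF balanced_trg])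

lemma gam_h_axioms1: "gam_h_axioms Q1 rA rXO1 rOX1
    lA lXO1 lOX1 To (\<lambda>X. app (unop X)) (CT (\<lambda>a. gAbar a))
   (\<lambda>a. gop\<Gamma> (El a)) (\<lambda>a. gop\<Gamma> (Bar a)) (\<lambda>x w. gop\<Gamma> (XO1 x w)) (\<lambda>w x. gop\<Gamma> (OX1 w x))"
  by (intro gam_h_axioms.intro CT_eqI CT_closed CT_gopG; (assumption)?)
    (simp_all only: app_simps unop_simps klin_add[OF klin_app] gopG_Tn sum_trg Tn_props)

lemma gam_h_axioms2: "gam_h_axioms Q2 rA rXO2 rOX2
    lA lXO2 lOX2 To (\<lambda>X. app (unop X)) (CT (\<lambda>a. gAbar a))
   (\<lambda>a. gop\<Gamma> (El a)) (\<lambda>a. gop\<Gamma> (Bar a)) (\<lambda>x w. gop\<Gamma> (XO2 x w)) (\<lambda>w x. gop\<Gamma> (OX2 w x))"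
  by (intro gam_h_axioms.intro CT_eqI CT_closed CT_gopG; (assumption)?)
    (simp_all only: app_simps unop_simps klin_add[OF klin_app] gopG_Tn sum_trg Tn_props)

sublocale Ga: gam "(*)" 1 Q1 Q2 d0 d1 wg rA rB
   rXO1 rOX1 rXO2 rOX2 rX1
   lA lB
   lXO1 lOX1 lXO2 lOX2 lX1 To
   "\<lambda>X. app (unop X)" "CT (\<lambda>a. gAbar a)" "\<lambda>a. gop\<Gamma> (El a)" "\<lambda>a. gop\<Gamma> (Bar a)" "\<lambda>x w. gop\<Gamma> (XO1 x w)" "\<lambda>w x. gop\<Gamma> (OX1 w x)"
   "\<lambda>x w. gop\<Gamma> (XO2 x w)" "\<lambda>w x. gop\<Gamma> (OX2 w x)" "\<lambda>x. gop\<Gamma> (Vf x)"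
  by (intro gam.intro gam_h.intro Rd.dx_axioms Ld.dx_axioms Bg1.bal_h_axioms Bg2.bal_h_axioms gam_h_axioms1 gam_h_axioms2 gam_axioms.intro CT_gopG)
    (simp only: gopG_Tn sum_trg Tn_props kr_minus mult_minus_right Tn_minusl kappa_vfrF sum_negf diff_conv_add_uminus)

lemma Tn_scale: "Tn \<tau> (u * \<kappa>r (cscale k f)) v = cscale k (Tn \<tau> (u * \<kappa>r f) v)" "Tn \<tau> u (\<kappa>l (cscale k f) * v) = cscale k (Tn \<tau> u (\<kappa>l f * v))"
  unfolding Tn_mult by (simp_all add: cscale_multl cscale_multr tensor_rels.Ten_scale[OF tensor_rels_op])

lemma kappa_gA_scale: "\<kappa>r (gA (scA k a)) = \<kappa>r (cscale k (gA a))" "\<kappa>l (gA (scA k a)) = \<kappa>l (cscale k (gA a))"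
  "\<kappa>r (gAbar (scA k a)) = \<kappa>r (cscale k (gAbar a))" "\<kappa>l (gAbar (scA k a)) = \<kappa>l (cscale k (gAbar a))"
  by (rule Rh.kappa_Ae Lh.kappa_Ae, rule Ae_rel.intros)+

sublocale GL: lift_DX "\<lambda>k X. Opp (lop_scale k (unop X))" scA P1 P2 d0 d1 wg "\<lambda>a. gop\<Gamma> (El a)" "\<lambda>a. gop\<Gamma> (Bar a)" "\<lambda>x w. gop\<Gamma> (XO1 x w)" "\<lambda>w x. gop\<Gamma> (OX1 w x)"
   "\<lambda>x w. gop\<Gamma> (XO2 x w)" "\<lambda>w x. gop\<Gamma> (OX2 w x)" "\<lambda>x. gop\<Gamma> (Vf x)"
proof (intro lift_DX.intro lift_DX_axioms.intro ko.kring_axioms Ga.gam_dx)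
  fix k a
  show "gop\<Gamma> (El (scA k a)) = Opp (lop_scale k (unop (gop\<Gamma> (El a))))"
    by (rule CT_eqI[OF CT_gopG CT_closed(5)[OF CT_gopG]]) (simp only: gopG_Tn sum_trg Tn_props opp.sel app_simps kappa_gA_scale Tn_scale)
  show "gop\<Gamma> (Bar (scA k a)) = Opp (lop_scale k (unop (gop\<Gamma> (Bar a))))"
    by (rule CT_eqI[OF CT_gopG CT_closed(5)[OF CT_gopG]]) (simp only: gopG_Tn sum_trg Tn_props opp.sel app_simps kappa_gA_scale Tn_scale)
qed

definition "\<Gamma> f = unop (GL.lift f)"

lemma GL_gen: "GL.lift (gen g) = gop\<Gamma> g"
  by (simp add: GL.lift_gen) (cases g; simp)

lemma Gam_Ten: "app (\<Gamma> (gen g)) (TO.Ten f h) = (\<Sum>(a, b)\<leftarrow>trg g. TO.Ten (f * a) (b * h))"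
  by (simp only: \<Gamma>_def GL_gen) (unfold gop\<Gamma>_def, rule trop_Ten[OF balanced_trg])

lemma GL_CT: "GL.lift f \<in> CT (\<lambda>a. gAbar a)"
  by (rule lift_CT[OF GL.free_lift_axioms CT_gopG]) (metis GL.lift_gen GL_gen CT_gopG)

sublocale Hb: half_hopf I "\<lambda>a. gA a" "\<lambda>a. gAbar a" TD.pr TD.Ten TO.pr TO.Ten \<Phi> \<Gamma> "\<lambda>h. GC.Rm h 1" "Lt (\<lambda>a. gAbar a)"
proof (intro half_hopf.intro half_hopf_axioms.intro)
  show "btensor I (rel_dia (\<lambda>a. gA a) (\<lambda>a. gAbar a)) TD.pr TD.Ten" by (rule TD.btensor)
  show "btensor I (rel_op (\<lambda>a. gAbar a)) TO.pr TO.Ten" by (rule TO.btensor)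
  show "app (\<Gamma> 1) p = TO.pr p" for p
  proof (rule TO.Ten_eq[where F = "app (\<Gamma> 1)" and G = TO.pr])
    show "app (\<Gamma> 1) (TO.Ten f g) = TO.pr (TO.Ten f g)" for f g
      unfolding TO.pr_Ten by (simp only: Tn_kappa[symmetric] \<Gamma>_def GL.lift_one gopG_Tn sum_trg Tn_props)
    show "app (\<Gamma> 1) (TO.pr p) = app (\<Gamma> 1) p" for p using GL_CT[of 1] by (simp add: CT_def \<Gamma>_def)
  qed (simp_all add: klin_app TO.klin_pr TO.pr_pr)
  show "f \<in> I \<Longrightarrow> \<Gamma> f = 0" for f unfolding I_def by (simp add: \<Gamma>_def GL.lift_I unop_simps)
  show "app (\<Gamma> f) (TO.pr p) = app (\<Gamma> f) p" "TO.pr (app (\<Gamma> f) p) = app (\<Gamma> f) p"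
    "app (Lt (\<lambda>a. gAbar a) h) (app (\<Gamma> f) p) = app (\<Gamma> f) (app (Lt (\<lambda>a. gAbar a) h) p)" for f p h
    using GL_CT[of f] by (simp_all add: CT_def \<Gamma>_def)
  show "app (\<Gamma> (gAbar r)) (TO.Ten f g) = TO.Ten f (gA r * g)" for r f g
    by (simp only: Gam_Ten sum_trg mult_1_right)
qed (rule I_mult I_zero GC.Phi_add GC.Phi_scale GC.Phi_mult GC.Phi_one GC.Phi_I GC.Phi_pr GC.pr_Phi GC.Phi_t GC.Rm_pr GC.Rm_Phi
      Lt_Ten Lt_pr; assumption?
   | simp add: \<Gamma>_def GL.lift_add GL.lift_mult GL.lift_cscale unop_simps GC.Rm_D)+

lemma D_one: "D u (\<kappa>l 1 * v) = D u v" "D (\<kappa>l 1 * u) v = D u v"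
  unfolding D_kl_mult unfolding D_def by simp_all

lemma pr_D: "TD.pr (D u v) = D u v"
  by (simp add: D_def TD.pr_Ten)

lemmas Phi_minus = additive_minus[of \<Phi>, OF PhiL.lift_add]

text \<open>The two identities of \<open>good_lists\<close> are supplied by
  \<open>trans_fxo\<close>, \<open>cop_gxo\<close> and their companions for the other
  generators.\<close>

lemma good_gen: "Hb.good (gen g)"
proof (rule Hb.good_lists)
  show "app (\<Gamma> (gen g)) (TO.Ten u v) = (\<Sum>(a, c)\<leftarrow>trg g. TO.Ten (u * a) (c * v))" for u v by (rule Gam_Ten)
  show "app (\<Phi> (gen g)) (TD.Ten u v) = (\<Sum>(a, c)\<leftarrow>map (\<lambda>(a, b). (gen a, gen b)) (cop g). TD.Ten (a * u) (c * v))" for u v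
    by (simp add: GC.Phi_gen split_def comp_def)
next
  fix v
  have "(\<Sum>(a, c)\<leftarrow>trg g. app (\<Phi> a) (D (\<kappa>l 1) (\<kappa>l c * \<kappa>l v))) = D (\<kappa>l (gen g) * \<kappa>l 1) (\<kappa>l v)"
    by (cases g) (simp_all only: sum_trg Phi_gen Phi_minus Phi_one pr_D D_props D_one gop_D[of "El _"] gop_D[of "Bar _"] sum_cop kappa_vfrF app_simps sum_negf
      De.G1.trans_fxo De.G1.trans_fox De.G2.trans_fxo De.G2.trans_fox De.trans_fvf[unfolded diff_conv_add_uminus])
  thus "(\<Sum>(a, c)\<leftarrow>trg g. app (\<Phi> a) (TD.Ten 1 (c * v))) = TD.Ten (gen g) v"
    by (simp only: Lh.kappa_mult[symmetric] D_kl mult_1_right)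
next
  fix v
  have "(\<Sum>(a, c)\<leftarrow>cop g. app (unop (gop\<Gamma> a)) (To (\<kappa>r 1) (\<kappa>l (gen c) * \<kappa>l v))) = To (\<kappa>r 1 * \<kappa>r (gen g)) (\<kappa>l v)"
    by (cases g) (simp_all only: sum_cop gopG_Tn[of "El _"] sum_trg Tn_props To_bal
      Ga.G1.cop_gxo Ga.G1.cop_gox Ga.G2.cop_gxo Ga.G2.cop_gox Ga.cop_gvf)
  hence "(\<Sum>(a, c)\<leftarrow>cop g. app (\<Gamma> (gen a)) (TO.Ten 1 (gen c * v))) = TO.Ten (gen g) v"
    by (simp only: Lh.kappa_mult[symmetric] Rh.kappa_mult[symmetric] Tn_kappa mult_1_left \<Gamma>_def GL_gen)
  thus "(\<Sum>(a, c)\<leftarrow>map (\<lambda>(a, b). (gen a, gen b)) (cop g). app (\<Gamma> a) (TO.Ten 1 (c * v))) = TO.Ten (gen g) v"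
    by (simp add: split_def comp_def)
qed

text \<open>The inverse of \<open>\<theta>\<close> is the inverse of \<open>\<beta>\<close> for the mirror image of \<open>B\<close>, in which \<open>vfrF\<close> plays the role of the
  generators \<open>Vf\<close>.\<close>

sublocale Lmd: dx "\<lambda>a b. b * a" 1 "mirror Q1" "mirror Q2" d0 d1 "\<lambda>w v. - wg v w" lB lA
   "\<lambda>x w. lOX1 w x" "\<lambda>w x. lXO1 x w" "\<lambda>x w. lOX2 w x" "\<lambda>w x. lXO2 x w" Ld.vfr
  by (rule Ld.mirror_dx)

sublocale Rmd: dx "\<lambda>a b. b * a" 1 "mirror Q1" "mirror Q2" d0 d1 "\<lambda>w v. - wg v w" rB rA
   "\<lambda>x w. rOX1 w x" "\<lambda>w x. rXO1 x w" "\<lambda>x w. rOX2 w x" "\<lambda>w x. rXO2 x w" Rd.vfr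
  by (rule Rd.mirror_dx)

lemma Lmd_vfr: "Lmd.vfr x = \<kappa>l (gX1 x)"
  by (simp add: Lmd.vfr_def Ld.vf_vfr)

text \<open>The list belonging to \<open>Vf y\<close> is the one for \<open>vfrF y\<close>.\<close>

fun trt :: "('a, 'm, 'x, 'n, 'y) gens \<Rightarrow> (('k, 'a, 'm, 'x, 'n, 'y) falg \<times> ('k, 'a, 'm, 'x, 'n, 'y) falg) list" where
  "trt (El a) = [(1, gAbar a)]"
| "trt (Bar a) = [(gAbar a, 1)]"
| "trt (OX1 w x) = map (\<lambda>(v, y). (gOX1 v x, gXO1 y w)) (coev P1)"
| "trt (XO1 x w) = map (\<lambda>(y, v). (gXO1 y w, gOX1 v x)) (coevr P1)"
| "trt (Vf y) = (vfrF y, 1) # map (\<lambda>(v, x). (- gOX1 v y, gX1 x)) (coev P1)"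
| "trt (OX2 w x) = map (\<lambda>(v, y). (gOX2 v x, gXO2 y w)) (coev P2)"
| "trt (XO2 x w) = map (\<lambda>(y, v). (gXO2 y w, gOX2 v x)) (coevr P2)"

lemma sum_trt:
  "(\<Sum>(a, b)\<leftarrow>trt (El r). F a b) = F 1 (gAbar r)"
  "(\<Sum>(a, b)\<leftarrow>trt (Bar r). F a b) = F (gAbar r) 1"
  "(\<Sum>(a, b)\<leftarrow>trt (OX1 w x). F a b) = (\<Sum>i<nc Q1. F (gOX1 (om Q1 i) x) (gXO1 (xi Q1 i) w))"
  "(\<Sum>(a, b)\<leftarrow>trt (XO1 x w). F a b) = (\<Sum>j<nd Q1. F (gXO1 (up Q1 j) w) (gOX1 (rh Q1 j) x))"
  "(\<Sum>(a, b)\<leftarrow>trt (Vf x). F a b) = F (vfrF x) 1 + (\<Sum>i<nc Q1. F (- gOX1 (om Q1 i) x) (gX1 (xi Q1 i)))"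
  "(\<Sum>(a, b)\<leftarrow>trt (OX2 v z). F a b) = (\<Sum>i<nc Q2. F (gOX2 (om Q2 i) z) (gXO2 (xi Q2 i) v))"
  "(\<Sum>(a, b)\<leftarrow>trt (XO2 z v). F a b) = (\<Sum>j<nd Q2. F (gXO2 (up Q2 j) v) (gOX2 (rh Q2 j) z))"
  by (simp_all add: sum_coev[symmetric, of "\<lambda>v y. F (gOX1 v x) (gXO1 y w)"] sum_coev[symmetric, of "\<lambda>v y. F (- gOX1 v x) (gX1 y)"]
     sum_coev[symmetric, of "\<lambda>v' y. F (gOX2 v' z) (gXO2 y v)"] sum_coevr[symmetric, of "\<lambda>y v. F (gXO1 y w) (gOX1 v x)"]
     sum_coevr[symmetric, of "\<lambda>y v'. F (gXO2 y v) (gOX2 v' z)"] split_def comp_def)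

abbreviation Tt where "Tt \<equiv> Tn (\<lambda>a. gA a)"

lemmas Tt_bal = Tn_props(3)[of "\<lambda>a. gA a"]

sublocale Bt1: bal_h "\<lambda>a b. b * a" 1 "mirror Q1" rB rA "\<lambda>x w. rOX1 w x" "\<lambda>w x. rXO1 x w"
    lB lA "\<lambda>x w. lOX1 w x" "\<lambda>w x. lXO1 x w" Tt
  by (intro bal_h.intro Rmd.K1.hst_axioms Lmd.K1.hst_axioms bal_h_axioms.intro Tn_props)

sublocale Bt2: bal_h "\<lambda>a b. b * a" 1 "mirror Q2" rB rA "\<lambda>x w. rOX2 w x" "\<lambda>w x. rXO2 x w"
    lB lA "\<lambda>x w. lOX2 w x" "\<lambda>w x. lXO2 x w" Tt
  by (intro bal_h.intro Rmd.K2.hst_axioms Lmd.K2.hst_axioms bal_h_axioms.intro Tn_props)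

sublocale Bt: bal "\<lambda>a b. b * a" 1 "mirror Q1" "mirror Q2" d0 d1 "\<lambda>w v. - wg v w" rB rA
   "\<lambda>x w. rOX1 w x" "\<lambda>w x. rXO1 x w" "\<lambda>x w. rOX2 w x" "\<lambda>w x. rXO2 x w" Rd.vfr
   lB lA
   "\<lambda>x w. lOX1 w x" "\<lambda>w x. lXO1 x w" "\<lambda>x w. lOX2 w x" "\<lambda>w x. lXO2 x w" Ld.vfr Tt
  by (intro bal.intro Rmd.dx_axioms Lmd.dx_axioms Bt1.bal_h_axioms)

lemma balanced_trt: "balanced (\<lambda>a. gA a) (trt g)"
proof (rule balancedI, cases g)
  fix u v r
  case (Bar a)
  have "Tt (u * \<kappa>r (gA r) * \<kappa>r (gAbar a)) v = Tt (u * \<kappa>r (gAbar a)) (\<kappa>l (gA r) * v)"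
    by (simp only: mult.assoc Rd.K1.st) (simp only: mult.assoc[symmetric] Tt_bal)
  thus "(\<Sum>(a, b)\<leftarrow>trt g. Tt (u * \<kappa>r (gA r) * \<kappa>r a) (\<kappa>l b * v)) = (\<Sum>(a, b)\<leftarrow>trt g. Tt (u * \<kappa>r a) (\<kappa>l b * (\<kappa>l (gA r) * v)))"
    by (simp only: Bar sum_trt Tn_props)
next
  fix u v r
  case (El a)
  have "Tt (u * \<kappa>r (gA r)) (\<kappa>l (gAbar a) * v) = Tt u (\<kappa>l (gAbar a) * (\<kappa>l (gA r) * v))"
    by (simp only: mult.assoc[symmetric] Ld.K1.st[symmetric]) (simp only: mult.assoc Tt_bal)
  thus "(\<Sum>(a, b)\<leftarrow>trt g. Tt (u * \<kappa>r (gA r) * \<kappa>r a) (\<kappa>l b * v)) = (\<Sum>(a, b)\<leftarrow>trt g. Tt (u * \<kappa>r a) (\<kappa>l b * (\<kappa>l (gA r) * v)))"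
    by (simp only: El sum_trt Tn_props)
next
  fix u v r
  case (Vf x)
  show "(\<Sum>(a, b)\<leftarrow>trt g. Tt (u * \<kappa>r (gA r) * \<kappa>r a) (\<kappa>l b * v)) = (\<Sum>(a, b)\<leftarrow>trt g. Tt (u * \<kappa>r a) (\<kappa>l b * (\<kappa>l (gA r) * v)))"
    using Bt.takeuchi_vf[of u r x v]
    by (simp only: Vf sum_trt Tn_props kr_minus mult_minus_right Tn_minusl kappa_vfrF sum_negf diff_conv_add_uminus mirror_simps Lmd_vfr)
qed (simp_all only: sum_trt Bt1.takeuchi_xo[unfolded mirror_simps] Bt1.takeuchi_ox[unfolded mirror_simps]
   Bt2.takeuchi_xo[unfolded mirror_simps] Bt2.takeuchi_ox[unfolded mirror_simps])

definition gop\<Theta> where "gop\<Theta> g = trop (\<lambda>a. gA a) (trt g)"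

lemma gopT_Tn: "app (unop (gop\<Theta> g)) (Tt u v) = (\<Sum>(a, b)\<leftarrow>trt g. Tt (u * \<kappa>r a) (\<kappa>l b * v))"
  unfolding gop\<Theta>_def by (rule trop_Tn[OF balanced_trt])

lemma CT_gopT: "gop\<Theta> g \<in> CT (\<lambda>a. gA a)"
  unfolding gop\<Theta>_def by (rule CT_trop[OF balanced_trt])

lemma gam_h_axiomsT1: "gam_h_axioms (mirror Q1) rB (\<lambda>x w. rOX1 w x) (\<lambda>w x. rXO1 x w)
    lB (\<lambda>x w. lOX1 w x) (\<lambda>w x. lXO1 x w) Tt (\<lambda>X. app (unop X)) (CT (\<lambda>a. gA a))
   (\<lambda>a. gop\<Theta> (Bar a)) (\<lambda>a. gop\<Theta> (El a)) (\<lambda>x w. gop\<Theta> (OX1 w x)) (\<lambda>w x. gop\<Theta> (XO1 x w))"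
  by (intro gam_h_axioms.intro CT_eqI CT_closed CT_gopT; (assumption)?)
    (simp_all only: app_simps unop_simps klin_add[OF klin_app] gopT_Tn sum_trt Tn_props mirror_simps)

lemma gam_h_axiomsT2: "gam_h_axioms (mirror Q2) rB (\<lambda>x w. rOX2 w x) (\<lambda>w x. rXO2 x w)
    lB (\<lambda>x w. lOX2 w x) (\<lambda>w x. lXO2 x w) Tt (\<lambda>X. app (unop X)) (CT (\<lambda>a. gA a))
   (\<lambda>a. gop\<Theta> (Bar a)) (\<lambda>a. gop\<Theta> (El a)) (\<lambda>x w. gop\<Theta> (OX2 w x)) (\<lambda>w x. gop\<Theta> (XO2 x w))"
  by (intro gam_h_axioms.intro CT_eqI CT_closed CT_gopT; (assumption)?)
    (simp_all only: app_simps unop_simps klin_add[OF klin_app] gopT_Tn sum_trt Tn_props mirror_simps)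

sublocale Gt: gam "\<lambda>a b. b * a" 1 "mirror Q1" "mirror Q2" d0 d1 "\<lambda>w v. - wg v w" rB rA
   "\<lambda>x w. rOX1 w x" "\<lambda>w x. rXO1 x w" "\<lambda>x w. rOX2 w x" "\<lambda>w x. rXO2 x w" Rd.vfr
   lB lA
   "\<lambda>x w. lOX1 w x" "\<lambda>w x. lXO1 x w" "\<lambda>x w. lOX2 w x" "\<lambda>w x. lXO2 x w" Ld.vfr Tt
   "\<lambda>X. app (unop X)" "CT (\<lambda>a. gA a)" "\<lambda>a. gop\<Theta> (Bar a)" "\<lambda>a. gop\<Theta> (El a)" "\<lambda>x w. gop\<Theta> (OX1 w x)" "\<lambda>w x. gop\<Theta> (XO1 x w)"
   "\<lambda>x w. gop\<Theta> (OX2 w x)" "\<lambda>w x. gop\<Theta> (XO2 x w)" "\<lambda>x. gop\<Theta> (Vf x)"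
  by (intro gam.intro gam_h.intro Rmd.dx_axioms Lmd.dx_axioms Bt1.bal_h_axioms Bt2.bal_h_axioms gam_h_axiomsT1 gam_h_axiomsT2 gam_axioms.intro CT_gopT)
    (simp only: gopT_Tn sum_trt Tn_props kr_minus mult_minus_right Tn_minusl kappa_vfrF sum_negf diff_conv_add_uminus mirror_simps Lmd_vfr)

sublocale Md: dx "\<lambda>a b. b * a" 1 "mirror Q1" "mirror Q2" d0 d1 "\<lambda>w v. - wg v w"
   "\<lambda>a. gop\<Theta> (Bar a)" "\<lambda>a. gop\<Theta> (El a)" "\<lambda>x w. gop\<Theta> (OX1 w x)" "\<lambda>w x. gop\<Theta> (XO1 x w)"
   "\<lambda>x w. gop\<Theta> (OX2 w x)" "\<lambda>w x. gop\<Theta> (XO2 x w)" "\<lambda>x. gop\<Theta> (Vf x)"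
  by (rule Gt.gam_dx)

lemma CT_vfr: "Md.vfr x \<in> CT (\<lambda>a. gA a)"
  unfolding Md.vfr_def by (intro CT_sum CT_closed CT_gopT)

text \<open>Mirroring twice returns to the original relations, so the mirrored operators do
  represent \<open>B\<close>, with \<open>Md.vfr\<close> as the image of the generators
  \<open>Vf\<close>.\<close>

sublocale TL: lift_DX "\<lambda>k X. Opp (lop_scale k (unop X))" scA P1 P2 d0 d1 wg "\<lambda>a. gop\<Theta> (El a)" "\<lambda>a. gop\<Theta> (Bar a)" "\<lambda>x w. gop\<Theta> (XO1 x w)" "\<lambda>w x. gop\<Theta> (OX1 w x)"
   "\<lambda>x w. gop\<Theta> (XO2 x w)" "\<lambda>w x. gop\<Theta> (OX2 w x)" Md.vfr
proof (intro lift_DX.intro lift_DX_axioms.intro ko.kring_axioms)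
  show "dx (*) 1 Q1 Q2 d0 d1 wg (\<lambda>a. gop\<Theta> (El a)) (\<lambda>a. gop\<Theta> (Bar a)) (\<lambda>x w. gop\<Theta> (XO1 x w))
     (\<lambda>w x. gop\<Theta> (OX1 w x)) (\<lambda>x w. gop\<Theta> (XO2 x w)) (\<lambda>w x. gop\<Theta> (OX2 w x)) Md.vfr"
    using Md.mirror_dx by simp
  fix k a
  show "gop\<Theta> (El (scA k a)) = Opp (lop_scale k (unop (gop\<Theta> (El a))))"
    by (rule CT_eqI[OF CT_gopT CT_closed(5)[OF CT_gopT]]) (simp only: gopT_Tn sum_trt Tn_props opp.sel app_simps kappa_gA_scale Tn_scale)
  show "gop\<Theta> (Bar (scA k a)) = Opp (lop_scale k (unop (gop\<Theta> (Bar a))))"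
    by (rule CT_eqI[OF CT_gopT CT_closed(5)[OF CT_gopT]]) (simp only: gopT_Tn sum_trt Tn_props opp.sel app_simps kappa_gA_scale Tn_scale)
qed

definition "\<Theta> f = unop (TL.lift f)"

text \<open>By \<open>vf_vfr\<close> for the mirrored operators, the element \<open>vfrF y\<close>
  acts through the operator that takes the role of a vector field there.\<close>

lemma TL_vfrF: "TL.lift (vfrF y) = gop\<Theta> (Vf y)"
  using Md.vf_vfr[of y] by (simp add: vfrF_def TL.lift_sum TL.lift_mult TL.lift_gen)

lemma Theta_gen: "g \<notin> range Vf \<Longrightarrow> \<Theta> (gen g) = unop (gop\<Theta> g)"
  by (simp add: \<Theta>_def TL.lift_gen) (cases g; simp)

lemma Theta_Ten: "g \<notin> range Vf \<Longrightarrow> app (\<Theta> (gen g)) (TT.Ten f h) = (\<Sum>(a, b)\<leftarrow>trt g. TT.Ten (f * a) (b * h))"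
  by (subst Theta_gen, assumption, unfold gop\<Theta>_def, rule trop_Ten[OF balanced_trt])

lemma Theta_vfrF: "app (\<Theta> (vfrF y)) (TT.Ten f h) = (\<Sum>(a, b)\<leftarrow>trt (Vf y). TT.Ten (f * a) (b * h))"
  by (simp only: \<Theta>_def TL_vfrF) (unfold gop\<Theta>_def, rule trop_Ten[OF balanced_trt])

lemma TL_CT: "TL.lift f \<in> CT (\<lambda>a. gA a)"
proof (rule lift_CT[OF TL.free_lift_axioms CT_gopT])
  show "TL.G g \<in> CT (\<lambda>a. gA a)" for g by (cases g) (simp_all add: CT_gopT CT_vfr)
qed

sublocale Ht: half_hopf I "\<lambda>a. gAbar a" "\<lambda>a. gA a" TD.pr "\<lambda>f g. TD.Ten g f" TT.pr TT.Ten \<Phi> \<Theta> "\<lambda>h. GC.Rm 1 h" "Lt (\<lambda>a. gA a)"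
proof (intro half_hopf.intro half_hopf_axioms.intro)
  show "btensor I (rel_dia (\<lambda>a. gAbar a) (\<lambda>a. gA a)) TD.pr (\<lambda>f g. TD.Ten g f)" by (rule btensor_flip[OF TD.btensor])
  show "btensor I (rel_op (\<lambda>a. gA a)) TT.pr TT.Ten" by (rule TT.btensor)
  show "app (\<Theta> 1) p = TT.pr p" for p
  proof (rule TT.Ten_eq[where F = "app (\<Theta> 1)" and G = TT.pr])
    show "app (\<Theta> 1) (TT.Ten f g) = TT.pr (TT.Ten f g)" for f g
      unfolding TT.pr_Ten by (simp only: Tn_kappa[symmetric] \<Theta>_def TL.lift_one gopT_Tn sum_trt Tn_props)
    show "app (\<Theta> 1) (TT.pr p) = app (\<Theta> 1) p" for p using TL_CT[of 1] by (simp add: CT_def \<Theta>_def)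
  qed (simp_all add: klin_app TT.klin_pr TT.pr_pr)
  show "f \<in> I \<Longrightarrow> \<Theta> f = 0" for f unfolding I_def by (simp add: \<Theta>_def TL.lift_I unop_simps)
  show "app (\<Theta> f) (TT.pr p) = app (\<Theta> f) p" "TT.pr (app (\<Theta> f) p) = app (\<Theta> f) p"
    "app (Lt (\<lambda>a. gA a) h) (app (\<Theta> f) p) = app (\<Theta> f) (app (Lt (\<lambda>a. gA a) h) p)" for f p h
    using TL_CT[of f] by (simp_all add: CT_def \<Theta>_def)
  show "app (\<Theta> (gA r)) (TT.Ten f g) = TT.Ten f (gAbar r * g)" for r f g
    by (subst Theta_Ten) (auto simp only: sum_trt mult_1_right)
qed (rule I_mult I_zero GC.Phi_add GC.Phi_scale GC.Phi_mult GC.Phi_one GC.Phi_I GC.Phi_pr GC.pr_Phi GC.Phi_s GC.Rm_pr GC.Rm_Phi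
      Lt_Ten Lt_pr; assumption?
   | simp add: \<Theta>_def TL.lift_add TL.lift_mult TL.lift_cscale unop_simps GC.Rm_D)+

lemma D_t1: "D (\<kappa>l (gAbar 1) * u) v = D u v" "D u (\<kappa>l (gAbar 1) * v) = D u v"
  using D_props(4)[of u v] D_props(5)[of u v] Ld.K1.s_one by simp_all

lemma Phi_vfrF: "app (\<Phi> (vfrF y)) (D u v) = D u (\<kappa>l (vfrF y) * v) + (\<Sum>j<nd Q1. D (\<kappa>l (vfrF (up Q1 j)) * u) (\<kappa>l (gOX1 (rh Q1 j) y) * v))"
  unfolding kappa_vfrF De.ap_fvfr[symmetric] by (simp add: vfrF_def PhiL.lift_sum PhiL.lift_mult Phi_gen app_simps additive_sum[of "\<lambda>X. app X p" for p])

lemma CD_Phi: "\<Phi> f \<in> CD"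
  by (simp add: CD_def Phi_pr)

sublocale DelM1: del_h "\<lambda>a b. b * a" 1 "mirror Q1" lB lA "\<lambda>x w. lOX1 w x" "\<lambda>w x. lXO1 x w" "\<lambda>u v. D v u"
  by (intro del_h.intro Lmd.K1.hst_axioms del_h_axioms.intro D_props D_t1 D_props(3)[symmetric])

sublocale DelM2: del_h "\<lambda>a b. b * a" 1 "mirror Q2" lB lA "\<lambda>x w. lOX2 w x" "\<lambda>w x. lXO2 x w" "\<lambda>u v. D v u"
  by (intro del_h.intro Lmd.K2.hst_axioms del_h_axioms.intro D_props D_t1 D_props(3)[symmetric])

lemma delta_h_axiomsM1: "delta_h_axioms (mirror Q1) lB lA (\<lambda>x w. lOX1 w x) (\<lambda>w x. lXO1 x w) (\<lambda>u v. D v u) app CD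
   (\<lambda>a. gop (Bar a)) (\<lambda>a. gop (El a)) (\<lambda>x w. gop (OX1 w x)) (\<lambda>w x. gop (XO1 x w))"
  by (intro delta_h_axioms.intro CD_eqI CD_closed)
    (simp_all only: app_simps klin_add[OF klin_app] gop_D sum_cop D_props mirror_simps)

lemma delta_h_axiomsM2: "delta_h_axioms (mirror Q2) lB lA (\<lambda>x w. lOX2 w x) (\<lambda>w x. lXO2 x w) (\<lambda>u v. D v u) app CD
   (\<lambda>a. gop (Bar a)) (\<lambda>a. gop (El a)) (\<lambda>x w. gop (OX2 w x)) (\<lambda>w x. gop (XO2 x w))"
  by (intro delta_h_axioms.intro CD_eqI CD_closed)
    (simp_all only: app_simps klin_add[OF klin_app] gop_D sum_cop D_props mirror_simps)

text \<open>With the factors of \<open>D\<close> exchanged, the same operators form the coproduct of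
  the mirror image; \<open>ap_fvfr\<close> gives \<open>vfrF\<close> the coproduct of a vector
  field.\<close>

sublocale DeM: delta "\<lambda>a b. b * a" 1 "mirror Q1" "mirror Q2" d0 d1 "\<lambda>w v. - wg v w" lB lA
   "\<lambda>x w. lOX1 w x" "\<lambda>w x. lXO1 x w" "\<lambda>x w. lOX2 w x" "\<lambda>w x. lXO2 x w" Ld.vfr "\<lambda>u v. D v u" app CD
   "\<lambda>a. gop (Bar a)" "\<lambda>a. gop (El a)" "\<lambda>x w. gop (OX1 w x)" "\<lambda>w x. gop (XO1 x w)" "\<lambda>x w. gop (OX2 w x)" "\<lambda>w x. gop (XO2 x w)" "\<lambda>x. \<Phi> (vfrF x)"
  by (intro delta.intro delta_h.intro Lmd.dx_axioms DelM1.del_h_axioms DelM2.del_h_axioms delta_h_axiomsM1 delta_h_axiomsM2 delta_axioms.intro CD_Phi)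
    (simp only: Phi_vfrF kappa_vfrF mirror_simps)

lemma good_gen_not_Vf:
  assumes g: "g \<notin> range Vf"
  shows "Ht.good (gen g)"
proof (rule Ht.good_lists)
  show "app (\<Theta> (gen g)) (TT.Ten u v) = (\<Sum>(a, c)\<leftarrow>trt g. TT.Ten (u * a) (c * v))" for u v by (rule Theta_Ten[OF g])
  show "app (\<Phi> (gen g)) (TD.Ten v u) = (\<Sum>(a, c)\<leftarrow>map (\<lambda>(a, b). (gen b, gen a)) (cop g). TD.Ten (c * v) (a * u))" for u v
    by (simp add: GC.Phi_gen split_def comp_def)
next
  fix v
  have "(\<Sum>(a, c)\<leftarrow>trt g. app (\<Phi> a) (D (\<kappa>l c * \<kappa>l v) (\<kappa>l 1))) = D (\<kappa>l v) (\<kappa>l (gen g) * \<kappa>l 1)"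
  proof (cases g)
    case (Vf x)
    thus ?thesis using g by blast
  qed (simp_all only: sum_trt Phi_gen Phi_one pr_D D_props D_one gop_D[of "El _"] gop_D[of "Bar _"] sum_cop
      DeM.G1.trans_fxo[unfolded mirror_simps] DeM.G1.trans_fox[unfolded mirror_simps]
      DeM.G2.trans_fxo[unfolded mirror_simps] DeM.G2.trans_fox[unfolded mirror_simps])
  thus "(\<Sum>(a, c)\<leftarrow>trt g. app (\<Phi> a) (TD.Ten (c * v) 1)) = TD.Ten v (gen g)"
    by (simp only: Lh.kappa_mult[symmetric] D_kl mult_1_right)
next
  fix v
  have T: "\<Theta> (gA a) = unop (gop\<Theta> (El a))" "\<Theta> (gAbar a) = unop (gop\<Theta> (Bar a))"
    "\<Theta> (gXO1 x w) = unop (gop\<Theta> (XO1 x w))" "\<Theta> (gOX1 w x) = unop (gop\<Theta> (OX1 w x))"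
    "\<Theta> (gXO2 z u) = unop (gop\<Theta> (XO2 z u))" "\<Theta> (gOX2 u z) = unop (gop\<Theta> (OX2 u z))" for a x w z u
    by (rule Theta_gen, blast)+
  have "(\<Sum>(a, c)\<leftarrow>cop g. app (\<Theta> (gen c)) (Tt (\<kappa>r 1) (\<kappa>l (gen a) * \<kappa>l v))) = Tt (\<kappa>r 1 * \<kappa>r (gen g)) (\<kappa>l v)"
  proof (cases g)
    case (Vf x)
    thus ?thesis using g by blast
  qed (simp_all only: sum_cop T gopT_Tn[of "El _"] gopT_Tn[of "Bar _"] sum_trt Tn_props Tt_bal
      Gt.G1.cop_gxo[unfolded mirror_simps] Gt.G1.cop_gox[unfolded mirror_simps] Gt.G2.cop_gxo[unfolded mirror_simps] Gt.G2.cop_gox[unfolded mirror_simps])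
  hence "(\<Sum>(a, c)\<leftarrow>cop g. app (\<Theta> (gen c)) (TT.Ten 1 (gen a * v))) = TT.Ten (gen g) v"
    by (simp only: Lh.kappa_mult[symmetric] Rh.kappa_mult[symmetric] Tn_kappa mult_1_left)
  thus "(\<Sum>(a, c)\<leftarrow>map (\<lambda>(a, b). (gen b, gen a)) (cop g). app (\<Theta> a) (TT.Ten 1 (c * v))) = TT.Ten (gen g) v"
    by (simp add: split_def comp_def)
qed

lemma good_vfrF: "Ht.good (vfrF y)"
proof (rule Ht.good_lists)
  \<comment> \<open>The coproduct of \<open>vfrF y\<close> from \<open>ap_fvfr\<close>, with the
    factors exchanged.\<close>
  let ?cp = "(vfrF y, 1) # map (\<lambda>(x, w). (gOX1 w y, vfrF x)) (coevr P1)"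
  have cp: "(\<Sum>(a, c)\<leftarrow>?cp. F a c) = F (vfrF y) 1 + (\<Sum>j<nd Q1. F (gOX1 (rh Q1 j) y) (vfrF (up Q1 j)))"
    for F :: "_ \<Rightarrow> _ \<Rightarrow> 'z::ab_group_add"
    by (simp add: sum_coevr[symmetric, of "\<lambda>x w. F (gOX1 w y) (vfrF x)"] split_def comp_def)
  show "app (\<Theta> (vfrF y)) (TT.Ten u v) = (\<Sum>(a, c)\<leftarrow>trt (Vf y). TT.Ten (u * a) (c * v))" for u v by (rule Theta_vfrF)
  show "app (\<Phi> (vfrF y)) (TD.Ten v u) = (\<Sum>(a, c)\<leftarrow>?cp. TD.Ten (c * v) (a * u))" for u v
    unfolding cp using Phi_vfrF[of y "\<kappa>l v" "\<kappa>l u"] by (simp only: Lh.kappa_mult[symmetric] D_kl mult_1_left)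
  fix v
  have "(\<Sum>(a, c)\<leftarrow>trt (Vf y). app (\<Phi> a) (D (\<kappa>l c * \<kappa>l v) (\<kappa>l 1))) = D (\<kappa>l v) (\<kappa>l (vfrF y) * \<kappa>l 1)"
    using DeM.trans_fvf[of y "\<kappa>l v" "\<kappa>l 1"]
    by (simp only: sum_trt D_one Phi_minus app_simps sum_negf Phi_gen mirror_simps Lmd_vfr kappa_vfrF diff_conv_add_uminus)
  thus "(\<Sum>(a, c)\<leftarrow>trt (Vf y). app (\<Phi> a) (TD.Ten (c * v) 1)) = TD.Ten v (vfrF y)"
    by (simp only: Lh.kappa_mult[symmetric] D_kl mult_1_right)
  have "app (\<Theta> (vfrF y)) (Tt (\<kappa>r 1) (\<kappa>l v)) + (\<Sum>j<nd Q1. app (\<Theta> (gOX1 (rh Q1 j) y)) (Tt (\<kappa>r 1) (\<kappa>l (vfrF (up Q1 j)) * \<kappa>l v)))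
    = Tt (\<kappa>r 1 * \<kappa>r (vfrF y)) (\<kappa>l v)"
    using Gt.cop_gvf[of y "\<kappa>r 1" "\<kappa>l v"] by (simp add: \<Theta>_def TL_vfrF TL.lift_gen kappa_vfrF)
  thus "(\<Sum>(a, c)\<leftarrow>?cp. app (\<Theta> a) (TT.Ten 1 (c * v))) = TT.Ten (vfrF y) v"
    unfolding cp by (simp only: Lh.kappa_mult[symmetric] Rh.kappa_mult[symmetric] Tn_kappa mult_1_left)
qed

text \<open>\<open>\<Theta>\<close> is given by a list on \<open>vfrF\<close> but not on
  \<open>Vf\<close>. In \<open>B\<close>, however, a vector field is a sum of products of good
  elements by \<open>vf_vfr\<close>.\<close>

lemma good_Vf: "Ht.good (gX1 x)"
proof (rule Ht.good_cong)
  have "\<kappa>l (gX1 x) = \<kappa>l (\<Sum>j<nd Q1. gXO1 x (rh Q1 j) * vfrF (up Q1 j))"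
    by (simp add: Lh.kappa_sum Lh.kappa_mult kappa_vfrF Ld.vf_vfr)
  from kl_inj[OF this]
  show "gX1 x - (\<Sum>j<nd Q1. gXO1 x (rh Q1 j) * vfrF (up Q1 j)) \<in> I" by (simp add: q_eq_iff)
  show "Ht.good (\<Sum>j<nd Q1. gXO1 x (rh Q1 j) * vfrF (up Q1 j))"
    by (intro Ht.good_sum Ht.good_mult good_gen_not_Vf good_vfrF) blast
qed

lemma good_gen_theta: "Ht.good (gen g)"
  using good_Vf good_gen_not_Vf by (cases "g \<in> range Vf") auto

lemma schauenburg: "schauenburg_hopf_algebroid scA B (\<lambda>a. q (gA a)) (\<lambda>a. q (gAbar a)) GC.\<Delta> GC.\<epsilon>"
  by (rule GC.schauenburg[OF Hb.beta_pT Hb.pD_beta Hb.pT_betai Hb.beta_inverse(2)[OF good_gen] Hb.beta_inverse(1)[OF good_gen] Hb.beta_T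
      Ht.beta_pT Ht.pD_beta Ht.pT_betai Ht.beta_inverse(2)[OF good_gen_theta] Ht.beta_inverse(1)[OF good_gen_theta] Ht.beta_T])

section \<open>The prescribed values on the generators\<close>

lemma sum_in_Delta:
  assumes "(\<Sum>(a, b)\<leftarrow>tr. TD.Ten a b) = app (\<Phi> f) (TD.Ten 1 1)"
  shows "(\<Sum>(a, b)\<leftarrow>tr. pure (q a, q b)) \<in> GC.\<Delta> (q f)"
proof -
  have "TD.cr (\<Sum>(a, b)\<leftarrow>tr. pure (q a, q b)) = (\<Sum>(a, b)\<leftarrow>tr. pure (q a, q b))"
    by (simp add: klin_sum_list[OF TD.klin_cr] split_def TD.cr_pure)
  moreover have "TD.pr (\<Sum>(a, b)\<leftarrow>tr. pure (q a, q b)) = app (\<Phi> f) (TD.Ten 1 1)"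
    unfolding assms[symmetric] by (simp add: klin_sum_list[OF TD.klin_pr] split_def TD.Ten_def)
  ultimately show ?thesis using TD.keys_cr[of "\<Sum>(a, b)\<leftarrow>tr. pure (q a, q b)"] by (simp add: GC.in_Delta)
qed

lemma cop_in_Delta: "(\<Sum>(a, b)\<leftarrow>cop g. pure (q (gen a), q (gen b))) \<in> GC.\<Delta> (q (gen g))"
  using sum_in_Delta[of "map (\<lambda>(a, b). (gen a, gen b)) (cop g)" "gen g"] by (simp add: GC.Phi_gen split_def comp_def)

lemma eps_gen: "GC.\<epsilon> (q (gen g)) = egen g 1"
  by (simp add: GC.eps_q Ef_gen)

lemma coalgebra: "DX_coalgebra P1 P2 B (\<lambda>g. q (gen g)) GC.\<Delta> GC.\<epsilon>"
proof -
  have "pure (q (gA a), q (gAbar b)) \<in> GC.\<Delta> (q (gA a * gAbar b))" for a b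
    using sum_in_Delta[of "[(gA a, gAbar b)]" "gA a * gAbar b"] by (simp add: PhiL.lift_mult app_simps GC.Phi_s GC.Phi_t)
  moreover have "GC.\<epsilon> (q (gA a * gAbar b)) = a * b" for a b
    by (simp add: GC.eps_q GC.E_mult GC.E_s GC.E_t)
  \<comment> \<open>This is the value that \<open>egen\<close> gives for the counit of
    \<open>Vf x\<close>.\<close>
  moreover have "ev P1 x (d0 1) = 0" for x
    using additive_zero[of "ev P1 x"] Ld.A1.el_addr[of x] Ld.d0_one by simp
  moreover have "q (gA 1) = \<one>\<^bsub>B\<^esub>"
    using q_Ae[OF Ae_rel.intros(4)] by (simp add: q_one)
  ultimately show ?thesis
    using cop_in_Delta[of "XO1 _ _"] cop_in_Delta[of "OX1 _ _"] cop_in_Delta[of "Vf _"] cop_in_Delta[of "XO2 _ _"] cop_in_Delta[of "OX2 _ _"]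
    by (simp add: DX_coalgebra_def q_mult eps_gen Ld.A1.lO_one[simplified] Ld.A1.rO_one[simplified] Ld.A2.lO_one[simplified] Ld.A2.rO_one[simplified]
      split_def comp_def)
qed

end

theorem theorem5p4:
  fixes scA :: "'k::field \<Rightarrow> 'a::{ring,monoid_mult} \<Rightarrow> 'a"
    and P1 :: "('a, 'm::ab_group_add, 'x::ab_group_add) pivotal_data"
    and P2 :: "('a, 'n::ab_group_add, 'y::ab_group_add) pivotal_data"
    and d0 :: "'a \<Rightarrow> 'm" and d1 :: "'m \<Rightarrow> 'n" and wedge :: "'m \<Rightarrow> 'm \<Rightarrow> 'n"
  assumes "k_algebra scA"
    and "pivotal_bimodule scA P1"
    and "pivotal_bimodule scA P2"
    and "calculus_data scA (Om P1) (Om P2) d0 d1 wedge"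
    and "pivotal_morphism scA P1 P2 wedge"
  defines "B \<equiv> DX scA P1 P2 d0 d1 wedge"
    and "\<pi> \<equiv> DX_gen scA P1 P2 d0 d1 wedge"
  shows "\<exists>\<Delta> \<epsilon>. DX_coalgebra P1 P2 B \<pi> \<Delta> \<epsilon> \<and>
    schauenburg_hopf_algebroid scA B (\<lambda>a. \<pi> (El a)) (\<lambda>a. \<pi> (Bar a)) \<Delta> \<epsilon>"
proof -
  interpret S: DX_setup scA P1 P2 d0 d1 wedge by (rule DX_setup.intro) (rule assms)+
  have "B = S.B" by (simp only: B_def DX_def presented_algebra_def S.B_def) (simp only: S.I_def)
  moreover have "\<pi> = (\<lambda>g. S.q (gen g))" by (simp only: \<pi>_def DX_gen_def S.q_def fun_eq_iff) (simp add: S.I_def)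
  ultimately show ?thesis using S.coalgebra S.schauenburg by blast
qed

end
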